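(* Let $u(x;a_0,E_0,c_0)$ be a periodic traveling wave solution of the generalized Benjamin-Bona-Mahony equation, as described in the context, with parameters $(a_0,E_0,c_0)$, $c_0>1$, and period $T(a_0,E_0,c_0)$. If $\{T,M,P\}_{a,E,c}<0$ at $(a_0,E_0,c_0)$, then the number of roots (counted with multiplicity) of the function $\mu\mapsto D(\mu,1)$ on the positive real axis, i.e. the number of $T$-periodic eigenvalues of $\mathcal{A}$ on the positive real axis, is odd. In particular, if $T_E(a_0,E_0,c_0)=\partial_E T(a_0,E_0,c_0)>0$, then the wave $u(x;a_0,E_0,c_0)$ is spectrally unstable to $T(a_0,E_0,c_0)$-periodic perturbations if and only if $\{T,M,P\}_{a,E,c}$ is negative at $(a_0,E_0,c_0)$.
   Context: The generalized Benjamin-Bona-Mahony (gBBM) equation is $u_t-u_{xxt}+u_x+(f(u))_x=0$ with $f\in C^2(\mathbb{R})$; let $F'=f$, $F(0)=0$. Periodic traveling waves. For $a,E\in\mathbb{R}$ and $c>1$ let $V(u;a,c)=F(u)-\frac{c-1}{2}u^2-au$. It is assumed throughout that $(a,E,c)$ lies in the interior of the set of parameters for which $V(\cdot;a,c)$ has a non-degenerate local minimum and the equation $V(\cdot;a,c)=E$ has simple roots $u_-<u_+$ with $V(\cdot;a,c)<E$ on $(u_-,u_+)$ (so $u_\pm$ are $C^1$ functions of $(a,E,c)$). Then $u(x;a,E,c)$ denotes the periodic solution of $cu_{xx}-(c-1)u+f(u)=a$, $\frac{c}{2}u_x^2+V(u;a,c)=E$, oscillating between $u_-$ and $u_+$,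 normalized by $u(0)=u_-$, $u_x(0)=0$; $u(x-ct;a,E,c)$ solves gBBM. Its period is $T=T(a,E,c)$, and $M(a,E,c)=\int_0^T u\,dx$, $P(a,E,c)=\frac12\int_0^T(u^2+u_x^2)\,dx$; these are $C^1$ functions of $(a,E,c)$. The bracket $\{T,M,P\}_{a,E,c}=\frac{\partial(T,M,P)}{\partial(a,E,c)}$ denotes the $3\times 3$ Jacobian determinant. Linearization. Put $\mathcal{L}=-c\partial_x^2+(c-1)-f'(u)$, $\mathcal{D}=1-\partial_x^2$, $\mathcal{A}=\mathcal{D}^{-1}\partial_x\mathcal{L}$. The spectral problem is $\partial_x\mathcal{L}v=\mu\mathcal{D}v$, $\mu\in\mathbb{C}$. It is equivalent to the system $Y_x=\mathbf{H}(x,\mu)Y$ for $Y=(v,v_x,v_{xx})^t$ with $$\mathbf{H}(x,\mu)=\begin{pmatrix}0&1&0\\0&0&1\\-\frac1c(\mu+u_xf''(u))&\frac1c(c-1-f'(u))&\frac{\mu}{c}\end{pmatrix}.$$ Let $\Phi(x;\mu)$ be its fundamental matrix with $\Phi(0;\mu)=\mathbf{I}$. The monodromy matrix is $\mathbf{M}(\mu)=\Phi(T;\mu)$ and the periodic Evans function is $D(\mu,\lambda)=\det(\mathbf{M}(\mu)-\lambda\mathbf{I})$, $\mu,\lambda\in\mathbb{C}$. Roots $\mu$ of $D(\mu,1)$ are exactly the eigenvalues of $\mathcal{A}$ on $L^2_{\rm per}([0,T])$ ("$T$-periodic eigenvalues"), with multiplicity. The wave is spectrally unstable to $T$-periodic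 perturbations if $\mathcal{A}$ on $L^2_{\rm per}([0,T])$ has an eigenvalue with positive real part. *)

theory Defs
  imports "HOL-Complex_Analysis.Complex_Analysis"
begin

definition C2_real :: "(real \<Rightarrow> real) \<Rightarrow> bool" where
  "C2_real f \<longleftrightarrow> (\<forall>x. f differentiable (at x)) \<and> (\<forall>x. deriv f differentiable (at x)) \<and>
     continuous_on UNIV (deriv (deriv f))"

definition gbbm_V :: "(real \<Rightarrow> real) \<Rightarrow> real \<Rightarrow> real \<Rightarrow> real \<Rightarrow> real" where
  "gbbm_V F a c w = F w - (c - 1) / 2 * w\<^sup>2 - a * w"

definition nondegenerate_local_min :: "(real \<Rightarrow> real) \<Rightarrow> real \<Rightarrow> bool" where
  "nondegenerate_local_min g z \<longleftrightarrow>
     (\<forall>\<^sub>F w in nhds z. g z \<le> g w) \<and> deriv (deriv g) z \<noteq> 0"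

definition potential_well ::
  "(real \<Rightarrow> real) \<Rightarrow> real \<Rightarrow> real \<Rightarrow> real \<Rightarrow> real \<Rightarrow> real \<Rightarrow> bool" where
  "potential_well F a E c um up \<longleftrightarrow>
     um < up \<and>
     gbbm_V F a c um = E \<and> deriv (gbbm_V F a c) um \<noteq> 0 \<and>
     gbbm_V F a c up = E \<and> deriv (gbbm_V F a c) up \<noteq> 0 \<and>
     (\<forall>w\<in>{um<..<up}. gbbm_V F a c w < E)"

text \<open>Parameters are triples \<open>(a, E, c)\<close>.\<close>

definition wave_parameters :: "(real \<Rightarrow> real) \<Rightarrow> (real \<times> real \<times> real) set" where
  "wave_parameters F = {(a, E, c). 1 < c \<and>
     (\<exists>z. nondegenerate_local_min (gbbm_V F a c) z) \<and>
     (\<exists>um up. potential_well F a E c um up)}"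

definition periodic_wave ::
  "(real \<Rightarrow> real) \<Rightarrow> (real \<Rightarrow> real) \<Rightarrow> real \<Rightarrow> real \<Rightarrow> real \<Rightarrow> real \<Rightarrow> real \<Rightarrow>
    (real \<Rightarrow> real) \<Rightarrow> bool" where
  "periodic_wave f F a E c um up u \<longleftrightarrow>
     (\<forall>x. u differentiable (at x)) \<and> (\<forall>x. deriv u differentiable (at x)) \<and>
     (\<forall>x. c * deriv (deriv u) x - (c - 1) * u x + f (u x) = a) \<and>
     (\<forall>x. c / 2 * (deriv u x)\<^sup>2 + gbbm_V F a c (u x) = E) \<and>
     (\<exists>t>0. \<forall>x. u (x + t) = u x) \<and>
     range u = {um..up} \<and> u 0 = um \<and> deriv u 0 = 0"

definition wave_period :: "(real \<Rightarrow> real) \<Rightarrow> real" where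
  "wave_period u = Inf {t. 0 < t \<and> (\<forall>x. u (x + t) = u x)}"

definition wave_mass :: "(real \<Rightarrow> real) \<Rightarrow> real" where
  "wave_mass u = integral {0..wave_period u} u"

definition wave_momentum :: "(real \<Rightarrow> real) \<Rightarrow> real" where
  "wave_momentum u =
     1 / 2 * integral {0..wave_period u} (\<lambda>x. (u x)\<^sup>2 + (deriv u x)\<^sup>2)"

definition gradient3 :: "(real \<Rightarrow> real \<Rightarrow> real \<Rightarrow> real) \<Rightarrow> real \<Rightarrow> real \<Rightarrow> real \<Rightarrow> real^3" where
  "gradient3 g a E c =
     vector [deriv (\<lambda>s. g s E c) a, deriv (\<lambda>s. g a s c) E, deriv (\<lambda>s. g a E s) c]"

definition TMP_bracket ::
  "(real \<Rightarrow> real \<Rightarrow> real \<Rightarrow> real \<Rightarrow> real) \<Rightarrow> real \<Rightarrow> real \<Rightarrow> real \<Rightarrow> real" where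
  "TMP_bracket u a E c = det (vector
     [gradient3 (\<lambda>a E c. wave_period (u a E c)) a E c,
      gradient3 (\<lambda>a E c. wave_mass (u a E c)) a E c,
      gradient3 (\<lambda>a E c. wave_momentum (u a E c)) a E c] :: real^3^3)"

definition evans_H :: "(real \<Rightarrow> real) \<Rightarrow> real \<Rightarrow> (real \<Rightarrow> real) \<Rightarrow> real \<Rightarrow> complex \<Rightarrow> complex^3^3" where
  "evans_H f c u x \<mu> = vector
     [vector [0, 1, 0],
      vector [0, 0, 1],
      vector [- (\<mu> + of_real (deriv u x * deriv (deriv f) (u x))) / of_real c,
              of_real ((c - 1 - deriv f (u x)) / c),
              \<mu> / of_real c]]"

definition fundamental_matrix ::
  "(real \<Rightarrow> real) \<Rightarrow> real \<Rightarrow> (real \<Rightarrow> real) \<Rightarrow> (real \<Rightarrow> complex \<Rightarrow> complex^3^3) \<Rightarrow> bool" where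
  "fundamental_matrix f c u \<Phi> \<longleftrightarrow>
     (\<forall>\<mu>. \<Phi> 0 \<mu> = mat 1 \<and>
       (\<forall>x. ((\<lambda>y. \<Phi> y \<mu>) has_vector_derivative (evans_H f c u x \<mu> ** \<Phi> x \<mu>)) (at x)))"

definition evans_D :: "(real \<Rightarrow> complex \<Rightarrow> complex^3^3) \<Rightarrow> real \<Rightarrow> complex \<Rightarrow> complex \<Rightarrow> complex" where
  "evans_D \<Phi> T \<mu> l = det (\<Phi> T \<mu> - mat l)"

text \<open>
  Unbounded operators on the space of \<open>T\<close>-periodic square-integrable functions are given by
  their graphs. \<open>per_deriv T v w\<close> says that \<open>v\<close> is the absolutely continuous
  representative of an element of the periodic Sobolev space of order 1 and that \<open>w\<close> is
  a weak derivative of it. Below, \<open>op_A\<close> is the composition of \<open>op_L\<close>, the derivative and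
  the inverse of \<open>op_D\<close>; equalities of square-integrable functions hold almost everywhere.
\<close>

definition L2_per :: "real \<Rightarrow> (real \<Rightarrow> complex) set" where
  "L2_per T = {v. v \<in> borel_measurable lborel \<and> (\<forall>x. v (x + T) = v x) \<and>
     set_integrable lborel {0..T} (\<lambda>x. (cmod (v x))\<^sup>2)}"

definition per_deriv :: "real \<Rightarrow> (real \<Rightarrow> complex) \<Rightarrow> (real \<Rightarrow> complex) \<Rightarrow> bool" where
  "per_deriv T v w \<longleftrightarrow> v \<in> L2_per T \<and> w \<in> L2_per T \<and>
     (\<forall>x y. x \<le> y \<longrightarrow> (w has_integral (v y - v x)) {x..y})"

definition op_L ::
  "(real \<Rightarrow> real) \<Rightarrow> real \<Rightarrow> (real \<Rightarrow> real) \<Rightarrow> real \<Rightarrow>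
    (real \<Rightarrow> complex) \<Rightarrow> (real \<Rightarrow> complex) \<Rightarrow> bool" where
  "op_L f c u T v g \<longleftrightarrow> g \<in> L2_per T \<and>
     (\<exists>v1 v2. per_deriv T v v1 \<and> per_deriv T v1 v2 \<and>
       (AE x in lborel. g x = - of_real c * v2 x + of_real (c - 1 - deriv f (u x)) * v x))"

definition op_D :: "real \<Rightarrow> (real \<Rightarrow> complex) \<Rightarrow> (real \<Rightarrow> complex) \<Rightarrow> bool" where
  "op_D T w h \<longleftrightarrow> h \<in> L2_per T \<and>
     (\<exists>w1 w2. per_deriv T w w1 \<and> per_deriv T w1 w2 \<and> (AE x in lborel. h x = w x - w2 x))"

definition op_A ::
  "(real \<Rightarrow> real) \<Rightarrow> real \<Rightarrow> (real \<Rightarrow> real) \<Rightarrow> real \<Rightarrow>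
    (real \<Rightarrow> complex) \<Rightarrow> (real \<Rightarrow> complex) \<Rightarrow> bool" where
  "op_A f c u T v w \<longleftrightarrow> (\<exists>g h. op_L f c u T v g \<and> per_deriv T g h \<and> op_D T w h)"

text \<open>
  Elements of the domain and of the range of \<open>op_A\<close> are continuous representatives, so
  that being nonzero as a function and being nonzero in \<open>L2_per\<close> coincide.
\<close>

definition periodic_eigenvalue ::
  "(real \<Rightarrow> real) \<Rightarrow> real \<Rightarrow> (real \<Rightarrow> real) \<Rightarrow> real \<Rightarrow> complex \<Rightarrow> bool" where
  "periodic_eigenvalue f c u T \<mu> \<longleftrightarrow>
     (\<exists>v. (\<exists>x. v x \<noteq> 0) \<and> op_A f c u T v (\<lambda>x. \<mu> * v x))"

definition spectrally_unstable ::
  "(real \<Rightarrow> real) \<Rightarrow> real \<Rightarrow> (real \<Rightarrow> real) \<Rightarrow> real \<Rightarrow> bool" where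
  "spectrally_unstable f c u T \<longleftrightarrow> (\<exists>\<mu>. 0 < Re \<mu> \<and> periodic_eigenvalue f c u T \<mu>)"

definition positive_real_roots :: "(complex \<Rightarrow> complex) \<Rightarrow> complex set" where
  "positive_real_roots g = {\<mu>. \<mu> \<in> \<real> \<and> 0 < Re \<mu> \<and> g \<mu> = 0}"

end

theory Submission
  imports Defs
begin

text \<open>On real \<open>\<mu>\<close> the entire function \<open>D(\<mu>, 1)\<close> is real. It is negative for large \<open>\<mu> > 0\<close>, and
  \<open>D(\<mu>, 1) / \<mu>\<^sup>3\<close> tends to the negative of the bracket as \<open>\<mu>\<close> tends to \<open>0\<close>, because the derivatives of the wave with
  respect to \<open>a\<close>, \<open>E\<close>, \<open>c\<close> and \<open>x\<close> solve the linearised equation or its first perturbation. So a negative bracket forces a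
  change of sign, hence an odd number of positive zeros.

  Conversely let \<open>T\<^sub>E > 0\<close> and let the bracket be nonnegative. An eigenfunction \<open>v\<close> with \<open>Re \<mu> > 0\<close> is orthogonal to \<open>1\<close> and
  \<open>u - u\<^sub>x\<^sub>x\<close>, and \<open>\<langle>L v, v\<rangle> = 0\<close>. As \<open>T\<^sub>E > 0\<close>, Picone's identity shows that the form of \<open>L\<close> is nonnegative on a subspace of
  codimension one and vanishes there only on multiples of \<open>u\<^sub>x\<close>. The sign of the bracket yields a periodic \<open>\<psi>\<close> with
  \<open>L \<psi>\<close> in the span of \<open>1\<close> and \<open>u - u\<^sub>x\<^sub>x\<close> and \<open>\<langle>L \<psi>, \<psi>\<rangle> \<le> 0\<close>. Since the form vanishes between \<open>\<psi>\<close> and \<open>v\<close>, \<open>v\<close> must lie in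
  the span of \<open>u\<^sub>x\<close> and \<open>\<psi>\<close>, which is impossible.\<close>

section \<open>Gronwall estimates\<close>

text \<open>The power \<open>\<mu>\<^sup>3\<close> has two sources. Conservation of mass and
  momentum turns two rows of \<open>\<Phi> T - 1\<close> into \<open>\<mu>\<close> times integrals,
  and translation invariance makes the column of \<open>u1\<close> vanish at
  \<open>\<mu> = 0\<close>; corrected to first order, that column yields the third factor. The sign
  at infinity is found by running the system backwards, where the large rate
  \<open>\<mu> / c\<close> damps instead of exciting. No spectral theory of L enters: the subspace
  of codimension one is cut out by point evaluation at the single zero of the even kernel solution
  in the open half period, so that Picone's identity applies between zeros, and T_E > 0 is the sign
  of its boundary term at the crest. The obstacle in the stable case is that the bracket may vanish,
  so no strict inequality is available: the equality case of Picone's identity has to be followed,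
  and the final contradiction comes from the equation for \<open>v\<close>, not from the form.
  Existence of solutions is taken from the given \<open>\<Phi>\<close>; uniqueness, holomorphy in
  \<open>\<mu>\<close>, differentiability in the parameters and the limit at 0 rest on Gronwall
  estimates.\<close>

definition gronwall_const :: "real \<Rightarrow> real \<Rightarrow> real" where
  "gronwall_const K X = (1 + X) * exp ((2 * K + 1) * X)"

lemma gronwall_const_ge_1: "0 \<le> K \<Longrightarrow> 0 \<le> X \<Longrightarrow> 1 \<le> gronwall_const K X"
  unfolding gronwall_const_def
  by (rule order_trans[of 1 "1 * 1"], simp, rule mult_mono) simp_all

text \<open>The norm need not be differentiable, so its square is used:
  \<open>exp (- (2*K+1) * t) * (y t \<bullet> y t) - e\<^sup>2 * t\<close> is nonincreasing. The
  extra 1 in the exponent pays for the inhomogeneity through 2 e |y| <= |y|^2 + e^2. The bound is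
  far from sharp; what matters is its linearity in \<open>norm (y 0) + e\<close>.\<close>

lemma gronwall:
  fixes y y' :: "real \<Rightarrow> 'a::real_inner"
  assumes der: "\<And>x. 0 \<le> x \<Longrightarrow> x \<le> X \<Longrightarrow> (y has_vector_derivative y' x) (at x)"
    and bnd: "\<And>x. 0 \<le> x \<Longrightarrow> x \<le> X \<Longrightarrow> norm (y' x) \<le> K * norm (y x) + e"
    and K: "0 \<le> K" and e: "0 \<le> e" and x: "0 \<le> x" "x \<le> X"
  shows "norm (y x) \<le> (norm (y 0) + e) * gronwall_const K X"
proof -
  define G where "G = (\<lambda>t. exp (- (2*K+1) * t) * (y t \<bullet> y t) - e\<^sup>2 * t)"
  define G' where "G' = (\<lambda>t. exp (- (2*K+1) * t) * (2 * (y t \<bullet> y' t) - (2*K+1) * (y t \<bullet> y t)) - e\<^sup>2)"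
  have dG: "(G has_real_derivative G' t) (at t)" if "0 \<le> t" "t \<le> X" for t
  proof -
    have "((\<lambda>t. y t \<bullet> y t) has_real_derivative (2 * (y t \<bullet> y' t))) (at t)"
      using has_derivative_inner[OF der[OF that, unfolded has_vector_derivative_def] der[OF that, unfolded has_vector_derivative_def]]
      unfolding has_field_derivative_def
      by (rule has_derivative_eq_rhs) (auto simp: inner_commute algebra_simps)
    then show ?thesis unfolding G_def G'_def
      by (auto intro!: derivative_eq_intros simp: algebra_simps)
  qed
  have G'0: "G' t \<le> 0" if "0 \<le> t" "t \<le> X" for t
  proof -
    have "y t \<bullet> y' t \<le> norm (y t) * norm (y' t)" by (rule norm_cauchy_schwarz)
    also have "\<dots> \<le> norm (y t) * (K * norm (y t) + e)" using bnd[OF that] by (intro mult_left_mono) auto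
    finally have 1: "y t \<bullet> y' t \<le> norm (y t) * (K * norm (y t) + e)" .
    have "2 * (norm (y t) * e) \<le> (norm (y t))\<^sup>2 + e\<^sup>2"
      using sum_squares_bound[of "norm (y t)" e] by (simp add: algebra_simps)
    with 1 have 2: "2 * (y t \<bullet> y' t) - (2*K+1) * (y t \<bullet> y t) \<le> e\<^sup>2"
      by (simp add: power2_norm_eq_inner[symmetric] algebra_simps power2_eq_square)
    have "exp (- (2*K+1) * t) * (2 * (y t \<bullet> y' t) - (2*K+1) * (y t \<bullet> y t)) \<le> exp (- (2*K+1) * t) * e\<^sup>2"
      using 2 by (intro mult_left_mono) auto
    also have "\<dots> \<le> 1 * e\<^sup>2"
    proof (rule mult_right_mono)
      have "- (2*K+1) * t \<le> 0" by (rule mult_nonpos_nonneg) (use K that in auto)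
      then show "exp (- (2*K+1) * t) \<le> 1" by (simp only: exp_le_one_iff)
    qed simp
    finally show ?thesis by (simp add: G'_def)
  qed
  have "G x \<le> G 0"
    using DERIV_nonpos_imp_nonincreasing[OF x(1), of G] dG G'0 x by (meson order_trans)
  then have "exp (- (2*K+1) * x) * (norm (y x))\<^sup>2 \<le> (norm (y 0))\<^sup>2 + e\<^sup>2 * x"
    by (simp add: G_def power2_norm_eq_inner)
  then have "exp ((2*K+1) * x) * (exp (- (2*K+1) * x) * (norm (y x))\<^sup>2) \<le> exp ((2*K+1) * x) * ((norm (y 0))\<^sup>2 + e\<^sup>2 * x)"
    by (intro mult_left_mono) auto
  moreover have eq: "exp ((2*K+1) * x) * (exp (- (2*K+1) * x) * (norm (y x))\<^sup>2) = (norm (y x))\<^sup>2"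
  proof -
    have "exp ((2*K+1) * x) * exp (- ((2*K+1) * x)) = 1"
      by (simp add: exp_minus)
    then show ?thesis by (simp only: mult.assoc[symmetric] mult_1_left mult_minus_left)
  qed
  ultimately have "(norm (y x))\<^sup>2 \<le> exp ((2*K+1) * x) * ((norm (y 0))\<^sup>2 + e\<^sup>2 * x)"
    by (metis (no_types))
  also have "\<dots> \<le> exp ((2*K+1) * X) * ((norm (y 0) + e)\<^sup>2 * (1 + X))"
  proof (intro mult_mono)
    show "exp ((2*K+1) * x) \<le> exp ((2*K+1) * X)" using K x by (simp add: mult_left_mono)
    have "(norm (y 0))\<^sup>2 + e\<^sup>2 * x \<le> (norm (y 0))\<^sup>2 * (1 + X) + e\<^sup>2 * (1 + X)"
      using x by (intro add_mono mult_left_mono) (auto simp: mult_le_cancel_left1)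
    also have "\<dots> \<le> (norm (y 0) + e)\<^sup>2 * (1 + X)"
      unfolding distrib_right[symmetric] using x e by (intro mult_right_mono) (auto simp: power2_sum)
    finally show "(norm (y 0))\<^sup>2 + e\<^sup>2 * x \<le> (norm (y 0) + e)\<^sup>2 * (1 + X)" .
  qed (use x in auto)
  also have "\<dots> = (norm (y 0) + e)\<^sup>2 * gronwall_const K X" by (simp add: gronwall_const_def)
  \<comment> \<open>As \<open>gronwall_const\<close> is at least 1, it may be replaced by its
    square, which makes both sides squares.\<close>
  also have "\<dots> \<le> (norm (y 0) + e)\<^sup>2 * (gronwall_const K X)\<^sup>2"
    using gronwall_const_ge_1[of K X] K x by (intro mult_left_mono self_le_power) auto
  finally have "(norm (y x))\<^sup>2 \<le> ((norm (y 0) + e) * gronwall_const K X)\<^sup>2" by (simp only: power_mult_distrib)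
  moreover have "0 \<le> (norm (y 0) + e) * gronwall_const K X"
    using gronwall_const_ge_1[of K X] K x e by (intro mult_nonneg_nonneg) auto
  ultimately show ?thesis by (rule power2_le_imp_le)
qed

lemma norm_triple_le: "norm (a, b, c) \<le> norm a + norm b + norm c"
  by (smt (verit) norm_Pair_le)

lemma norm_triple_ge: "norm a \<le> norm (a, b, c)" "norm b \<le> norm (a, b, c)" "norm c \<le> norm (a, b, c)"
  by (auto simp: norm_Pair real_le_rsqrt)

text \<open>As a first order system for the triple, the two shifted components contribute at most
  twice its norm and \<open>w\<close> at most \<open>3 * K\<close> times, whence the rate
  \<open>3 * K + 2\<close>.\<close>

lemma gronwall3:
  fixes v0 v1 v2 w :: "real \<Rightarrow> 'a::real_inner"
  assumes d0: "\<And>x. 0 \<le> x \<Longrightarrow> x \<le> X \<Longrightarrow> (v0 has_vector_derivative v1 x) (at x)"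
    and d1: "\<And>x. 0 \<le> x \<Longrightarrow> x \<le> X \<Longrightarrow> (v1 has_vector_derivative v2 x) (at x)"
    and d2: "\<And>x. 0 \<le> x \<Longrightarrow> x \<le> X \<Longrightarrow> (v2 has_vector_derivative w x) (at x)"
    and w: "\<And>x. 0 \<le> x \<Longrightarrow> x \<le> X \<Longrightarrow> norm (w x) \<le> K * (norm (v0 x) + norm (v1 x) + norm (v2 x)) + e"
    and K: "0 \<le> K" and e: "0 \<le> e" and x: "0 \<le> x" "x \<le> X"
  defines "B \<equiv> (norm (v0 0) + norm (v1 0) + norm (v2 0) + e) * gronwall_const (3 * K + 2) X"
  shows "norm (v0 x) \<le> B" "norm (v1 x) \<le> B" "norm (v2 x) \<le> B"
proof -
  let ?y = "\<lambda>x. (v0 x, v1 x, v2 x)"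
  have "norm (?y x) \<le> (norm (?y 0) + e) * gronwall_const (3 * K + 2) X"
  proof (rule gronwall)
    show "(?y has_vector_derivative (v1 x, v2 x, w x)) (at x)" if "0 \<le> x" "x \<le> X" for x
      using d0[OF that] d1[OF that] d2[OF that] by (intro has_vector_derivative_Pair)
    show "norm (v1 x, v2 x, w x) \<le> (3 * K + 2) * norm (?y x) + e" if "0 \<le> x" "x \<le> X" for x
    proof -
      have "norm (v1 x, v2 x, w x) \<le> norm (v1 x) + norm (v2 x) + norm (w x)" by (rule norm_triple_le)
      also have "\<dots> \<le> norm (?y x) + norm (?y x) + (K * (norm (?y x) + norm (?y x) + norm (?y x)) + e)"
        by (intro add_mono norm_triple_ge order_trans[OF w[OF that]] mult_left_mono K order_refl)
      finally show ?thesis by (simp add: algebra_simps)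
    qed
  qed (use K e x in auto)
  also have "\<dots> \<le> B" unfolding B_def
    using gronwall_const_ge_1[of "3*K+2" X] K x
    by (intro mult_right_mono add_mono norm_triple_le) auto
  finally have "norm (?y x) \<le> B" .
  then show "norm (v0 x) \<le> B" "norm (v1 x) \<le> B" "norm (v2 x) \<le> B"
    using norm_triple_ge order_trans by blast+
qed

lemma gronwall2:
  fixes v0 v1 w :: "real \<Rightarrow> 'a::real_inner"
  assumes d0: "\<And>x. 0 \<le> x \<Longrightarrow> x \<le> X \<Longrightarrow> (v0 has_vector_derivative v1 x) (at x)"
    and d1: "\<And>x. 0 \<le> x \<Longrightarrow> x \<le> X \<Longrightarrow> (v1 has_vector_derivative w x) (at x)"
    and w: "\<And>x. 0 \<le> x \<Longrightarrow> x \<le> X \<Longrightarrow> norm (w x) \<le> K * (norm (v0 x) + norm (v1 x)) + e"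
    and K: "0 \<le> K" and e: "0 \<le> e" and x: "0 \<le> x" "x \<le> X"
  defines "B \<equiv> (norm (v0 0) + norm (v1 0) + e) * gronwall_const (2 * K + 1) X"
  shows "norm (v0 x) \<le> B" "norm (v1 x) \<le> B"
proof -
  let ?y = "\<lambda>x. (v0 x, v1 x)"
  have ge: "norm (v0 x) \<le> norm (?y x)" "norm (v1 x) \<le> norm (?y x)" for x
    by (auto simp: norm_Pair real_le_rsqrt)
  have "norm (?y x) \<le> (norm (?y 0) + e) * gronwall_const (2 * K + 1) X"
  proof (rule gronwall)
    show "(?y has_vector_derivative (v1 x, w x)) (at x)" if "0 \<le> x" "x \<le> X" for x
      using d0[OF that] d1[OF that] by (intro has_vector_derivative_Pair)
    show "norm (v1 x, w x) \<le> (2 * K + 1) * norm (?y x) + e" if "0 \<le> x" "x \<le> X" for x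
    proof -
      have "norm (v1 x, w x) \<le> norm (v1 x) + norm (w x)" by (rule norm_Pair_le)
      also have "\<dots> \<le> norm (?y x) + (K * (norm (?y x) + norm (?y x)) + e)"
        by (intro add_mono ge order_trans[OF w[OF that]] mult_left_mono K order_refl)
      finally show ?thesis by (simp add: algebra_simps)
    qed
  qed (use K e x in auto)
  also have "\<dots> \<le> B" unfolding B_def
    using gronwall_const_ge_1[of "2*K+1" X] K x
    by (intro mult_right_mono add_mono norm_Pair_le) auto
  finally have "norm (?y x) \<le> B" .
  then show "norm (v0 x) \<le> B" "norm (v1 x) \<le> B"
    using ge order_trans by blast+
qed

section \<open>Uniqueness to the right and to the left, for equations of order two and three\<close>

lemma has_vector_derivative_reflect:
  assumes "(g has_vector_derivative g') (at (a - x))"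
  shows "((\<lambda>t. g (a - t)) has_vector_derivative - g') (at x)"
proof -
  have "((\<lambda>t. a - t) has_vector_derivative - 1) (at x)" by (auto intro!: derivative_eq_intros)
  from vector_diff_chain_at[OF this, of g g'] assms show ?thesis by (simp add: o_def)
qed

lemma has_vector_derivative_shift:
  assumes "(g has_vector_derivative g') (at (x + a))"
  shows "((\<lambda>t. g (t + a)) has_vector_derivative g') (at x)"
proof -
  have "((\<lambda>t. t + a) has_vector_derivative 1) (at x)" by (auto intro!: derivative_eq_intros)
  from vector_diff_chain_at[OF this, of g g'] assms show ?thesis by (simp add: o_def)
qed

text \<open>Gronwall with zero data and zero inhomogeneity, to the right of \<open>b\<close> after a
  shift and to the left after a reflection. A locally uniform bound suffices, because only the
  points between \<open>b\<close> and \<open>x\<close> are visited.\<close>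

lemma unique3:
  fixes v0 v1 v2 w :: "real \<Rightarrow> 'a::real_inner"
  assumes d0: "\<And>x. (v0 has_vector_derivative v1 x) (at x)"
    and d1: "\<And>x. (v1 has_vector_derivative v2 x) (at x)"
    and d2: "\<And>x. (v2 has_vector_derivative w x) (at x)"
    and w: "\<And>X. \<exists>K. \<forall>x. \<bar>x\<bar> \<le> X \<longrightarrow> norm (w x) \<le> K * (norm (v0 x) + norm (v1 x) + norm (v2 x))"
    and z: "v0 b = 0" "v1 b = 0" "v2 b = 0"
  shows "v0 x = 0" "v1 x = 0" "v2 x = 0"
proof -
  obtain K where K: "\<And>t. \<bar>t\<bar> \<le> \<bar>b\<bar> + \<bar>x\<bar> \<Longrightarrow> norm (w t) \<le> K * (norm (v0 t) + norm (v1 t) + norm (v2 t))"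
    using w by blast
  have K': "norm (w t) \<le> max K 0 * (norm (v0 t) + norm (v1 t) + norm (v2 t)) + 0" if "\<bar>t\<bar> \<le> \<bar>b\<bar> + \<bar>x\<bar>" for t
    using K[OF that] by (smt (verit) mult_right_mono norm_ge_zero)
  have "v0 x = 0 \<and> v1 x = 0 \<and> v2 x = 0"
  proof (cases "b \<le> x")
    case True
    have d: "((\<lambda>t. v0 (t + b)) has_vector_derivative v1 (t + b)) (at t)"
      "((\<lambda>t. v1 (t + b)) has_vector_derivative v2 (t + b)) (at t)"
      "((\<lambda>t. v2 (t + b)) has_vector_derivative w (t + b)) (at t)" for t
      using has_vector_derivative_shift d0 d1 d2 by blast+
    have b: "norm (w (t + b)) \<le> max K 0 * (norm (v0 (t + b)) + norm (v1 (t + b)) + norm (v2 (t + b))) + 0"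
      if "0 \<le> t" "t \<le> x - b" for t
      by (rule K') (use that in auto)
    show ?thesis
      using gronwall3[OF d b, of "x - b" "x - b"] True z by simp
  next
    case False
    \<comment> \<open>Reflection changes the sign of odd derivatives; negating \<open>v1\<close>
      restores the form of the system.\<close>
    have d: "((\<lambda>t. v0 (b - t)) has_vector_derivative - v1 (b - t)) (at t)"
      "((\<lambda>t. - v1 (b - t)) has_vector_derivative v2 (b - t)) (at t)"
      "((\<lambda>t. v2 (b - t)) has_vector_derivative - w (b - t)) (at t)" for t
      using has_vector_derivative_reflect d0 d1 d2
      by (force intro: has_vector_derivative_minus[of "\<lambda>t. v1 (b - t)" "- v2 (b - t)", simplified])+
    have b: "norm (- w (b - t)) \<le> max K 0 * (norm (v0 (b - t)) + norm (- v1 (b - t)) + norm (v2 (b - t))) + 0"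
      if "0 \<le> t" "t \<le> b - x" for t
      unfolding norm_minus_cancel by (rule K') (use that in auto)
    show ?thesis
      using gronwall3[OF d b, of "b - x" "b - x"] False z by simp
  qed
  then show "v0 x = 0" "v1 x = 0" "v2 x = 0" by auto
qed

lemma unique2:
  fixes v0 v1 w :: "real \<Rightarrow> 'a::real_inner"
  assumes d0: "\<And>x. (v0 has_vector_derivative v1 x) (at x)"
    and d1: "\<And>x. (v1 has_vector_derivative w x) (at x)"
    and w: "\<And>X. \<exists>K. \<forall>x. \<bar>x\<bar> \<le> X \<longrightarrow> norm (w x) \<le> K * (norm (v0 x) + norm (v1 x))"
    and z: "v0 b = 0" "v1 b = 0"
  shows "v0 x = 0" "v1 x = 0"
proof -
  obtain K where K: "\<And>t. \<bar>t\<bar> \<le> \<bar>b\<bar> + \<bar>x\<bar> \<Longrightarrow> norm (w t) \<le> K * (norm (v0 t) + norm (v1 t))"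
    using w by blast
  have K': "norm (w t) \<le> max K 0 * (norm (v0 t) + norm (v1 t)) + 0" if "\<bar>t\<bar> \<le> \<bar>b\<bar> + \<bar>x\<bar>" for t
    using K[OF that] by (smt (verit) mult_right_mono norm_ge_zero)
  have "v0 x = 0 \<and> v1 x = 0"
  proof (cases "b \<le> x")
    case True
    have d: "((\<lambda>t. v0 (t + b)) has_vector_derivative v1 (t + b)) (at t)"
      "((\<lambda>t. v1 (t + b)) has_vector_derivative w (t + b)) (at t)" for t
      using has_vector_derivative_shift d0 d1 by blast+
    have b: "norm (w (t + b)) \<le> max K 0 * (norm (v0 (t + b)) + norm (v1 (t + b))) + 0"
      if "0 \<le> t" "t \<le> x - b" for t
      by (rule K') (use that in auto)
    show ?thesis
      using gronwall2[OF d b, of "x - b" "x - b"] True z by simp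
  next
    case False
    have d: "((\<lambda>t. v0 (b - t)) has_vector_derivative - v1 (b - t)) (at t)"
      "((\<lambda>t. - v1 (b - t)) has_vector_derivative w (b - t)) (at t)" for t
      using has_vector_derivative_reflect d0 d1
      by (force intro: has_vector_derivative_minus[of "\<lambda>t. v1 (b - t)" "- w (b - t)", simplified])+
    have b: "norm (w (b - t)) \<le> max K 0 * (norm (v0 (b - t)) + norm (- v1 (b - t))) + 0"
      if "0 \<le> t" "t \<le> b - x" for t
      unfolding norm_minus_cancel by (rule K') (use that in auto)
    show ?thesis
      using gronwall2[OF d b, of "b - x" "b - x"] False z by simp
  qed
  then show "v0 x = 0" "v1 x = 0" by auto
qed

lemma continuous_antiderivative:
  fixes g :: "real \<Rightarrow> 'a::banach"
  assumes "continuous_on UNIV g"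
  obtains G where "G b = 0" "\<And>x. (G has_vector_derivative g x) (at x)"
proof -
  \<comment> \<open>The second branch is required because an integral over \<open>{b..x}\<close>
    with \<open>x < b\<close> is 0 by convention, not the negative of the reversed one.\<close>
  define G where "G = (\<lambda>x. if b \<le> x then integral {b..x} g else - integral {x..b} g)"
  have int: "g integrable_on {p..r}" for p r
    using assms continuous_on_subset integrable_continuous_real by blast
  have "(G has_vector_derivative g x) (at x)" for x
  proof -
    define p where "p = min b x - 1"
    define r where "r = max b x + 1"
    have "((\<lambda>y. integral {p..y} g) has_vector_derivative g x) (at x within {p..r})"
      by (rule integral_has_vector_derivative)
        (use assms continuous_on_subset in \<open>auto simp: p_def r_def\<close>)
    then have "((\<lambda>y. integral {p..y} g) has_vector_derivative g x) (at x)"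
      by (subst (asm) at_within_interior) (auto simp: p_def r_def)
    then have "((\<lambda>y. integral {p..y} g - integral {p..b} g) has_vector_derivative g x) (at x)"
      by (auto intro!: derivative_eq_intros)
    then show ?thesis
    proof (rule has_vector_derivative_transform_within_open[where S="{p<..<r}"])
      fix y assume y: "y \<in> {p<..<r}"
      show "integral {p..y} g - integral {p..b} g = G y"
      proof (cases "b \<le> y")
        case True
        then show ?thesis
          using Henstock_Kurzweil_Integration.integral_combine[of p b y g] int by (auto simp: G_def p_def algebra_simps)
      next
        case False
        then show ?thesis
          using Henstock_Kurzweil_Integration.integral_combine[of p y b g] int y by (auto simp: G_def algebra_simps)
      qed
    qed (auto simp: p_def r_def)
  qed
  moreover have "G b = 0" by (simp add: G_def)
  ultimately show ?thesis using that by blast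
qed

section \<open>Parity of the number of positive zeros\<close>

lemma continuous_on_compose_of_real:
  assumes "g holomorphic_on UNIV"
  shows "continuous_on S (\<lambda>x. g (complex_of_real x))"
  by (rule continuous_on_compose2[OF holomorphic_on_imp_continuous_on[OF assms]])
    (auto intro: continuous_intros)

text \<open>The quotient is glued from two holomorphic pieces: \<open>zor_poly\<close> on a ball
  around the zero and the plain quotient on the punctured plane. The point \<open>w0\<close>
  guarantees that \<open>g\<close> is not identically zero, so that the order is finite.\<close>

lemma holomorphic_divide_zero:
  assumes hol: "g holomorphic_on UNIV" and nz: "g w0 \<noteq> 0" and r: "g r = 0"
  obtains h where "h holomorphic_on UNIV" "h r \<noteq> 0" "\<And>z. g z = (z - r) ^ nat (zorder g r) * h z" "zorder g r > 0"
proof -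
  define n where "n = nat (zorder g r)"
  have "zorder g r > 0 \<and> (\<exists>\<rho>>0. cball r \<rho> \<subseteq> UNIV \<and> zor_poly g r holomorphic_on cball r \<rho> \<and>
     (\<forall>w\<in>cball r \<rho>. g w = zor_poly g r w * (w - r) ^ nat (zorder g r) \<and> zor_poly g r w \<noteq> 0))"
  proof -
    have "\<exists>w\<in>UNIV. g w \<noteq> 0" using nz by blast
    from zorder_exist_zero[OF hol open_UNIV connected_UNIV UNIV_I this, of r] r show ?thesis by simp
  qed
  then obtain \<rho> where pos: "zorder g r > 0" and \<rho>: "\<rho> > 0" and hh: "zor_poly g r holomorphic_on cball r \<rho>"
    and eq: "\<And>w. w \<in> cball r \<rho> \<Longrightarrow> g w = zor_poly g r w * (w - r) ^ n \<and> zor_poly g r w \<noteq> 0"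
    unfolding n_def by blast
  define H where "H = (\<lambda>w. if w = r then zor_poly g r r else g w / (w - r) ^ n)"
  have "H holomorphic_on ball r \<rho>"
    by (rule holomorphic_transform[OF holomorphic_on_subset[OF hh ball_subset_cball]])
       (use eq in \<open>force simp: H_def\<close>)
  moreover have "H holomorphic_on (UNIV - {r})"
  proof (rule holomorphic_transform)
    show "(\<lambda>w. g w / (w - r) ^ n) holomorphic_on (UNIV - {r})"
      by (intro holomorphic_intros holomorphic_on_subset[OF hol]) auto
  qed (auto simp: H_def)
  ultimately have "H holomorphic_on (ball r \<rho> \<union> (UNIV - {r}))"
    by (rule holomorphic_on_Un) auto
  moreover have "ball r \<rho> \<union> (UNIV - {r}) = UNIV" using \<rho> by auto
  moreover have "H r \<noteq> 0" using eq[of r] \<rho> by (auto simp: H_def)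
  moreover have "g z = (z - r) ^ n * H z" for z
    using r pos by (auto simp: H_def n_def)
  ultimately show ?thesis using that pos unfolding n_def by metis
qed

text \<open>Induction on the number of zeros. Dividing by \<open>(z - r) ^ m\<close> removes the
  zero \<open>r\<close>, keeps the orders of the others and keeps the function real; the divisor is
  positive at \<open>b\<close> and has the sign of \<open>(-1) ^ m\<close> at \<open>a\<close>, so
  the parity of the total order and the sign of the product of the end values change together.
  Without zeros the intermediate value theorem excludes a change of sign.\<close>

lemma sign_change_parity:
  fixes a b :: real
  assumes "g holomorphic_on UNIV" "\<And>x::real. g (of_real x) \<in> \<real>" "a < b"
    "g (of_real a) \<noteq> 0" "g (of_real b) \<noteq> 0" "finite {x. a < x \<and> x < b \<and> g (of_real x) = 0}"
  shows "even (\<Sum>x | a < x \<and> x < b \<and> g (of_real x) = 0. zorder g (of_real x)) \<longleftrightarrow>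
     Re (g (of_real a)) * Re (g (of_real b)) > 0"
  using assms
proof (induction "card {x. a < x \<and> x < b \<and> g (of_real x) = 0}" arbitrary: g)
  case 0
  then have e: "{x. a < x \<and> x < b \<and> g (of_real x) = 0} = {}" by auto
  have cont: "continuous_on {a..b} (\<lambda>x. Re (g (of_real x)))"
    by (rule continuous_on_Re[OF continuous_on_compose_of_real[OF "0.prems"(1)]])
  have nz: "Re (g (of_real x)) \<noteq> 0" if "x \<in> {a..b}" for x
  proof
    assume "Re (g (of_real x)) = 0"
    then have "g (of_real x) = 0" using "0.prems"(2)[of x] by (simp add: complex_is_Real_iff complex_eq_iff)
    moreover from this have "x \<noteq> a" "x \<noteq> b" using "0.prems"(4,5) by metis+
    ultimately have "x \<in> {x. a < x \<and> x < b \<and> g (of_real x) = 0}" using that by simp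
    then show False unfolding e by simp
  qed
  have "Re (g (of_real a)) * Re (g (of_real b)) > 0"
  proof (rule ccontr)
    assume "\<not> ?thesis"
    then have "Re (g (of_real a)) * Re (g (of_real b)) \<le> 0" by simp
    then consider "Re (g (of_real a)) \<le> 0" "0 \<le> Re (g (of_real b))" | "Re (g (of_real b)) \<le> 0" "0 \<le> Re (g (of_real a))"
      unfolding mult_le_0_iff by blast
    then show False
    proof cases
      case 1
      then show False using IVT'[of "\<lambda>x. Re (g (of_real x))" a 0 b, OF _ _ _ cont] nz "0.prems"(3)
        by (metis atLeastAtMost_iff less_eq_real_def)
    next
      case 2
      then show False using IVT2'[of "\<lambda>x. Re (g (of_real x))" b 0 a, OF _ _ _ cont] nz "0.prems"(3)
        by (metis atLeastAtMost_iff less_eq_real_def)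
    qed
  qed
  then show ?case unfolding e by simp
next
  case (Suc n)
  let ?Z = "\<lambda>g. {x. a < x \<and> x < b \<and> g (complex_of_real x) = 0}"
  from Suc.hyps(2) obtain r where r: "r \<in> ?Z g" by (metis (no_types, lifting) Suc_neq_Zero all_not_in_conv card.empty)
  from r have g0: "g (of_real r) = 0" by simp
  obtain h where h: "h holomorphic_on UNIV" "h (of_real r) \<noteq> 0"
    and gh: "\<And>z. g z = (z - of_real r) ^ nat (zorder g (of_real r)) * h z" and pos: "zorder g (of_real r) > 0"
    using holomorphic_divide_zero[OF Suc.prems(1,4) g0] by metis
  define m where "m = nat (zorder g (of_real r))"
  note gh = gh[folded m_def]
  have m: "m > 0" "zorder g (of_real r) = int m" using pos by (auto simp: m_def)
  have real': "h (of_real x) \<in> \<real>" if "x \<noteq> r" for x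
  proof -
    have "h (of_real x) = g (of_real x) / of_real ((x - r) ^ m)" using that gh[of "of_real x"] by simp
    then show ?thesis using Suc.prems(2)[of x] by (metis Reals_divide Reals_of_real)
  qed
  have real: "h (of_real x) \<in> \<real>" for x
  proof (cases "x = r")
    case True
    have "isCont (\<lambda>x. Im (h (of_real x))) r"
      using continuous_on_Im[OF continuous_on_compose_of_real[OF h(1), of UNIV]]
        continuous_on_eq_continuous_at[OF open_UNIV] by blast
    then have "((\<lambda>x. Im (h (of_real x))) \<longlongrightarrow> Im (h (of_real r))) (at r)" by (simp add: isCont_def)
    moreover have "((\<lambda>x. Im (h (of_real x))) \<longlongrightarrow> 0) (at r)"
      by (rule tendsto_eventually) (use real' in \<open>auto simp: eventually_at_filter complex_is_Real_iff\<close>)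
    ultimately have "Im (h (of_real r)) = 0" using tendsto_unique trivial_limit_at by blast
    with True show ?thesis by (simp add: complex_is_Real_iff)
  qed (rule real')
  have Zh: "?Z h = ?Z g - {r}" using h(2) gh by auto
  have fin: "finite (?Z h)" using Suc.prems(6) by (simp add: Zh)
  \<comment> \<open>The removed factor does not vanish at the other zeros and is absorbed into the
    nonvanishing cofactor there.\<close>
  have ord: "zorder g (of_real x) = zorder h (of_real x)" if "x \<in> ?Z h" for x
  proof -
    have ne: "x \<noteq> r" using that Zh by auto
    have h0: "h (of_real x) = 0" using that by simp
    obtain k where k: "k holomorphic_on UNIV" "k (of_real x) \<noteq> 0"
      and hk: "\<And>z. h z = (z - of_real x) ^ nat (zorder h (of_real x)) * k z" and pos': "zorder h (of_real x) > 0"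
      using holomorphic_divide_zero[OF h h0] by metis
    define l where "l = nat (zorder h (of_real x))"
    have l: "zorder h (of_real x) = int l" using pos' by (simp add: l_def)
    note hk = hk[folded l_def]
    show ?thesis
    proof (rule zorder_eqI[of UNIV "of_real x" "\<lambda>z. (z - of_real r) ^ m * k z"])
      show "(\<lambda>z. (z - of_real r) ^ m * k z) holomorphic_on UNIV" by (intro holomorphic_intros k(1))
      show "(of_real x - of_real r) ^ m * k (of_real x) \<noteq> 0" using k(2) ne by simp
      show "g w = (w - of_real r) ^ m * k w * (w - of_real x) powi zorder h (of_real x)" for w
        using hk[of w] gh[of w] by (simp add: l)
    qed auto
  qed
  have IH: "even (\<Sum>x\<in>?Z h. zorder h (of_real x)) \<longleftrightarrow> Re (h (of_real a)) * Re (h (of_real b)) > 0"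
    by (rule Suc.hyps(1)) (use Suc.hyps(2) r Suc.prems Zh h real fin gh in auto)
  have "(\<Sum>x\<in>?Z g. zorder g (of_real x)) = int m + (\<Sum>x\<in>?Z h. zorder g (of_real x))"
    using sum.remove[OF Suc.prems(6) r, of "\<lambda>x. zorder g (of_real x)"] m Zh by simp
  then have S: "(\<Sum>x\<in>?Z g. zorder g (of_real x)) = int m + (\<Sum>x\<in>?Z h. zorder h (of_real x))"
    using ord by simp
  have Re_g: "Re (g (of_real x)) = (x - r) ^ m * Re (h (of_real x))" for x
  proof -
    have "g (of_real x) = of_real ((x - r) ^ m) * h (of_real x)" by (simp add: gh)
    then show ?thesis by (simp only: times_complex.sel Re_complex_of_real Im_complex_of_real)
  qed
  note a = Re_g[of a] and b = Re_g[of b]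
  have b0: "(b - r) ^ m > 0" using r by simp
  have ha: "Re (h (of_real a)) \<noteq> 0" "Re (h (of_real b)) \<noteq> 0"
    using Suc.prems(4,5) real[of a] real[of b] gh by (auto simp: complex_is_Real_iff complex_eq_iff)
  have "Re (g (of_real a)) * Re (g (of_real b)) > 0 \<longleftrightarrow> (even m \<longleftrightarrow> Re (h (of_real a)) * Re (h (of_real b)) > 0)"
  proof (cases "even m")
    case True
    then have "(a - r) ^ m > 0" using r by (simp add: zero_less_power_eq)
    then show ?thesis using b0 True unfolding a b by (simp add: zero_less_mult_iff mult_less_0_iff)
  next
    case False
    then have "(a - r) ^ m < 0" using r by (simp add: power_less_zero_eq)
    moreover have "(0 < s * x * (p * y)) = (\<not> 0 < x * y)" if "s < 0" "0 < p" "x \<noteq> 0" "y \<noteq> 0" for s p x y :: real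
      using that by (auto simp: zero_less_mult_iff mult_less_0_iff)
    ultimately show ?thesis using b0 False ha unfolding a b by blast
  qed
  then show ?case unfolding S IH[symmetric] by auto
qed

text \<open>The signs near 0 and near infinity confine the positive zeros to a compact interval away
  from the origin, so that a zero of \<open>g\<close> at 0 cannot interfere. The opposite signs at
  its ends also show that \<open>g\<close> is not constant, whence finiteness.\<close>

lemma odd_positive_zeros:
  assumes hol: "g holomorphic_on UNIV" and real: "\<And>x::real. g (of_real x) \<in> \<real>"
    and near: "\<forall>\<^sub>F x in at_right 0. Re (g (of_real x)) > 0"
    and far: "\<forall>\<^sub>F x in at_top. Re (g (of_real x)) < 0"
  defines "Z \<equiv> positive_real_roots g"
  shows "finite Z" "odd (\<Sum>z\<in>Z. zorder g z)"
proof -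
  obtain e where e: "e > 0" "\<And>x. 0 < x \<Longrightarrow> x < e \<Longrightarrow> Re (g (of_real x)) > 0"
    using near unfolding eventually_at_right_field by auto
  obtain R0 where R0: "\<And>x. x \<ge> R0 \<Longrightarrow> Re (g (of_real x)) < 0"
    using far unfolding eventually_at_top_linorder by auto
  define a where "a = e / 2"
  define b where "b = max R0 e"
  have a: "0 < a" "a < b" "\<And>x. 0 < x \<Longrightarrow> x \<le> a \<Longrightarrow> Re (g (of_real x)) > 0"
    using e by (auto simp: a_def b_def)
  have b: "\<And>x. x \<ge> b \<Longrightarrow> Re (g (of_real x)) < 0" using R0 by (auto simp: b_def)
  let ?Y = "{x. a < x \<and> x < b \<and> g (complex_of_real x) = 0}"
  have Z: "Z = of_real ` ?Y"
  proof (intro equalityI subsetI)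
    fix z assume "z \<in> Z"
    then obtain x where x: "z = of_real x" "x > 0" "g (of_real x) = 0"
      unfolding Z_def positive_real_roots_def by (auto elim!: Reals_cases)
    then have "\<not> x \<le> a" "\<not> x \<ge> b" using a(3)[of x] b[of x] by auto
    then show "z \<in> of_real ` ?Y" using x by auto
  qed (use a in \<open>auto simp: Z_def positive_real_roots_def\<close>)
  have nz: "g (of_real a) \<noteq> 0" "g (of_real b) \<noteq> 0" using a(3)[of a] a(1) b[of b] by auto
  have ab: "g (of_real a) \<noteq> g (of_real b)" using a(3)[of a] a(1) b[of b] by auto
  have nc: "\<not> g constant_on UNIV"
  proof
    assume "g constant_on UNIV"
    then obtain y where "\<And>x. g x = y" unfolding constant_on_def by auto
    with ab show False by simp
  qed
  have "compact (complex_of_real ` {a..b})" by (intro compact_continuous_image continuous_intros) auto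
  then have "finite {z \<in> of_real ` {a..b}. g z = 0}"
    by (intro holomorphic_compact_finite_zeros[OF hol open_UNIV connected_UNIV _ _ nc]) auto
  then have "finite Z" by (rule finite_subset[rotated]) (auto simp: Z)
  then show "finite Z" .
  then have fin: "finite ?Y" unfolding Z by (rule finite_imageD) (auto simp: inj_on_def)
  have "odd (\<Sum>x\<in>?Y. zorder g (of_real x))"
    using sign_change_parity[OF hol real a(2) nz fin] a(3)[of a] a(1) b[of b] by (auto simp: zero_less_mult_iff)
  then show "odd (\<Sum>z\<in>Z. zorder g z)"
    unfolding Z by (subst sum.reindex) (auto simp: inj_on_def)
qed

lemma C2_realD:
  assumes "C2_real f"
  shows "(f has_real_derivative deriv f x) (at x)"
    "(deriv f has_real_derivative deriv (deriv f) x) (at x)"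
    "continuous_on S (deriv (deriv f))"
  using assms continuous_on_subset[OF _ subset_UNIV]
  unfolding C2_real_def DERIV_deriv_iff_real_differentiable by blast+

lemma C2_real_Lipschitz:
  assumes "C2_real f"
  obtains K where "K \<ge> 0" "\<And>s t. s \<in> {p..r} \<Longrightarrow> t \<in> {p..r} \<Longrightarrow> \<bar>f s - f t\<bar> \<le> K * \<bar>s - t\<bar>"
    "\<And>s. s \<in> {p..r} \<Longrightarrow> \<bar>deriv f s\<bar> \<le> K"
proof -
  have "continuous_on {p..r} (deriv f)"
    using C2_realD(2)[OF assms] by (intro DERIV_continuous_on) (blast intro: has_field_derivative_at_within)
  then have "bounded (deriv f ` {p..r})"
    by (intro compact_imp_bounded compact_continuous_image) auto
  then obtain K where K: "\<And>s. s \<in> {p..r} \<Longrightarrow> \<bar>deriv f s\<bar> \<le> K"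
    unfolding bounded_iff by (metis imageI real_norm_def)
  have "\<bar>f s - f t\<bar> \<le> max K 0 * \<bar>s - t\<bar>" if "s \<in> {p..r}" "t \<in> {p..r}" for s t
    using field_differentiable_bound[of "{p..r}" f "deriv f" "max K 0" s t] that K C2_realD(1)[OF assms]
    by (fastforce intro: has_field_derivative_at_within)
  then show ?thesis using that[of "max K 0"] K by (meson max.cobounded2 max.coboundedI1)
qed

section \<open>The wave profile\<close>

locale wave =
  fixes f F u :: "real \<Rightarrow> real" and a E c um up :: real
  assumes C2: "C2_real f" and F: "\<And>x. (F has_real_derivative f x) (at x)" and c: "1 < c"
    and well: "potential_well F a E c um up"
    and wave: "periodic_wave f F a E c um up u"
begin

abbreviation "u1 \<equiv> deriv u"
abbreviation "u2 \<equiv> deriv (deriv u)"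
text \<open>The potential of the linearised operator, which acts by L v = - c v_xx + q v;
  \<open>q'\<close> is the derivative of \<open>q\<close> along the wave.\<close>

definition "q x = c - 1 - deriv f (u x)"
definition "q' x = - (u1 x * deriv (deriv f) (u x))"

lemma du: "(u has_real_derivative u1 x) (at x)" and du1: "(u1 has_real_derivative u2 x) (at x)"
  using wave unfolding periodic_wave_def DERIV_deriv_iff_real_differentiable by blast+

lemma u2_eq: "u2 x = (a + (c - 1) * u x - f (u x)) / c"
proof -
  have "c * u2 x - (c - 1) * u x + f (u x) = a" using wave unfolding periodic_wave_def by blast
  then show ?thesis using c by (simp add: field_simps)
qed

lemma energy: "c / 2 * (u1 x)\<^sup>2 + gbbm_V F a c (u x) = E"
  using wave unfolding periodic_wave_def by blast

lemma u_0: "u 0 = um" and u1_0: "u1 0 = 0" and range_u: "range u = {um..up}"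
  using wave unfolding periodic_wave_def by blast+

lemma u_in: "u x \<in> {um..up}"
  using range_u by blast

lemma continuous_u: "continuous_on S u" and continuous_u1: "continuous_on S u1"
  by (auto intro!: DERIV_continuous_on has_field_derivative_at_within[OF du] has_field_derivative_at_within[OF du1])

lemma dV: "(gbbm_V F a c has_real_derivative (f w - (c - 1) * w - a)) (at w)"
  unfolding gbbm_V_def by (auto intro!: derivative_eq_intros F simp: field_simps)

lemma um_less_up: "um < up" and V_um: "gbbm_V F a c um = E" and V_up: "gbbm_V F a c up = E"
  and V_less: "w \<in> {um<..<up} \<Longrightarrow> gbbm_V F a c w < E"
  and V'_um_nz: "f um - (c - 1) * um - a \<noteq> 0" and V'_up_nz: "f up - (c - 1) * up - a \<noteq> 0"
  using well unfolding potential_well_def DERIV_imp_deriv[OF dV] by blast+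

text \<open>A nonnegative slope at \<open>um\<close> would be positive, since the root is simple,
  and would lift V above \<open>E\<close> inside the well.\<close>

lemma V'_um: "f um - (c - 1) * um - a < 0"
proof (rule ccontr)
  assume "\<not> ?thesis"
  then have "f um - (c - 1) * um - a > 0" using V'_um_nz by simp
  from DERIV_pos_inc_right[OF dV this] obtain d where
    d: "d > 0" "\<And>h. 0 < h \<Longrightarrow> h < d \<Longrightarrow> gbbm_V F a c um < gbbm_V F a c (um + h)" by blast
  define h where "h = min d (up - um) / 2"
  have "0 < h" "h < d" "h < up - um" using d(1) um_less_up by (auto simp: h_def min_def)
  then show False using d(2)[of h] V_less[of "um + h"] V_um by auto
qed

lemma V'_up: "f up - (c - 1) * up - a > 0"
proof (rule ccontr)
  assume "\<not> ?thesis"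
  then have "f up - (c - 1) * up - a < 0" using V'_up_nz by simp
  from DERIV_neg_dec_left[OF dV this] obtain d where
    d: "d > 0" "\<And>h. 0 < h \<Longrightarrow> h < d \<Longrightarrow> gbbm_V F a c up < gbbm_V F a c (up - h)" by blast
  define h where "h = min d (up - um) / 2"
  have "0 < h" "h < d" "h < up - um" using d(1) um_less_up by (auto simp: h_def min_def)
  then show False using d(2)[of h] V_less[of "up - h"] V_up by auto
qed

lemma u2_um: "u x = um \<Longrightarrow> u2 x > 0" and u2_up: "u x = up \<Longrightarrow> u2 x < 0"
  using V'_um V'_up c unfolding u2_eq by (auto simp: divide_simps)

lemma u1_zero_iff: "u1 x = 0 \<longleftrightarrow> u x = um \<or> u x = up"
proof -
  have "u1 x = 0 \<longleftrightarrow> gbbm_V F a c (u x) = E" using energy[of x] c by auto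
  also have "\<dots> \<longleftrightarrow> u x = um \<or> u x = up"
  proof
    assume "gbbm_V F a c (u x) = E"
    then have "u x \<notin> {um<..<up}" using V_less[of "u x"] by auto
    then show "u x = um \<or> u x = up" using u_in[of x] by auto
  qed (use V_um V_up in auto)
  finally show ?thesis .
qed

text \<open>The wave and its mirror image about a critical point \<open>b\<close> solve the same
  second order equation with the same data at \<open>b\<close>.\<close>

lemma reflect:
  assumes b: "u1 b = 0"
  shows "u (2 * b - x) = u x" "u1 (2 * b - x) = - u1 x"
proof -
  obtain K where K: "K \<ge> 0" "\<And>s t. s \<in> {um..up} \<Longrightarrow> t \<in> {um..up} \<Longrightarrow> \<bar>f s - f t\<bar> \<le> K * \<bar>s - t\<bar>"
    by (rule C2_real_Lipschitz[OF C2, of um up]) blast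
  define v0 where "v0 = (\<lambda>x. u x - u (2 * b - x))"
  define v1 where "v1 = (\<lambda>x. u1 x + u1 (2 * b - x))"
  define w where "w = (\<lambda>x. u2 x - u2 (2 * b - x))"
  have d0: "(v0 has_vector_derivative v1 x) (at x)" for x
    using has_vector_derivative_diff[OF du[of x, unfolded has_real_derivative_iff_has_vector_derivative]
        has_vector_derivative_reflect[OF du[of "2 * b - x", unfolded has_real_derivative_iff_has_vector_derivative]]]
    by (simp add: v0_def v1_def)
  have d1: "(v1 has_vector_derivative w x) (at x)" for x
    using has_vector_derivative_add[OF du1[of x, unfolded has_real_derivative_iff_has_vector_derivative]
        has_vector_derivative_reflect[OF du1[of "2 * b - x", unfolded has_real_derivative_iff_has_vector_derivative]]]
    by (simp add: v1_def w_def)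
  have "norm (w x) \<le> ((c - 1 + K) / c) * (norm (v0 x) + norm (v1 x))" for x
  proof -
    have "w x = ((c - 1) * v0 x - (f (u x) - f (u (2 * b - x)))) / c"
      using c by (simp add: w_def u2_eq v0_def field_simps)
    also have "norm \<dots> \<le> ((c - 1) * \<bar>v0 x\<bar> + K * \<bar>v0 x\<bar>) / c"
    proof -
      have "\<bar>(c - 1) * v0 x - (f (u x) - f (u (2 * b - x)))\<bar> \<le> \<bar>(c - 1) * v0 x\<bar> + \<bar>f (u x) - f (u (2 * b - x))\<bar>"
        by linarith
      also have "\<dots> \<le> (c - 1) * \<bar>v0 x\<bar> + K * \<bar>v0 x\<bar>"
        using K(2)[OF u_in u_in, of x "2 * b - x"] c by (simp add: v0_def abs_mult)
      finally show ?thesis using c by (simp add: divide_right_mono)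
    qed
    also have "\<dots> = ((c - 1 + K) / c) * \<bar>v0 x\<bar>" by (simp add: algebra_simps add_divide_distrib)
    also have "\<dots> \<le> ((c - 1 + K) / c) * (norm (v0 x) + norm (v1 x))"
      using c K(1) by (intro mult_left_mono) auto
    finally show ?thesis .
  qed
  then have w: "\<exists>K. \<forall>x. \<bar>x\<bar> \<le> X \<longrightarrow> norm (w x) \<le> K * (norm (v0 x) + norm (v1 x))" for X by blast
  have "v0 b = 0" "v1 b = 0" using b by (auto simp: v0_def v1_def)
  from unique2[OF d0 d1 w this, of x] show "u (2 * b - x) = u x" "u1 (2 * b - x) = - u1 x"
    by (auto simp: v0_def v1_def)
qed

lemma u_minus: "u (- x) = u x" and u1_minus: "u1 (- x) = - u1 x"
  using reflect[OF u1_0, of x] by auto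

text \<open>Half of the period: the first time at which the wave, started at its minimum, reaches
  its maximum.\<close>

definition "\<tau> = Inf {x. 0 \<le> x \<and> u x = up}"

lemma tau: "0 < \<tau>" "u \<tau> = up" "\<And>x. 0 \<le> x \<Longrightarrow> x < \<tau> \<Longrightarrow> u x \<noteq> up"
proof -
  let ?S = "{x. 0 \<le> x \<and> u x = up}"
  have "up \<in> range u" using range_u um_less_up by auto
  then obtain x0 where "u x0 = up" by blast
  \<comment> \<open>The range condition yields a crest at a point of unknown sign; evenness moves it
    to the right of 0.\<close>
  then have ne: "\<bar>x0\<bar> \<in> ?S" using u_minus by (auto simp: abs_if)
  have "closed ({0..} \<inter> u -` {up})"
    using continuous_closed_vimage[of "{up}" u] DERIV_isCont[OF du]
    by (intro closed_Int) auto
  moreover have "{0..} \<inter> u -` {up} = ?S" by auto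
  ultimately have cl: "closed ?S" by simp
  have "\<tau> \<in> ?S" unfolding \<tau>_def
    by (rule closed_contains_Inf[OF _ _ cl]) (use ne in \<open>auto simp only: bdd_below_def mem_Collect_eq\<close>)
  moreover have "\<tau> \<noteq> 0" using calculation u_0 um_less_up by auto
  ultimately show "0 < \<tau>" "u \<tau> = up" by auto
  show "u x \<noteq> up" if "0 \<le> x" "x < \<tau>" for x
    using that cInf_lower[of x ?S] unfolding \<tau>_def by (force simp: bdd_below_def)
qed

lemma u1_tau: "u1 \<tau> = 0" and u2_tau: "u2 \<tau> < 0" and u2_0: "u2 0 > 0"
  using u1_zero_iff tau(2) u2_up u2_um u_0 by auto

lemma u1_pos_near_0: obtains d where "d > 0" "\<And>x. 0 < x \<Longrightarrow> x < d \<Longrightarrow> u1 x > 0"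
  using DERIV_pos_inc_right[OF du1 u2_0] u1_0 by auto

text \<open>A return to \<open>um\<close> before the crest would create an interior local maximum
  with a value strictly between \<open>um\<close> and \<open>up\<close>, where the energy relation
  excludes \<open>u1 = 0\<close>.\<close>

lemma u_neq_um:
  assumes x: "0 < x" "x < \<tau>"
  shows "u x \<noteq> um"
proof
  assume ux: "u x = um"
  obtain d where d: "d > 0" "\<And>x. 0 < x \<Longrightarrow> x < d \<Longrightarrow> u1 x > 0" by (rule u1_pos_near_0) blast
  define h where "h = min d x / 2"
  have h: "0 < h" "h < d" "h < x" using d x by (auto simp: h_def min_def)
  have "u h > u 0"
    by (rule DERIV_pos_imp_increasing_open[OF h(1)])
       (use d h du continuous_u in \<open>force+\<close>)
  moreover obtain y where y: "y \<in> {0..x}" "\<And>z. z \<in> {0..x} \<Longrightarrow> u z \<le> u y"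
    using continuous_attains_sup[of "{0..x}" u] continuous_u x by auto
  moreover have "u h \<le> u y" using y(2)[of h] h by simp
  ultimately have uy: "um < u y" using u_0 by simp
  then have y': "0 < y" "y < x" using y(1) u_0 ux by (auto simp: order_le_less)
  have "u1 y = 0"
    by (rule DERIV_local_max[OF du, of "min y (x - y)"])
       (use y y' in \<open>auto simp: abs_if split: if_splits\<close>)
  then show False using u1_zero_iff uy tau(3)[of y] y' x by auto
qed

lemma u1_pos:
  assumes x: "0 < x" "x < \<tau>"
  shows "u1 x > 0"
proof (rule ccontr)
  assume n: "\<not> ?thesis"
  have nz: "u1 y \<noteq> 0" if "0 < y" "y < \<tau>" for y
    using u1_zero_iff u_neq_um tau(3) that by auto
  obtain d where d: "d > 0" "\<And>x. 0 < x \<Longrightarrow> x < d \<Longrightarrow> u1 x > 0" by (rule u1_pos_near_0) blast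
  define h where "h = min d x / 2"
  have h: "0 < h" "h < d" "h < x" using d x by (auto simp: h_def min_def)
  have "\<exists>y\<ge>h. y \<le> x \<and> u1 y = 0"
    by (rule IVT2') (use n d(2)[of h] h continuous_u1 in auto)
  then obtain y where "h \<le> y" "y \<le> x" "u1 y = 0" by blast
  then show False using nz[of y] x h by simp
qed

lemma u1_neg:
  assumes "\<tau> < x" "x < 2 * \<tau>"
  shows "u1 x < 0"
  using u1_pos[of "2 * \<tau> - x"] reflect(2)[OF u1_tau, of x] assms by auto

definition "T = 2 * \<tau>"

lemma T_pos: "0 < T" using tau by (simp add: T_def)

lemma u_refl: "u (T - x) = u x" and u1_refl: "u1 (T - x) = - u1 x"
  using reflect[OF u1_tau] by (auto simp: T_def)

lemma u_T: "u (x + T) = u x" and u1_T: "u1 (x + T) = u1 x"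
  using u_refl[of "- x"] u_minus[of x] u1_refl[of "- x"] u1_minus[of x] by (auto simp: add.commute)

lemma u2_T: "u2 (x + T) = u2 x" by (simp add: u2_eq u_T)

text \<open>\<open>T\<close> is a period as the composition of the reflections about 0 and
  \<open>\<tau>\<close>; no shorter one exists because the value \<open>um\<close> is not taken
  again before \<open>2 * \<tau>\<close>.\<close>

lemma wave_period_eq: "wave_period u = T"
  unfolding wave_period_def
proof (rule cInf_eq_minimum)
  show "T \<in> {t. 0 < t \<and> (\<forall>x. u (x + t) = u x)}" using T_pos u_T by auto
  fix t assume t: "t \<in> {t. 0 < t \<and> (\<forall>x. u (x + t) = u x)}"
  then have ut: "0 < t" "u t = um" using u_0 by (auto dest: spec[of _ 0])
  show "T \<le> t"
  proof (rule ccontr)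
    assume "\<not> T \<le> t"
    then have lt: "t < 2 * \<tau>" by (simp add: T_def)
    then have "0 < 2 * \<tau> - t" by simp
    consider "t < \<tau>" | "t = \<tau>" | "\<tau> < t" by linarith
    then show False
    proof cases
      case 1 then show False using u_neq_um ut by auto
    next
      case 2 then show False using tau(2) ut um_less_up by auto
    next
      case 3 then show False using u_neq_um[of "2 * \<tau> - t"] ut lt u_refl[of t] by (auto simp: T_def)
    qed
  qed
qed

lemma dq: "(q has_real_derivative q' x) (at x)"
  unfolding q_def q'_def
  by (auto intro!: derivative_eq_intros DERIV_chain2[OF C2_realD(2)[OF C2] du])

text \<open>The profile equation differentiated in x; it says that \<open>u1\<close> lies in the
  kernel of L.\<close>

lemma du2: "(u2 has_real_derivative (q x * u1 x / c)) (at x)"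
proof -
  have "((\<lambda>x. (a + (c - 1) * u x - f (u x)) / c) has_real_derivative (q x * u1 x / c)) (at x)"
    unfolding q_def using c
    by (auto intro!: derivative_eq_intros du DERIV_chain2[OF C2_realD(1)[OF C2] du] simp: field_simps)
  then show ?thesis by (simp add: u2_eq[abs_def])
qed

lemma continuous_u2: "continuous_on S u2" and continuous_q: "continuous_on S q"
  by (auto intro!: DERIV_continuous_on has_field_derivative_at_within[OF du2] has_field_derivative_at_within[OF dq])

lemma continuous_q': "continuous_on S q'"
  unfolding q'_def
  by (intro continuous_intros continuous_u1 continuous_on_compose2[OF C2_realD(3)[OF C2, of UNIV] continuous_u]) auto

lemma q_T: "q (x + T) = q x" and q'_T: "q' (x + T) = q' x" and q_refl: "q (T - x) = q x"
  by (simp_all add: q_def q'_def u_T u1_T u_refl)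

end

section \<open>The periodic Evans function\<close>

text \<open>Lipschitz difference quotients extend continuously to \<open>z\<close>, so the
  derivative exists without its value being known. Holomorphy in \<open>\<mu>\<close> is thus
  obtained without solving the variational equation.\<close>

lemma field_differentiable_if_Lipschitz_quotient:
  fixes g :: "complex \<Rightarrow> complex"
  assumes r: "r > 0" and C: "C \<ge> 0"
    and L: "\<And>x y. x \<in> ball z r - {z} \<Longrightarrow> y \<in> ball z r - {z} \<Longrightarrow>
      cmod ((g x - g z) / (x - z) - (g y - g z) / (y - z)) \<le> C * cmod (x - y)"
  shows "g field_differentiable at z"
proof -
  let ?h = "\<lambda>x. (g x - g z) / (x - z)"
  have "uniformly_continuous_on (ball z r - {z}) ?h"
    unfolding uniformly_continuous_on_def
  proof (intro allI impI)
    fix e :: real assume e: "e > 0"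
    show "\<exists>d>0. \<forall>x\<in>ball z r - {z}. \<forall>x'\<in>ball z r - {z}. dist x' x < d \<longrightarrow> dist (?h x') (?h x) < e"
    proof (intro exI[of _ "e / (C + 1)"] conjI ballI impI)
      show "e / (C + 1) > 0" using e C by simp
      fix x x' assume x: "x \<in> ball z r - {z}" "x' \<in> ball z r - {z}" and d: "dist x' x < e / (C + 1)"
      have "dist (?h x') (?h x) \<le> C * cmod (x' - x)" using L[OF x(2,1)] by (simp add: dist_norm)
      also have "\<dots> \<le> (C + 1) * cmod (x' - x)" by (intro mult_right_mono) auto
      also have "\<dots> < e" using d C by (simp add: dist_norm field_simps)
      finally show "dist (?h x') (?h x) < e" .
    qed
  qed
  moreover have "z \<in> closure (ball z r - {z})"
    using r islimpt_in_closure[of z "ball z r"] interior_limit_point[of z "ball z r"] by auto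
  ultimately obtain l where "(?h \<longlongrightarrow> l) (at z within (ball z r - {z}))"
    by (rule uniformly_continuous_on_extension_at_closure)
  then have "(?h \<longlongrightarrow> l) (at z within ball z r)" by (simp add: at_within_def)
  then have "(?h \<longlongrightarrow> l) (at z)" using r by (simp add: at_within_open[of z "ball z r"])
  then have "(g has_field_derivative l) (at z)" by (simp add: has_field_derivative_iff)
  then show ?thesis by (auto simp: field_differentiable_def)
qed

context wave begin

lemma q_bound: obtains Q where "Q \<ge> 0" "\<And>x. \<bar>x\<bar> \<le> X \<Longrightarrow> \<bar>q x\<bar> \<le> Q" "\<And>x. \<bar>x\<bar> \<le> X \<Longrightarrow> \<bar>q' x\<bar> \<le> Q"
proof -
  have "bounded (q ` {-X..X})" "bounded (q' ` {-X..X})"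
    by (auto intro!: compact_imp_bounded compact_continuous_image continuous_q continuous_q')
  then obtain A B where "\<And>x. x \<in> {-X..X} \<Longrightarrow> \<bar>q x\<bar> \<le> A" "\<And>x. x \<in> {-X..X} \<Longrightarrow> \<bar>q' x\<bar> \<le> B"
    unfolding bounded_iff by (metis imageI real_norm_def)
  then show ?thesis by (intro that[of "max 0 (max A B)"]) (auto simp: abs_le_iff max.coboundedI1 max.coboundedI2)
qed

text \<open>The equation (L v)_x = \<mu> (v - v_xx) solved for v_xxx, as in the third row of
  \<open>evans_H\<close>.\<close>

definition third_rhs :: "complex \<Rightarrow> real \<Rightarrow> complex \<Rightarrow> complex \<Rightarrow> complex \<Rightarrow> complex" where
  "third_rhs \<mu> x v w z = ((of_real (q' x) - \<mu>) * v + of_real (q x) * w + \<mu> * z) / of_real c"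

definition third_sol :: "complex \<Rightarrow> (real \<Rightarrow> complex) \<Rightarrow> (real \<Rightarrow> complex) \<Rightarrow> (real \<Rightarrow> complex) \<Rightarrow> bool" where
  "third_sol \<mu> v0 v1 v2 \<longleftrightarrow> (\<forall>x. (v0 has_vector_derivative v1 x) (at x) \<and>
     (v1 has_vector_derivative v2 x) (at x) \<and>
     (v2 has_vector_derivative third_rhs \<mu> x (v0 x) (v1 x) (v2 x)) (at x))"

lemma third_rhs_bound:
  assumes "\<bar>q x\<bar> \<le> Q" "\<bar>q' x\<bar> \<le> Q" "cmod \<mu> \<le> R"
  shows "cmod (third_rhs \<mu> x v w z) \<le> (Q + R) * (cmod v + cmod w + cmod z)"
proof -
  have "cmod (third_rhs \<mu> x v w z) = cmod ((of_real (q' x) - \<mu>) * v + of_real (q x) * w + \<mu> * z) / c"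
    using c by (simp add: third_rhs_def norm_divide)
  also have "\<dots> \<le> cmod ((of_real (q' x) - \<mu>) * v + of_real (q x) * w + \<mu> * z) / 1"
    using c by (intro divide_left_mono) auto
  also have "\<dots> = cmod ((of_real (q' x) - \<mu>) * v + of_real (q x) * w + \<mu> * z)" by simp
  also have "\<dots> \<le> cmod (of_real (q' x) - \<mu>) * cmod v + cmod (of_real (q x)) * cmod w + cmod \<mu> * cmod z"
    using norm_triangle_ineq[of "(of_real (q' x) - \<mu>) * v + of_real (q x) * w" "\<mu> * z"]
      norm_triangle_ineq[of "(of_real (q' x) - \<mu>) * v" "of_real (q x) * w"]
    unfolding norm_mult by linarith
  also have "\<dots> \<le> (Q + R) * cmod v + (Q + R) * cmod w + (Q + R) * cmod z"
  proof (intro add_mono mult_right_mono norm_ge_zero)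
    show "cmod (of_real (q' x) - \<mu>) \<le> Q + R"
      using norm_triangle_ineq4[of "of_real (q' x)" \<mu>] assms by (simp add: norm_of_real)
    show "cmod (of_real (q x)) \<le> Q + R" "cmod \<mu> \<le> Q + R"
      using assms order_trans[OF norm_ge_zero assms(3)] by (auto simp: norm_of_real)
  qed
  finally show ?thesis by (simp add: algebra_simps)
qed

lemma third_rhs_linear: "third_rhs \<mu> x (s * v + v') (s * w + w') (s * z + z') = s * third_rhs \<mu> x v w z + third_rhs \<mu> x v' w' z'"
  unfolding third_rhs_def add_divide_distrib[symmetric] times_divide_eq_right by (simp add: algebra_simps)

lemma third_rhs_diff: "third_rhs \<mu> x (v - v') (w - w') (z - z') = third_rhs \<mu> x v w z - third_rhs \<mu> x v' w' z'"
  using third_rhs_linear[of \<mu> x "-1" v' v w' w z' z] by simp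

text \<open>The constant depends on \<open>R\<close> and \<open>X\<close> only, not on
  \<open>\<mu>\<close>, the solution or the forcing \<open>e\<close>. A change of
  \<open>\<mu>\<close> can therefore be treated as a forcing term, which serves both holomorphy and
  the limit at \<open>\<mu> = 0\<close>.\<close>

lemma evans_gronwall:
  obtains C where "C > 0"
    "\<And>\<mu> v0 v1 v2 e \<epsilon> x. cmod \<mu> \<le> R \<Longrightarrow> (\<And>x. (v0 has_vector_derivative v1 x) (at x)) \<Longrightarrow>
       (\<And>x. (v1 has_vector_derivative v2 x) (at x)) \<Longrightarrow>
       (\<And>x. (v2 has_vector_derivative (third_rhs \<mu> x (v0 x) (v1 x) (v2 x) + e x)) (at x)) \<Longrightarrow>
       (\<And>x. 0 \<le> x \<Longrightarrow> x \<le> X \<Longrightarrow> cmod (e x) \<le> \<epsilon>) \<Longrightarrow> 0 \<le> \<epsilon> \<Longrightarrow> 0 \<le> x \<Longrightarrow> x \<le> X \<Longrightarrow>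
       cmod (v0 x) \<le> C * (cmod (v0 0) + cmod (v1 0) + cmod (v2 0) + \<epsilon>) \<and>
       cmod (v1 x) \<le> C * (cmod (v0 0) + cmod (v1 0) + cmod (v2 0) + \<epsilon>) \<and>
       cmod (v2 x) \<le> C * (cmod (v0 0) + cmod (v1 0) + cmod (v2 0) + \<epsilon>)"
proof -
  obtain Q where Q: "Q \<ge> 0" "\<And>x. \<bar>x\<bar> \<le> X \<Longrightarrow> \<bar>q x\<bar> \<le> Q" "\<And>x. \<bar>x\<bar> \<le> X \<Longrightarrow> \<bar>q' x\<bar> \<le> Q"
    by (rule q_bound[of X]) blast
  define K where "K = Q + \<bar>R\<bar>"
  have K: "K \<ge> 0" using Q by (simp add: K_def)
  show ?thesis
  proof (rule that[of "gronwall_const (3 * K + 2) \<bar>X\<bar>"])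
    show "gronwall_const (3 * K + 2) \<bar>X\<bar> > 0"
      using gronwall_const_ge_1[of "3*K+2" "\<bar>X\<bar>"] K by simp
    fix \<mu> v0 v1 v2 e \<epsilon> and x :: real
    assume \<mu>: "cmod \<mu> \<le> R" and d: "\<And>x. (v0 has_vector_derivative v1 x) (at x)"
       "\<And>x. (v1 has_vector_derivative v2 x) (at x)"
       "\<And>x. (v2 has_vector_derivative (third_rhs \<mu> x (v0 x) (v1 x) (v2 x) + e x)) (at x)"
       and e: "\<And>x. 0 \<le> x \<Longrightarrow> x \<le> X \<Longrightarrow> cmod (e x) \<le> \<epsilon>" "0 \<le> \<epsilon>" and x: "0 \<le> x" "x \<le> X"
    have w: "cmod (third_rhs \<mu> x (v0 x) (v1 x) (v2 x) + e x) \<le> K * (cmod (v0 x) + cmod (v1 x) + cmod (v2 x)) + \<epsilon>"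
      if "0 \<le> x" "x \<le> X" for x
    proof -
      have "cmod \<mu> \<le> \<bar>R\<bar>" using \<mu> by linarith
      then have "cmod (third_rhs \<mu> x (v0 x) (v1 x) (v2 x)) \<le> K * (cmod (v0 x) + cmod (v1 x) + cmod (v2 x))"
        unfolding K_def using that Q(2,3)[of x] by (intro third_rhs_bound) auto
      then show ?thesis
        using e(1)[OF that] norm_triangle_ineq[of "third_rhs \<mu> x (v0 x) (v1 x) (v2 x)" "e x"] by linarith
    qed
    show "cmod (v0 x) \<le> gronwall_const (3 * K + 2) \<bar>X\<bar> * (cmod (v0 0) + cmod (v1 0) + cmod (v2 0) + \<epsilon>) \<and>
       cmod (v1 x) \<le> gronwall_const (3 * K + 2) \<bar>X\<bar> * (cmod (v0 0) + cmod (v1 0) + cmod (v2 0) + \<epsilon>) \<and>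
       cmod (v2 x) \<le> gronwall_const (3 * K + 2) \<bar>X\<bar> * (cmod (v0 0) + cmod (v1 0) + cmod (v2 0) + \<epsilon>)"
      using gronwall3[OF d w K e(2) x] x by (simp add: mult.commute)
  qed
qed

lemma third_sol_zero:
  assumes s: "third_sol \<mu> v0 v1 v2" and z: "v0 b = 0" "v1 b = 0" "v2 b = 0"
  shows "v0 x = 0" "v1 x = 0" "v2 x = 0"
proof -
  have w: "\<exists>K. \<forall>x. \<bar>x\<bar> \<le> X \<longrightarrow> cmod (third_rhs \<mu> x (v0 x) (v1 x) (v2 x)) \<le> K * (cmod (v0 x) + cmod (v1 x) + cmod (v2 x))" for X
    by (rule q_bound[of X]) (meson third_rhs_bound order_refl)
  show "v0 x = 0" "v1 x = 0" "v2 x = 0"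
    using unique3[of v0 v1 v2 "\<lambda>x. third_rhs \<mu> x (v0 x) (v1 x) (v2 x)" b x, OF _ _ _ w z] s
    unfolding third_sol_def by blast+
qed

lemma third_sol_add_scale:
  assumes "third_sol \<mu> v0 v1 v2" "third_sol \<mu> w0 w1 w2"
  shows "third_sol \<mu> (\<lambda>x. s * v0 x + w0 x) (\<lambda>x. s * v1 x + w1 x) (\<lambda>x. s * v2 x + w2 x)"
  using assms unfolding third_sol_def third_rhs_linear
  by (intro allI conjI has_vector_derivative_add has_vector_derivative_mult_right) blast+

lemma third_sol_null: "third_sol \<mu> (\<lambda>x. 0) (\<lambda>x. 0) (\<lambda>x. 0)"
  by (simp add: third_sol_def third_rhs_def)

lemma third_sol_diff:
  assumes "third_sol \<mu> v0 v1 v2" "third_sol \<mu> w0 w1 w2"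
  shows "third_sol \<mu> (\<lambda>x. v0 x - w0 x) (\<lambda>x. v1 x - w1 x) (\<lambda>x. v2 x - w2 x)"
  using third_sol_add_scale[OF assms(2,1), of "-1"] by simp

lemma third_sol_unique:
  assumes "third_sol \<mu> v0 v1 v2" "third_sol \<mu> w0 w1 w2" "v0 b = w0 b" "v1 b = w1 b" "v2 b = w2 b"
  shows "v0 x = w0 x" "v1 x = w1 x" "v2 x = w2 x"
  using third_sol_zero[OF third_sol_diff[OF assms(1,2)], of b x] assms(3-) by auto

lemma third_sol_shift:
  assumes "third_sol \<mu> v0 v1 v2"
  shows "third_sol \<mu> (\<lambda>x. v0 (x + T)) (\<lambda>x. v1 (x + T)) (\<lambda>x. v2 (x + T))"
proof -
  have L: "third_rhs \<mu> (x + T) = third_rhs \<mu> x" for x by (intro ext) (simp add: third_rhs_def q_T q'_T)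
  have "((\<lambda>x. v2 (x + T)) has_vector_derivative third_rhs \<mu> (x + T) (v0 (x + T)) (v1 (x + T)) (v2 (x + T))) (at x)" for x
    using assms unfolding third_sol_def by (blast intro: has_vector_derivative_shift)
  then show ?thesis
    using assms unfolding third_sol_def L by (blast intro: has_vector_derivative_shift)
qed

lemma third_sol_cnj:
  assumes "third_sol (of_real \<mu>) v0 v1 v2"
  shows "third_sol (of_real \<mu>) (\<lambda>x. cnj (v0 x)) (\<lambda>x. cnj (v1 x)) (\<lambda>x. cnj (v2 x))"
proof -
  have "third_rhs (of_real \<mu>) x (cnj a) (cnj b) (cnj d) = cnj (third_rhs (of_real \<mu>) x a b d)" for x a b d
    by (simp add: third_rhs_def)
  then show ?thesis
    using assms unfolding third_sol_def by (auto intro: has_vector_derivative_cnj)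
qed

end

section \<open>The monodromy matrix: shift, reality, holomorphy in the spectral parameter\<close>

locale wave_evans = wave +
  fixes \<Phi> :: "real \<Rightarrow> complex \<Rightarrow> complex^3^3"
  assumes fund: "fundamental_matrix f c u \<Phi>"
begin

lemma Phi_0: "\<Phi> 0 \<mu> = mat 1"
  using fund by (simp add: fundamental_matrix_def)

lemma Phi_column: "third_sol \<mu> (\<lambda>x. \<Phi> x \<mu> $ 1 $ j) (\<lambda>x. \<Phi> x \<mu> $ 2 $ j) (\<lambda>x. \<Phi> x \<mu> $ 3 $ j)"
proof -
  have d: "((\<lambda>y. \<Phi> y \<mu> $ i $ j) has_vector_derivative ((evans_H f c u x \<mu> ** \<Phi> x \<mu>) $ i $ j)) (at x)" for x i
  proof -
    have "((\<lambda>y. \<Phi> y \<mu>) has_vector_derivative (evans_H f c u x \<mu> ** \<Phi> x \<mu>)) (at x)"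
      using fund by (simp add: fundamental_matrix_def)
    from bounded_linear.has_vector_derivative[OF bounded_linear_vec_nth this, of i]
    have "((\<lambda>y. \<Phi> y \<mu> $ i) has_vector_derivative ((evans_H f c u x \<mu> ** \<Phi> x \<mu>) $ i)) (at x)" .
    from bounded_linear.has_vector_derivative[OF bounded_linear_vec_nth this, of j] show ?thesis .
  qed
  have "(evans_H f c u x \<mu> ** \<Phi> x \<mu>) $ 1 $ j = \<Phi> x \<mu> $ 2 $ j"
    "(evans_H f c u x \<mu> ** \<Phi> x \<mu>) $ 2 $ j = \<Phi> x \<mu> $ 3 $ j"
    "(evans_H f c u x \<mu> ** \<Phi> x \<mu>) $ 3 $ j = third_rhs \<mu> x (\<Phi> x \<mu> $ 1 $ j) (\<Phi> x \<mu> $ 2 $ j) (\<Phi> x \<mu> $ 3 $ j)" for x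
    using c by (simp_all add: evans_H_def matrix_matrix_mult_def sum_3 vector_3 third_rhs_def q_def q'_def field_simps)
  with d show ?thesis unfolding third_sol_def by metis
qed

lemma Phi_vector: "third_sol \<mu> (\<lambda>x. (\<Phi> x \<mu> *v y) $ 1) (\<lambda>x. (\<Phi> x \<mu> *v y) $ 2) (\<lambda>x. (\<Phi> x \<mu> *v y) $ 3)"
proof -
  have "(\<Phi> x \<mu> *v y) $ i = y $ 3 * \<Phi> x \<mu> $ i $ 3 + (y $ 2 * \<Phi> x \<mu> $ i $ 2 + (y $ 1 * \<Phi> x \<mu> $ i $ 1 + 0))" for x i
    by (simp add: matrix_vector_mult_def sum_3)
  then show ?thesis
    by (simp only:) (intro third_sol_add_scale Phi_column third_sol_null)
qed

lemma third_sol_Phi: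
  assumes s: "third_sol \<mu> v0 v1 v2"
  shows "vector [v0 x, v1 x, v2 x] = \<Phi> x \<mu> *v vector [v0 0, v1 0, v2 0]"
  using third_sol_unique[OF s Phi_vector[of \<mu> "vector [v0 0, v1 0, v2 0]"], of 0 x]
  by (simp add: vec_eq_iff forall_3 vector_3 Phi_0)

lemma Phi_inj:
  assumes "\<Phi> x \<mu> *v y = 0"
  shows "y = 0"
  using third_sol_zero[OF Phi_vector[of \<mu> y], of x 0] assms by (simp add: vec_eq_iff forall_3 Phi_0)

lemma det_Phi_nz: "det (\<Phi> x \<mu>) \<noteq> 0"
  using Phi_inj[of x \<mu>] matrix_left_invertible_ker[of "\<Phi> x \<mu>"] invertible_left_inverse[of "\<Phi> x \<mu>"]
    invertible_det_nz[of "\<Phi> x \<mu>"] by blast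

text \<open>The coefficients have period \<open>T\<close>, so shifted columns are solutions again.
  Taken at \<open>x = - T\<close> this exhibits \<open>\<Phi> (- T)\<close> as the inverse of the
  monodromy matrix.\<close>

lemma Phi_shift: "\<Phi> (x + T) \<mu> = \<Phi> x \<mu> ** \<Phi> T \<mu>"
proof -
  have "vector [\<Phi> (x + T) \<mu> $ 1 $ j, \<Phi> (x + T) \<mu> $ 2 $ j, \<Phi> (x + T) \<mu> $ 3 $ j] =
     \<Phi> x \<mu> *v vector [\<Phi> T \<mu> $ 1 $ j, \<Phi> T \<mu> $ 2 $ j, \<Phi> T \<mu> $ 3 $ j]" for j
    using third_sol_Phi[OF third_sol_shift[OF Phi_column], of x] by simp
  then show ?thesis
    by (simp add: vec_eq_iff forall_3 vector_3 matrix_vector_mult_def matrix_matrix_mult_def sum_3)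
qed

lemma Phi_real: "\<Phi> x (of_real \<mu>) $ i $ j \<in> \<real>"
proof -
  have eq: "cnj (\<Phi> 0 (of_real \<mu>) $ i $ j) = \<Phi> 0 (of_real \<mu>) $ i $ j" for i
    by (simp add: Phi_0 mat_def)
  have "cnj (\<Phi> x (of_real \<mu>) $ i $ j) = \<Phi> x (of_real \<mu>) $ i $ j" for i
    using third_sol_unique[OF third_sol_cnj[OF Phi_column] Phi_column eq eq eq, of x] exhaust_3[of i] by auto
  then show ?thesis by (simp add: Reals_cnj_iff)
qed

lemma evans_D_real: "evans_D \<Phi> x (of_real \<mu>) 1 \<in> \<real>"
  unfolding evans_D_def det_3
  by (auto intro!: Reals_add Reals_diff Reals_mult Phi_real simp: mat_def)

text \<open>Three rounds of one Gronwall bound: the entries are bounded (\<open>B1\<close>), they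
  are Lipschitz in the parameter (\<open>Bd\<close>), and their difference quotients at
  \<open>\<mu>\<close> solve the equation with a forcing that is Lipschitz in \<open>\<nu>\<close>,
  so that the quotients are Lipschitz as well.\<close>

lemma Phi_holomorphic:
  assumes X: "0 \<le> X"
  shows "(\<lambda>\<mu>. \<Phi> X \<mu> $ i $ j) holomorphic_on UNIV"
  unfolding holomorphic_on_def
proof (intro ballI)
  fix \<mu> :: complex
  define R where "R = cmod \<mu> + 1"
  obtain C where C: "C > 0"
    "\<And>\<mu> v0 v1 v2 e \<epsilon> x. cmod \<mu> \<le> R \<Longrightarrow> (\<And>x. (v0 has_vector_derivative v1 x) (at x)) \<Longrightarrow>
       (\<And>x. (v1 has_vector_derivative v2 x) (at x)) \<Longrightarrow>
       (\<And>x. (v2 has_vector_derivative (third_rhs \<mu> x (v0 x) (v1 x) (v2 x) + e x)) (at x)) \<Longrightarrow>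
       (\<And>x. 0 \<le> x \<Longrightarrow> x \<le> X \<Longrightarrow> cmod (e x) \<le> \<epsilon>) \<Longrightarrow> 0 \<le> \<epsilon> \<Longrightarrow> 0 \<le> x \<Longrightarrow> x \<le> X \<Longrightarrow>
       cmod (v0 x) \<le> C * (cmod (v0 0) + cmod (v1 0) + cmod (v2 0) + \<epsilon>) \<and>
       cmod (v1 x) \<le> C * (cmod (v0 0) + cmod (v1 0) + cmod (v2 0) + \<epsilon>) \<and>
       cmod (v2 x) \<le> C * (cmod (v0 0) + cmod (v1 0) + cmod (v2 0) + \<epsilon>)"
    by (rule evans_gronwall[of R X]) blast
  define A where "A = (\<lambda>\<nu> x i. \<Phi> x \<nu> $ i $ j)"
  have A: "((\<lambda>x. A \<nu> x 1) has_vector_derivative A \<nu> x 2) (at x)"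
    "((\<lambda>x. A \<nu> x 2) has_vector_derivative A \<nu> x 3) (at x)"
    "((\<lambda>x. A \<nu> x 3) has_vector_derivative third_rhs \<nu> x (A \<nu> x 1) (A \<nu> x 2) (A \<nu> x 3)) (at x)" for \<nu> x
    using Phi_column[of \<nu> j] unfolding third_sol_def A_def by blast+
  have A0: "A \<nu> 0 i = (if i = j then 1 else 0)" for \<nu> i by (simp add: A_def Phi_0 mat_def)
  have B1: "cmod (A \<nu> x i) \<le> C * 3" if "cmod \<nu> \<le> R" "0 \<le> x" "x \<le> X" for \<nu> x i
  proof -
    have "cmod (A \<nu> x i) \<le> C * (cmod (A \<nu> 0 1) + cmod (A \<nu> 0 2) + cmod (A \<nu> 0 3) + 0)"
      using C(2)[of \<nu> "\<lambda>x. A \<nu> x 1" "\<lambda>x. A \<nu> x 2" "\<lambda>x. A \<nu> x 3" "\<lambda>x. 0" 0 x] A that exhaust_3[of i] by auto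
    also have "\<dots> \<le> C * 3" using C(1) by (intro mult_left_mono) (auto simp: A0)
    finally show ?thesis .
  qed
  \<comment> \<open>The right-hand side is affine in the parameter, so changing it acts as a forcing
    by the third component minus the first.\<close>
  have third_rhs_change: "third_rhs \<nu> x a b d = third_rhs \<mu> x a b d + (\<nu> - \<mu>) * (d - a) / of_real c" for \<nu> \<mu> x a b d
    using c by (simp add: third_rhs_def field_simps)
  have Bd: "cmod (A \<nu> x i - A \<mu> x i) \<le> C * (cmod (\<nu> - \<mu>) * (C * 6))"
    if "cmod \<nu> \<le> R" "cmod \<mu> \<le> R" "0 \<le> x" "x \<le> X" for \<nu> \<mu> x i
  proof -
    let ?d = "\<lambda>x i. A \<nu> x i - A \<mu> x i"
    let ?e = "\<lambda>x. (\<nu> - \<mu>) * (A \<nu> x 3 - A \<nu> x 1) / of_real c"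
    have d: "((\<lambda>x. ?d x 1) has_vector_derivative ?d x 2) (at x)"
      "((\<lambda>x. ?d x 2) has_vector_derivative ?d x 3) (at x)" for x
      by (intro has_vector_derivative_diff A)+
    have "third_rhs \<nu> x (A \<nu> x 1) (A \<nu> x 2) (A \<nu> x 3) - third_rhs \<mu> x (A \<mu> x 1) (A \<mu> x 2) (A \<mu> x 3) =
      third_rhs \<mu> x (?d x 1) (?d x 2) (?d x 3) + ?e x" for x
      unfolding third_rhs_diff third_rhs_change[of \<nu> x _ _ _ \<mu>] by simp
    then have d3: "((\<lambda>x. ?d x 3) has_vector_derivative third_rhs \<mu> x (?d x 1) (?d x 2) (?d x 3) + ?e x) (at x)" for x
      using has_vector_derivative_diff[OF A(3) A(3), of \<nu> \<mu> x] by simp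
    have e: "cmod (?e x) \<le> cmod (\<nu> - \<mu>) * (C * 6)" if x: "0 \<le> x" "x \<le> X" for x
    proof -
      have "cmod (?e x) = cmod (\<nu> - \<mu>) * cmod (A \<nu> x 3 - A \<nu> x 1) / c" using c by (simp add: norm_mult norm_divide)
      also have "\<dots> \<le> cmod (\<nu> - \<mu>) * cmod (A \<nu> x 3 - A \<nu> x 1) / 1" using c by (intro divide_left_mono) auto
      also have "\<dots> \<le> cmod (\<nu> - \<mu>) * (C * 6)"
        using B1[of \<nu> x 3] B1[of \<nu> x 1] x \<open>cmod \<nu> \<le> R\<close> norm_triangle_ineq4[of "A \<nu> x 3" "A \<nu> x 1"]
        unfolding div_by_1 by (intro mult_left_mono) auto
      finally show ?thesis .
    qed
    show ?thesis
      using C(2)[OF \<open>cmod \<mu> \<le> R\<close> d d3 e _ that(3,4)] C(1) exhaust_3[of i] by (auto simp: A0)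
  qed
  have muR: "cmod \<mu> \<le> R" by (simp add: R_def)
  show "(\<lambda>\<mu>. \<Phi> X \<mu> $ i $ j) field_differentiable at \<mu> within UNIV"
  proof (rule field_differentiable_if_Lipschitz_quotient[of 1 "C * (2 * (C * (C * 6)))"])
    fix \<nu> \<nu>' assume n: "\<nu> \<in> ball \<mu> 1 - {\<mu>}" "\<nu>' \<in> ball \<mu> 1 - {\<mu>}"
    have R: "cmod \<nu> \<le> R" "cmod \<nu>' \<le> R"
      using n norm_triangle_ineq2[of \<nu> \<mu>] norm_triangle_ineq2[of \<nu>' \<mu>] by (auto simp: R_def dist_norm norm_minus_commute)
    let ?Q = "\<lambda>\<nu> x i. (A \<nu> x i - A \<mu> x i) / (\<nu> - \<mu>)"
    let ?d = "\<lambda>x i. ?Q \<nu> x i - ?Q \<nu>' x i"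
    let ?e = "\<lambda>x. ((A \<nu> x 3 - A \<nu>' x 3) - (A \<nu> x 1 - A \<nu>' x 1)) / of_real c"
    have d: "((\<lambda>x. ?d x 1) has_vector_derivative ?d x 2) (at x)"
      "((\<lambda>x. ?d x 2) has_vector_derivative ?d x 3) (at x)" for x
      by (intro has_vector_derivative_diff has_vector_derivative_divide A)+
    have q: "(third_rhs \<nu> x (A \<nu> x 1) (A \<nu> x 2) (A \<nu> x 3) - third_rhs \<mu> x (A \<mu> x 1) (A \<mu> x 2) (A \<mu> x 3)) / (\<nu> - \<mu>) =
        third_rhs \<mu> x (?Q \<nu> x 1) (?Q \<nu> x 2) (?Q \<nu> x 3) + (A \<nu> x 3 - A \<nu> x 1) / of_real c"
      if "\<nu> \<noteq> \<mu>" for \<nu> x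
      using that c by (simp add: third_rhs_def divide_simps) (simp add: algebra_simps)
    have d3: "((\<lambda>x. ?d x 3) has_vector_derivative third_rhs \<mu> x (?d x 1) (?d x 2) (?d x 3) + ?e x) (at x)" for x
    proof -
      have "((\<lambda>x. ?d x 3) has_vector_derivative
         (third_rhs \<nu> x (A \<nu> x 1) (A \<nu> x 2) (A \<nu> x 3) - third_rhs \<mu> x (A \<mu> x 1) (A \<mu> x 2) (A \<mu> x 3)) / (\<nu> - \<mu>) -
         (third_rhs \<nu>' x (A \<nu>' x 1) (A \<nu>' x 2) (A \<nu>' x 3) - third_rhs \<mu> x (A \<mu> x 1) (A \<mu> x 2) (A \<mu> x 3)) / (\<nu>' - \<mu>)) (at x)"
        by (intro has_vector_derivative_diff has_vector_derivative_divide A)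
      moreover have "(third_rhs \<nu> x (A \<nu> x 1) (A \<nu> x 2) (A \<nu> x 3) - third_rhs \<mu> x (A \<mu> x 1) (A \<mu> x 2) (A \<mu> x 3)) / (\<nu> - \<mu>) -
         (third_rhs \<nu>' x (A \<nu>' x 1) (A \<nu>' x 2) (A \<nu>' x 3) - third_rhs \<mu> x (A \<mu> x 1) (A \<mu> x 2) (A \<mu> x 3)) / (\<nu>' - \<mu>)
        = third_rhs \<mu> x (?d x 1) (?d x 2) (?d x 3) + ?e x"
      proof -
        have n': "\<nu> \<noteq> \<mu>" "\<nu>' \<noteq> \<mu>" using n by auto
        have aux: "(P + (a3 - a1) / k) - (R + (b3 - b1) / k) = P - R + ((a3 - b3) - (a1 - b1)) / k"
          for P R a1 a3 b1 b3 k :: complex by (simp add: diff_divide_distrib)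
        show ?thesis
          unfolding q[OF n'(1)] q[OF n'(2)] third_rhs_diff[of \<mu> x "?Q \<nu> x 1" "?Q \<nu>' x 1" "?Q \<nu> x 2" "?Q \<nu>' x 2" "?Q \<nu> x 3" "?Q \<nu>' x 3"]
          by (rule aux)
      qed
      ultimately show ?thesis by (simp only:)
    qed
    have e: "cmod (?e x) \<le> 2 * (C * (cmod (\<nu> - \<nu>') * (C * 6)))" if x: "0 \<le> x" "x \<le> X" for x
    proof -
      have "cmod (?e x) = cmod ((A \<nu> x 3 - A \<nu>' x 3) - (A \<nu> x 1 - A \<nu>' x 1)) / c" using c by (simp add: norm_divide)
      also have "\<dots> \<le> cmod ((A \<nu> x 3 - A \<nu>' x 3) - (A \<nu> x 1 - A \<nu>' x 1)) / 1" using c by (intro divide_left_mono) auto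
      also have "\<dots> \<le> 2 * (C * (cmod (\<nu> - \<nu>') * (C * 6)))"
        using Bd[OF R x, of 3] Bd[OF R x, of 1] norm_triangle_ineq4[of "A \<nu> x 3 - A \<nu>' x 3" "A \<nu> x 1 - A \<nu>' x 1"] by simp
      finally show ?thesis .
    qed
    have "cmod (?d X i) \<le> C * (2 * (C * (cmod (\<nu> - \<nu>') * (C * 6))))"
      using C(2)[OF muR d d3 e _ X order_refl] C(1) exhaust_3[of i] by (auto simp: A0)
    then show "cmod ((\<Phi> X \<nu> $ i $ j - \<Phi> X \<mu> $ i $ j) / (\<nu> - \<mu>) - (\<Phi> X \<nu>' $ i $ j - \<Phi> X \<mu> $ i $ j) / (\<nu>' - \<mu>))
      \<le> C * (2 * (C * (C * 6))) * cmod (\<nu> - \<nu>')"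
      by (simp add: A_def algebra_simps)
  qed (use C(1) in auto)
qed

lemma evans_D_holomorphic: "0 \<le> X \<Longrightarrow> (\<lambda>\<mu>. evans_D \<Phi> X \<mu> l) holomorphic_on UNIV"
  unfolding evans_D_def det_3 vector_minus_component
  by (intro holomorphic_intros Phi_holomorphic)

end

section \<open>High frequencies\<close>

text \<open>This is the Evans system run backwards, \<open>t = - x\<close>, in the variables \<open>p = v + v\<^sub>x\<close>, \<open>m = v - v\<^sub>x\<close>, \<open>z = v\<^sub>x\<^sub>x - v\<close>
  with \<open>k = \<mu> / c\<close>: there \<open>z\<close> is damped at the large rate \<open>k\<close>, so \<open>p\<close> and \<open>m\<close> decouple in the limit.\<close>

lemma backward_solution_bound:
  fixes p m z \<rho> :: "real \<Rightarrow> complex"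
  assumes T: "T > 0" and k: "k \<ge> 1" "k \<ge> 4 * exp (2 * T) * B * T" and B: "B \<ge> 0"
    and dp: "\<And>t. (p has_vector_derivative (- p t - z t)) (at t)"
    and dm: "\<And>t. (m has_vector_derivative (m t + z t)) (at t)"
    and dz: "\<And>t. (z has_vector_derivative (- of_real k * z t - \<rho> t)) (at t)"
    and \<rho>: "\<And>t. 0 \<le> t \<Longrightarrow> t \<le> T \<Longrightarrow> cmod (\<rho> t) \<le> B * (cmod (p t) + cmod (m t))"
  defines "A \<equiv> cmod (p 0) + cmod (m 0) + cmod (z 0)"
  defines "W \<equiv> exp T * (1 + B * T * (4 * exp (2 * T))) * A / k"
  shows "cmod (of_real (exp T) * p T - p 0) \<le> W"
    "cmod (of_real (exp (- T)) * m T - m 0) \<le> W"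
    "cmod (z T) \<le> exp (- k * T) * A + B * (4 * exp (2 * T)) * A / k"
proof -
  have k0: "k > 0" using k by simp
  have cont: "continuous_on {0..T} p" "continuous_on {0..T} m" "continuous_on {0..t} z" for t
    by (intro continuous_at_imp_continuous_on ballI has_vector_derivative_continuous[OF dp]
        has_vector_derivative_continuous[OF dm] has_vector_derivative_continuous[OF dz])+
  have "continuous_on {0..T} (\<lambda>t. cmod (p t) + cmod (m t))"
    by (intro continuous_intros cont)
  then obtain t0 where t0: "t0 \<in> {0..T}"
    "\<And>t. t \<in> {0..T} \<Longrightarrow> cmod (p t) + cmod (m t) \<le> cmod (p t0) + cmod (m t0)"
    using continuous_attains_sup[of "{0..T}" "\<lambda>t. cmod (p t) + cmod (m t)"] T by auto
  \<comment> \<open>Bootstrap: \<open>z\<close> is bounded through \<open>S\<close>, then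
    \<open>p\<close> and \<open>m\<close> through \<open>z\<close>, and finally \<open>S\<close> by
    the initial data plus half of itself.\<close>
  define S where "S = cmod (p t0) + cmod (m t0)"
  have S0: "S \<ge> 0" by (simp add: S_def)
  have S: "cmod (p t) + cmod (m t) \<le> S" if "0 \<le> t" "t \<le> T" for t
    using t0(2)[of t] that by (simp add: S_def)
  have \<rho>S: "cmod (\<rho> t) \<le> B * S" if "0 \<le> t" "t \<le> T" for t
    using \<rho>[OF that] mult_left_mono[OF S[OF that] B] by linarith
  \<comment> \<open>Integrating factor, used with the rate \<open>k\<close> for \<open>z\<close> and
    with the rates 1 and -1 for \<open>p\<close> and \<open>m\<close>.\<close>
  have dexp: "((\<lambda>t. of_real (exp (s * t)) * g t) has_vector_derivative
      of_real (exp (s * t)) * (of_real s * g t + g')) (at t)"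
    if "(g has_vector_derivative g') (at t)" for s t g and g' :: complex
  proof -
    have "((\<lambda>t. complex_of_real (exp (s * t))) has_vector_derivative of_real (exp (s * t) * s)) (at t)"
      by (intro has_vector_derivative_of_real) (auto intro!: derivative_eq_intros)
    from has_vector_derivative_mult[OF this that] show ?thesis
      by (simp add: algebra_simps)
  qed
  have z: "cmod (z t) \<le> exp (- k * t) * cmod (z 0) + B * S / k" if t: "0 \<le> t" "t \<le> T" for t
  proof (cases "t = 0")
    case True
    then show ?thesis using B S0 k0 by simp
  next
    case False
    have "cmod (of_real (exp (k * t)) * z t - of_real (exp (k * 0)) * z 0) \<le>
        exp (k * t) * (B * S / k) - exp (k * 0) * (B * S / k)"
    proof (rule differentiable_bound_general[where f'="\<lambda>t. of_real (exp (k * t)) * (of_real k * z t + (- of_real k * z t - \<rho> t))"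
          and \<phi>'="\<lambda>t. exp (k * t) * (B * S)"])
      show "0 < t" using False t by simp
      show "continuous_on {0..t} (\<lambda>t. of_real (exp (k * t)) * z t)"
        by (intro continuous_intros cont)
      show "continuous_on {0..t} (\<lambda>t. exp (k * t) * (B * S / k))" by (intro continuous_intros)
      show "((\<lambda>t. exp (k * t) * (B * S / k)) has_vector_derivative exp (k * x) * (B * S)) (at x)" for x
        unfolding has_real_derivative_iff_has_vector_derivative[symmetric] using k0
        by (auto intro!: derivative_eq_intros)
      show "cmod (of_real (exp (k * x)) * (of_real k * z x + (- of_real k * z x - \<rho> x))) \<le> exp (k * x) * (B * S)"
        if "0 < x" "x < t" for x
        using \<rho>S[of x] that t by (simp add: norm_mult)
    qed (rule dexp[OF dz])
    also have "\<dots> \<le> exp (k * t) * (B * S / k)" using B S0 k0 by simp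
    finally have 1: "cmod (of_real (exp (k * t)) * z t) \<le> cmod (z 0) + exp (k * t) * (B * S / k)"
      using norm_triangle_ineq2[of "of_real (exp (k * t)) * z t" "z 0"] by simp
    have "cmod (z t) = exp (- k * t) * cmod (of_real (exp (k * t)) * z t)"
      by (simp add: norm_mult exp_minus)
    also have "\<dots> \<le> exp (- k * t) * (cmod (z 0) + exp (k * t) * (B * S / k))"
      by (intro mult_left_mono 1) simp
    also have "\<dots> = exp (- k * t) * cmod (z 0) + B * S / k"
      by (simp add: exp_minus distrib_left)
    finally show ?thesis .
  qed
  define V where "V = exp T * (cmod (z 0) + B * S * T) / k"
  have phi: "((\<lambda>t. exp T * (- exp (- k * t) * cmod (z 0) / k + B * S / k * t)) has_vector_derivative
      exp T * (exp (- k * x) * cmod (z 0) + B * S / k)) (at x)" for x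
    unfolding has_real_derivative_iff_has_vector_derivative[symmetric] using k0
    by (auto intro!: derivative_eq_intros simp: field_simps)
  have phi_le: "exp T * (- exp (- k * t) * cmod (z 0) / k + B * S / k * t) - exp T * (- exp (- k * 0) * cmod (z 0) / k + B * S / k * 0) \<le> V"
    if "0 \<le> t" "t \<le> T" for t
  proof -
    have "exp T * (- exp (- k * t) * cmod (z 0) / k + B * S / k * t) - exp T * (- exp (- k * 0) * cmod (z 0) / k + B * S / k * 0)
      = exp T * ((cmod (z 0) + B * S * t - exp (- k * t) * cmod (z 0)) / k)"
      using k0 by (simp add: field_simps)
    also have "\<dots> \<le> exp T * ((cmod (z 0) + B * S * T) / k)"
    proof (intro mult_left_mono divide_right_mono)
      have "B * S * t \<le> B * S * T" using that B S0 by (intro mult_left_mono) auto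
      moreover have "0 \<le> exp (- k * t) * cmod (z 0)" by simp
      ultimately show "cmod (z 0) + B * S * t - exp (- k * t) * cmod (z 0) \<le> cmod (z 0) + B * S * T" by linarith
    qed (use k0 in auto)
    finally show ?thesis by (simp add: V_def)
  qed
  \<comment> \<open>In \<open>exp (s * t) * g t\<close> the diagonal term cancels and only
    \<open>z\<close> drives the variation; integrating the bound for \<open>z\<close> gains the
    factor 1 / k contained in \<open>V\<close>.\<close>
  have gen: "cmod (of_real (exp (s * t)) * g t - g 0) \<le> V"
    if g: "\<And>t. (g has_vector_derivative g' t) (at t)" and s: "\<bar>s\<bar> \<le> 1"
      and eq: "\<And>t. cmod (of_real s * g t + g' t) = cmod (z t)" and t: "0 \<le> t" "t \<le> T"
    for s t and g g' :: "real \<Rightarrow> complex"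
  proof (cases "t = 0")
    case True
    then show ?thesis using B S0 k0 T by (simp add: V_def)
  next
    case False
    have "cmod (of_real (exp (s * t)) * g t - of_real (exp (s * 0)) * g 0) \<le>
       exp T * (- exp (- k * t) * cmod (z 0) / k + B * S / k * t) - exp T * (- exp (- k * 0) * cmod (z 0) / k + B * S / k * 0)"
    proof (rule differentiable_bound_general[where f'="\<lambda>t. of_real (exp (s * t)) * (of_real s * g t + g' t)"
        and \<phi>'="\<lambda>x. exp T * (exp (- k * x) * cmod (z 0) + B * S / k)"])
      show "0 < t" using False t by simp
      show "continuous_on {0..t} (\<lambda>t. of_real (exp (s * t)) * g t)"
        by (intro continuous_intros continuous_at_imp_continuous_on ballI has_vector_derivative_continuous[OF g])
      show "continuous_on {0..t} (\<lambda>t. exp T * (- exp (- k * t) * cmod (z 0) / k + B * S / k * t))"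
        using k0 by (intro continuous_intros) auto
      show "cmod (of_real (exp (s * x)) * (of_real s * g x + g' x)) \<le> exp T * (exp (- k * x) * cmod (z 0) + B * S / k)"
        if x: "0 < x" "x < t" for x
      proof -
        have "s * x \<le> T"
        proof -
          have "s * x \<le> 1 * x" using s x by (intro mult_right_mono) auto
          also have "\<dots> \<le> T" using x t by simp
          finally show ?thesis .
        qed
        then have "exp (s * x) * cmod (z x) \<le> exp T * (exp (- k * x) * cmod (z 0) + B * S / k)"
          using z[of x] x t by (intro mult_mono) auto
        then show ?thesis by (simp add: norm_mult eq)
      qed
    qed (rule dexp[OF g], rule phi)
    also have "\<dots> \<le> V" by (rule phi_le[OF t])
    finally show ?thesis by simp
  qed
  have p: "cmod (of_real (exp (1 * t)) * p t - p 0) \<le> V" if "0 \<le> t" "t \<le> T" for t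
    by (rule gen[OF dp]) (use that in auto)
  have m: "cmod (of_real (exp (- 1 * t)) * m t - m 0) \<le> V" if "0 \<le> t" "t \<le> T" for t
    by (rule gen[OF dm]) (use that in auto)
  have eT: "exp T \<ge> 1" using T by simp
  have p': "cmod (p t) \<le> cmod (p 0) + V" if t: "0 \<le> t" "t \<le> T" for t
  proof -
    have "cmod (p t) \<le> exp t * cmod (p t)" using t by (simp add: mult_le_cancel_right1)
    also have "\<dots> = cmod (of_real (exp (1 * t)) * p t)" by (simp add: norm_mult)
    also have "\<dots> \<le> cmod (p 0) + V" using norm_triangle_ineq2[of "of_real (exp (1 * t)) * p t" "p 0"] p[OF t] by linarith
    finally show ?thesis .
  qed
  have m': "cmod (m t) \<le> exp T * (cmod (m 0) + V)" if t: "0 \<le> t" "t \<le> T" for t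
  proof -
    have "cmod (of_real (exp (- 1 * t)) * m t) = exp (- t) * cmod (m t)"
      by (simp only: norm_mult norm_of_real abs_exp_cancel mult_minus_left mult_1)
    then have "cmod (m t) = exp t * cmod (of_real (exp (- 1 * t)) * m t)"
      by (simp add: exp_minus)
    also have "\<dots> \<le> exp T * (cmod (m 0) + V)"
      using norm_triangle_ineq2[of "of_real (exp (- 1 * t)) * m t" "m 0"] m[OF t] t by (intro mult_mono) auto
    finally show ?thesis .
  qed
  have V0: "V \<ge> 0" using B S0 k0 T by (simp add: V_def)
  have t0': "0 \<le> t0" "t0 \<le> T" using t0 by auto
  have e2: "exp (2 * T) = exp T * exp T" by (simp add: exp_add[symmetric])
  have A0: "A \<ge> 0" by (simp add: A_def)
  have S_le: "S \<le> 4 * exp (2 * T) * A"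
  proof -
    have 1: "S \<le> cmod (p 0) + V + exp T * (cmod (m 0) + V)"
      using p'[OF t0'] m'[OF t0'] by (simp add: S_def)
    have 2: "1 * (cmod (p 0) + V) \<le> exp T * (cmod (p 0) + V)"
      using eT V0 by (intro mult_right_mono) auto
    have 3: "exp T * (cmod (p 0) + V) + exp T * (cmod (m 0) + V) = exp T * (cmod (p 0) + cmod (m 0)) + 2 * exp T * V"
      by (simp add: algebra_simps)
    have 4: "2 * exp T * V = 2 * exp (2 * T) * cmod (z 0) / k + (4 * exp (2 * T) * B * T) / k * S / 2"
      unfolding V_def e2 using k0 by (simp add: field_simps)
    have 5: "2 * exp (2 * T) * cmod (z 0) / k \<le> 2 * exp (2 * T) * cmod (z 0) / 1"
      using k k0 by (intro divide_left_mono) auto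
    \<comment> \<open>The assumption \<open>k \<ge> 4 * exp (2 * T) * B * T\<close> is made for this
      step: it gives the feedback of \<open>S\<close> into itself the factor 1/2.\<close>
    have 6: "(4 * exp (2 * T) * B * T) / k * S / 2 \<le> 1 * S / 2"
      using k(2) k0 S0 by (intro divide_right_mono mult_right_mono) auto
    have 7: "exp T * (cmod (p 0) + cmod (m 0)) \<le> exp (2 * T) * (cmod (p 0) + cmod (m 0))"
      using T by (intro mult_right_mono) auto
    have 8: "0 \<le> exp (2 * T) * (cmod (p 0) + cmod (m 0))" by simp
    have "S' \<le> 4 * G + 2 * w3"
      if "S' \<le> a + b" "1 * a \<le> a'" "a' + b = g + v" "v = w1 + w2" "w1 \<le> w3 / 1" "w2 \<le> 1 * S' / 2" "g \<le> G" "0 \<le> G"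
      for S' a a' b g v w1 w2 w3 G :: real using that by linarith
    from this[OF 1 2 3 4 5 6 7 8] show ?thesis by (simp add: A_def algebra_simps)
  qed
  have "V \<le> W"
  proof -
    have "B * S * T \<le> B * (4 * exp (2 * T) * A) * T" using S_le B T by (intro mult_left_mono mult_right_mono) auto
    moreover have "cmod (z 0) \<le> A" by (simp add: A_def)
    ultimately have "cmod (z 0) + B * S * T \<le> (1 + B * T * (4 * exp (2 * T))) * A" by (simp add: algebra_simps)
    then have "exp T * (cmod (z 0) + B * S * T) \<le> exp T * ((1 + B * T * (4 * exp (2 * T))) * A)"
      by (intro mult_left_mono) auto
    then show ?thesis using k0 by (simp add: V_def W_def divide_right_mono mult.assoc)
  qed
  then show "cmod (of_real (exp T) * p T - p 0) \<le> W" "cmod (of_real (exp (- T)) * m T - m 0) \<le> W"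
    using p[of T] m[of T] T by auto
  have "cmod (z T) \<le> exp (- k * T) * cmod (z 0) + B * S / k" using z[of T] T by simp
  also have "\<dots> \<le> exp (- k * T) * A + B * (4 * exp (2 * T) * A) / k"
    using S_le B k0 by (intro add_mono mult_left_mono divide_right_mono) (auto simp: A_def)
  finally show "cmod (z T) \<le> exp (- k * T) * A + B * (4 * exp (2 * T)) * A / k" by (simp add: mult.assoc)
qed

context wave_evans begin

text \<open>As \<open>\<mu>\<close> grows, v_xx - v is damped to 0 along the backward flow, so the
  limit behaves like a solution of v_xx = v: v + v_x is multiplied by exp (- T), v - v_x by exp T,
  and the initial second derivative is forgotten.\<close>

lemma backward_limits:
  fixes v0 v1 v2 :: "real \<Rightarrow> real \<Rightarrow> complex"
  assumes sol: "\<And>\<mu>. third_sol (of_real \<mu>) (v0 \<mu>) (v1 \<mu>) (v2 \<mu>)"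
    and init: "\<And>\<mu>. v0 \<mu> 0 = i0" "\<And>\<mu>. v1 \<mu> 0 = i1" "\<And>\<mu>. v2 \<mu> 0 = i2"
  defines "P \<equiv> of_real (exp (- T)) * (i0 + i1)" and "M \<equiv> of_real (exp T) * (i0 - i1)"
  shows "((\<lambda>\<mu>. v0 \<mu> (- T)) \<longlongrightarrow> (P + M) / 2) at_top"
    "((\<lambda>\<mu>. v1 \<mu> (- T)) \<longlongrightarrow> (P - M) / 2) at_top"
    "((\<lambda>\<mu>. v2 \<mu> (- T)) \<longlongrightarrow> (P + M) / 2) at_top"
proof -
  obtain Q where Q: "Q \<ge> 0" "\<And>x. \<bar>x\<bar> \<le> T \<Longrightarrow> \<bar>q x\<bar> \<le> Q" "\<And>x. \<bar>x\<bar> \<le> T \<Longrightarrow> \<bar>q' x\<bar> \<le> Q"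
    by (rule q_bound[of T]) blast
  \<comment> \<open>The term \<open>\<rho>\<close> has the coefficients q' / c and q / c - 1,
    bounded by \<open>Q\<close> and \<open>Q + 1\<close> since c > 1.\<close>
  define B where "B = 2 * Q + 1"
  have B: "B \<ge> 0" using Q by (simp add: B_def)
  define A where "A = cmod (i0 + i1) + cmod (i0 - i1) + cmod (i2 - i0)"
  define p where "p = (\<lambda>\<mu> t. v0 \<mu> (0 - t) + v1 \<mu> (0 - t))"
  define m where "m = (\<lambda>\<mu> t. v0 \<mu> (0 - t) - v1 \<mu> (0 - t))"
  define z where "z = (\<lambda>\<mu> t. v2 \<mu> (0 - t) - v0 \<mu> (0 - t))"
  define \<rho> where "\<rho> = (\<lambda>\<mu> t. of_real (q' (0 - t)) / of_real c * v0 \<mu> (0 - t) + (of_real (q (0 - t)) / of_real c - 1) * v1 \<mu> (0 - t))"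
  have d: "((\<lambda>t. v0 \<mu> (0 - t)) has_vector_derivative - v1 \<mu> (0 - t)) (at t)"
    "((\<lambda>t. v1 \<mu> (0 - t)) has_vector_derivative - v2 \<mu> (0 - t)) (at t)"
    "((\<lambda>t. v2 \<mu> (0 - t)) has_vector_derivative - third_rhs (of_real \<mu>) (0 - t) (v0 \<mu> (0 - t)) (v1 \<mu> (0 - t)) (v2 \<mu> (0 - t))) (at t)"
    for \<mu> t
    using sol[of \<mu>] has_vector_derivative_reflect unfolding third_sol_def by blast+
  have dp: "(p \<mu> has_vector_derivative (- p \<mu> t - z \<mu> t)) (at t)" for \<mu> t
    using has_vector_derivative_add[OF d(1)[of \<mu> t] d(2)[of \<mu> t]] unfolding p_def z_def by simp
  have dm: "(m \<mu> has_vector_derivative (m \<mu> t + z \<mu> t)) (at t)" for \<mu> t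
    using has_vector_derivative_diff[OF d(1)[of \<mu> t] d(2)[of \<mu> t]] unfolding m_def z_def by simp
  have third_rhs_eq: "- third_rhs (of_real \<mu>) s w0 w1 w2 - (- w1) =
      - of_real (\<mu> / c) * (w2 - w0) - (of_real (q' s) / of_real c * w0 + (of_real (q s) / of_real c - 1) * w1)"
    for \<mu> s w0 w1 w2 using c by (simp add: third_rhs_def field_simps)
  have dz: "(z \<mu> has_vector_derivative (- of_real (\<mu> / c) * z \<mu> t - \<rho> \<mu> t)) (at t)" for \<mu> t
    using has_vector_derivative_diff[OF d(3)[of \<mu> t] d(1)[of \<mu> t]] unfolding z_def \<rho>_def third_rhs_eq .
  have \<rho>: "cmod (\<rho> \<mu> t) \<le> B * (cmod (p \<mu> t) + cmod (m \<mu> t))" if "0 \<le> t" "t \<le> T" for \<mu> t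
  proof -
    have v: "v0 \<mu> (0 - t) = (p \<mu> t + m \<mu> t) / 2" "v1 \<mu> (0 - t) = (p \<mu> t - m \<mu> t) / 2"
      by (simp_all add: p_def m_def)
    have v': "cmod (v0 \<mu> (0 - t)) \<le> cmod (p \<mu> t) + cmod (m \<mu> t)" "cmod (v1 \<mu> (0 - t)) \<le> cmod (p \<mu> t) + cmod (m \<mu> t)"
      using norm_triangle_ineq[of "p \<mu> t" "m \<mu> t"] norm_triangle_ineq4[of "p \<mu> t" "m \<mu> t"] norm_ge_zero[of "p \<mu> t"] norm_ge_zero[of "m \<mu> t"]
      unfolding v norm_divide by (simp_all, (smt (verit) norm_ge_zero)+)
    have c1: "\<bar>s / c\<bar> \<le> \<bar>s\<bar>" for s using c by (simp add: abs_divide divide_le_eq mult_le_cancel_left1)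
    have "\<bar>q' (0 - t) / c\<bar> \<le> Q" using c1[of "q' (0 - t)"] Q(3)[of "0 - t"] that by simp
    then have n1: "cmod (of_real (q' (0 - t)) / of_real c) \<le> Q"
      by (simp only: of_real_divide[symmetric] norm_of_real)
    have "\<bar>q (0 - t)\<bar> \<le> Q" using Q(2)[of "0 - t"] that by simp
    then have "\<bar>q (0 - t) / c\<bar> \<le> Q" using c1[of "q (0 - t)"] by linarith
    then have "\<bar>q (0 - t) / c - 1\<bar> \<le> Q + 1" by linarith
    then have n2: "cmod (of_real (q (0 - t)) / of_real c - 1) \<le> Q + 1"
      using norm_of_real[of "q (0 - t) / c - 1", where ?'a=complex] by simp
    have "cmod (\<rho> \<mu> t) \<le> cmod (of_real (q' (0 - t)) / of_real c) * cmod (v0 \<mu> (0 - t)) + cmod (of_real (q (0 - t)) / of_real c - 1) * cmod (v1 \<mu> (0 - t))"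
      unfolding \<rho>_def by (rule order_trans[OF norm_triangle_ineq]) (simp only: norm_mult order_refl)
    also have "\<dots> \<le> Q * (cmod (p \<mu> t) + cmod (m \<mu> t)) + (Q + 1) * (cmod (p \<mu> t) + cmod (m \<mu> t))"
      using n1 n2 v' Q(1) by (intro add_mono mult_mono) auto
    finally show ?thesis by (simp add: B_def algebra_simps)
  qed
  define W where "W = exp T * (1 + B * T * (4 * exp (2 * T))) * A"
  have A: "cmod (p \<mu> 0) + cmod (m \<mu> 0) + cmod (z \<mu> 0) = A" for \<mu>
    by (simp add: p_def m_def z_def A_def init)
  have scale: "filterlim (\<lambda>\<mu>. \<mu> / c) at_top at_top"
    using filterlim_tendsto_pos_mult_at_top[OF tendsto_const _ filterlim_ident, of "1 / c"] c by simp
  have big: "\<forall>\<^sub>F \<mu> in at_top. \<mu> / c \<ge> 1 \<and> \<mu> / c \<ge> 4 * exp (2 * T) * B * T"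
  proof -
    show ?thesis using scale unfolding filterlim_at_top eventually_conj_iff by blast
  qed
  have ev: "\<forall>\<^sub>F \<mu> in at_top. cmod (of_real (exp T) * p \<mu> T - (i0 + i1)) \<le> W / (\<mu> / c)
      \<and> cmod (of_real (exp (- T)) * m \<mu> T - (i0 - i1)) \<le> W / (\<mu> / c)
      \<and> cmod (z \<mu> T) \<le> exp (- (\<mu> / c) * T) * A + B * (4 * exp (2 * T)) * A / (\<mu> / c)"
    using big
  proof eventually_elim
    case (elim \<mu>)
    have i: "p \<mu> 0 = i0 + i1" "m \<mu> 0 = i0 - i1" by (simp_all add: p_def m_def init)
    show ?case
      using backward_solution_bound[OF T_pos _ _ B dp dm dz \<rho>, of \<mu>, unfolded A] elim
      unfolding i W_def by blast
  qed
  have lim0: "((\<lambda>\<mu>. K / (\<mu> / c)) \<longlongrightarrow> 0) at_top" for K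
    by (rule tendsto_divide_0[OF tendsto_const filterlim_at_top_imp_at_infinity[OF scale]])
  have limz: "((\<lambda>\<mu>. exp (- (\<mu> / c) * T) * A + B * (4 * exp (2 * T)) * A / (\<mu> / c)) \<longlongrightarrow> 0) at_top"
  proof -
    have "((\<lambda>\<mu>. exp (- (\<mu> / c) * T) * A) \<longlongrightarrow> 0 * A) at_top"
    proof (intro tendsto_mult tendsto_const)
      have "filterlim (\<lambda>\<mu>. (- T) * (\<mu> / c)) at_bot at_top"
        by (rule filterlim_tendsto_neg_mult_at_bot[OF tendsto_const _ scale]) (use T_pos in simp)
      from filterlim_compose[OF exp_at_bot this] show "((\<lambda>\<mu>. exp (- (\<mu> / c) * T)) \<longlongrightarrow> 0) at_top"
        by (simp add: mult.commute)
    qed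
    from tendsto_add[OF this lim0] show ?thesis by simp
  qed
  have "((\<lambda>\<mu>. of_real (exp T) * p \<mu> T - (i0 + i1)) \<longlongrightarrow> 0) at_top"
    by (rule Lim_null_comparison[OF _ lim0]) (use ev in \<open>auto elim: eventually_mono\<close>)
  then have "((\<lambda>\<mu>. of_real (exp (-T)) * ((of_real (exp T) * p \<mu> T - (i0 + i1)) + (i0 + i1))) \<longlongrightarrow> of_real (exp (-T)) * (0 + (i0 + i1))) at_top"
    by (intro tendsto_intros)
  moreover have "(\<lambda>\<mu>. of_real (exp (-T)) * ((of_real (exp (T)) * p \<mu> T - (i0 + i1)) + (i0 + i1))) = (\<lambda>\<mu>. p \<mu> T)"
    by (simp add: fun_eq_iff exp_minus)
  ultimately have p: "((\<lambda>\<mu>. p \<mu> T) \<longlongrightarrow> P) at_top" by (simp only: P_def add_0)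
  have "((\<lambda>\<mu>. of_real (exp (-T)) * m \<mu> T - (i0 - i1)) \<longlongrightarrow> 0) at_top"
    by (rule Lim_null_comparison[OF _ lim0]) (use ev in \<open>auto elim: eventually_mono\<close>)
  then have "((\<lambda>\<mu>. of_real (exp T) * ((of_real (exp (-T)) * m \<mu> T - (i0 - i1)) + (i0 - i1))) \<longlongrightarrow> of_real (exp T) * (0 + (i0 - i1))) at_top"
    by (intro tendsto_intros)
  moreover have "(\<lambda>\<mu>. of_real (exp (T)) * ((of_real (exp (-T)) * m \<mu> T - (i0 - i1)) + (i0 - i1))) = (\<lambda>\<mu>. m \<mu> T)"
    by (simp add: fun_eq_iff exp_minus)
  ultimately have m: "((\<lambda>\<mu>. m \<mu> T) \<longlongrightarrow> M) at_top" by (simp only: M_def add_0)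
  have z: "((\<lambda>\<mu>. z \<mu> T) \<longlongrightarrow> 0) at_top"
    by (rule Lim_null_comparison[OF _ limz]) (use ev in \<open>auto elim: eventually_mono\<close>)
  have "((\<lambda>\<mu>. (p \<mu> T + m \<mu> T) / 2) \<longlongrightarrow> (P + M) / 2) at_top" by (intro tendsto_intros p m) auto
  then show v0: "((\<lambda>\<mu>. v0 \<mu> (- T)) \<longlongrightarrow> (P + M) / 2) at_top" by (simp add: p_def m_def)
  have "((\<lambda>\<mu>. (p \<mu> T - m \<mu> T) / 2) \<longlongrightarrow> (P - M) / 2) at_top" by (intro tendsto_intros p m) auto
  then show "((\<lambda>\<mu>. v1 \<mu> (- T)) \<longlongrightarrow> (P - M) / 2) at_top" by (simp add: p_def m_def)
  from tendsto_add[OF z v0] show "((\<lambda>\<mu>. v2 \<mu> (- T)) \<longlongrightarrow> (P + M) / 2) at_top" by (simp add: z_def)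
qed

text \<open>The determinant is real, never zero, continuous in x and equal to 1 at the origin, so it
  keeps its sign.\<close>

lemma det_Phi_pos:
  assumes "0 \<le> X"
  shows "Re (det (\<Phi> X (of_real \<mu>))) > 0" "det (\<Phi> X (of_real \<mu>)) \<in> \<real>"
proof -
  have real: "det (\<Phi> x (of_real \<mu>)) \<in> \<real>" for x
    unfolding det_3 by (auto intro!: Reals_add Reals_diff Reals_mult Phi_real)
  then show "det (\<Phi> X (of_real \<mu>)) \<in> \<real>" .
  have nz: "Re (det (\<Phi> x (of_real \<mu>))) \<noteq> 0" for x
    using det_Phi_nz[of x "of_real \<mu>"] real[of x] by (auto simp: complex_is_Real_iff complex_eq_iff)
  have "isCont (\<lambda>x. \<Phi> x (of_real \<mu>)) x" for x
    using fund has_vector_derivative_continuous unfolding fundamental_matrix_def by blast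
  then have "continuous_on {0..X} (\<lambda>x. \<Phi> x (of_real \<mu>))"
    by (simp add: continuous_at_imp_continuous_on)
  then have cont: "continuous_on {0..X} (\<lambda>x. Re (det (\<Phi> x (of_real \<mu>))))"
    unfolding det_3 by (intro continuous_intros)
  have "Re (det (\<Phi> 0 (of_real \<mu>))) = 1" by (simp add: Phi_0)
  then show "Re (det (\<Phi> X (of_real \<mu>))) > 0"
    using IVT2'[OF _ _ assms cont, of 0] nz by (metis linorder_not_le order.order_iff_strict zero_le_one)
qed

text \<open>\<open>det (\<Phi> T - 1) = det (\<Phi> T) * det (1 - \<Phi> (- T))\<close>, where the second factor tends to \<open>2 - 2 * cosh T\<close>.\<close>

lemma evans_D_neg_at_top: "\<forall>\<^sub>F \<mu> in at_top. Re (evans_D \<Phi> T (of_real \<mu>) 1) < 0"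
proof -
  define N where "N = (\<lambda>\<mu>::real. \<Phi> (- T) (of_real \<mu>))"
  have inv: "N \<mu> ** \<Phi> T (of_real \<mu>) = mat 1" for \<mu>
    using Phi_shift[of "- T" "of_real \<mu>"] by (simp add: N_def Phi_0)
  then have inv': "\<Phi> T (of_real \<mu>) ** N \<mu> = mat 1" for \<mu>
    using matrix_left_right_inverse by blast
  have D: "evans_D \<Phi> T (of_real \<mu>) 1 = det (\<Phi> T (of_real \<mu>)) * det (mat 1 - N \<mu>)" for \<mu>
  proof -
    have "\<Phi> T (of_real \<mu>) - mat 1 = \<Phi> T (of_real \<mu>) ** (mat 1 - N \<mu>)"
      using inv'[of \<mu>]
      by (simp add: vec_eq_iff matrix_matrix_mult_def right_diff_distrib sum_subtractf mat_def
          if_distrib[of "\<lambda>x. _ * x"] cong: if_cong)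
    then show ?thesis by (simp add: evans_D_def det_mul)
  qed
  \<comment> \<open>In the limit the third column vanishes and the first two consist of cosh T and -
    sinh T, with equal first and third rows.\<close>
  have lim: "((\<lambda>\<mu>. N \<mu> $ i $ 1) \<longlongrightarrow> (if i = 2 then of_real (exp (-T) - exp T) / 2 else of_real (exp (-T) + exp T) / 2)) at_top"
     "((\<lambda>\<mu>. N \<mu> $ i $ 2) \<longlongrightarrow> (if i = 2 then of_real (exp (-T) + exp T) / 2 else of_real (exp (-T) - exp T) / 2)) at_top"
     "((\<lambda>\<mu>. N \<mu> $ i $ 3) \<longlongrightarrow> 0) at_top" for i
    using backward_limits[of "\<lambda>\<mu> x. \<Phi> x (of_real \<mu>) $ 1 $ 1" "\<lambda>\<mu> x. \<Phi> x (of_real \<mu>) $ 2 $ 1" "\<lambda>\<mu> x. \<Phi> x (of_real \<mu>) $ 3 $ 1" 1 0 0]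
      backward_limits[of "\<lambda>\<mu> x. \<Phi> x (of_real \<mu>) $ 1 $ 2" "\<lambda>\<mu> x. \<Phi> x (of_real \<mu>) $ 2 $ 2" "\<lambda>\<mu> x. \<Phi> x (of_real \<mu>) $ 3 $ 2" 0 1 0]
      backward_limits[of "\<lambda>\<mu> x. \<Phi> x (of_real \<mu>) $ 1 $ 3" "\<lambda>\<mu> x. \<Phi> x (of_real \<mu>) $ 2 $ 3" "\<lambda>\<mu> x. \<Phi> x (of_real \<mu>) $ 3 $ 3" 0 0 1]
      exhaust_3[of i]
    by (auto simp: Phi_column Phi_0 mat_def N_def)
  define C where "C = complex_of_real (exp (-T) + exp T) / 2"
  define S where "S = complex_of_real (exp (-T) - exp T) / 2"
  have "((\<lambda>\<mu>. det (mat 1 - N \<mu>)) \<longlongrightarrow>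
     (1 - C) * (1 - C) * (1 - 0) + (0 - S) * (0 - 0) * (0 - C) + (0 - 0) * (0 - S) * (0 - S)
     - (1 - C) * (0 - 0) * (0 - S) - (0 - S) * (0 - S) * (1 - 0) - (0 - 0) * (1 - C) * (0 - C)) at_top"
    unfolding det_3 vector_minus_component
    by (intro tendsto_intros) (use lim[of 1] lim[of 2] lim[of 3] in \<open>simp_all add: mat_def C_def S_def\<close>)
  moreover have "(1 - C) * (1 - C) - S * S = of_real (2 - exp T - exp (- T))"
  proof -
    have "exp (-T) * exp T = (1::real)" by (simp add: exp_minus)
    then have "complex_of_real (exp (-T)) * of_real (exp T) = 1" by (metis of_real_1 of_real_mult)
    then show ?thesis by (simp add: C_def S_def field_simps)
  qed
  ultimately have "((\<lambda>\<mu>. det (mat 1 - N \<mu>)) \<longlongrightarrow> of_real (2 - exp T - exp (- T))) at_top" by simp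
  then have "((\<lambda>\<mu>. Re (det (mat 1 - N \<mu>))) \<longlongrightarrow> 2 - exp T - exp (- T)) at_top"
    by (auto dest: tendsto_Re)
  moreover have "2 - exp T - exp (- T) < 0"
  proof -
    have "exp T > 1" using T_pos by simp
    then have "0 < (exp T - 1) * (exp T - 1)" by simp
    then have "2 * exp T < exp T * exp T + 1" by (simp add: algebra_simps)
    then have "exp (- T) * (2 * exp T) < exp (- T) * (exp T * exp T + 1)" by simp
    moreover have one: "exp (- T) * exp T = 1" by (simp add: exp_minus)
    moreover have "exp (- T) * (exp T * exp T + 1) = exp T + exp (- T)"
      by (simp only: distrib_left mult.assoc[symmetric] one mult_1_left mult_1_right)
    ultimately show ?thesis by (simp only: mult.left_commute[of _ 2])
  qed
  ultimately have "\<forall>\<^sub>F \<mu> in at_top. Re (det (mat 1 - N \<mu>)) < 0" by (rule order_tendstoD)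
  then show ?thesis
  proof eventually_elim
    case (elim \<mu>)
    have "Re (evans_D \<Phi> T (of_real \<mu>) 1) = Re (det (\<Phi> T (of_real \<mu>))) * Re (det (mat 1 - N \<mu>))"
      using det_Phi_pos(2)[of T \<mu>] T_pos by (simp add: D complex_is_Real_iff)
    then show ?case using det_Phi_pos(1)[of T \<mu>] T_pos elim by (simp add: mult_less_0_iff)
  qed
qed

end

section \<open>Periodic eigenvalues as Evans zeros\<close>

text \<open>Regularity gain: a primitive in the integral sense of a continuous function differs from
  a classical antiderivative by a constant.\<close>

lemma has_vector_derivative_if_has_integral:
  fixes g :: "real \<Rightarrow> 'a::banach"
  assumes g: "continuous_on UNIV g"
    and v: "\<And>x y. x \<le> y \<Longrightarrow> (g has_integral (v y - v x)) {x..y}"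
  shows "(v has_vector_derivative g x) (at x)"
proof -
  obtain G where G: "G 0 = 0" "\<And>x. (G has_vector_derivative g x) (at x)"
    by (rule continuous_antiderivative[OF g]) blast
  have inc: "v y - v x = G y - G x" if "x \<le> y" for x y
  proof (rule has_integral_unique[OF v[OF that]])
    show "(g has_integral (G y - G x)) {x..y}"
      by (rule fundamental_theorem_of_calculus[OF that]) (rule has_vector_derivative_at_within[OF G(2)])
  qed
  have "G y + v 0 = v y" for y
    using inc[of 0 y] inc[of y 0] G(1) by (cases "0 \<le> y") (auto simp: algebra_simps)
  moreover have "((\<lambda>y. G y + v 0) has_vector_derivative g x) (at x)"
    using G(2) by (auto intro!: derivative_eq_intros)
  ultimately show ?thesis by simp
qed

lemma per_deriv_continuous:
  assumes "per_deriv T v w"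
  shows "continuous_on UNIV v"
proof -
  have int: "(w has_integral (v y - v x)) {x..y}" if "x \<le> y" for x y
    using assms that unfolding per_deriv_def by blast
  have "isCont v x" for x
  proof -
    have eq: "v (x - 1) + integral {x - 1..y} w = v y" if "y \<in> {x - 1..x + 1}" for y
      using integral_unique[OF int[of "x - 1" y]] that by simp
    have "continuous_on {x - 1..x + 1} (\<lambda>y. v (x - 1) + integral {x - 1..y} w)"
      by (intro continuous_intros indefinite_integral_continuous_1 has_integral_integrable[OF int]) simp
    then have "continuous_on {x - 1..x + 1} v"
      by (rule continuous_on_eq) (rule eq)
    then show ?thesis by (rule continuous_on_interior) simp
  qed
  then show ?thesis by (simp add: continuous_on_eq_continuous_at)
qed

lemma L2_perI:
  assumes "continuous_on UNIV v" "\<And>x. v (x + T) = v x"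
  shows "v \<in> L2_per T"
proof -
  have "continuous_on {0..T} (\<lambda>x. (cmod (v x))\<^sup>2)"
    by (intro continuous_intros continuous_on_subset[OF assms(1)]) auto
  then have "set_integrable lborel {0..T} (\<lambda>x. (cmod (v x))\<^sup>2)"
    by (rule borel_integrable_atLeastAtMost')
  moreover have "v \<in> borel_measurable lborel"
    using borel_measurable_continuous_onI[OF assms(1)] by simp
  ultimately show ?thesis using assms(2) by (simp add: L2_per_def)
qed

lemma per_derivI:
  assumes "\<And>x. (v has_vector_derivative w x) (at x)" "continuous_on UNIV w"
    "\<And>x. v (x + T) = v x" "\<And>x. w (x + T) = w x"
  shows "per_deriv T v w"
  unfolding per_deriv_def
proof (intro conjI allI impI L2_perI assms(2-))
  show "continuous_on UNIV v"
    by (intro continuous_at_imp_continuous_on ballI has_vector_derivative_continuous[OF assms(1)])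
  show "(w has_integral (v y - v x)) {x..y}" if "x \<le> y" for x y
    by (rule fundamental_theorem_of_calculus[OF that]) (rule has_vector_derivative_at_within[OF assms(1)])
qed

context wave begin

definition periodic_sol where
  "periodic_sol \<mu> v0 v1 v2 \<longleftrightarrow> third_sol \<mu> v0 v1 v2 \<and>
     (\<forall>x. v0 (x + T) = v0 x \<and> v1 (x + T) = v1 x \<and> v2 (x + T) = v2 x) \<and> (\<exists>x. v0 x \<noteq> 0)"

lemma third_sol_continuous:
  assumes "third_sol \<mu> v0 v1 v2"
  shows "continuous_on S v0" "continuous_on S v1" "continuous_on S v2"
proof -
  have "isCont v0 x" "isCont v1 x" "isCont v2 x" for x
    using assms has_vector_derivative_continuous unfolding third_sol_def by blast+
  then show "continuous_on S v0" "continuous_on S v1" "continuous_on S v2"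
    by (simp_all add: continuous_at_imp_continuous_on)
qed

text \<open>The third order equation brought back to divergence form, the source of the conservation
  laws used at low frequency.\<close>

lemma third_sol_L_deriv:
  assumes "third_sol \<mu> v0 v1 v2"
  shows "((\<lambda>x. - of_real c * v2 x + of_real (q x) * v0 x) has_vector_derivative \<mu> * (v0 x - v2 x)) (at x)"
proof -
  have q: "((\<lambda>x. complex_of_real (q x)) has_vector_derivative of_real (q' x)) (at x)"
    by (intro has_vector_derivative_of_real) (use dq in \<open>simp add: has_real_derivative_iff_has_vector_derivative[symmetric]\<close>)
  have d: "(v0 has_vector_derivative v1 x) (at x)" "(v2 has_vector_derivative third_rhs \<mu> x (v0 x) (v1 x) (v2 x)) (at x)"
    using assms unfolding third_sol_def by blast+
  have "((\<lambda>x. - of_real c * v2 x + of_real (q x) * v0 x) has_vector_derivative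
      - of_real c * third_rhs \<mu> x (v0 x) (v1 x) (v2 x) + (of_real (q x) * v1 x + of_real (q' x) * v0 x)) (at x)"
    by (intro has_vector_derivative_add has_vector_derivative_mult_right has_vector_derivative_mult q d)
  moreover have "- of_real c * third_rhs \<mu> x (v0 x) (v1 x) (v2 x) + (of_real (q x) * v1 x + of_real (q' x) * v0 x) = \<mu> * (v0 x - v2 x)"
    using c by (simp add: third_rhs_def field_simps)
  ultimately show ?thesis by simp
qed

text \<open>The operators are given by graphs up to null sets. Each weak derivative is replaced by a
  continuous expression in functions already known to be continuous, after which the integral
  relations become classical derivatives.\<close>

lemma periodic_sol_if_eigenvalue:
  assumes "periodic_eigenvalue f c u T \<mu>"
  obtains v0 v1 v2 where "periodic_sol \<mu> v0 v1 v2"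
proof -
  obtain v g h v1 v2 w1 w2 where nz: "\<exists>x. v x \<noteq> 0" and gL: "g \<in> L2_per T"
    and v1: "per_deriv T v v1" and v2: "per_deriv T v1 v2"
    and g: "AE x in lborel. g x = - of_real c * v2 x + of_real (c - 1 - deriv f (u x)) * v x"
    and gh: "per_deriv T g h" and w1: "per_deriv T (\<lambda>x. \<mu> * v x) w1" and w2: "per_deriv T w1 w2"
    and h: "AE x in lborel. h x = \<mu> * v x - w2 x"
    using assms unfolding periodic_eigenvalue_def op_A_def op_L_def op_D_def by blast
  have int: "(w has_integral (v y - v x)) {x..y}" if "per_deriv T v w" "x \<le> y" for v w x y
    using that unfolding per_deriv_def by blast
  have per: "v (x + T) = v x" if "per_deriv T v w" for v w x
    using that unfolding per_deriv_def L2_per_def by blast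
  note cv = per_deriv_continuous[OF v1] and cv1 = per_deriv_continuous[OF v2]
    and cg = per_deriv_continuous[OF gh] and cw1 = per_deriv_continuous[OF w2]
  have cq: "continuous_on UNIV (\<lambda>x. complex_of_real (q x))" by (intro continuous_intros continuous_q)
  \<comment> \<open>The relation L v = g solved for the second derivative: \<open>g\<close> and
    \<open>v\<close> are continuous, so this is the continuous representative of
    \<open>v2\<close>.\<close>
  define v2' where "v2' = (\<lambda>x. (of_real (q x) * v x - g x) / of_real c)"
  have cv2': "continuous_on UNIV v2'" unfolding v2'_def using c by (intro continuous_intros cq cv cg) auto
  have dv: "(v has_vector_derivative v1 x) (at x)" for x
    by (rule has_vector_derivative_if_has_integral[OF cv1 int[OF v1]])
  have ae: "AE x in lborel. v2 x = v2' x"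
    using g by eventually_elim (use c in \<open>simp add: v2'_def q_def field_simps\<close>)
  have dv1: "(v1 has_vector_derivative v2' x) (at x)" for x
  proof (rule has_vector_derivative_if_has_integral[OF cv2'])
    fix x y :: real assume "x \<le> y"
    have "AE x' in lborel. x' \<in> {x..y} \<longrightarrow> v2 x' = v2' x'" using ae by eventually_elim simp
    from has_integral_AE[OF this] int[OF v2 \<open>x \<le> y\<close>] show "(v2' has_integral (v1 y - v1 x)) {x..y}" by blast
  qed
  have w1_eq: "w1 x = \<mu> * v1 x" for x
  proof (rule vector_derivative_unique_at)
    show "((\<lambda>x. \<mu> * v x) has_vector_derivative w1 x) (at x)"
      by (rule has_vector_derivative_if_has_integral[OF cw1 int[OF w1]])
    show "((\<lambda>x. \<mu> * v x) has_vector_derivative \<mu> * v1 x) (at x)"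
      by (intro has_vector_derivative_mult_right dv)
  qed
  \<comment> \<open>\<open>w2\<close> is only a weak derivative of \<open>w1 = \<mu> * v1\<close>,
    but its integrals agree with those of \<open>\<mu> * v2'\<close>, and the relation for
    \<open>g\<close> is an integrated one.\<close>
  have dg: "(g has_vector_derivative \<mu> * (v x - v2' x)) (at x)" for x
  proof (rule has_vector_derivative_if_has_integral[where g="\<lambda>x. \<mu> * (v x - v2' x)"])
    show "continuous_on UNIV (\<lambda>x. \<mu> * (v x - v2' x))" by (intro continuous_intros cv cv2')
    fix x y :: real assume xy: "x \<le> y"
    have "AE x' in lborel. x' \<in> {x..y} \<longrightarrow> h x' = \<mu> * v x' - w2 x'" using h by eventually_elim simp
    from has_integral_AE[OF this] int[OF gh xy]
    have 1: "((\<lambda>x'. \<mu> * v x' - w2 x') has_integral (g y - g x)) {x..y}" by blast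
    have 2: "((\<lambda>x'. \<mu> * v2' x') has_integral (w1 y - w1 x)) {x..y}"
      unfolding w1_eq
      by (rule fundamental_theorem_of_calculus[OF xy, of "\<lambda>x. \<mu> * v1 x"],
          rule has_vector_derivative_at_within, rule has_vector_derivative_mult_right, rule dv1)
    from has_integral_diff[OF has_integral_add[OF 1 int[OF w2 xy]] 2]
    show "((\<lambda>x. \<mu> * (v x - v2' x)) has_integral (g y - g x)) {x..y}"
      by (simp add: algebra_simps)
  qed
  have q: "((\<lambda>x. complex_of_real (q x)) has_vector_derivative of_real (q' x)) (at x)" for x
    by (intro has_vector_derivative_of_real) (use dq in \<open>simp add: has_real_derivative_iff_has_vector_derivative[symmetric]\<close>)
  have "(v2' has_vector_derivative ((of_real (q x) * v1 x + of_real (q' x) * v x) - \<mu> * (v x - v2' x)) / of_real c) (at x)" for x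
    unfolding v2'_def[abs_def]
    by (intro has_vector_derivative_divide has_vector_derivative_diff has_vector_derivative_mult q dv dg[unfolded v2'_def])
  moreover have "((of_real (q x) * v1 x + of_real (q' x) * v x) - \<mu> * (v x - v2' x)) / of_real c = third_rhs \<mu> x (v x) (v1 x) (v2' x)" for x
    by (simp add: third_rhs_def algebra_simps)
  ultimately have "third_sol \<mu> v v1 v2'" using dv dv1 by (simp add: third_sol_def)
  moreover have "v2' (x + T) = v2' x" for x using per[OF gh] per[OF v1] by (simp add: v2'_def q_T)
  ultimately have "periodic_sol \<mu> v v1 v2'" using nz per[OF v1] per[OF v2] by (simp add: periodic_sol_def)
  then show ?thesis by (rule that)
qed

lemma eigenvalue_if_periodic_sol:
  assumes "periodic_sol \<mu> v0 v1 v2"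
  shows "periodic_eigenvalue f c u T \<mu>"
proof -
  have s: "third_sol \<mu> v0 v1 v2" and per: "\<And>x. v0 (x + T) = v0 x" "\<And>x. v1 (x + T) = v1 x" "\<And>x. v2 (x + T) = v2 x"
    and nz: "\<exists>x. v0 x \<noteq> 0" using assms unfolding periodic_sol_def by blast+
  have d: "(v0 has_vector_derivative v1 x) (at x)" "(v1 has_vector_derivative v2 x) (at x)" for x
    using s unfolding third_sol_def by blast+
  note cont = third_sol_continuous[OF s]
  have cq: "continuous_on UNIV (\<lambda>x. complex_of_real (q x))" by (intro continuous_intros continuous_q)
  define g where "g = (\<lambda>x. - of_real c * v2 x + of_real (q x) * v0 x)"
  define h where "h = (\<lambda>x. \<mu> * v0 x - \<mu> * v2 x)"
  have cg: "continuous_on UNIV g" unfolding g_def by (intro continuous_intros cont cq)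
  have ch: "continuous_on UNIV h" unfolding h_def by (intro continuous_intros cont)
  have gh: "per_deriv T g h"
    using third_sol_L_deriv[OF s] by (intro per_derivI ch) (auto simp: g_def h_def per q_T algebra_simps)
  have v01: "per_deriv T v0 v1" and v12: "per_deriv T v1 v2"
    by (intro per_derivI d cont per)+
  have "g \<in> L2_per T" by (rule L2_perI[OF cg]) (simp add: g_def per q_T)
  moreover have "AE x in lborel. g x = - of_real c * v2 x + of_real (c - 1 - deriv f (u x)) * v0 x"
    by (simp add: g_def q_def)
  ultimately have "op_L f c u T v0 g" using v01 v12 unfolding op_L_def by blast
  moreover have "op_D T (\<lambda>x. \<mu> * v0 x) h"
  proof -
    have "per_deriv T (\<lambda>x. \<mu> * v0 x) (\<lambda>x. \<mu> * v1 x)" "per_deriv T (\<lambda>x. \<mu> * v1 x) (\<lambda>x. \<mu> * v2 x)"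
      by (intro per_derivI has_vector_derivative_mult_right d continuous_intros cont; simp add: per)+
    moreover have "h \<in> L2_per T" by (rule L2_perI[OF ch]) (simp add: h_def per)
    moreover have "AE x in lborel. h x = \<mu> * v0 x - \<mu> * v2 x" by (simp add: h_def)
    ultimately show ?thesis unfolding op_D_def by blast
  qed
  ultimately show ?thesis using nz gh unfolding periodic_eigenvalue_def op_A_def by blast
qed

end

context wave_evans begin

text \<open>A vector fixed by the monodromy matrix is the initial vector of a
  \<open>T\<close>-periodic solution, and conversely.\<close>

lemma evans_zero_iff: "evans_D \<Phi> T \<mu> 1 = 0 \<longleftrightarrow> periodic_eigenvalue f c u T \<mu>"
proof
  assume "evans_D \<Phi> T \<mu> 1 = 0"
  then have "\<not> invertible (\<Phi> T \<mu> - mat 1)" by (simp add: evans_D_def invertible_det_nz)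
  then obtain y where y: "y \<noteq> 0" "(\<Phi> T \<mu> - mat 1) *v y = 0"
    unfolding invertible_left_inverse matrix_left_invertible_ker by blast
  then have Ty: "\<Phi> T \<mu> *v y = y" by (simp add: matrix_vector_mult_diff_rdistrib)
  let ?v = "\<lambda>i x. (\<Phi> x \<mu> *v y) $ i"
  note s = Phi_vector[of \<mu> y]
  have "?v 1 (x + T) = ?v 1 x \<and> ?v 2 (x + T) = ?v 2 x \<and> ?v 3 (x + T) = ?v 3 x" for x
    using third_sol_unique[OF third_sol_shift[OF s] s, of 0 x] by (simp add: Ty Phi_0)
  \<comment> \<open>The eigenfunction is the first component; if it vanished identically, so would
    its derivatives and with them the initial vector.\<close>
  moreover have "\<exists>x. ?v 1 x \<noteq> 0"
  proof (rule ccontr)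
    assume n: "\<not> ?thesis"
    then have v1: "?v 1 = (\<lambda>x. 0)" by auto
    have z: "g x = 0" if "\<And>x. ((\<lambda>x. 0) has_vector_derivative g x) (at x)" for g :: "real \<Rightarrow> complex" and x
      using vector_derivative_unique_at[OF that[of x] has_vector_derivative_const] .
    have v2: "?v 2 = (\<lambda>x. 0)" using z[of "?v 2"] s unfolding third_sol_def v1 by blast
    have v3: "?v 3 = (\<lambda>x. 0)" using z[of "?v 3"] s unfolding third_sol_def v2 by blast
    have "\<Phi> 0 \<mu> *v y = 0"
      using fun_cong[OF v1, of 0] fun_cong[OF v2, of 0] fun_cong[OF v3, of 0] by (simp add: vec_eq_iff forall_3)
    then show False using y(1) by (simp add: Phi_0)
  qed
  ultimately have "periodic_sol \<mu> (?v 1) (?v 2) (?v 3)" using s unfolding periodic_sol_def by blast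
  then show "periodic_eigenvalue f c u T \<mu>" by (rule eigenvalue_if_periodic_sol)
next
  assume "periodic_eigenvalue f c u T \<mu>"
  then obtain v0 v1 v2 where p: "periodic_sol \<mu> v0 v1 v2" by (rule periodic_sol_if_eigenvalue)
  then have s: "third_sol \<mu> v0 v1 v2" unfolding periodic_sol_def by blast
  define y :: "complex^3" where "y = vector [v0 0, v1 0, v2 0]"
  have "v0 (0 + T) = v0 0" "v1 (0 + T) = v1 0" "v2 (0 + T) = v2 0" using p unfolding periodic_sol_def by blast+
  then have "\<Phi> T \<mu> *v y = y" using third_sol_Phi[OF s, of T] by (simp add: y_def)
  then have k: "(\<Phi> T \<mu> - mat 1) *v y = 0" by (simp add: matrix_vector_mult_diff_rdistrib)
  have "y \<noteq> 0"
  proof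
    assume "y = 0"
    then have "v0 0 = 0" "v1 0 = 0" "v2 0 = 0" by (simp_all add: y_def vec_eq_iff forall_3 vector_3)
    from third_sol_zero(1)[OF s this] p show False unfolding periodic_sol_def by blast
  qed
  with k have "\<not> invertible (\<Phi> T \<mu> - mat 1)"
    unfolding invertible_left_inverse matrix_left_invertible_ker by blast
  then show "evans_D \<Phi> T \<mu> 1 = 0" by (simp add: evans_D_def invertible_det_nz)
qed

end

section \<open>Dependence on the parameters\<close>

text \<open>Differentiability at parameter 0 with a remainder uniform in \<open>x\<close>.
  Uniformity permits evaluation at points that move with the parameter, such as the period, and
  integration in \<open>x\<close>.\<close>

definition uniform_deriv :: "real \<Rightarrow> (real \<Rightarrow> real \<Rightarrow> real) \<Rightarrow> (real \<Rightarrow> real) \<Rightarrow> bool" where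
  "uniform_deriv X g \<gamma> \<longleftrightarrow> (\<forall>e>0. \<forall>\<^sub>F s in at 0. \<forall>x\<in>{0..X}. \<bar>g s x - g 0 x - s * \<gamma> x\<bar> \<le> e * \<bar>s\<bar>)"

lemma uniform_derivD:
  "uniform_deriv X g \<gamma> \<Longrightarrow> e > 0 \<Longrightarrow> \<forall>\<^sub>F s in at 0. \<forall>x\<in>{0..X}. \<bar>g s x - g 0 x - s * \<gamma> x\<bar> \<le> e * \<bar>s\<bar>"
  by (simp add: uniform_deriv_def)

lemma has_real_derivative_iff_small:
  "(h has_real_derivative D) (at 0) \<longleftrightarrow> (\<forall>e>0. \<forall>\<^sub>F s in at 0. \<bar>h s - h 0 - s * D\<bar> \<le> e * \<bar>s\<bar>)"
proof
  assume "(h has_real_derivative D) (at 0)"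
  then have lim: "((\<lambda>s. (h s - h 0) / s) \<longlongrightarrow> D) (at 0)" by (simp add: has_field_derivative_iff)
  show "\<forall>e>0. \<forall>\<^sub>F s in at 0. \<bar>h s - h 0 - s * D\<bar> \<le> e * \<bar>s\<bar>"
  proof (intro allI impI)
    fix e :: real assume "e > 0"
    with lim have "\<forall>\<^sub>F s in at 0. dist ((h s - h 0) / s) D < e" by (rule tendstoD)
    moreover have "\<forall>\<^sub>F s in at (0::real). s \<noteq> 0" by (simp add: eventually_at_filter)
    ultimately show "\<forall>\<^sub>F s in at 0. \<bar>h s - h 0 - s * D\<bar> \<le> e * \<bar>s\<bar>"
    proof eventually_elim
      case (elim s)
      have "h s - h 0 - s * D = s * ((h s - h 0) / s - D)" using elim by (simp add: field_simps)
      then have "\<bar>h s - h 0 - s * D\<bar> = \<bar>s\<bar> * dist ((h s - h 0) / s) D" by (simp add: abs_mult dist_real_def)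
      also have "\<dots> \<le> \<bar>s\<bar> * e" using elim by (intro mult_left_mono) auto
      finally show ?case by (simp add: mult.commute)
    qed
  qed
next
  assume *: "\<forall>e>0. \<forall>\<^sub>F s in at 0. \<bar>h s - h 0 - s * D\<bar> \<le> e * \<bar>s\<bar>"
  have "((\<lambda>s. (h s - h 0) / s) \<longlongrightarrow> D) (at 0)"
  proof (rule tendstoI)
    fix e :: real assume e: "e > 0"
    then have "\<forall>\<^sub>F s in at 0. \<bar>h s - h 0 - s * D\<bar> \<le> (e / 2) * \<bar>s\<bar>"
      by (intro *[rule_format]) simp
    moreover have "\<forall>\<^sub>F s in at (0::real). s \<noteq> 0" by (simp add: eventually_at_filter)
    ultimately show "\<forall>\<^sub>F s in at 0. dist ((h s - h 0) / s) D < e"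
    proof eventually_elim
      case (elim s)
      have "(h s - h 0) / s - D = (h s - h 0 - s * D) / s" using elim by (simp add: field_simps)
      then have "dist ((h s - h 0) / s) D = \<bar>h s - h 0 - s * D\<bar> / \<bar>s\<bar>" by (simp add: dist_real_def abs_divide)
      also have "\<dots> \<le> e / 2" using elim by (simp add: divide_le_eq)
      finally show ?case using e by simp
    qed
  qed
  then show "(h has_real_derivative D) (at 0)" by (simp add: has_field_derivative_iff)
qed

lemma uniform_deriv_remainder:
  assumes u: "uniform_deriv X g \<gamma>" and \<xi>: "isCont \<xi> 0" "0 < \<xi> 0" "\<xi> 0 < X"
  shows "((\<lambda>s. g s (\<xi> s) - g 0 (\<xi> s) - s * \<gamma> (\<xi> s)) has_real_derivative 0) (at 0)"
  unfolding has_real_derivative_iff_small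
proof (intro allI impI)
  fix e :: real assume "e > 0"
  then have "\<forall>\<^sub>F s in at 0. \<forall>x\<in>{0..X}. \<bar>g s x - g 0 x - s * \<gamma> x\<bar> \<le> e * \<bar>s\<bar>"
    using u by (simp add: uniform_deriv_def)
  moreover have "\<forall>\<^sub>F s in at 0. 0 < \<xi> s" "\<forall>\<^sub>F s in at 0. \<xi> s < X"
    using \<xi> order_tendstoD unfolding isCont_def by blast+
  ultimately show "\<forall>\<^sub>F s in at 0. \<bar>g s (\<xi> s) - g 0 (\<xi> s) - s * \<gamma> (\<xi> s) -
      (g 0 (\<xi> 0) - g 0 (\<xi> 0) - 0 * \<gamma> (\<xi> 0)) - s * 0\<bar> \<le> e * \<bar>s\<bar>"
    by eventually_elim simp
qed

lemma has_real_derivative_times_id: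
  assumes "isCont h 0"
  shows "((\<lambda>s. s * h s) has_real_derivative h 0) (at (0::real))"
proof -
  have "((\<lambda>s. (s * h s - 0 * h 0) / (s - 0)) \<longlongrightarrow> h 0) (at 0)"
    by (rule Lim_transform_eventually[OF assms[unfolded isCont_def]])
       (auto simp: eventually_at_filter)
  then show ?thesis by (simp add: has_field_derivative_iff)
qed

lemma uniform_deriv_moving:
  assumes u: "uniform_deriv X g \<gamma>" and \<xi>: "(\<xi> has_real_derivative \<xi>') (at 0)" "0 < \<xi> 0" "\<xi> 0 < X"
    and \<gamma>: "isCont \<gamma> (\<xi> 0)" and g: "(g 0 has_real_derivative g') (at (\<xi> 0))"
  shows "((\<lambda>s. g s (\<xi> s)) has_real_derivative (\<gamma> (\<xi> 0) + g' * \<xi>')) (at 0)"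
proof -
  have c\<xi>: "isCont \<xi> 0" using \<xi>(1) DERIV_isCont by blast
  have "isCont (\<lambda>s. \<gamma> (\<xi> s)) 0" using isCont_o2[OF c\<xi> \<gamma>] .
  from DERIV_add[OF DERIV_add[OF uniform_deriv_remainder[OF u c\<xi> \<xi>(2,3)] has_real_derivative_times_id[OF this]]
      DERIV_chain2[OF g \<xi>(1)]]
  show ?thesis by simp
qed

text \<open>Implicit differentiation of g s (\<xi> s) = 0 where only continuity of
  \<open>\<xi>\<close> is known beforehand: the increment of \<open>g 0\<close> is a continuous
  slope times the increment of \<open>\<xi>\<close>, and the slope stays away from 0.\<close>

lemma uniform_deriv_implicit:
  assumes u: "uniform_deriv X g \<gamma>" and \<xi>: "isCont \<xi> 0" "0 < \<xi> 0" "\<xi> 0 < X"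
    and \<gamma>: "isCont \<gamma> (\<xi> 0)" and g: "(g 0 has_real_derivative g') (at (\<xi> 0))" "g' \<noteq> 0"
    and z: "\<forall>\<^sub>F s in at 0. g s (\<xi> s) = 0" "g 0 (\<xi> 0) = 0"
  shows "(\<xi> has_real_derivative (- \<gamma> (\<xi> 0) / g')) (at 0)"
proof -
  let ?h = "\<lambda>s. g s (\<xi> s) - g 0 (\<xi> s) - s * \<gamma> (\<xi> s)"
  obtain D where D: "\<And>y. g 0 y - g 0 (\<xi> 0) = D y * (y - \<xi> 0)" "isCont D (\<xi> 0)" "D (\<xi> 0) = g'"
    using g(1) unfolding CARAT_DERIV by blast
  have "isCont (\<lambda>s. \<gamma> (\<xi> s)) 0" using isCont_o2[OF \<xi>(1) \<gamma>] .
  then have c1: "((\<lambda>s. \<gamma> (\<xi> s)) \<longlongrightarrow> \<gamma> (\<xi> 0)) (at 0)" by (simp add: isCont_def)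
  have "isCont (\<lambda>s. D (\<xi> s)) 0" using isCont_o2[OF \<xi>(1) D(2)] .
  then have c2: "((\<lambda>s. D (\<xi> s)) \<longlongrightarrow> g') (at 0)" using D(3) by (simp add: isCont_def)
  have c3: "((\<lambda>s. ?h s / s) \<longlongrightarrow> 0) (at 0)"
    using uniform_deriv_remainder[OF u \<xi>] by (simp add: has_field_derivative_iff)
  have "((\<lambda>s. - (?h s / s + \<gamma> (\<xi> s)) / D (\<xi> s)) \<longlongrightarrow> - (0 + \<gamma> (\<xi> 0)) / g') (at 0)"
    by (intro tendsto_intros c1 c2 c3 g(2))
  moreover have "\<forall>\<^sub>F s in at 0. - (?h s / s + \<gamma> (\<xi> s)) / D (\<xi> s) = (\<xi> s - \<xi> 0) / (s - 0)"
  proof -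
    have "\<forall>\<^sub>F s in at 0. D (\<xi> s) \<noteq> 0" using c2 g(2) tendsto_imp_eventually_ne by blast
    moreover have "\<forall>\<^sub>F s in at (0::real). s \<noteq> 0" by (simp add: eventually_at_filter)
    ultimately show ?thesis using z(1)
    proof eventually_elim
      case (elim s)
      have 1: "?h s / s + \<gamma> (\<xi> s) = - g 0 (\<xi> s) / s" using elim by (simp add: field_simps)
      have 2: "g 0 (\<xi> s) = D (\<xi> s) * (\<xi> s - \<xi> 0)" using D(1)[of "\<xi> s"] z(2) by simp
      have "- (- (D (\<xi> s) * (\<xi> s - \<xi> 0)) / s) / D (\<xi> s) = (\<xi> s - \<xi> 0) / (s - 0)"
        using elim by simp
      then show ?case unfolding 1 unfolding 2 .
    qed
  qed
  ultimately have "((\<lambda>s. (\<xi> s - \<xi> 0) / (s - 0)) \<longlongrightarrow> - \<gamma> (\<xi> 0) / g') (at 0)"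
    by (simp add: Lim_transform_eventually)
  then show ?thesis by (simp add: has_field_derivative_iff)
qed

lemma uniform_deriv_integral:
  assumes u: "uniform_deriv X g \<gamma>" and X: "X \<ge> 0"
    and int: "\<forall>\<^sub>F s in at 0. continuous_on UNIV (g s)" "continuous_on UNIV (g 0)" "continuous_on UNIV \<gamma>"
  shows "uniform_deriv X (\<lambda>s x. integral {0..x} (g s)) (\<lambda>x. integral {0..x} \<gamma>)"
  unfolding uniform_deriv_def
proof (intro allI impI)
  fix e :: real assume e: "e > 0"
  have "\<forall>\<^sub>F s in at 0. \<forall>x\<in>{0..X}. \<bar>g s x - g 0 x - s * \<gamma> x\<bar> \<le> (e / (X + 1)) * \<bar>s\<bar>"
    by (rule uniform_derivD[OF u]) (use e X in simp)
  with int(1) show "\<forall>\<^sub>F s in at 0. \<forall>x\<in>{0..X}.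
      \<bar>integral {0..x} (g s) - integral {0..x} (g 0) - s * integral {0..x} \<gamma>\<bar> \<le> e * \<bar>s\<bar>"
  proof eventually_elim
    case (elim s)
    show ?case
    proof
      fix x assume x: "x \<in> {0..X}"
      have i: "g s integrable_on {0..x}" "g 0 integrable_on {0..x}" "\<gamma> integrable_on {0..x}"
        by (rule integrable_continuous_real, rule continuous_on_subset[OF elim(1)] continuous_on_subset[OF int(2)]
            continuous_on_subset[OF int(3)], simp)+
      have "integral {0..x} (g s) - integral {0..x} (g 0) - s * integral {0..x} \<gamma> =
         integral {0..x} (\<lambda>y. g s y - g 0 y - s * \<gamma> y)"
        using i by (simp add: integral_diff integrable_diff integrable_on_mult_right)
      also have "norm \<dots> \<le> (e / (X + 1)) * \<bar>s\<bar> * (x - 0)"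
      proof (rule integral_bound)
        show "0 \<le> x" using x by simp
        show "continuous_on {0..x} (\<lambda>y. g s y - g 0 y - s * \<gamma> y)"
          by (intro continuous_intros continuous_on_subset[OF elim(1)] continuous_on_subset[OF int(2)]
              continuous_on_subset[OF int(3)]) auto
      qed (use elim(2) x in auto)
      also have "\<dots> \<le> (e / (X + 1)) * \<bar>s\<bar> * (X + 1)" using x e X by (intro mult_left_mono) auto
      also have "\<dots> = e * \<bar>s\<bar>" using X by simp
      finally show "\<bar>integral {0..x} (g s) - integral {0..x} (g 0) - s * integral {0..x} \<gamma>\<bar> \<le> e * \<bar>s\<bar>" by simp
    qed
  qed
qed

lemma uniform_deriv_add:
  assumes "uniform_deriv X g \<gamma>" "uniform_deriv X h \<eta>"
  shows "uniform_deriv X (\<lambda>s x. g s x + h s x) (\<lambda>x. \<gamma> x + \<eta> x)"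
  unfolding uniform_deriv_def
proof (intro allI impI)
  fix e :: real assume e: "e > 0"
  have "\<forall>\<^sub>F s in at 0. \<forall>x\<in>{0..X}. \<bar>g s x - g 0 x - s * \<gamma> x\<bar> \<le> (e/2) * \<bar>s\<bar>"
    "\<forall>\<^sub>F s in at 0. \<forall>x\<in>{0..X}. \<bar>h s x - h 0 x - s * \<eta> x\<bar> \<le> (e/2) * \<bar>s\<bar>"
    by (rule uniform_derivD[OF assms(1)], use e in simp, rule uniform_derivD[OF assms(2)], use e in simp)
  then show "\<forall>\<^sub>F s in at 0. \<forall>x\<in>{0..X}. \<bar>(g s x + h s x) - (g 0 x + h 0 x) - s * (\<gamma> x + \<eta> x)\<bar> \<le> e * \<bar>s\<bar>"
  proof eventually_elim
    case (elim s)
    show ?case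
    proof
      fix x assume "x \<in> {0..X}"
      then have "\<bar>g s x - g 0 x - s * \<gamma> x\<bar> \<le> (e/2) * \<bar>s\<bar>" "\<bar>h s x - h 0 x - s * \<eta> x\<bar> \<le> (e/2) * \<bar>s\<bar>"
        using elim by auto
      moreover have "(g s x + h s x) - (g 0 x + h 0 x) - s * (\<gamma> x + \<eta> x) = (g s x - g 0 x - s * \<gamma> x) + (h s x - h 0 x - s * \<eta> x)"
        by (simp add: algebra_simps)
      ultimately show "\<bar>(g s x + h s x) - (g 0 x + h 0 x) - s * (\<gamma> x + \<eta> x)\<bar> \<le> e * \<bar>s\<bar>" by linarith
    qed
  qed
qed

lemma uniform_deriv_square:
  assumes u: "uniform_deriv X g \<gamma>" and B: "\<And>x. x \<in> {0..X} \<Longrightarrow> \<bar>g 0 x\<bar> \<le> B" "\<And>x. x \<in> {0..X} \<Longrightarrow> \<bar>\<gamma> x\<bar> \<le> B" "B \<ge> 0"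
  shows "uniform_deriv X (\<lambda>s x. (g s x)\<^sup>2) (\<lambda>x. 2 * g 0 x * \<gamma> x)"
  unfolding uniform_deriv_def
proof (intro allI impI)
  fix e :: real assume e: "e > 0"
  define e' where "e' = e / (2 * (2 * B + 1))"
  have e': "e' > 0" using e B(3) by (simp add: e'_def)
  have 1: "\<forall>\<^sub>F s in at 0. \<forall>x\<in>{0..X}. \<bar>g s x - g 0 x - s * \<gamma> x\<bar> \<le> e' * \<bar>s\<bar>"
    using u e' unfolding uniform_deriv_def by simp
  have "((\<lambda>s::real. \<bar>s\<bar>) \<longlongrightarrow> 0) (at 0)" by (rule tendsto_rabs_zero) (rule tendsto_ident_at)
  then have 2: "\<forall>\<^sub>F s::real in at 0. \<bar>s\<bar> < e / (2 * (e' + B)\<^sup>2)"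
    by (rule order_tendstoD) (use e e' B(3) in auto)
  from 1 2 show "\<forall>\<^sub>F s in at 0. \<forall>x\<in>{0..X}. \<bar>(g s x)\<^sup>2 - (g 0 x)\<^sup>2 - s * (2 * g 0 x * \<gamma> x)\<bar> \<le> e * \<bar>s\<bar>"
  proof eventually_elim
    case (elim s)
    show ?case
    proof
      fix x assume x: "x \<in> {0..X}"
      let ?r = "g s x - g 0 x - s * \<gamma> x"
      have r: "\<bar>?r\<bar> \<le> e' * \<bar>s\<bar>" using elim(1) x by blast
      have d: "\<bar>g s x - g 0 x\<bar> \<le> (e' + B) * \<bar>s\<bar>"
      proof -
        have "\<bar>g s x - g 0 x\<bar> \<le> \<bar>?r\<bar> + \<bar>s\<bar> * \<bar>\<gamma> x\<bar>" by (metis abs_mult abs_triangle_ineq diff_add_cancel)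
        also have "\<dots> \<le> e' * \<bar>s\<bar> + \<bar>s\<bar> * B" using r B(2)[OF x] by (intro add_mono mult_left_mono) auto
        finally show ?thesis by (simp add: algebra_simps)
      qed
      have "\<bar>g s x - g 0 x\<bar>\<^sup>2 \<le> ((e' + B) * \<bar>s\<bar>)\<^sup>2" using d by (intro power_mono) auto
      also have "\<dots> = ((e' + B)\<^sup>2 * \<bar>s\<bar>) * \<bar>s\<bar>" by (simp add: power2_eq_square)
      also have "\<dots> \<le> (e / 2) * \<bar>s\<bar>"
      proof (rule mult_right_mono)
        have "(e' + B)\<^sup>2 > 0" using e' B(3) by simp
        then show "(e' + B)\<^sup>2 * \<bar>s\<bar> \<le> e / 2" using elim(2) by (simp add: field_simps)
      qed simp
      finally have s1: "(g s x - g 0 x)\<^sup>2 \<le> (e / 2) * \<bar>s\<bar>" by simp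
      have "\<bar>2 * g 0 x * ?r\<bar> = 2 * \<bar>g 0 x\<bar> * \<bar>?r\<bar>" by (simp add: abs_mult)
      also have "\<dots> \<le> (2 * B + 1) * (e' * \<bar>s\<bar>)"
        using r B(1)[OF x] B(3) by (intro mult_mono) auto
      also have "\<dots> = (e / 2) * \<bar>s\<bar>" using B(3) by (simp add: e'_def field_simps)
      finally have s2: "\<bar>2 * g 0 x * ?r\<bar> \<le> (e / 2) * \<bar>s\<bar>" .
      have "(g s x)\<^sup>2 - (g 0 x)\<^sup>2 - s * (2 * g 0 x * \<gamma> x) = (g s x - g 0 x)\<^sup>2 + 2 * g 0 x * ?r"
        by (simp add: power2_eq_square algebra_simps)
      then show "\<bar>(g s x)\<^sup>2 - (g 0 x)\<^sup>2 - s * (2 * g 0 x * \<gamma> x)\<bar> \<le> e * \<bar>s\<bar>"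
        using s1 s2 zero_le_power2[of "g s x - g 0 x"] by linarith
    qed
  qed
qed

text \<open>Second order Taylor bound with a constant uniform on the interval, from the mean value
  inequality for \<open>f y - deriv f t * y\<close> between \<open>t\<close> and
  \<open>s\<close>.\<close>

lemma C2_real_quadratic:
  assumes C2: "C2_real f"
  obtains K where "K \<ge> 0" "\<And>s t. s \<in> {p..r} \<Longrightarrow> t \<in> {p..r} \<Longrightarrow> \<bar>f s - f t - deriv f t * (s - t)\<bar> \<le> K * (s - t)\<^sup>2"
proof -
  have "bounded (deriv (deriv f) ` {p..r})"
    by (intro compact_imp_bounded compact_continuous_image C2_realD(3)[OF C2]) auto
  then obtain K where K: "\<And>s. s \<in> {p..r} \<Longrightarrow> \<bar>deriv (deriv f) s\<bar> \<le> K"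
    unfolding bounded_iff by (metis imageI real_norm_def)
  have L: "\<bar>deriv f s - deriv f t\<bar> \<le> max K 0 * \<bar>s - t\<bar>" if "s \<in> {p..r}" "t \<in> {p..r}" for s t
    using field_differentiable_bound[of "{p..r}" "deriv f" "deriv (deriv f)" "max K 0" s t] that K
    by (simp add: has_field_derivative_at_within[OF C2_realD(2)[OF C2]] max.coboundedI1)
  have "\<bar>f s - f t - deriv f t * (s - t)\<bar> \<le> max K 0 * (s - t)\<^sup>2" if st: "s \<in> {p..r}" "t \<in> {p..r}" for s t
  proof -
    let ?g = "\<lambda>y. f y - deriv f t * y"
    let ?I = "{min s t..max s t}"
    have "\<bar>?g s - ?g t\<bar> \<le> (max K 0 * \<bar>s - t\<bar>) * \<bar>s - t\<bar>"
    proof (rule field_differentiable_bound[of ?I ?g "\<lambda>y. deriv f y - deriv f t", unfolded real_norm_def])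
      show "(?g has_field_derivative deriv f z - deriv f t) (at z within ?I)" for z
        by (auto intro!: derivative_eq_intros has_field_derivative_at_within[OF C2_realD(1)[OF C2]])
      show "\<bar>deriv f z - deriv f t\<bar> \<le> max K 0 * \<bar>s - t\<bar>" if "z \<in> ?I" for z
      proof -
        have "\<bar>deriv f z - deriv f t\<bar> \<le> max K 0 * \<bar>z - t\<bar>" using L[of z t] that st by (auto simp: min_def max_def split: if_splits)
        also have "\<dots> \<le> max K 0 * \<bar>s - t\<bar>" using that by (intro mult_left_mono) (auto simp: min_def max_def split: if_splits)
        finally show ?thesis .
      qed
    qed auto
    then show ?thesis by (simp add: power2_eq_square abs_mult[symmetric] algebra_simps)
  qed
  then show ?thesis using that[of "max K 0"] by simp
qed

text \<open>A curve of waves \<open>v s\<close> with initial velocity \<open>(al, et, ga)\<close> in parameter space. Here \<open>\<phi>\<close> will be its velocity at \<open>s = 0\<close>,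
  and \<open>\<phi> 0\<close> comes from differentiating \<open>V(m s) = E + s * et\<close>.\<close>

locale wave_family = wave f F u a E c um up for f F u a E c um up +
  fixes al et ga \<delta> :: real and v :: "real \<Rightarrow> real \<Rightarrow> real" and m p :: "real \<Rightarrow> real" and \<phi> \<phi>1 :: "real \<Rightarrow> real"
  assumes v_0: "v 0 = u" and m_0: "m 0 = um" and p_0: "p 0 = up" and \<delta>: "\<delta> > 0"
    and fam: "\<bar>s\<bar> < \<delta> \<Longrightarrow> wave f F (v s) (a + s * al) (E + s * et) (c + s * ga) (m s) (p s)"
    and m_cont: "isCont m 0" and p_cont: "isCont p 0"
    and d\<phi>: "(\<phi> has_real_derivative \<phi>1 x) (at x)"
    and d\<phi>1: "(\<phi>1 has_real_derivative ((q x * \<phi> x + al + ga * (u x - u2 x)) / c)) (at x)"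
    and \<phi>_0: "\<phi> 0 = (et + al * um + ga * um\<^sup>2 / 2) / (f um - (c - 1) * um - a)" and \<phi>1_0: "\<phi>1 0 = 0"
begin

lemma eventually_wave: "\<forall>\<^sub>F s in at 0. wave f F (v s) (a + s * al) (E + s * et) (c + s * ga) (m s) (p s)"
proof -
  have "\<forall>\<^sub>F s in at 0. \<bar>s\<bar> < \<delta>"
    using \<delta> by (auto simp: eventually_at dist_real_def intro!: exI[of _ \<delta>])
  then show ?thesis by eventually_elim (rule fam)
qed

text \<open>The level condition at parameter s says that the unperturbed potential exceeds
  \<open>E\<close> at \<open>m s\<close> by s times the explicit term \<open>?N s\<close>. Dividing
  by the slope of V, nonzero at the simple root \<open>um\<close>, gives the derivative from mere
  continuity of \<open>m\<close>.\<close>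

lemma dm: "(m has_real_derivative \<phi> 0) (at 0)"
proof -
  let ?d = "f um - (c - 1) * um - a"
  let ?N = "\<lambda>s. et + al * m s + ga * (m s)\<^sup>2 / 2"
  obtain D where D: "\<And>y. gbbm_V F a c y - gbbm_V F a c um = D y * (y - um)" "isCont D um" "D um = ?d"
    using dV[of um] unfolding CARAT_DERIV by blast
  have mlim: "(m \<longlongrightarrow> um) (at 0)" using m_cont m_0 by (simp add: isCont_def)
  have "isCont (\<lambda>s. D (m s)) 0" using isCont_o2[OF m_cont, of D] D(2) m_0 by simp
  then have c2: "((\<lambda>s. D (m s)) \<longlongrightarrow> ?d) (at 0)" using D(3) m_0 by (simp add: isCont_def)
  have "((\<lambda>s. ?N s / D (m s)) \<longlongrightarrow> (et + al * um + ga * um\<^sup>2 / 2) / ?d) (at 0)"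
    by (intro tendsto_intros mlim c2 V'_um_nz) auto
  moreover have "\<forall>\<^sub>F s in at 0. ?N s / D (m s) = (m s - m 0) / (s - 0)"
  proof -
    have "\<forall>\<^sub>F s in at 0. D (m s) \<noteq> 0" using c2 V'_um_nz tendsto_imp_eventually_ne by blast
    moreover have "\<forall>\<^sub>F s in at (0::real). s \<noteq> 0" by (simp add: eventually_at_filter)
    ultimately show ?thesis using eventually_wave
    proof eventually_elim
      case (elim s)
      have "gbbm_V F (a + s * al) (c + s * ga) (m s) = E + s * et" using elim wave.V_um by blast
      then have "gbbm_V F a c (m s) - gbbm_V F a c um = s * ?N s"
        unfolding V_um by (simp add: gbbm_V_def field_simps)
      then have "D (m s) * (m s - um) = s * ?N s" using D(1)[of "m s"] by simp
      then have "?N s * s = (m s - um) * D (m s)" by (simp only: mult.commute)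
      then show ?case using elim(1,2) by (simp only: m_0 diff_zero frac_eq_eq not_False_eq_True)
    qed
  qed
  ultimately have "((\<lambda>s. (m s - m 0) / (s - 0)) \<longlongrightarrow> \<phi> 0) (at 0)"
    unfolding \<phi>_0 by (rule Lim_transform_eventually)
  then show ?thesis by (simp add: has_field_derivative_iff)
qed

lemma continuous_\<phi>: "continuous_on S \<phi>" and continuous_\<phi>1: "continuous_on S \<phi>1"
  by (auto intro!: DERIV_continuous_on has_field_derivative_at_within[OF d\<phi>] has_field_derivative_at_within[OF d\<phi>1])

text \<open>Two rounds of Gronwall. The plain difference of the waves is O(s). This makes the Taylor
  remainder of \<open>f\<close> and the change of the coefficient c terms of order s^2 in the
  equation for v s - u - s \<phi>, whose initial error is o(s) by \<open>dm\<close>.\<close>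

lemma uniform:
  assumes X: "X \<ge> 0"
  shows "uniform_deriv X v \<phi>" "uniform_deriv X (\<lambda>s. deriv (v s)) \<phi>1"
proof -
  define I where "I = {um - 1..up + 1}"
  obtain K where K: "K \<ge> 0" "\<And>s t. s \<in> I \<Longrightarrow> t \<in> I \<Longrightarrow> \<bar>f s - f t\<bar> \<le> K * \<bar>s - t\<bar>" "\<And>s. s \<in> I \<Longrightarrow> \<bar>deriv f s\<bar> \<le> K"
    unfolding I_def by (rule C2_real_Lipschitz[OF C2, of "um - 1" "up + 1"]) blast
  obtain K2 where K2: "K2 \<ge> 0" "\<And>s t. s \<in> I \<Longrightarrow> t \<in> I \<Longrightarrow> \<bar>f s - f t - deriv f t * (s - t)\<bar> \<le> K2 * (s - t)\<^sup>2"
    unfolding I_def by (rule C2_real_quadratic[OF C2, of "um - 1" "up + 1"]) blast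
  have "continuous_on I f"
    by (rule DERIV_continuous_on[OF has_field_derivative_at_within[OF C2_realD(1)[OF C2]]])
  then have "bounded (f ` I)" unfolding I_def by (intro compact_imp_bounded compact_continuous_image) auto
  then obtain B2 where B2: "\<And>y. y \<in> I \<Longrightarrow> \<bar>f y\<bar> \<le> B2"
    unfolding bounded_iff by (metis imageI real_norm_def)
  define B where "B = max (\<bar>um - 1\<bar> + \<bar>up + 1\<bar>) B2"
  have B: "\<bar>y\<bar> \<le> B" "\<bar>f y\<bar> \<le> B" if "y \<in> I" for y
    using that B2[OF that] by (auto simp: B_def I_def)
  have B0: "B \<ge> 0" using B(1)[of um] um_less_up by (simp add: I_def)
  \<comment> \<open>By continuity of \<open>m\<close> and \<open>p\<close> all nearby waves stay in
    the fixed interval \<open>I\<close>, where one set of bounds for \<open>f\<close> is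
    valid.\<close>
  have ev_in: "\<forall>\<^sub>F s in at 0. wave f F (v s) (a + s * al) (E + s * et) (c + s * ga) (m s) (p s) \<and> (\<forall>x. v s x \<in> I) \<and> \<bar>s\<bar> \<le> 1"
  proof -
    have "\<forall>\<^sub>F s in at 0. um - 1 < m s" "\<forall>\<^sub>F s in at 0. p s < up + 1"
      using order_tendstoD(1)[OF m_cont[unfolded isCont_def], of "um - 1"]
        order_tendstoD(2)[OF p_cont[unfolded isCont_def], of "up + 1"] by (simp_all add: m_0 p_0)
    moreover have "\<forall>\<^sub>F s in at (0::real). \<bar>s\<bar> \<le> 1" by (auto simp: eventually_at dist_real_def intro!: exI[of _ 1])
    ultimately show ?thesis using eventually_wave
    proof eventually_elim
      case (elim s)
      have "v s x \<in> {m s..p s}" for x using elim wave.u_in by blast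
      then have "v s x \<in> I" for x using elim(1,2) by (auto simp: I_def intro: order_trans less_imp_le dest!: meta_spec[of _ x])
      then show ?case using elim by blast
    qed
  qed
  have u_I: "u x \<in> I" for x using u_in[of x] by (auto simp: I_def)
  \<comment> \<open>\<open>CC\<close> bounds the second derivatives of the nearby waves for |s| <=
    1; \<open>A\<close> and \<open>R\<close> collect the forcing coefficients of the first and of
    the second round.\<close>
  define CC where "CC = (\<bar>a\<bar> + \<bar>al\<bar> + (c + \<bar>ga\<bar>) * B + B)"
  define A where "A = \<bar>al\<bar> + \<bar>ga\<bar> * B + \<bar>ga\<bar> * CC"
  have CC0: "CC \<ge> 0" using B0 c by (simp add: CC_def)
  have A0: "A \<ge> 0" using B0 CC0 by (simp add: A_def)
  define KK where "KK = c - 1 + K"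
  have KK0: "KK \<ge> 0" using c K by (simp add: KK_def)
  define G where "G = gronwall_const (2 * KK + 1) X"
  have G: "G \<ge> 1" unfolding G_def using KK0 X by (intro gronwall_const_ge_1) auto
  define L where "L = (\<bar>\<phi> 0\<bar> + 1 + A) * G"
  have L0: "L \<ge> 0" using G A0 by (simp add: L_def)
  define R where "R = K2 * L\<^sup>2 + \<bar>ga\<bar> * (L + (KK * (L + L) + A))"
  have R0: "R \<ge> 0" using K2 L0 KK0 A0 by (simp add: R_def)
  have dm1: "\<forall>\<^sub>F s in at 0. \<bar>m s - um - s * \<phi> 0\<bar> \<le> e * \<bar>s\<bar>" if "e > 0" for e
    using dm that unfolding has_real_derivative_iff_small m_0 by blast
  have main: "\<forall>\<^sub>F s in at 0. \<forall>x\<in>{0..X}. \<bar>v s x - u x - s * \<phi> x\<bar> \<le> e * \<bar>s\<bar> \<and> \<bar>deriv (v s) x - u1 x - s * \<phi>1 x\<bar> \<le> e * \<bar>s\<bar>"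
    if e: "e > 0" for e
  proof -
    \<comment> \<open>Half of \<open>e\<close> is reserved for the initial error, the other half for
      the quadratic forcing.\<close>
    define e' where "e' = min 1 (e / (2 * G))"
    have e': "e' > 0" "e' \<le> 1" "e' * G \<le> e / 2" using e G by (auto simp: e'_def min_def field_simps)
    have "((\<lambda>s::real. \<bar>s\<bar>) \<longlongrightarrow> 0) (at 0)" by (rule tendsto_rabs_zero) (rule tendsto_ident_at)
    then have "\<forall>\<^sub>F s::real in at 0. \<bar>s\<bar> < e / (2 * G * (R + 1))"
      by (rule order_tendstoD) (use e G R0 in auto)
    then show ?thesis using ev_in dm1[OF e'(1)]
    proof eventually_elim
      case (elim s)
      then interpret s: wave f F "v s" "a + s * al" "E + s * et" "c + s * ga" "m s" "p s" by blast
      have sI: "v s x \<in> I" for x using elim by blast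
      have s1: "\<bar>s\<bar> \<le> 1" using elim by blast
      have cs: "c + s * ga > 1" by (rule s.c)
      have w2: "\<bar>s.u2 x\<bar> \<le> CC" for x
      proof -
        have "\<bar>(a + s * al) + (c + s * ga - 1) * v s x - f (v s x)\<bar> \<le> \<bar>a\<bar> + \<bar>s * al\<bar> + \<bar>c + s * ga - 1\<bar> * \<bar>v s x\<bar> + \<bar>f (v s x)\<bar>"
          unfolding abs_mult[symmetric] by linarith
        also have "\<dots> \<le> \<bar>a\<bar> + 1 * \<bar>al\<bar> + (c + \<bar>ga\<bar>) * B + B"
        proof (intro add_mono mult_mono order_refl B(1)[OF sI] B(2)[OF sI])
          show "\<bar>s * al\<bar> \<le> 1 * \<bar>al\<bar>" unfolding abs_mult using s1 by (intro mult_right_mono) auto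
          have "\<bar>s * ga\<bar> \<le> 1 * \<bar>ga\<bar>" unfolding abs_mult using s1 by (intro mult_right_mono) auto
          then show "\<bar>c + s * ga - 1\<bar> \<le> c + \<bar>ga\<bar>" using cs by linarith
        qed (use c in auto)
        finally have n: "\<bar>(a + s * al) + (c + s * ga - 1) * v s x - f (v s x)\<bar> \<le> CC" by (simp add: CC_def)
        have "\<bar>s.u2 x\<bar> = \<bar>(a + s * al) + (c + s * ga - 1) * v s x - f (v s x)\<bar> / (c + s * ga)"
          unfolding s.u2_eq using cs by (simp add: abs_divide)
        also have "\<dots> \<le> \<bar>(a + s * al) + (c + s * ga - 1) * v s x - f (v s x)\<bar> / 1"
          using cs by (intro divide_left_mono) auto
        finally show ?thesis using n by simp
      qed
      have cw2: "c * s.u2 x = (a + s * al) + (c + s * ga - 1) * v s x - f (v s x) - s * ga * s.u2 x" for x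
      proof -
        have "(c + s * ga) * s.u2 x = (a + s * al) + (c + s * ga - 1) * v s x - f (v s x)"
          using cs by (simp add: s.u2_eq)
        then show ?thesis by (simp add: algebra_simps)
      qed
      have cu2: "c * u2 x = a + (c - 1) * u x - f (u x)" for x using c by (simp add: u2_eq)
      have c_div: "\<bar>y\<bar> \<le> z" if "\<bar>c * y\<bar> \<le> z" for y z
      proof -
        have "1 * \<bar>y\<bar> \<le> c * \<bar>y\<bar>" using c by (intro mult_right_mono) auto
        then show ?thesis using that c by (simp add: abs_mult)
      qed
      have abs_le: "\<bar>y\<bar> \<le> \<bar>y1\<bar> + \<bar>y2\<bar> + \<bar>y3\<bar>" if "y = y1 - y2 + y3" for y y1 y2 y3 :: real
        using that by linarith
      note hv = has_real_derivative_iff_has_vector_derivative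
      let ?d = "\<lambda>x. v s x - u x" and ?d1 = "\<lambda>x. s.u1 x - u1 x" and ?d2 = "\<lambda>x. s.u2 x - u2 x"
      have dd: "(?d has_vector_derivative ?d1 x) (at x)" "(?d1 has_vector_derivative ?d2 x) (at x)" for x
        unfolding hv[symmetric] by (intro DERIV_diff du du1 s.du s.du1)+
      have d2: "\<bar>?d2 x\<bar> \<le> KK * (\<bar>?d x\<bar> + \<bar>?d1 x\<bar>) + A * \<bar>s\<bar>" for x
      proof (rule c_div)
        have "c * ?d2 x = (c - 1) * ?d x - (f (v s x) - f (u x)) + s * (al + ga * v s x - ga * s.u2 x)"
          using cw2[of x] cu2[of x] by (simp add: algebra_simps)
        then have "\<bar>c * ?d2 x\<bar> \<le> \<bar>(c - 1) * ?d x\<bar> + \<bar>f (v s x) - f (u x)\<bar> + \<bar>s * (al + ga * v s x - ga * s.u2 x)\<bar>"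
          by linarith
        also have "\<dots> \<le> (c - 1) * \<bar>?d x\<bar> + K * \<bar>?d x\<bar> + \<bar>s\<bar> * A"
        proof (intro add_mono)
          show "\<bar>(c - 1) * ?d x\<bar> \<le> (c - 1) * \<bar>?d x\<bar>" using c by (simp add: abs_mult)
          show "\<bar>f (v s x) - f (u x)\<bar> \<le> K * \<bar>?d x\<bar>" by (rule K(2)[OF sI u_I])
          have "\<bar>al + ga * v s x - ga * s.u2 x\<bar> \<le> \<bar>al\<bar> + \<bar>ga\<bar> * \<bar>v s x\<bar> + \<bar>ga\<bar> * \<bar>s.u2 x\<bar>"
            unfolding abs_mult[symmetric] by linarith
          also have "\<dots> \<le> A" unfolding A_def using B(1)[OF sI] w2[of x] by (intro add_mono mult_left_mono) auto
          finally show "\<bar>s * (al + ga * v s x - ga * s.u2 x)\<bar> \<le> \<bar>s\<bar> * A"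
            unfolding abs_mult by (intro mult_left_mono) auto
        qed
        also have "\<dots> = KK * \<bar>?d x\<bar> + A * \<bar>s\<bar>" by (simp add: KK_def algebra_simps)
        also have "\<dots> \<le> KK * (\<bar>?d x\<bar> + \<bar>?d1 x\<bar>) + A * \<bar>s\<bar>" using KK0 by (intro add_mono mult_left_mono order_refl) auto
        finally show "\<bar>c * ?d2 x\<bar> \<le> KK * (\<bar>?d x\<bar> + \<bar>?d1 x\<bar>) + A * \<bar>s\<bar>" .
      qed
      have m1: "\<bar>m s - um\<bar> \<le> (\<bar>\<phi> 0\<bar> + 1) * \<bar>s\<bar>"
      proof -
        have "\<bar>m s - um\<bar> \<le> \<bar>m s - um - s * \<phi> 0\<bar> + \<bar>s * \<phi> 0\<bar>" by linarith
        also have "\<dots> \<le> 1 * \<bar>s\<bar> + \<bar>s\<bar> * \<bar>\<phi> 0\<bar>"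
          unfolding abs_mult using elim(3) e'(2) by (intro add_mono order_trans[OF elim(3)] mult_right_mono) auto
        finally show ?thesis by (simp add: algebra_simps)
      qed
      have dL: "\<bar>?d x\<bar> \<le> L * \<bar>s\<bar> \<and> \<bar>?d1 x\<bar> \<le> L * \<bar>s\<bar>" if x: "0 \<le> x" "x \<le> X" for x
      proof -
        have *: "norm (?d2 x) \<le> KK * (norm (?d x) + norm (?d1 x)) + A * \<bar>s\<bar>" for x using d2[of x] by simp
        have "(norm (?d 0) + norm (?d1 0) + A * \<bar>s\<bar>) * gronwall_const (2 * KK + 1) X \<le> ((\<bar>\<phi> 0\<bar> + 1) * \<bar>s\<bar> + 0 + A * \<bar>s\<bar>) * G"
          unfolding G_def[symmetric] using m1 G by (intro mult_right_mono add_mono) (auto simp: s.u_0 u_0 s.u1_0 u1_0)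
        also have "\<dots> = L * \<bar>s\<bar>" by (simp add: L_def algebra_simps)
        finally show ?thesis
          using gronwall2[OF dd(1) dd(2) * KK0 _ x] A0 by simp
      qed
      let ?r = "\<lambda>x. v s x - u x - s * \<phi> x" and ?r1 = "\<lambda>x. s.u1 x - u1 x - s * \<phi>1 x"
        and ?r2 = "\<lambda>x. s.u2 x - u2 x - s * ((q x * \<phi> x + al + ga * (u x - u2 x)) / c)"
      have dr: "(?r has_vector_derivative ?r1 x) (at x)" "(?r1 has_vector_derivative ?r2 x) (at x)" for x
        unfolding hv[symmetric] by (intro DERIV_diff DERIV_cmult du du1 s.du s.du1 d\<phi> d\<phi>1)+
      \<comment> \<open>Splitting c + s ga leaves the linearised equation with potential
        \<open>q\<close>, the Taylor remainder of \<open>f\<close>, and s ga times a difference that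
        the first round has shown to be O(s).\<close>
      have r2: "\<bar>?r2 x\<bar> \<le> KK * (\<bar>?r x\<bar> + \<bar>?r1 x\<bar>) + R * \<bar>s\<bar>\<^sup>2" if x: "0 \<le> x" "x \<le> X" for x
      proof (rule c_div)
        have "c * ?r2 x = c * s.u2 x - c * u2 x - s * (q x * \<phi> x + al + ga * (u x - u2 x))"
          using c by (simp add: field_simps)
        also have "\<dots> = q x * ?r x - (f (v s x) - f (u x) - deriv f (u x) * ?d x) + s * ga * (?d x - ?d2 x)"
          unfolding cw2 cu2 q_def by (simp add: algebra_simps)
        finally have rhs: "c * ?r2 x = q x * ?r x - (f (v s x) - f (u x) - deriv f (u x) * ?d x) + s * ga * (?d x - ?d2 x)" .
        have "\<bar>c * ?r2 x\<bar> \<le> \<bar>q x * ?r x\<bar> + \<bar>f (v s x) - f (u x) - deriv f (u x) * ?d x\<bar> + \<bar>s * ga * (?d x - ?d2 x)\<bar>"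
          by (rule abs_le[OF rhs])
        also have "\<dots> \<le> KK * \<bar>?r x\<bar> + K2 * (L * \<bar>s\<bar>)\<^sup>2 + \<bar>s\<bar> * \<bar>ga\<bar> * (L * \<bar>s\<bar> + (KK * (L * \<bar>s\<bar> + L * \<bar>s\<bar>) + A * \<bar>s\<bar>))"
        proof (intro add_mono)
          have "\<bar>q x\<bar> \<le> KK" unfolding q_def KK_def using K(3)[OF u_I[of x]] c by linarith
          then show "\<bar>q x * ?r x\<bar> \<le> KK * \<bar>?r x\<bar>" unfolding abs_mult by (intro mult_right_mono) auto
          have "\<bar>?d x\<bar>\<^sup>2 \<le> (L * \<bar>s\<bar>)\<^sup>2" using dL[OF x] by (intro power_mono) auto
          then have "(?d x)\<^sup>2 \<le> (L * \<bar>s\<bar>)\<^sup>2" by simp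
          from mult_left_mono[OF this K2(1)] K2(2)[OF sI u_I, of x x]
          show "\<bar>f (v s x) - f (u x) - deriv f (u x) * ?d x\<bar> \<le> K2 * (L * \<bar>s\<bar>)\<^sup>2" by linarith
          have "\<bar>?d x - ?d2 x\<bar> \<le> \<bar>?d x\<bar> + \<bar>?d2 x\<bar>" by linarith
          also have "\<dots> \<le> L * \<bar>s\<bar> + (KK * (L * \<bar>s\<bar> + L * \<bar>s\<bar>) + A * \<bar>s\<bar>)"
          proof -
            have "KK * (\<bar>?d x\<bar> + \<bar>?d1 x\<bar>) \<le> KK * (L * \<bar>s\<bar> + L * \<bar>s\<bar>)"
              using dL[OF x] KK0 by (intro mult_left_mono add_mono) auto
            then show ?thesis using dL[OF x] d2[of x] by linarith
          qed
          finally show "\<bar>s * ga * (?d x - ?d2 x)\<bar> \<le> \<bar>s\<bar> * \<bar>ga\<bar> * (L * \<bar>s\<bar> + (KK * (L * \<bar>s\<bar> + L * \<bar>s\<bar>) + A * \<bar>s\<bar>))"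
            unfolding abs_mult by (intro mult_left_mono) auto
        qed
        also have "\<dots> = KK * \<bar>?r x\<bar> + R * \<bar>s\<bar>\<^sup>2" by (simp add: R_def power2_eq_square algebra_simps)
        also have "\<dots> \<le> KK * (\<bar>?r x\<bar> + \<bar>?r1 x\<bar>) + R * \<bar>s\<bar>\<^sup>2" using KK0 by (intro add_mono mult_left_mono order_refl) auto
        finally show "\<bar>c * ?r2 x\<bar> \<le> KK * (\<bar>?r x\<bar> + \<bar>?r1 x\<bar>) + R * \<bar>s\<bar>\<^sup>2" .
      qed
      show ?case
      proof
        fix x assume "x \<in> {0..X}"
        then have x: "0 \<le> x" "x \<le> X" by auto
        have *: "norm (?r2 x) \<le> KK * (norm (?r x) + norm (?r1 x)) + R * \<bar>s\<bar>\<^sup>2" if "0 \<le> x" "x \<le> X" for x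
          using r2[OF that] by simp
        have Rs: "0 \<le> R * \<bar>s\<bar>\<^sup>2" using R0 by simp
        have g1: "norm (?r x) \<le> (norm (?r 0) + norm (?r1 0) + R * \<bar>s\<bar>\<^sup>2) * gronwall_const (2 * KK + 1) X"
          by (rule gronwall2(1)[OF dr(1) dr(2) _ KK0 Rs x], rule *)
        have g2: "norm (?r1 x) \<le> (norm (?r 0) + norm (?r1 0) + R * \<bar>s\<bar>\<^sup>2) * gronwall_const (2 * KK + 1) X"
          by (rule gronwall2(2)[OF dr(1) dr(2) _ KK0 Rs x], rule *)
        have "(norm (?r 0) + norm (?r1 0) + R * \<bar>s\<bar>\<^sup>2) * gronwall_const (2 * KK + 1) X \<le> (e' * \<bar>s\<bar> + 0 + R * \<bar>s\<bar>\<^sup>2) * G"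
          unfolding G_def[symmetric] using elim(3) G
          by (intro mult_right_mono add_mono) (auto simp: s.u_0 u_0 s.u1_0 u1_0 \<phi>1_0)
        also have "\<dots> = (e' * G) * \<bar>s\<bar> + (R * \<bar>s\<bar> * G) * \<bar>s\<bar>" by (simp add: power2_eq_square algebra_simps)
        also have "\<dots> \<le> (e / 2) * \<bar>s\<bar> + (e / 2) * \<bar>s\<bar>"
        proof (intro add_mono mult_right_mono e'(3))
          have pos: "2 * G * (R + 1) > 0" using G R0 by simp
          have "\<bar>s\<bar> * (2 * G * (R + 1)) < e" using elim(1) by (simp only: pos_less_divide_eq[OF pos])
          moreover have "2 * ((R + 1) * (\<bar>s\<bar> * G)) = \<bar>s\<bar> * (2 * G * (R + 1))" by (simp add: algebra_simps)
          ultimately have "(R + 1) * (\<bar>s\<bar> * G) \<le> e / 2" by linarith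
          moreover have "R * (\<bar>s\<bar> * G) \<le> (R + 1) * (\<bar>s\<bar> * G)" using G by (intro mult_right_mono) auto
          ultimately show "R * \<bar>s\<bar> * G \<le> e / 2" by (simp add: mult.assoc)
        qed auto
        finally have "(norm (?r 0) + norm (?r1 0) + R * \<bar>s\<bar>\<^sup>2) * gronwall_const (2 * KK + 1) X \<le> e * \<bar>s\<bar>" by simp
        then show "\<bar>?r x\<bar> \<le> e * \<bar>s\<bar> \<and> \<bar>?r1 x\<bar> \<le> e * \<bar>s\<bar>"
          using g1 g2 by simp
      qed
    qed
  qed
  show "uniform_deriv X v \<phi>" "uniform_deriv X (\<lambda>s. deriv (v s)) \<phi>1"
    unfolding uniform_deriv_def v_0 by (intro allI impI; drule main; erule eventually_mono; blast)+
qed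

end

lemma integral_has_real_derivative_at:
  fixes g :: "real \<Rightarrow> real"
  assumes "continuous_on UNIV g" "x > 0"
  shows "((\<lambda>x. integral {0..x} g) has_real_derivative g x) (at x)"
proof -
  have "((\<lambda>x. integral {0..x} g) has_vector_derivative g x) (at x within {0..x + 1})"
    by (rule integral_has_vector_derivative) (use assms continuous_on_subset in auto)
  then have "((\<lambda>x. integral {0..x} g) has_vector_derivative g x) (at x)"
    using assms(2) by (subst (asm) at_within_interior) auto
  then show ?thesis by (simp add: has_real_derivative_iff_has_vector_derivative)
qed

lemma continuous_on_bounded:
  fixes g :: "real \<Rightarrow> real"
  assumes "continuous_on {x0..X} g"
  obtains B where "B \<ge> 0" "\<And>x. x \<in> {x0..X} \<Longrightarrow> \<bar>g x\<bar> \<le> B"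
proof -
  have "bounded (g ` {x0..X})" using assms by (intro compact_imp_bounded compact_continuous_image) auto
  then obtain B where "\<And>x. x \<in> {x0..X} \<Longrightarrow> \<bar>g x\<bar> \<le> B" unfolding bounded_iff by (metis imageI real_norm_def)
  then show ?thesis using that[of "\<bar>B\<bar>"] by force
qed

context wave begin

lemma u_mono:
  assumes "0 \<le> x" "x \<le> y" "y \<le> \<tau>"
  shows "u x \<le> u y"
proof (rule DERIV_nonneg_imp_increasing_open[OF assms(2)])
  show "\<exists>D. (u has_real_derivative D) (at z) \<and> 0 \<le> D" if "x < z" "z < y" for z
    using du[of z] u1_pos[of z] that assms by (intro exI[of _ "u1 z"]) auto
qed (rule continuous_u)

lemma u1_nonneg: "0 \<le> x \<Longrightarrow> x \<le> \<tau> \<Longrightarrow> 0 \<le> u1 x"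
  using u1_pos[of x] u1_0 u1_tau by (cases "x = 0 \<or> x = \<tau>") auto

text \<open>The Wronskian of two kernel elements of L is constant, and its value at 0 is positive.
  Hence \<open>e0\<close> and \<open>u1\<close> form a basis of the solutions of L y = 0.\<close>

lemma kernel_wronskian:
  assumes e: "\<And>x. (e0 has_real_derivative e1 x) (at x)" "\<And>x. (e1 has_real_derivative (q x * e0 x / c)) (at x)"
    "e0 0 = 1" "e1 0 = 0"
  shows "e0 x * u2 x - e1 x * u1 x = u2 0"
proof -
  have "((\<lambda>x. e0 x * u2 x - e1 x * u1 x) has_real_derivative 0) (at x)" for x
    using DERIV_diff[OF DERIV_mult[OF e(1)[of x] du2[of x]] DERIV_mult[OF e(2)[of x] du1[of x]]]
    by (simp add: algebra_simps)
  then have "\<forall>x. ((\<lambda>x. e0 x * u2 x - e1 x * u1 x) has_real_derivative 0) (at x)" by blast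
  from DERIV_isconst_all[OF this, of x 0] show ?thesis using e by (simp add: u1_0)
qed

end

section \<open>Variation of period, mass and momentum along a curve of waves\<close>

context wave_family begin

abbreviation "ts s \<equiv> wave.\<tau> (v s) (p s)"

lemma ts_0: "ts 0 = \<tau>" by (simp add: v_0 p_0)

lemma uniform_pointwise:
  assumes "uniform_deriv X g \<gamma>" "x \<in> {0..X}"
  shows "((\<lambda>s. g s x) \<longlongrightarrow> g 0 x) (at 0)"
proof -
  have "((\<lambda>s. g s x) has_real_derivative \<gamma> x) (at 0)"
    unfolding has_real_derivative_iff_small
  proof (intro allI impI)
    fix e :: real assume "e > 0"
    from uniform_derivD[OF assms(1) this]
    show "\<forall>\<^sub>F s in at 0. \<bar>g s x - g 0 x - s * \<gamma> x\<bar> \<le> e * \<bar>s\<bar>"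
      by (rule eventually_mono) (use assms(2) in blast)
  qed
  from DERIV_isCont[OF this] show ?thesis by (simp add: isCont_def)
qed

text \<open>Just after \<open>\<tau>\<close> the slope is negative, hence also for nearby waves,
  whose slope is nonnegative up to their own crest. Before \<open>\<tau>\<close> the wave stays a
  fixed distance below \<open>up\<close>, so nearby waves cannot have reached \<open>p s\<close>
  yet.\<close>

lemma ts_cont: "isCont ts 0"
  unfolding isCont_def ts_0
proof (rule order_tendstoI)
  fix b assume b: "\<tau> < b"
  define e where "e = min (b - \<tau>) \<tau> / 2"
  have e2: "2 * e = min (b - \<tau>) \<tau>" by (simp add: e_def)
  have "0 < e" using b tau(1) by (simp add: e_def)
  moreover have "2 * e \<le> b - \<tau>" "2 * e \<le> \<tau>" unfolding e2 by simp_all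
  ultimately have e: "0 < e" "\<tau> + e < b" "e < \<tau>" by auto
  have "u1 (\<tau> + e) < 0" by (rule u1_neg) (use e in auto)
  moreover have "((\<lambda>s. deriv (v s) (\<tau> + e)) \<longlongrightarrow> u1 (\<tau> + e)) (at 0)"
    using uniform_pointwise[OF uniform(2)[of "\<tau> + e"], of "\<tau> + e"] e tau(1) by (simp add: v_0)
  ultimately have "\<forall>\<^sub>F s in at 0. deriv (v s) (\<tau> + e) < 0" by (simp add: order_tendstoD(2))
  then show "\<forall>\<^sub>F s in at 0. ts s < b" using eventually_wave
  proof eventually_elim
    case (elim s)
    interpret s: wave f F "v s" "a + s * al" "E + s * et" "c + s * ga" "m s" "p s" by (rule elim(2))
    show ?case
    proof (rule ccontr)
      assume "\<not> ts s < b"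
      then have "0 \<le> s.u1 (\<tau> + e)" by (intro s.u1_nonneg) (use e tau(1) in auto)
      with elim(1) show False by simp
    qed
  qed
next
  fix b assume b: "b < \<tau>"
  define y where "y = max 0 b"
  have y: "0 \<le> y" "y < \<tau>" "b \<le> y" using b tau(1) by (auto simp: y_def)
  \<comment> \<open>A third of the gap: one part for the change of \<open>p\<close>, one for the
    change of the wave, and one remains.\<close>
  define g where "g = (up - u y) / 3"
  have "u y \<noteq> up" using tau(3) y by auto
  then have g: "g > 0" using u_in[of y] by (simp add: g_def)
  obtain B where B: "B \<ge> 0" "\<And>x. x \<in> {0..\<tau>} \<Longrightarrow> \<bar>\<phi> x\<bar> \<le> B"
    by (rule continuous_on_bounded[OF continuous_\<phi>, of 0 \<tau>]) blast
  have "\<forall>\<^sub>F s in at 0. \<forall>x\<in>{0..\<tau>}. \<bar>v s x - v 0 x - s * \<phi> x\<bar> \<le> 1 * \<bar>s\<bar>"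
    by (rule uniform_derivD[OF uniform(1)]) (use tau(1) in auto)
  moreover have "\<forall>\<^sub>F s in at 0. up - g < p s"
    using order_tendstoD(1)[OF p_cont[unfolded isCont_def], of "up - g"] g by (simp add: p_0)
  moreover have "\<forall>\<^sub>F s in at 0. \<bar>s\<bar> < g / (B + 1)"
  proof -
    have "((\<lambda>s::real. \<bar>s\<bar>) \<longlongrightarrow> 0) (at 0)" by (rule tendsto_rabs_zero) (rule tendsto_ident_at)
    then show ?thesis by (rule order_tendstoD) (use g B(1) in auto)
  qed
  ultimately show "\<forall>\<^sub>F s in at 0. b < ts s" using eventually_wave
  proof eventually_elim
    case (elim s)
    interpret s: wave f F "v s" "a + s * al" "E + s * et" "c + s * ga" "m s" "p s" by (rule elim(4))
    show ?case
    proof (rule ccontr)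
      assume "\<not> b < ts s"
      then have le: "ts s \<le> y" using y by simp
      have t: "ts s \<in> {0..\<tau>}" using le y s.tau(1) by auto
      have "\<bar>v s (ts s) - u (ts s) - s * \<phi> (ts s)\<bar> \<le> \<bar>s\<bar>" using elim(1) t by (simp add: v_0)
      moreover have "\<bar>s * \<phi> (ts s)\<bar> \<le> \<bar>s\<bar> * B" unfolding abs_mult using B(2)[OF t] by (intro mult_left_mono) auto
      moreover have "\<bar>s\<bar> * (B + 1) < g" using elim(3) B(1) by (simp add: pos_less_divide_eq)
      moreover have "\<bar>s\<bar> * (B + 1) = \<bar>s\<bar> * B + \<bar>s\<bar>" by (simp add: algebra_simps)
      moreover have "u (ts s) \<le> u y" by (rule u_mono) (use le y t in auto)
      moreover have "up - u y = 3 * g" by (simp add: g_def)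
      ultimately show False using elim(2) s.tau(2) g by linarith
    qed
  qed
qed

text \<open>Twice the derivative of the half period, by implicit differentiation of the condition
  that the slope vanishes at \<open>ts s\<close>.\<close>

definition "Td = - 2 * \<phi>1 \<tau> / u2 \<tau>"

lemma isCont_\<phi>: "isCont \<phi> x" "isCont \<phi>1 x"
  using d\<phi> d\<phi>1 DERIV_isCont by blast+

lemma dts: "(ts has_real_derivative Td / 2) (at 0)"
proof -
  have "(ts has_real_derivative (- \<phi>1 (ts 0) / u2 \<tau>)) (at 0)"
  proof (rule uniform_deriv_implicit[OF uniform(2)[of "\<tau> + 1"] ts_cont])
    show "\<forall>\<^sub>F s in at 0. deriv (v s) (ts s) = 0"
      using eventually_wave by eventually_elim (rule wave.u1_tau)
  qed (use tau(1) u1_tau u2_tau isCont_\<phi> du1[of \<tau>] in \<open>auto simp: v_0 p_0\<close>)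
  then show ?thesis by (simp add: Td_def ts_0)
qed

lemma dT: "((\<lambda>s. wave_period (v s)) has_real_derivative Td) (at 0)"
proof (rule has_field_derivative_transform_within_open)
  show "((\<lambda>s. 2 * ts s) has_real_derivative Td) (at 0)"
    using DERIV_cmult[OF dts, of 2] by simp
  fix s assume "s \<in> {- \<delta><..<\<delta>}"
  then have "wave f F (v s) (a + s * al) (E + s * et) (c + s * ga) (m s) (p s)" by (intro fam) auto
  then show "2 * ts s = wave_period (v s)" by (simp add: wave.wave_period_eq wave.T_def)
qed (use \<delta> in auto)

lemma period_0: "wave_period (v 0) = T" by (simp add: v_0 wave_period_eq)

lemma T_bounds: "0 < wave_period (v 0)" "wave_period (v 0) < T + 1"
  using T_pos by (simp_all add: period_0)

lemma u_T': "u T = um" "u1 T = 0" "u2 T = u2 0"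
  using u_T[of 0] u1_T[of 0] u2_T[of 0] u_0 u1_0 by auto

text \<open>After one period each wave of the curve is back at its minimum \<open>m s\<close> with
  slope 0; both relations are differentiated at \<open>s = 0\<close>. So \<open>\<phi>\<close>
  closes up while its derivative jumps by a multiple of \<open>Td\<close>, and the period derivative
  is encoded in \<open>\<phi>\<close> alone.\<close>

lemma \<phi>_T: "\<phi> T = \<phi> 0" and \<phi>1_T: "\<phi>1 T = - u2 0 * Td"
proof -
  have X: "0 \<le> T + 1" using T_pos by simp
  have w: "v s (wave_period (v s)) = m s" "deriv (v s) (wave_period (v s)) = 0"
    if "s \<in> {- \<delta><..<\<delta>}" for s
  proof -
    interpret s: wave f F "v s" "a + s * al" "E + s * et" "c + s * ga" "m s" "p s" by (rule fam) (use that in auto)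
    show "v s (wave_period (v s)) = m s" "deriv (v s) (wave_period (v s)) = 0"
      using s.u_T[of 0] s.u1_T[of 0] s.u_0 s.u1_0 by (simp_all add: s.wave_period_eq)
  qed
  have "((\<lambda>s. v s (wave_period (v s))) has_real_derivative (\<phi> (wave_period (v 0)) + 0 * Td)) (at 0)"
    by (rule uniform_deriv_moving[OF uniform(1)[OF X] dT T_bounds isCont_\<phi>(1)])
       (use du[of T] u_T' in \<open>simp add: v_0 wave_period_eq\<close>)
  then have "(m has_real_derivative (\<phi> (wave_period (v 0)) + 0 * Td)) (at 0)"
    by (rule has_field_derivative_transform_within_open[OF _ open_greaterThanLessThan _ w(1)]) (use \<delta> in auto)
  then have "(m has_real_derivative \<phi> T) (at 0)" by (simp only: period_0 mult_zero_left add_0_right)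
  then show "\<phi> T = \<phi> 0" using dm DERIV_unique by blast
  have "((\<lambda>s. deriv (v s) (wave_period (v s))) has_real_derivative (\<phi>1 (wave_period (v 0)) + u2 0 * Td)) (at 0)"
    by (rule uniform_deriv_moving[OF uniform(2)[OF X] dT T_bounds isCont_\<phi>(2)])
       (use du1[of T] u_T' in \<open>simp add: v_0 wave_period_eq\<close>)
  then have "((\<lambda>s. 0) has_real_derivative (\<phi>1 (wave_period (v 0)) + u2 0 * Td)) (at 0)"
    by (rule has_field_derivative_transform_within_open[OF _ open_greaterThanLessThan _ w(2)]) (use \<delta> in auto)
  then have "((\<lambda>s. 0) has_real_derivative (\<phi>1 T + u2 0 * Td)) (at 0)" by (simp only: period_0)
  then have "\<phi>1 T + u2 0 * Td = 0" using DERIV_const DERIV_unique by blast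
  then show "\<phi>1 T = - u2 0 * Td" by simp
qed

lemma eventually_continuous: "\<forall>\<^sub>F s in at 0. continuous_on UNIV (v s) \<and> continuous_on UNIV (deriv (v s))"
  using eventually_wave by eventually_elim (simp add: wave.continuous_u wave.continuous_u1)

text \<open>Leibniz rule: the moving end point contributes the integrand there, and
  \<open>u T = um\<close>. For the momentum below, the slope term drops out at the end point because
  \<open>u1 T = 0\<close>.\<close>

lemma dM: "((\<lambda>s. wave_mass (v s)) has_real_derivative (integral {0..T} \<phi> + um * Td)) (at 0)"
proof -
  have X: "0 \<le> T + 1" using T_pos by simp
  have "uniform_deriv (T + 1) (\<lambda>s x. integral {0..x} (v s)) (\<lambda>x. integral {0..x} \<phi>)"
  proof (rule uniform_deriv_integral[OF uniform(1)[OF X] X])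
    show "\<forall>\<^sub>F s in at 0. continuous_on UNIV (v s)" using eventually_continuous by eventually_elim simp
  qed (simp_all add: v_0 continuous_u continuous_\<phi>)
  from uniform_deriv_moving[OF this dT T_bounds, of um]
  show ?thesis
    using integral_has_real_derivative_at[OF continuous_\<phi> T_pos, THEN DERIV_isCont]
      integral_has_real_derivative_at[OF continuous_u T_pos] u_T'
    by (simp add: wave_mass_def wave_period_eq v_0)
qed

lemma dP: "((\<lambda>s. wave_momentum (v s)) has_real_derivative (integral {0..T} (\<lambda>x. u x * \<phi> x + u1 x * \<phi>1 x) + um\<^sup>2 / 2 * Td)) (at 0)"
proof -
  have X: "0 \<le> T + 1" using T_pos by simp
  obtain B1 where B1: "B1 \<ge> 0" "\<And>x. x \<in> {0..T + 1} \<Longrightarrow> \<bar>u x\<bar> \<le> B1" by (rule continuous_on_bounded[OF continuous_u, of 0 "T + 1"]) blast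
  obtain B2 where B2: "B2 \<ge> 0" "\<And>x. x \<in> {0..T + 1} \<Longrightarrow> \<bar>u1 x\<bar> \<le> B2" by (rule continuous_on_bounded[OF continuous_u1, of 0 "T + 1"]) blast
  obtain B3 where B3: "B3 \<ge> 0" "\<And>x. x \<in> {0..T + 1} \<Longrightarrow> \<bar>\<phi> x\<bar> \<le> B3" by (rule continuous_on_bounded[OF continuous_\<phi>, of 0 "T + 1"]) blast
  obtain B4 where B4: "B4 \<ge> 0" "\<And>x. x \<in> {0..T + 1} \<Longrightarrow> \<bar>\<phi>1 x\<bar> \<le> B4" by (rule continuous_on_bounded[OF continuous_\<phi>1, of 0 "T + 1"]) blast
  have s1: "uniform_deriv (T + 1) (\<lambda>s x. (v s x)\<^sup>2) (\<lambda>x. 2 * v 0 x * \<phi> x)"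
    by (rule uniform_deriv_square[OF uniform(1)[OF X], of "max B1 B3"]) (use B1 B3 in \<open>auto simp: v_0 max.coboundedI1 max.coboundedI2\<close>)
  have s2: "uniform_deriv (T + 1) (\<lambda>s x. (deriv (v s) x)\<^sup>2) (\<lambda>x. 2 * deriv (v 0) x * \<phi>1 x)"
    by (rule uniform_deriv_square[OF uniform(2)[OF X], of "max B2 B4"]) (use B2 B4 in \<open>auto simp: v_0 max.coboundedI1 max.coboundedI2\<close>)
  let ?\<gamma> = "\<lambda>x. 2 * u x * \<phi> x + 2 * u1 x * \<phi>1 x"
  have c\<gamma>: "continuous_on UNIV ?\<gamma>" by (intro continuous_intros continuous_u continuous_u1 continuous_\<phi> continuous_\<phi>1)
  have cg: "continuous_on UNIV (\<lambda>x. (u x)\<^sup>2 + (u1 x)\<^sup>2)" by (intro continuous_intros continuous_u continuous_u1)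
  have "uniform_deriv (T + 1) (\<lambda>s x. integral {0..x} (\<lambda>x. (v s x)\<^sup>2 + (deriv (v s) x)\<^sup>2)) (\<lambda>x. integral {0..x} ?\<gamma>)"
  proof (rule uniform_deriv_integral[OF uniform_deriv_add[OF s1 s2, unfolded v_0] X])
    show "\<forall>\<^sub>F s in at 0. continuous_on UNIV (\<lambda>x. (v s x)\<^sup>2 + (deriv (v s) x)\<^sup>2)"
      using eventually_continuous by eventually_elim (auto intro!: continuous_intros)
  qed (simp_all add: v_0 c\<gamma> cg)
  from DERIV_cmult[OF uniform_deriv_moving[OF this dT T_bounds, of "um\<^sup>2"], of "1 / 2"]
  have "((\<lambda>s. wave_momentum (v s)) has_real_derivative (1 / 2 * (integral {0..T} ?\<gamma> + um\<^sup>2 * Td))) (at 0)"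
    using integral_has_real_derivative_at[OF c\<gamma> T_pos, THEN DERIV_isCont]
      integral_has_real_derivative_at[OF cg T_pos] u_T'
    by (simp add: wave_momentum_def wave_period_eq v_0)
  note h = this
  have eq: "integral {0..T} ?\<gamma> = 2 * integral {0..T} (\<lambda>x. u x * \<phi> x + u1 x * \<phi>1 x)"
    unfolding integral_mult_right[symmetric] by (simp add: algebra_simps)
  show ?thesis by (rule DERIV_cong[OF h]) (simp add: eq add_divide_distrib)
qed

end

section \<open>Solving the linearised equation\<close>

context wave_evans begin

text \<open>Existence comes from the given fundamental matrix at \<open>\<mu> = 0\<close>: there L v
  is constant along solutions, and the initial second derivative is chosen to make this constant
  0.\<close>

lemma even_solution:
  obtains e0 e1 where "\<And>x. (e0 has_real_derivative e1 x) (at x)" "\<And>x. (e1 has_real_derivative (q x * e0 x / c)) (at x)"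
    "e0 0 = 1" "e1 0 = 0"
proof -
  define y :: "complex^3" where "y = vector [1, 0, of_real (q 0 / c)]"
  define w where "w = (\<lambda>i x. (\<Phi> x 0 *v y) $ i)"
  have s: "third_sol 0 (w 1) (w 2) (w 3)" unfolding w_def by (rule Phi_vector)
  have i: "w 1 0 = 1" "w 2 0 = 0" "w 3 0 = of_real (q 0 / c)" by (simp_all add: w_def Phi_0 y_def vector_3)
  have "((\<lambda>x. - of_real c * w 3 x + of_real (q x) * w 1 x) has_vector_derivative 0) (at x within UNIV)" for x
    using third_sol_L_deriv[OF s, of x] by simp
  note d0 = this
  obtain k where k: "\<And>x. x \<in> UNIV \<Longrightarrow> - of_real c * w 3 x + of_real (q x) * w 1 x = k"
    by (rule has_vector_derivative_zero_constant[OF convex_UNIV d0]) blast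
  have "- of_real c * w 3 x + of_real (q x) * w 1 x = - of_real c * w 3 0 + of_real (q 0) * w 1 0" for x
    using k[of x] k[of 0] by simp
  also have "- of_real c * w 3 0 + of_real (q 0) * w 1 0 = 0" using c by (simp add: i)
  finally have w3: "w 3 x = of_real (q x) * w 1 x / of_real c" for x using c by (simp add: field_simps)
  have Re: "((\<lambda>x. Re (g x)) has_real_derivative Re g') (at x)" if "(g has_vector_derivative g') (at x)" for g g' x
    using bounded_linear.has_vector_derivative[OF bounded_linear_Re that]
    by (simp add: has_real_derivative_iff_has_vector_derivative)
  have d: "(w 1 has_vector_derivative w 2 x) (at x)" "(w 2 has_vector_derivative w 3 x) (at x)" for x
    using s unfolding third_sol_def by blast+
  have "Re (w 3 x) = q x * Re (w 1 x) / c" for x by (simp add: w3)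
  then show ?thesis
    using that[of "\<lambda>x. Re (w 1 x)" "\<lambda>x. Re (w 2 x)"] Re[OF d(1)] Re[OF d(2)] i by simp
qed

text \<open>Variation of constants with the pair \<open>u1\<close>, \<open>e0\<close>, whose
  Wronskian is the constant \<open>\<kappa>\<close>.\<close>

lemma linear_solution:
  assumes \<rho>: "continuous_on UNIV \<rho>"
  obtains \<phi> \<phi>1 where "\<And>x. (\<phi> has_real_derivative \<phi>1 x) (at x)"
    "\<And>x. (\<phi>1 has_real_derivative ((q x * \<phi> x + \<rho> x) / c)) (at x)" "\<phi> 0 = i0" "\<phi>1 0 = 0"
proof -
  obtain e0 e1 where e: "\<And>x. (e0 has_real_derivative e1 x) (at x)" "\<And>x. (e1 has_real_derivative (q x * e0 x / c)) (at x)"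
    "e0 0 = 1" "e1 0 = 0" by (rule even_solution) blast
  have ce: "continuous_on UNIV e0"
    by (rule DERIV_continuous_on[OF has_field_derivative_at_within[OF e(1)]])
  have cont: "continuous_on UNIV (\<lambda>x. e0 x * \<rho> x)" "continuous_on UNIV (\<lambda>x. u1 x * \<rho> x)"
    by (intro continuous_intros ce continuous_u1 \<rho>)+
  obtain G1 where G1: "G1 0 = 0" "\<And>x. (G1 has_vector_derivative e0 x * \<rho> x) (at x)"
    by (rule continuous_antiderivative[OF cont(1), of 0]) blast
  obtain G2 where G2: "G2 0 = 0" "\<And>x. (G2 has_vector_derivative u1 x * \<rho> x) (at x)"
    by (rule continuous_antiderivative[OF cont(2), of 0]) blast
  note G = G1(2)[unfolded has_real_derivative_iff_has_vector_derivative[symmetric]]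
    G2(2)[unfolded has_real_derivative_iff_has_vector_derivative[symmetric]]
  define \<kappa> where "\<kappa> = u2 0"
  have \<kappa>: "\<kappa> > 0" using u2_0 by (simp add: \<kappa>_def)
  have W: "e0 x * u2 x - e1 x * u1 x = \<kappa>" for x
    unfolding \<kappa>_def by (rule kernel_wronskian[OF e])
  define \<phi> where "\<phi> = (\<lambda>x. i0 * e0 x + (u1 x * G1 x - e0 x * G2 x) / (c * \<kappa>))"
  define \<phi>1 where "\<phi>1 = (\<lambda>x. i0 * e1 x + (u2 x * G1 x - e1 x * G2 x) / (c * \<kappa>))"
  show ?thesis
  proof (rule that[of \<phi> \<phi>1])
    fix x
    have "(\<phi> has_real_derivative (i0 * e1 x + ((u2 x * G1 x + e0 x * \<rho> x * u1 x) - (e1 x * G2 x + u1 x * \<rho> x * e0 x)) / (c * \<kappa>))) (at x)"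
      unfolding \<phi>_def by (intro DERIV_add DERIV_cmult DERIV_cdivide DERIV_diff DERIV_mult e du1 G)
    then show "(\<phi> has_real_derivative \<phi>1 x) (at x)" by (simp add: \<phi>1_def mult.commute mult.left_commute)
    have "(\<phi>1 has_real_derivative (i0 * (q x * e0 x / c) + ((q x * u1 x / c * G1 x + e0 x * \<rho> x * u2 x) - (q x * e0 x / c * G2 x + u1 x * \<rho> x * e1 x)) / (c * \<kappa>))) (at x)"
      unfolding \<phi>1_def by (intro DERIV_add DERIV_cmult DERIV_cdivide DERIV_diff DERIV_mult e du2 G)
    moreover have "i0 * (q x * e0 x / c) + ((q x * u1 x / c * G1 x + e0 x * \<rho> x * u2 x) - (q x * e0 x / c * G2 x + u1 x * \<rho> x * e1 x)) / (c * \<kappa>)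
      = (q x * \<phi> x + \<rho> x) / c"
    proof -
      have "e0 x * \<rho> x * u2 x - u1 x * \<rho> x * e1 x = \<rho> x * \<kappa>" unfolding W[of x, symmetric] by (simp add: algebra_simps)
      then have 1: "(q x * u1 x / c * G1 x + e0 x * \<rho> x * u2 x) - (q x * e0 x / c * G2 x + u1 x * \<rho> x * e1 x)
        = q x / c * (u1 x * G1 x - e0 x * G2 x) + \<rho> x * \<kappa>" by (simp add: algebra_simps)
      show ?thesis unfolding 1 \<phi>_def using c \<kappa> by (simp add: field_simps)
    qed
    ultimately show "(\<phi>1 has_real_derivative ((q x * \<phi> x + \<rho> x) / c)) (at x)" by simp
  qed (simp_all add: \<phi>_def \<phi>1_def e G1 G2 u1_0)
qed

end

section \<open>Index of the linearised operator\<close>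

lemma periodic_eq_0:
  fixes g :: "real \<Rightarrow> 'a::real_normed_vector"
  assumes T: "T > 0" and per: "\<And>x. g (x + T) = g x" and z: "\<And>x. x \<in> {0..T} \<Longrightarrow> g x = 0"
  shows "g x = 0"
proof -
  have n: "g (y + of_nat n * T) = g y" for n y
  proof (induction n)
    case (Suc n)
    have "g (y + of_nat (Suc n) * T) = g ((y + of_nat n * T) + T)" by (simp add: algebra_simps)
    then show ?case using per Suc by simp
  qed simp
  define k where "k = \<lfloor>x / T\<rfloor>"
  define y where "y = x - of_int k * T"
  have "of_int k \<le> x / T" "x / T < of_int k + 1" unfolding k_def by linarith+
  then have y: "y \<in> {0..T}" using T by (auto simp: y_def field_simps)
  have "g x = g y"
  proof (cases "k \<ge> 0")
    case True
    then have "x = y + of_nat (nat k) * T" by (simp add: y_def)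
    then show ?thesis using n by metis
  next
    case False
    then have "y = x + of_nat (nat (- k)) * T" by (simp add: y_def)
    then show ?thesis using n by metis
  qed
  then show ?thesis using z[OF y] by simp
qed

lemma integral_FTC:
  fixes G g :: "real \<Rightarrow> real"
  assumes "p \<le> r" "\<And>x. (G has_real_derivative g x) (at x)"
  shows "integral {p..r} g = G r - G p"
  by (rule integral_unique, rule fundamental_theorem_of_calculus[OF assms(1)])
    (use assms(2) in \<open>simp add: has_real_derivative_iff_has_vector_derivative has_vector_derivative_at_within\<close>)

text \<open>Since y solves c y_xx = Q y, the integrand of the form minus the derivative of
  \<open>B\<close> is the square c (\<phi>1 - (y1 / y) \<phi>)^2. Boundary terms therefore bound the
  form from below, and equality makes \<phi> / y constant. At an end where y vanishes, its simple
  zero is compensated by a zero of \<phi>.\<close>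

lemma Picone:
  fixes y y1 \<phi> \<phi>1 Q :: "real \<Rightarrow> real"
  assumes pr: "p < r" and c: "c > 0"
    and dy: "\<And>x. (y has_real_derivative y1 x) (at x)" "\<And>x. (y1 has_real_derivative (Q x * y x / c)) (at x)"
    and d\<phi>: "\<And>x. (\<phi> has_real_derivative \<phi>1 x) (at x)" and c\<phi>: "continuous_on UNIV \<phi>1" "continuous_on UNIV Q"
    and nz: "\<And>x. p < x \<Longrightarrow> x < r \<Longrightarrow> y x \<noteq> 0"
    and ends: "\<And>x. x \<in> {p, r} \<Longrightarrow> y x \<noteq> 0 \<or> \<phi> x = 0 \<and> y1 x \<noteq> 0"
  defines "B \<equiv> \<lambda>x. c * (y1 x / y x) * (\<phi> x)\<^sup>2"
    and "I \<equiv> integral {p..r} (\<lambda>x. c * (\<phi>1 x)\<^sup>2 + Q x * (\<phi> x)\<^sup>2)"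
  shows "B r - B p \<le> I" "I = B r - B p \<Longrightarrow> \<exists>k. \<forall>x. p < x \<and> x < r \<longrightarrow> \<phi> x = k * y x"
proof -
  let ?g = "\<lambda>x. c * (\<phi>1 x)\<^sup>2 + Q x * (\<phi> x)\<^sup>2"
  have cy: "isCont y x" "isCont y1 x" "isCont \<phi> x" for x
    using dy d\<phi> DERIV_isCont by blast+
  have cphi: "continuous_on UNIV \<phi>" by (rule DERIV_continuous_on[OF has_field_derivative_at_within[OF d\<phi>]])
  have cg: "continuous_on UNIV ?g" by (intro continuous_intros c\<phi> cphi)
  obtain K where K: "K p = 0" "\<And>x. (K has_vector_derivative ?g x) (at x)"
    by (rule continuous_antiderivative[OF cg, of p]) blast
  have dK: "(K has_real_derivative ?g x) (at x)" for x
    using K(2) by (simp add: has_real_derivative_iff_has_vector_derivative)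
  have KI: "K r = I"
    using integral_FTC[of p r, OF _ dK] pr K(1) by (simp add: I_def)
  \<comment> \<open>At a common zero, \<phi>^2 / y is rewritten through the difference quotients of
    both functions; the remaining factor \<phi> sends it to 0, the value of \<open>B\<close>
    there.\<close>
  have BcontE: "isCont B x" if "y x \<noteq> 0 \<or> \<phi> x = 0 \<and> y1 x \<noteq> 0" for x
  proof (cases "y x = 0")
    case False
    then show ?thesis unfolding B_def by (intro continuous_intros cy) auto
  next
    case True
    with that have z: "\<phi> x = 0" "y1 x \<noteq> 0" by auto
    have l1: "((\<lambda>t. \<phi> t / (t - x)) \<longlongrightarrow> \<phi>1 x) (at x)" "((\<lambda>t. y t / (t - x)) \<longlongrightarrow> y1 x) (at x)"
      using d\<phi>[of x] dy(1)[of x] True z by (simp_all add: has_field_derivative_iff)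
    have "((\<lambda>t. c * y1 t * ((\<phi> t / (t - x)) / (y t / (t - x))) * \<phi> t) \<longlongrightarrow> c * y1 x * (\<phi>1 x / y1 x) * \<phi> x) (at x)"
      using cy[of x] z(2) unfolding isCont_def by (intro tendsto_intros l1) auto
    moreover have "\<forall>\<^sub>F t in at x. c * y1 t * ((\<phi> t / (t - x)) / (y t / (t - x))) * \<phi> t = B t"
      by (auto simp: eventually_at_filter B_def power2_eq_square)
    ultimately have "(B \<longlongrightarrow> c * y1 x * (\<phi>1 x / y1 x) * \<phi> x) (at x)"
      by (rule Lim_transform_eventually)
    moreover have "c * y1 x * (\<phi>1 x / y1 x) * \<phi> x = B x" by (simp add: B_def z)
    ultimately show ?thesis by (simp add: isCont_def)
  qed
  have Bcont: "isCont B x" if "x \<in> {p..r}" for x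
    by (rule BcontE) (use that nz[of x] ends[of x] in force)
  define G where "G = (\<lambda>x. K x - B x)"
  have G_cont: "continuous_on {s..t} G" if "p \<le> s" "t \<le> r" for s t
    unfolding G_def using Bcont DERIV_isCont[OF dK] that
    by (intro continuous_at_imp_continuous_on ballI continuous_diff) auto
  have dG: "(G has_real_derivative c * (\<phi>1 x - y1 x / y x * \<phi> x)\<^sup>2) (at x)" if "p < x" "x < r" for x
  proof -
    have n: "y x \<noteq> 0" using nz that by blast
    have "(B has_real_derivative c * ((Q x * y x / c * y x - y1 x * y1 x) / (y x * y x)) * (\<phi> x)\<^sup>2 + (2 * \<phi> x * \<phi>1 x) * (c * (y1 x / y x))) (at x)"
      unfolding B_def power2_eq_square
      by (rule DERIV_cong[OF DERIV_mult[OF DERIV_cmult[OF DERIV_divide[OF dy(2) dy(1) n]] DERIV_mult[OF d\<phi> d\<phi>]]]) simp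
    from DERIV_diff[OF dK[of x] this] have
      "(G has_real_derivative ?g x - (c * ((Q x * y x / c * y x - y1 x * y1 x) / (y x * y x)) * (\<phi> x)\<^sup>2 + (2 * \<phi> x * \<phi>1 x) * (c * (y1 x / y x)))) (at x)"
      unfolding G_def .
    moreover have "?g x - (c * ((Q x * y x / c * y x - y1 x * y1 x) / (y x * y x)) * (\<phi> x)\<^sup>2 + (2 * \<phi> x * \<phi>1 x) * (c * (y1 x / y x)))
       = c * (\<phi>1 x - y1 x / y x * \<phi> x)\<^sup>2"
      using n c by (simp add: field_simps power2_eq_square)
    ultimately show ?thesis by simp
  qed
  have mono: "G s \<le> G t" if "p \<le> s" "s \<le> t" "t \<le> r" for s t
  proof (rule DERIV_nonneg_imp_increasing_open[OF that(2)])
    show "\<exists>D. (G has_real_derivative D) (at x) \<and> 0 \<le> D" if "s < x" "x < t" for x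
      using dG[of x] that \<open>p \<le> s\<close> \<open>t \<le> r\<close> c by (intro exI[of _ "c * (\<phi>1 x - y1 x / y x * \<phi> x)\<^sup>2"]) auto
  qed (rule G_cont, use that in auto)
  have ends': "G p = - B p" "G r = I - B r" using K(1) KI by (auto simp: G_def)
  show "B r - B p \<le> I" using mono[of p r] pr ends' by simp
  assume "I = B r - B p"
  then have "G r = G p" using ends' by simp
  then have Gc: "G x = G p" if "p \<le> x" "x \<le> r" for x
    using mono[of p x] mono[of x r] that by simp
  have zero: "\<phi>1 x * y x - \<phi> x * y1 x = 0" if x: "p < x" "x < r" for x
  proof -
    have "(G has_real_derivative 0) (at x)"
    proof (rule has_field_derivative_transform_within_open[OF DERIV_const[of "G p"] open_greaterThanLessThan])
      show "x \<in> {p<..<r}" using x by simp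
      show "G p = G t" if "t \<in> {p<..<r}" for t using Gc[of t] that by simp
    qed
    then have "c * (\<phi>1 x - y1 x / y x * \<phi> x)\<^sup>2 = 0" using dG[OF x] DERIV_unique by blast
    then have "\<phi>1 x = y1 x / y x * \<phi> x" using c by simp
    then show ?thesis using nz[OF x] by (simp add: field_simps)
  qed
  have dq: "((\<lambda>x. \<phi> x / y x) has_real_derivative 0) (at x)" if x: "p < x" "x < r" for x
    using DERIV_divide[OF d\<phi>[of x] dy(1)[of x] nz[OF x]] zero[OF x] by (simp add: mult.commute)
  define z where "z = (p + r) / 2"
  have z: "p < z" "z < r" using pr by (auto simp: z_def)
  have "\<phi> x / y x = \<phi> z / y z" if x: "p < x" "x < r" for x
    by (rule DERIV_isconst3[of p r x z "\<lambda>x. \<phi> x / y x"]) (use x z pr dq in auto)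
  then have "\<forall>x. p < x \<and> x < r \<longrightarrow> \<phi> x = (\<phi> z / y z) * y x" using nz by (metis nonzero_eq_divide_eq)
  then show "\<exists>k. \<forall>x. p < x \<and> x < r \<longrightarrow> \<phi> x = k * y x" by blast
qed

lemma integral_fold:
  fixes g :: "real \<Rightarrow> real"
  assumes g: "continuous_on UNIV g" and t: "t > 0"
  shows "integral {0..2 * t} g = integral {0..t} (\<lambda>x. g x + g (2 * t - x))"
proof -
  obtain G where G0: "G 0 = 0" and G: "\<And>x. (G has_real_derivative g x) (at x)"
    using continuous_antiderivative[OF g, of 0] unfolding has_real_derivative_iff_has_vector_derivative by metis
  have d: "((\<lambda>x. G x - G (2 * t - x)) has_real_derivative (g x + g (2 * t - x))) (at x)" for x
    using G by (auto intro!: derivative_eq_intros DERIV_chain2[OF G])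
  show ?thesis
    using integral_FTC[OF _ G, of 0 "2 * t"] integral_FTC[OF _ d, of 0 t] t by (simp add: G0)
qed

context wave begin

text \<open>On functions whose even part about \<open>\<tau>\<close> vanishes at the zero \<open>x0\<close> of the even kernel solution \<open>e0\<close>,
  the quadratic form of the linearised operator is nonnegative, with kernel spanned by \<open>u1\<close>.\<close>

lemma form_nonneg:
  assumes e: "\<And>x. (e0 has_real_derivative e1 x) (at x)" "\<And>x. (e1 has_real_derivative (q x * e0 x / c)) (at x)"
    "e0 0 = 1" "e1 0 = 0" "e1 \<tau> < 0"
  obtains x0 where "x0 \<in> {0<..<\<tau>}"
    "\<And>\<phi> \<phi>1. (\<And>x. (\<phi> has_real_derivative \<phi>1 x) (at x)) \<Longrightarrow> continuous_on UNIV \<phi>1 \<Longrightarrow>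
       (\<And>x. \<phi> (x + T) = \<phi> x) \<Longrightarrow> \<phi> x0 + \<phi> (T - x0) = 0 \<Longrightarrow>
       integral {0..T} (\<lambda>x. c * (\<phi>1 x)\<^sup>2 + q x * (\<phi> x)\<^sup>2) \<le> 0 \<Longrightarrow>
       integral {0..T} (\<lambda>x. c * (\<phi>1 x)\<^sup>2 + q x * (\<phi> x)\<^sup>2) = 0 \<and> (\<exists>k. \<forall>x. \<phi> x = k * u1 x)"
proof -
  have c0: "c > 0" using c by simp
  define \<kappa> where "\<kappa> = u2 0"
  have \<kappa>: "\<kappa> > 0" using u2_0 by (simp add: \<kappa>_def)
  have W: "e0 x * u2 x - e1 x * u1 x = \<kappa>" for x
    unfolding \<kappa>_def by (rule kernel_wronskian[OF e(1-4)])
  \<comment> \<open>At \<open>\<tau>\<close> the slope \<open>u1\<close> vanishes, so the Wronskian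
    fixes the sign of \<open>e0 \<tau>\<close>.\<close>
  have e\<tau>: "e0 \<tau> < 0"
  proof -
    have "e0 \<tau> * u2 \<tau> > 0" using W[of \<tau>] u1_tau \<kappa> by simp
    then show ?thesis using u2_tau by (simp add: zero_less_mult_iff)
  qed
  have ce: "continuous_on S e0" for S
    by (rule DERIV_continuous_on[OF has_field_derivative_at_within[OF e(1)]])
  have "\<exists>x\<ge>0. x \<le> \<tau> \<and> e0 x = 0"
    by (rule IVT2') (use e e\<tau> tau(1) ce in auto)
  then obtain x0 where x0: "0 \<le> x0" "x0 \<le> \<tau>" "e0 x0 = 0" by blast
  then have x0': "0 < x0" "x0 < \<tau>" using e e\<tau> by (auto simp: order_le_less)
  \<comment> \<open>By the Wronskian \<open>e0 / u1\<close> is strictly decreasing on the open half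
    period, so \<open>e0\<close> has at most one zero there.\<close>
  have uniq: "False" if "0 < s" "s < t" "t < \<tau>" "e0 s = 0" "e0 t = 0" for s t
  proof -
    have d: "((\<lambda>x. e0 x / u1 x) has_real_derivative (- \<kappa> / (u1 x * u1 x))) (at x)" if "s \<le> x" "x \<le> t" for x
    proof -
      have "u1 x \<noteq> 0" using u1_pos[of x] that \<open>0 < s\<close> \<open>t < \<tau>\<close> by simp
      have "e1 x * u1 x - e0 x * u2 x = - \<kappa>" using W[of x] by simp
      then show ?thesis using DERIV_divide[OF e(1)[of x] du1[of x] \<open>u1 x \<noteq> 0\<close>] by simp
    qed
    have "e0 s / u1 s > e0 t / u1 t"
    proof (rule DERIV_neg_imp_decreasing[OF that(2)])
      fix x assume x: "s \<le> x" "x \<le> t"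
      have "u1 x > 0" using u1_pos[of x] x that by simp
      then have "- \<kappa> / (u1 x * u1 x) < 0" using \<kappa> by simp
      then show "\<exists>D. ((\<lambda>x. e0 x / u1 x) has_real_derivative D) (at x) \<and> D < 0" using d[OF x] by blast
    qed
    then show False using that by simp
  qed
  have nz0: "e0 x \<noteq> 0" if "0 < x" "x < x0" for x using uniq[of x x0] that x0 x0' by auto
  have nz1: "e0 x \<noteq> 0" if "x0 < x" "x < \<tau>" for x using uniq[of x0 x] that x0 x0' by auto
  have e1x0: "e1 x0 \<noteq> 0" using W[of x0] x0 \<kappa> by auto
  show ?thesis
  proof (rule that[of x0])
    show "x0 \<in> {0<..<\<tau>}" using x0' by simp
    fix \<phi> \<phi>1
    assume d\<phi>: "\<And>x. (\<phi> has_real_derivative \<phi>1 x) (at x)" and c\<phi>1: "continuous_on UNIV \<phi>1"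
      and per: "\<And>x. \<phi> (x + T) = \<phi> x" and ev0: "\<phi> x0 + \<phi> (T - x0) = 0"
      and le: "integral {0..T} (\<lambda>x. c * (\<phi>1 x)\<^sup>2 + q x * (\<phi> x)\<^sup>2) \<le> 0"
    \<comment> \<open>Even and odd parts about \<open>\<tau>\<close>. The potential is even there,
      so the form splits and each part lives on half a period: the odd part vanishes at both ends
      like \<open>u1\<close>, the even part vanishes at \<open>x0\<close> like
      \<open>e0\<close>.\<close>
    define a0 where "a0 = (\<lambda>x. (\<phi> x + \<phi> (T - x)) / 2)"
    define a1 where "a1 = (\<lambda>x. (\<phi>1 x - \<phi>1 (T - x)) / 2)"
    define b0 where "b0 = (\<lambda>x. (\<phi> x - \<phi> (T - x)) / 2)"
    define b1 where "b1 = (\<lambda>x. (\<phi>1 x + \<phi>1 (T - x)) / 2)"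
    have d: "((\<lambda>x. \<phi> (T - x)) has_real_derivative - \<phi>1 (T - x)) (at x)" for x
    proof -
      have "((\<lambda>x. T - x) has_real_derivative - 1) (at x)" by (auto intro!: derivative_eq_intros)
      from DERIV_chain2[OF d\<phi> this] show ?thesis by simp
    qed
    have da: "(a0 has_real_derivative a1 x) (at x)" for x
      unfolding a0_def a1_def by (rule DERIV_cong[OF DERIV_cdivide[OF DERIV_add[OF d\<phi> d]]]) simp
    have db: "(b0 has_real_derivative b1 x) (at x)" for x
      unfolding b0_def b1_def by (rule DERIV_cong[OF DERIV_cdivide[OF DERIV_diff[OF d\<phi> d]]]) simp
    have c\<phi>1': "continuous_on UNIV (\<lambda>x. \<phi>1 (T - x))"
      by (rule continuous_on_compose2[OF c\<phi>1]) (auto intro!: continuous_intros)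
    have ca: "continuous_on UNIV a1" "continuous_on UNIV b1"
      unfolding a1_def b1_def by (auto intro!: continuous_intros c\<phi>1 c\<phi>1')
    have ca0: "continuous_on UNIV a0" "continuous_on UNIV b0" "continuous_on UNIV \<phi>"
      by (rule DERIV_continuous_on[OF has_field_derivative_at_within[OF da]]
        DERIV_continuous_on[OF has_field_derivative_at_within[OF db]]
        DERIV_continuous_on[OF has_field_derivative_at_within[OF d\<phi>]])+
    let ?fa = "\<lambda>x. c * (a1 x)\<^sup>2 + q x * (a0 x)\<^sup>2" and ?fb = "\<lambda>x. c * (b1 x)\<^sup>2 + q x * (b0 x)\<^sup>2"
    have cf: "continuous_on UNIV ?fa" "continuous_on UNIV ?fb" "continuous_on UNIV (\<lambda>x. c * (\<phi>1 x)\<^sup>2 + q x * (\<phi> x)\<^sup>2)"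
      by (intro continuous_intros ca ca0 continuous_q c\<phi>1)+
    have int: "g integrable_on {s..t}" if "continuous_on UNIV g" for g :: "real \<Rightarrow> real" and s t
      using that continuous_on_subset integrable_continuous_real by blast
    have total: "integral {0..T} (\<lambda>x. c * (\<phi>1 x)\<^sup>2 + q x * (\<phi> x)\<^sup>2) = 2 * (integral {0..\<tau>} ?fa + integral {0..\<tau>} ?fb)"
    proof -
      have "integral {0..T} (\<lambda>x. c * (\<phi>1 x)\<^sup>2 + q x * (\<phi> x)\<^sup>2) =
         integral {0..\<tau>} (\<lambda>x. (c * (\<phi>1 x)\<^sup>2 + q x * (\<phi> x)\<^sup>2) + (c * (\<phi>1 (T - x))\<^sup>2 + q (T - x) * (\<phi> (T - x))\<^sup>2))"
        using integral_fold[OF cf(3) tau(1)] by (simp add: T_def)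
      also have "\<dots> = integral {0..\<tau>} (\<lambda>x. 2 * (?fa x + ?fb x))"
        by (rule integral_cong) (simp add: a0_def a1_def b0_def b1_def q_refl power2_eq_square field_simps)
      also have "\<dots> = 2 * (integral {0..\<tau>} ?fa + integral {0..\<tau>} ?fb)"
        by (simp only: integral_mult_right integral_add[OF int[OF cf(1)] int[OF cf(2)]])
      finally show ?thesis .
    qed
    have split: "integral {0..\<tau>} ?fa = integral {0..x0} ?fa + integral {x0..\<tau>} ?fa"
      using Henstock_Kurzweil_Integration.integral_combine[of 0 x0 \<tau> ?fa] int[OF cf(1)] x0' by simp
    have a0x0: "a0 x0 = 0" using ev0 by (simp add: a0_def)
    have "\<phi> T = \<phi> 0" using per[of 0] by simp
    then have b00: "b0 0 = 0" by (simp add: b0_def)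
    have b0\<tau>: "b0 \<tau> = 0" by (simp add: b0_def T_def)
    have ends1: "e0 x \<noteq> 0 \<or> a0 x = 0 \<and> e1 x \<noteq> 0" if "x \<in> {0, x0}" for x
      using that e(3) a0x0 e1x0 by auto
    note P1 = Picone[OF x0'(1) c0 e(1,2) da ca(1) continuous_q nz0 ends1]
    have ends2: "e0 x \<noteq> 0 \<or> a0 x = 0 \<and> e1 x \<noteq> 0" if "x \<in> {x0, \<tau>}" for x
      using that e\<tau> a0x0 e1x0 by auto
    note P2 = Picone[OF x0'(2) c0 e(1,2) da ca(1) continuous_q nz1 ends2]
    have u1nz: "u1 x \<noteq> 0" if "0 < x" "x < \<tau>" for x using u1_pos[OF that] by simp
    have ends3: "u1 x \<noteq> 0 \<or> b0 x = 0 \<and> u2 x \<noteq> 0" if "x \<in> {0, \<tau>}" for x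
      using that b00 b0\<tau> u2_0 u2_tau by auto
    note P3 = Picone[OF tau(1) c0 du1 du2 db ca(2) continuous_q u1nz ends3]
    have I1: "0 \<le> integral {0..x0} ?fa" "integral {0..x0} ?fa = 0 \<Longrightarrow> \<exists>k. \<forall>x. 0 < x \<and> x < x0 \<longrightarrow> a0 x = k * e0 x"
      using P1 e(4) x0(3) by simp_all
    \<comment> \<open>The only surviving boundary term; its sign is where
      \<open>e1 \<tau> < 0\<close> enters.\<close>
    have B\<tau>: "0 \<le> c * (e1 \<tau> / e0 \<tau>) * (a0 \<tau>)\<^sup>2"
      using c0 e(5) e\<tau> by (intro mult_nonneg_nonneg divide_nonpos_neg) auto
    have I2: "c * (e1 \<tau> / e0 \<tau>) * (a0 \<tau>)\<^sup>2 \<le> integral {x0..\<tau>} ?fa"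
      "integral {x0..\<tau>} ?fa = c * (e1 \<tau> / e0 \<tau>) * (a0 \<tau>)\<^sup>2 \<Longrightarrow> \<exists>k. \<forall>x. x0 < x \<and> x < \<tau> \<longrightarrow> a0 x = k * e0 x"
      using P2 x0(3) by simp_all
    have I3: "0 \<le> integral {0..\<tau>} ?fb" "integral {0..\<tau>} ?fb = 0 \<Longrightarrow> \<exists>k. \<forall>x. 0 < x \<and> x < \<tau> \<longrightarrow> b0 x = k * u1 x"
      using P3 u1_0 u1_tau by simp_all
    have sum: "integral {0..x0} ?fa + integral {x0..\<tau>} ?fa + integral {0..\<tau>} ?fb \<le> 0"
      using le unfolding total split by simp
    have zero: "integral {0..x0} ?fa = 0" "integral {x0..\<tau>} ?fa = c * (e1 \<tau> / e0 \<tau>) * (a0 \<tau>)\<^sup>2"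
      "c * (e1 \<tau> / e0 \<tau>) * (a0 \<tau>)\<^sup>2 = 0" "integral {0..\<tau>} ?fb = 0"
    proof -
      have nonneg: "A = 0" "B = b" "b = 0" "C = 0" if "A + B + C \<le> 0" "0 \<le> A" "b \<le> B" "0 \<le> b" "0 \<le> C" for A B C b :: real
        using that by auto
      note * = nonneg[OF sum I1(1) I2(1) B\<tau> I3(1)]
      show "integral {0..x0} ?fa = 0" by (rule *(1))
      show "integral {x0..\<tau>} ?fa = c * (e1 \<tau> / e0 \<tau>) * (a0 \<tau>)\<^sup>2" by (rule *(2))
      show "c * (e1 \<tau> / e0 \<tau>) * (a0 \<tau>)\<^sup>2 = 0" by (rule *(3))
      show "integral {0..\<tau>} ?fb = 0" by (rule *(4))
    qed
    have lim_eq: "g z = h z" if "\<And>x. x \<in> {s<..<t} \<Longrightarrow> g x = h x" "s < t" "z \<in> {s..t}" "continuous_on UNIV g" "continuous_on UNIV h"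
      for g h :: "real \<Rightarrow> real" and s t z
    proof -
      have cl: "closure {s<..<t} = {s..t}" using that(2) by simp
      have "continuous_on {s..t} (\<lambda>x. g x - h x)"
        by (intro continuous_intros continuous_on_subset[OF that(4)] continuous_on_subset[OF that(5)]) auto
      then have "g z - h z = 0"
        unfolding cl[symmetric]
        by (rule continuous_constant_on_closure) (use that(1,3) cl in auto)
      then show ?thesis by simp
    qed
    \<comment> \<open>On either side of \<open>x0\<close> the even part is a multiple of
      \<open>e0\<close>, with constants that need not agree a priori. The boundary term gives
      \<open>a0 \<tau> = 0\<close>, hence \<open>k2 = 0\<close>; continuity of the derivative at the
      simple zero \<open>x0\<close> then gives \<open>k1 = 0\<close>.\<close>
    obtain k2 where k2: "\<And>x. x0 < x \<Longrightarrow> x < \<tau> \<Longrightarrow> a0 x = k2 * e0 x" using I2(2)[OF zero(2)] by blast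
    have "a0 \<tau> = k2 * e0 \<tau>"
      by (rule lim_eq[of x0 \<tau>]) (use k2 x0' ca0 ce in \<open>auto intro!: continuous_intros\<close>)
    moreover have "a0 \<tau> = 0" using zero(3) c0 e(5) e\<tau> by simp
    ultimately have "k2 = 0" using e\<tau> by simp
    then have a2: "a0 x = 0" if "x0 < x" "x < \<tau>" for x using k2 that by simp
    have a1z: "a1 x = 0" if "x \<in> {x0<..<\<tau>}" for x
    proof -
      have "(a0 has_real_derivative 0) (at x)"
        by (rule has_field_derivative_transform_within_open[OF DERIV_const[of 0] open_greaterThanLessThan that])
          (simp add: a2)
      then show ?thesis using da DERIV_unique by blast
    qed
    have "a1 x0 = 0"
      by (rule lim_eq[of x0 \<tau> a1 "\<lambda>x. 0"]) (use a1z x0' ca in auto)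
    obtain k1 where k1: "\<And>x. 0 < x \<Longrightarrow> x < x0 \<Longrightarrow> a0 x = k1 * e0 x" using I1(2)[OF zero(1)] by blast
    have a1k: "a1 x = k1 * e1 x" if "x \<in> {0<..<x0}" for x
    proof -
      have "(a0 has_real_derivative k1 * e1 x) (at x)"
        by (rule has_field_derivative_transform_within_open[OF DERIV_cmult[OF e(1)] open_greaterThanLessThan that])
          (simp add: k1)
      then show ?thesis using da DERIV_unique by blast
    qed
    have ce1: "continuous_on UNIV e1" by (rule DERIV_continuous_on[OF has_field_derivative_at_within[OF e(2)]])
    have "a1 x0 = k1 * e1 x0"
      by (rule lim_eq[of 0 x0 a1 "\<lambda>x. k1 * e1 x"]) (use a1k x0' ca ce1 in \<open>auto intro!: continuous_intros\<close>)
    then have "k1 = 0" using \<open>a1 x0 = 0\<close> e1x0 by simp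
    then have a0z: "a0 x = 0" if "0 < x" "x < \<tau>" for x
      using k1[of x] a2[of x] a0x0 that by (cases x x0 rule: linorder_cases) auto
    obtain k where k: "\<And>x. 0 < x \<Longrightarrow> x < \<tau> \<Longrightarrow> b0 x = k * u1 x" using I3(2)[OF zero(4)] by blast
    have 1: "\<phi> x = k * u1 x" if "x \<in> {0<..<\<tau>}" for x
    proof -
      have "\<phi> x = a0 x + b0 x" by (simp add: a0_def b0_def field_simps)
      then show ?thesis using a0z[of x] k[of x] that by simp
    qed
    have 2: "\<phi> x = k * u1 x" if "x \<in> {\<tau><..<T}" for x
    proof -
      have "\<phi> x = a0 (T - x) - b0 (T - x)" by (simp add: a0_def b0_def field_simps)
      then show ?thesis using a0z[of "T - x"] k[of "T - x"] that u1_refl[of x] by (simp add: T_def)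
    qed
    have cu: "continuous_on UNIV (\<lambda>x. k * u1 x)" by (intro continuous_intros continuous_u1)
    have "\<phi> x = k * u1 x" if "x \<in> {0..\<tau>}" for x
      by (rule lim_eq[OF 1 tau(1) that ca0(3) cu])
    moreover have "\<phi> x = k * u1 x" if "x \<in> {\<tau>..T}" for x
      by (rule lim_eq[OF 2 _ that ca0(3) cu]) (use tau(1) T_def in auto)
    ultimately have "\<phi> x - k * u1 x = 0" if "x \<in> {0..T}" for x using that by (cases "x \<le> \<tau>") auto
    then have "\<phi> x - k * u1 x = 0" for x
      by (rule periodic_eq_0[OF T_pos, rotated]) (simp_all add: per u1_T)
    then have "\<forall>x. \<phi> x = k * u1 x" by simp
    moreover have "integral {0..T} (\<lambda>x. c * (\<phi>1 x)\<^sup>2 + q x * (\<phi> x)\<^sup>2) = 0"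
      unfolding total split using zero by simp
    ultimately show "integral {0..T} (\<lambda>x. c * (\<phi>1 x)\<^sup>2 + q x * (\<phi> x)\<^sup>2) = 0 \<and> (\<exists>k. \<forall>x. \<phi> x = k * u1 x)" by blast
  qed
qed

end

section \<open>Low frequencies\<close>

lemma det_vector3:
  "det (vector [vector [x1, x2, x3], vector [y1, y2, y3], vector [z1, z2, z3]] :: 'a::comm_ring_1^3^3) =
     x1 * y2 * z3 + x2 * y3 * z1 + x3 * y1 * z2 - x1 * y3 * z2 - x2 * y1 * z3 - x3 * y2 * z1"
  by (simp add: det_3 vector_3)

context wave begin

text \<open>The velocity of a curve of waves in the direction \<open>(al, et, ga)\<close>, detached
  from the curve: L \<phi> = - (al + ga (u - u_xx)). The closing condition at \<open>T\<close> is
  recorded too; for curves of waves it comes from differentiating across the period.\<close>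

definition tangent :: "real \<Rightarrow> real \<Rightarrow> real \<Rightarrow> (real \<Rightarrow> real) \<Rightarrow> (real \<Rightarrow> real) \<Rightarrow> bool" where
  "tangent al et ga \<phi> \<phi>1 \<longleftrightarrow> (\<forall>x. (\<phi> has_real_derivative \<phi>1 x) (at x)) \<and>
     (\<forall>x. (\<phi>1 has_real_derivative ((q x * \<phi> x + al + ga * (u x - u2 x)) / c)) (at x)) \<and>
     \<phi> 0 = (et + al * um + ga * um\<^sup>2 / 2) / (f um - (c - 1) * um - a) \<and> \<phi>1 0 = 0 \<and> \<phi> T = \<phi> 0"

definition "second al ga \<phi> x = (q x * \<phi> x + al + ga * (u x - u2 x)) / c"

text \<open>Derivatives of period, mass and momentum read off from the velocity alone; the jump of
  \<open>\<phi>1\<close> over a period supplies the first.\<close>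

definition "dT_of \<phi>1 = - \<phi>1 T / u2 0"
definition "dM_of \<phi> \<phi>1 = integral {0..T} \<phi> + um * dT_of \<phi>1"
definition "dP_of \<phi> \<phi>1 = integral {0..T} (\<lambda>x. u x * \<phi> x + u1 x * \<phi>1 x) + um\<^sup>2 / 2 * dT_of \<phi>1"

lemma tangentD:
  assumes "tangent al et ga \<phi> \<phi>1"
  shows "(\<phi> has_real_derivative \<phi>1 x) (at x)"
    "(\<phi>1 has_real_derivative ((q x * \<phi> x + al + ga * (u x - u2 x)) / c)) (at x)"
    "\<phi> 0 = (et + al * um + ga * um\<^sup>2 / 2) / (f um - (c - 1) * um - a)" "\<phi>1 0 = 0" "\<phi> T = \<phi> 0"
    "\<phi>1 T = - u2 0 * dT_of \<phi>1" "continuous_on S \<phi>" "continuous_on S \<phi>1"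
proof -
  show d: "(\<phi> has_real_derivative \<phi>1 x) (at x)"
    "(\<phi>1 has_real_derivative ((q x * \<phi> x + al + ga * (u x - u2 x)) / c)) (at x)" for x
    using assms unfolding tangent_def by blast+
  show "\<phi> 0 = (et + al * um + ga * um\<^sup>2 / 2) / (f um - (c - 1) * um - a)" "\<phi>1 0 = 0" "\<phi> T = \<phi> 0"
    using assms unfolding tangent_def by blast+
  show "\<phi>1 T = - u2 0 * dT_of \<phi>1" using u2_0 by (simp add: dT_of_def)
  show "continuous_on S \<phi>" "continuous_on S \<phi>1"
    by (rule DERIV_continuous_on[OF has_field_derivative_at_within[OF d(1)]]
        DERIV_continuous_on[OF has_field_derivative_at_within[OF d(2)]])+
qed

text \<open>Pairings of v - v_xx with 1 and with \<open>u\<close>. Since (L v)_x is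
  \<open>\<mu>\<close> times this expression, they govern the increments of a solution over a
  period.\<close>

definition "mass_defect v0 v2 = integral {0..T} (\<lambda>x. v0 x - v2 x :: complex)"
definition "momentum_defect v0 v2 = integral {0..T} (\<lambda>x. of_real (u x) * (v0 x - v2 x) :: complex)"

lemma u2_T0: "u T = um" "u1 T = 0" "u2 T = u2 0" "q T = q 0"
  using u_T[of 0] u1_T[of 0] u2_T[of 0] q_T[of 0] u_0 u1_0 by auto

lemma complex_derivs:
  "((\<lambda>x. complex_of_real (u x)) has_vector_derivative of_real (u1 x)) (at x)"
  "((\<lambda>x. complex_of_real (u1 x)) has_vector_derivative of_real (u2 x)) (at x)"
  "((\<lambda>x. complex_of_real (u2 x)) has_vector_derivative of_real (q x * u1 x / c)) (at x)"
  by (rule has_vector_derivative_of_real[OF du] has_vector_derivative_of_real[OF du1]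
      has_vector_derivative_of_real[OF du2])+

text \<open>The first identity integrates (L v)_x = \<mu> (v - v_xx). For the second,
  \<open>u\<close> times this equation is integrated by parts; the leftover u_x L v is exact because
  \<open>u1\<close> is in the kernel of L, and as \<open>u1\<close> vanishes at both ends only the
  term with \<open>u2 0\<close> survives.\<close>

lemma third_sol_increments:
  assumes s: "third_sol \<mu> v0 v1 v2"
  shows "\<mu> * mass_defect v0 v2 = (- of_real c * v2 T + of_real (q 0) * v0 T) - (- of_real c * v2 0 + of_real (q 0) * v0 0)"
    "of_real (c * u2 0) * (v0 T - v0 0) = \<mu> * (of_real um * mass_defect v0 v2 - momentum_defect v0 v2)"
proof -
  let ?L = "\<lambda>x. - of_real c * v2 x + of_real (q x) * v0 x"
  have L: "(?L has_vector_derivative \<mu> * (v0 x - v2 x)) (at x)" for x by (rule third_sol_L_deriv[OF s])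
  have d: "(v0 has_vector_derivative v1 x) (at x)" "(v1 has_vector_derivative v2 x) (at x)" for x
    using s unfolding third_sol_def by blast+
  note cont = third_sol_continuous[OF s, of "{0..T}"]
  have T0: "0 \<le> T" using T_pos by simp
  have "((\<lambda>x. \<mu> * (v0 x - v2 x)) has_integral (?L T - ?L 0)) {0..T}"
    by (rule fundamental_theorem_of_calculus[OF T0]) (rule has_vector_derivative_at_within[OF L])
  then have "integral {0..T} (\<lambda>x. \<mu> * (v0 x - v2 x)) = ?L T - ?L 0" by (rule integral_unique)
  then show 1: "\<mu> * mass_defect v0 v2 = (- of_real c * v2 T + of_real (q 0) * v0 T) - (- of_real c * v2 0 + of_real (q 0) * v0 0)"
    by (simp add: mass_defect_def u2_T0)
  let ?G = "\<lambda>x. of_real (u x) * ?L x - (- of_real c * (of_real (u1 x) * v1 x) + of_real c * (of_real (u2 x) * v0 x))"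
  have h: "(?G has_vector_derivative ((of_real (u x) * (\<mu> * (v0 x - v2 x)) + of_real (u1 x) * ?L x) -
      (- of_real c * (of_real (u1 x) * v2 x + of_real (u2 x) * v1 x) + of_real c * (of_real (u2 x) * v1 x + of_real (q x * u1 x / c) * v0 x)))) (at x)" for x
    by (intro has_vector_derivative_diff has_vector_derivative_add has_vector_derivative_mult_right
        has_vector_derivative_mult complex_derivs L d)
  have eq: "(of_real (u x) * (\<mu> * (v0 x - v2 x)) + of_real (u1 x) * ?L x) -
      (- of_real c * (of_real (u1 x) * v2 x + of_real (u2 x) * v1 x) + of_real c * (of_real (u2 x) * v1 x + of_real (q x * u1 x / c) * v0 x))
    = \<mu> * (of_real (u x) * (v0 x - v2 x))" for x using c by (simp add: algebra_simps)
  have G: "(?G has_vector_derivative \<mu> * (of_real (u x) * (v0 x - v2 x))) (at x)" for x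
    using h[of x] unfolding eq .
  have "((\<lambda>x. \<mu> * (of_real (u x) * (v0 x - v2 x))) has_integral (?G T - ?G 0)) {0..T}"
    by (rule fundamental_theorem_of_calculus[OF T0]) (rule has_vector_derivative_at_within[OF G])
  then have "integral {0..T} (\<lambda>x. \<mu> * (of_real (u x) * (v0 x - v2 x))) = ?G T - ?G 0" by (rule integral_unique)
  then have 2: "\<mu> * momentum_defect v0 v2 = ?G T - ?G 0" by (simp add: momentum_defect_def)
  have "\<mu> * (of_real um * mass_defect v0 v2 - momentum_defect v0 v2) = of_real um * (\<mu> * mass_defect v0 v2) - \<mu> * momentum_defect v0 v2"
    by (simp add: algebra_simps)
  also have "\<dots> = of_real (c * u2 0) * (v0 T - v0 0)"
    unfolding 1 2 by (simp add: u2_T0 u_0 u1_0 algebra_simps)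
  finally show "of_real (c * u2 0) * (v0 T - v0 0) = \<mu> * (of_real um * mass_defect v0 v2 - momentum_defect v0 v2)" by simp
qed

end

section \<open>The Evans determinant in a basis of solutions and its leading term at the
  origin\<close>

context wave_evans begin

text \<open>Multiplying \<open>\<Phi> T - 1\<close> by the matrix of initial data gives the
  increments over a period. By \<open>third_sol_increments\<close> and row operations the rows of v
  and v_xx become, up to constants, \<open>\<mu>\<close> times the rows \<open>B\<close> and
  \<open>A\<close>; this extracts \<open>\<mu>\<^sup>2\<close>. The row of v_x stays as it
  is.\<close>

lemma evans_D_det:
  assumes s: "\<And>j. third_sol \<mu> (v0 j) (v1 j) (v2 j)"
  defines "A \<equiv> \<lambda>j::3. mass_defect (v0 j) (v2 j)" and "B \<equiv> \<lambda>j. momentum_defect (v0 j) (v2 j)" and "C \<equiv> \<lambda>j. v1 j T - v1 j 0"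
  shows "evans_D \<Phi> T \<mu> 1 * det (vector [vector [v0 1 0, v0 2 0, v0 3 0], vector [v1 1 0, v1 2 0, v1 3 0],
       vector [v2 1 0, v2 2 0, v2 3 0]] :: complex^3^3) * of_real (c\<^sup>2 * u2 0) =
     \<mu>\<^sup>2 * det (vector [vector [B 1, B 2, B 3], vector [C 1, C 2, C 3], vector [A 1, A 2, A 3]] :: complex^3^3)"
proof -
  let ?W = "vector [vector [v0 1 0, v0 2 0, v0 3 0], vector [v1 1 0, v1 2 0, v1 3 0],
       vector [v2 1 0, v2 2 0, v2 3 0]] :: complex^3^3"
  define x where "x = (\<lambda>j. v0 j T - v0 j 0)"
  define z where "z = (\<lambda>j. v2 j T - v2 j 0)"
  have prod: "(\<Phi> T \<mu> - mat 1) ** ?W = vector [vector [x 1, x 2, x 3], vector [C 1, C 2, C 3], vector [z 1, z 2, z 3]]"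
  proof -
    have col: "vector [v0 j T, v1 j T, v2 j T] = \<Phi> T \<mu> *v vector [v0 j 0, v1 j 0, v2 j 0]" for j
      by (rule third_sol_Phi[OF s])
    have "(\<Phi> T \<mu> - mat 1) *v vector [v0 j 0, v1 j 0, v2 j 0] = vector [x j, C j, z j]" for j
      unfolding matrix_vector_mult_diff_rdistrib col[symmetric] matrix_vector_mul_lid
      by (simp add: vec_eq_iff forall_3 vector_3 x_def C_def z_def)
    then have "((\<Phi> T \<mu> - mat 1) *v vector [v0 j 0, v1 j 0, v2 j 0]) $ i = vector [x j, C j, z j] $ i" for i j by simp
    then show ?thesis
      by (simp add: vec_eq_iff forall_3 vector_3 matrix_vector_mult_def matrix_matrix_mult_def sum_3)
  qed
  have D: "evans_D \<Phi> T \<mu> 1 * det ?W = det (vector [vector [x 1, x 2, x 3], vector [C 1, C 2, C 3], vector [z 1, z 2, z 3]] :: complex^3^3)"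
    unfolding evans_D_def det_mul[symmetric] prod ..
  define k where "k = complex_of_real (u2 0)"
  define c' where "c' = complex_of_real c"
  define qq where "qq = complex_of_real (q 0)"
  have k: "k \<noteq> 0" "c' \<noteq> 0" using u2_0 c by (auto simp: k_def c'_def)
  have xx: "x j = \<mu> * (of_real um * A j - B j) / (c' * k)" for j
    using third_sol_increments(2)[OF s, of j] k by (simp add: x_def A_def B_def k_def c'_def field_simps)
  have zz: "z j = (qq * x j - \<mu> * A j) / c'" for j
    using third_sol_increments(1)[OF s, of j] k unfolding x_def z_def A_def qq_def c'_def
    by (simp add: field_simps)
  have row: "det (vector [vector [x 1, x 2, x 3], vector [C 1, C 2, C 3], vector [z 1, z 2, z 3]] :: complex^3^3) * c' =
     - \<mu> * det (vector [vector [x 1, x 2, x 3], vector [C 1, C 2, C 3], vector [A 1, A 2, A 3]] :: complex^3^3)"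
  proof -
    have z': "z j * c' = qq * x j - \<mu> * A j" for j unfolding zz using k by simp
    have "det (vector [vector [x 1, x 2, x 3], vector [C 1, C 2, C 3], vector [z 1, z 2, z 3]] :: complex^3^3) * c' =
      x 1 * C 2 * (z 3 * c') + x 2 * C 3 * (z 1 * c') + x 3 * C 1 * (z 2 * c') - x 1 * C 3 * (z 2 * c') - x 2 * C 1 * (z 3 * c') - x 3 * C 2 * (z 1 * c')"
      unfolding det_vector3 by (simp add: algebra_simps)
    also have "\<dots> = - \<mu> * det (vector [vector [x 1, x 2, x 3], vector [C 1, C 2, C 3], vector [A 1, A 2, A 3]] :: complex^3^3)"
      unfolding z' det_vector3 by (simp add: algebra_simps)
    finally show ?thesis .
  qed
  have row2: "det (vector [vector [x 1, x 2, x 3], vector [C 1, C 2, C 3], vector [A 1, A 2, A 3]] :: complex^3^3) * (c' * k) =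
     - \<mu> * det (vector [vector [B 1, B 2, B 3], vector [C 1, C 2, C 3], vector [A 1, A 2, A 3]] :: complex^3^3)"
  proof -
    have x': "x j * (c' * k) = \<mu> * (of_real um * A j - B j)" for j unfolding xx using k by simp
    have "det (vector [vector [x 1, x 2, x 3], vector [C 1, C 2, C 3], vector [A 1, A 2, A 3]] :: complex^3^3) * (c' * k) =
      (x 1 * (c' * k)) * C 2 * A 3 + (x 2 * (c' * k)) * C 3 * A 1 + (x 3 * (c' * k)) * C 1 * A 2
      - (x 1 * (c' * k)) * C 3 * A 2 - (x 2 * (c' * k)) * C 1 * A 3 - (x 3 * (c' * k)) * C 2 * A 1"
      unfolding det_vector3 by (simp add: algebra_simps)
    also have "\<dots> = - \<mu> * det (vector [vector [B 1, B 2, B 3], vector [C 1, C 2, C 3], vector [A 1, A 2, A 3]] :: complex^3^3)"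
      unfolding x' det_vector3 by (simp add: algebra_simps)
    finally show ?thesis .
  qed
  have "evans_D \<Phi> T \<mu> 1 * det ?W * of_real (c\<^sup>2 * u2 0) =
     det (vector [vector [x 1, x 2, x 3], vector [C 1, C 2, C 3], vector [z 1, z 2, z 3]] :: complex^3^3) * c' * (c' * k)"
    unfolding D by (simp add: c'_def k_def power2_eq_square)
  also have "\<dots> = - \<mu> * (det (vector [vector [x 1, x 2, x 3], vector [C 1, C 2, C 3], vector [A 1, A 2, A 3]] :: complex^3^3) * (c' * k))"
    unfolding row by simp
  also have "\<dots> = \<mu>\<^sup>2 * det (vector [vector [B 1, B 2, B 3], vector [C 1, C 2, C 3], vector [A 1, A 2, A 3]] :: complex^3^3)"
    unfolding row2 by (simp add: power2_eq_square)
  finally show ?thesis .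
qed

lemma low_frequency_bound:
  fixes g0 g1 g2 h :: "real \<Rightarrow> complex"
  assumes g: "\<And>x. (g0 has_vector_derivative g1 x) (at x)" "\<And>x. (g1 has_vector_derivative g2 x) (at x)"
    "\<And>x. (g2 has_vector_derivative (third_rhs 0 x (g0 x) (g1 x) (g2 x) + h x)) (at x)"
  obtains K where "K \<ge> 0"
    "\<And>\<mu> s0 s1 s2 x. cmod \<mu> \<le> 1 \<Longrightarrow> (\<And>x. (s0 has_vector_derivative s1 x) (at x)) \<Longrightarrow> (\<And>x. (s1 has_vector_derivative s2 x) (at x)) \<Longrightarrow>
      (\<And>x. (s2 has_vector_derivative (third_rhs \<mu> x (s0 x) (s1 x) (s2 x) + h x)) (at x)) \<Longrightarrow>
      s0 0 = g0 0 \<Longrightarrow> s1 0 = g1 0 \<Longrightarrow> s2 0 = g2 0 \<Longrightarrow> 0 \<le> x \<Longrightarrow> x \<le> T \<Longrightarrow>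
      cmod (s0 x - g0 x) \<le> K * cmod \<mu> \<and> cmod (s1 x - g1 x) \<le> K * cmod \<mu> \<and> cmod (s2 x - g2 x) \<le> K * cmod \<mu>"
proof -
  obtain C where C: "C > 0"
    "\<And>\<mu> v0 v1 v2 e \<epsilon> x. cmod \<mu> \<le> 1 \<Longrightarrow> (\<And>x. (v0 has_vector_derivative v1 x) (at x)) \<Longrightarrow>
       (\<And>x. (v1 has_vector_derivative v2 x) (at x)) \<Longrightarrow>
       (\<And>x. (v2 has_vector_derivative (third_rhs \<mu> x (v0 x) (v1 x) (v2 x) + e x)) (at x)) \<Longrightarrow>
       (\<And>x. 0 \<le> x \<Longrightarrow> x \<le> T \<Longrightarrow> cmod (e x) \<le> \<epsilon>) \<Longrightarrow> 0 \<le> \<epsilon> \<Longrightarrow> 0 \<le> x \<Longrightarrow> x \<le> T \<Longrightarrow>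
       cmod (v0 x) \<le> C * (cmod (v0 0) + cmod (v1 0) + cmod (v2 0) + \<epsilon>) \<and>
       cmod (v1 x) \<le> C * (cmod (v0 0) + cmod (v1 0) + cmod (v2 0) + \<epsilon>) \<and>
       cmod (v2 x) \<le> C * (cmod (v0 0) + cmod (v1 0) + cmod (v2 0) + \<epsilon>)"
    by (rule evans_gronwall[of 1 T]) blast
  have "continuous_on {0..T} g0" "continuous_on {0..T} g2"
    by (intro continuous_at_imp_continuous_on ballI has_vector_derivative_continuous[OF g(1)]
        has_vector_derivative_continuous[OF g(3)])+
  then have "bounded ((\<lambda>x. g2 x - g0 x) ` {0..T})"
    by (intro compact_imp_bounded compact_continuous_image continuous_intros) auto
  then obtain B where B: "\<And>x. x \<in> {0..T} \<Longrightarrow> cmod (g2 x - g0 x) \<le> B" unfolding bounded_iff by blast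
  have B0: "B \<ge> 0" using B[of 0] T_pos norm_ge_zero[of "g2 0 - g0 0"] by (meson atLeastAtMost_iff less_imp_le order_refl order_trans)
  show ?thesis
  proof (rule that[of "C * B"])
    show "0 \<le> C * B" using C(1) B0 by simp
    fix \<mu> :: complex and s0 s1 s2 :: "real \<Rightarrow> complex" and x :: real
    assume \<mu>: "cmod \<mu> \<le> 1" and s: "\<And>x. (s0 has_vector_derivative s1 x) (at x)" "\<And>x. (s1 has_vector_derivative s2 x) (at x)"
      "\<And>x. (s2 has_vector_derivative (third_rhs \<mu> x (s0 x) (s1 x) (s2 x) + h x)) (at x)"
      and i: "s0 0 = g0 0" "s1 0 = g1 0" "s2 0 = g2 0" and x: "0 \<le> x" "x \<le> T"
    let ?e = "\<lambda>x. \<mu> * (g2 x - g0 x) / of_real c"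
    have d: "((\<lambda>x. s0 x - g0 x) has_vector_derivative s1 x - g1 x) (at x)"
      "((\<lambda>x. s1 x - g1 x) has_vector_derivative s2 x - g2 x) (at x)" for x
      by (intro has_vector_derivative_diff s g)+
    have eq: "(third_rhs \<mu> x (s0 x) (s1 x) (s2 x) + h x) - (third_rhs 0 x (g0 x) (g1 x) (g2 x) + h x) =
       third_rhs \<mu> x (s0 x - g0 x) (s1 x - g1 x) (s2 x - g2 x) + ?e x" for x
    proof -
      have "third_rhs \<mu> x (g0 x) (g1 x) (g2 x) = third_rhs 0 x (g0 x) (g1 x) (g2 x) + ?e x"
        using c by (simp add: third_rhs_def field_simps)
      then show ?thesis unfolding third_rhs_diff by simp
    qed
    have d3: "((\<lambda>x. s2 x - g2 x) has_vector_derivative third_rhs \<mu> x (s0 x - g0 x) (s1 x - g1 x) (s2 x - g2 x) + ?e x) (at x)" for x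
      using has_vector_derivative_diff[OF s(3)[of x] g(3)[of x]] unfolding eq .
    have e: "cmod (?e x) \<le> cmod \<mu> * B" if "0 \<le> x" "x \<le> T" for x
    proof -
      have "cmod (?e x) = cmod \<mu> * cmod (g2 x - g0 x) / c" using c by (simp add: norm_mult norm_divide)
      also have "\<dots> \<le> cmod \<mu> * cmod (g2 x - g0 x) / 1" using c by (intro divide_left_mono) auto
      also have "\<dots> \<le> cmod \<mu> * B" unfolding div_by_1 using B[of x] that by (intro mult_left_mono) auto
      finally show ?thesis .
    qed
    show "cmod (s0 x - g0 x) \<le> C * B * cmod \<mu> \<and> cmod (s1 x - g1 x) \<le> C * B * cmod \<mu> \<and> cmod (s2 x - g2 x) \<le> C * B * cmod \<mu>"
      using C(2)[OF \<mu> d d3 e _ x] i B0 by (simp add: mult_ac)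
  qed
qed

lemma low_frequency_limits:
  fixes g0 g1 g2 h :: "real \<Rightarrow> complex" and s0 s1 s2 :: "real \<Rightarrow> real \<Rightarrow> complex"
  assumes g: "\<And>x. (g0 has_vector_derivative g1 x) (at x)" "\<And>x. (g1 has_vector_derivative g2 x) (at x)"
    "\<And>x. (g2 has_vector_derivative (third_rhs 0 x (g0 x) (g1 x) (g2 x) + h x)) (at x)"
    and s: "\<And>\<mu> x. \<mu> > 0 \<Longrightarrow> (s0 \<mu> has_vector_derivative s1 \<mu> x) (at x)" "\<And>\<mu> x. \<mu> > 0 \<Longrightarrow> (s1 \<mu> has_vector_derivative s2 \<mu> x) (at x)"
      "\<And>\<mu> x. \<mu> > 0 \<Longrightarrow> (s2 \<mu> has_vector_derivative (third_rhs (of_real \<mu>) x (s0 \<mu> x) (s1 \<mu> x) (s2 \<mu> x) + h x)) (at x)"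
    and i: "\<And>\<mu>. \<mu> > 0 \<Longrightarrow> s0 \<mu> 0 = g0 0" "\<And>\<mu>. \<mu> > 0 \<Longrightarrow> s1 \<mu> 0 = g1 0" "\<And>\<mu>. \<mu> > 0 \<Longrightarrow> s2 \<mu> 0 = g2 0"
  shows "((\<lambda>\<mu>. mass_defect (s0 \<mu>) (s2 \<mu>)) \<longlongrightarrow> mass_defect g0 g2) (at_right 0)"
    "((\<lambda>\<mu>. momentum_defect (s0 \<mu>) (s2 \<mu>)) \<longlongrightarrow> momentum_defect g0 g2) (at_right 0)"
    "((\<lambda>\<mu>. s1 \<mu> T - s1 \<mu> 0) \<longlongrightarrow> g1 T - g1 0) (at_right 0)"
proof -
  obtain K where K: "K \<ge> 0"
    "\<And>\<mu> s0 s1 s2 x. cmod \<mu> \<le> 1 \<Longrightarrow> (\<And>x. (s0 has_vector_derivative s1 x) (at x)) \<Longrightarrow> (\<And>x. (s1 has_vector_derivative s2 x) (at x)) \<Longrightarrow>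
      (\<And>x. (s2 has_vector_derivative (third_rhs \<mu> x (s0 x) (s1 x) (s2 x) + h x)) (at x)) \<Longrightarrow>
      s0 0 = g0 0 \<Longrightarrow> s1 0 = g1 0 \<Longrightarrow> s2 0 = g2 0 \<Longrightarrow> 0 \<le> x \<Longrightarrow> x \<le> T \<Longrightarrow>
      cmod (s0 x - g0 x) \<le> K * cmod \<mu> \<and> cmod (s1 x - g1 x) \<le> K * cmod \<mu> \<and> cmod (s2 x - g2 x) \<le> K * cmod \<mu>"
    by (rule low_frequency_bound[OF g]) blast+
  have close: "cmod (s0 \<mu> x - g0 x) \<le> K * \<mu>" "cmod (s1 \<mu> x - g1 x) \<le> K * \<mu>" "cmod (s2 \<mu> x - g2 x) \<le> K * \<mu>"
    if "0 < \<mu>" "\<mu> \<le> 1" "0 \<le> x" "x \<le> T" for \<mu> x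
    using K(2)[of "of_real \<mu>" "s0 \<mu>" "s1 \<mu>" "s2 \<mu>" x] s i that by simp_all
  have ev: "\<forall>\<^sub>F \<mu> in at_right (0::real). 0 < \<mu> \<and> \<mu> \<le> 1"
    unfolding eventually_at_right_field by (intro exI[of _ 1]) auto
  have lim: "((\<lambda>\<mu>. k * \<mu>) \<longlongrightarrow> 0) (at_right 0)" for k :: real
    by (auto intro!: tendsto_eq_intros)
  have cs: "continuous_on {0..T} (s0 \<mu>)" "continuous_on {0..T} (s2 \<mu>)" if "\<mu> > 0" for \<mu>
    by (intro continuous_at_imp_continuous_on ballI has_vector_derivative_continuous[OF s(1)[OF that]]
        has_vector_derivative_continuous[OF s(3)[OF that]])+
  have cg: "continuous_on {0..T} g0" "continuous_on {0..T} g2"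
    by (intro continuous_at_imp_continuous_on ballI has_vector_derivative_continuous[OF g(1)]
        has_vector_derivative_continuous[OF g(3)])+
  obtain U where U: "U \<ge> 0" "\<And>x. x \<in> {0..T} \<Longrightarrow> \<bar>u x\<bar> \<le> U" by (rule continuous_on_bounded[OF continuous_u, of 0 T]) blast
  have int: "((\<lambda>\<mu>. integral {0..T} (\<lambda>x. p x * (s0 \<mu> x - s2 \<mu> x))) \<longlongrightarrow> integral {0..T} (\<lambda>x. p x * (g0 x - g2 x))) (at_right 0)"
    if p: "continuous_on {0..T} p" and P: "P \<ge> 0" "\<And>x. x \<in> {0..T} \<Longrightarrow> cmod (p x) \<le> P" for p P
  proof (rule Lim_transform2[OF tendsto_const], rule Lim_null_comparison[OF _ lim[of "P * (2 * K) * T"]])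
    show "\<forall>\<^sub>F \<mu> in at_right 0. norm (integral {0..T} (\<lambda>x. p x * (g0 x - g2 x)) - integral {0..T} (\<lambda>x. p x * (s0 \<mu> x - s2 \<mu> x))) \<le> P * (2 * K) * T * \<mu>"
      using ev
    proof eventually_elim
      case (elim \<mu>)
      have c1: "continuous_on {0..T} (\<lambda>x. p x * (g0 x - g2 x))" "continuous_on {0..T} (\<lambda>x. p x * (s0 \<mu> x - s2 \<mu> x))"
        using cs elim by (auto intro!: continuous_intros p cg)
      have "integral {0..T} (\<lambda>x. p x * (g0 x - g2 x)) - integral {0..T} (\<lambda>x. p x * (s0 \<mu> x - s2 \<mu> x)) =
        integral {0..T} (\<lambda>x. p x * (g0 x - g2 x) - p x * (s0 \<mu> x - s2 \<mu> x))"
        using c1 by (intro integral_diff[symmetric] integrable_continuous_real)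
      also have "norm \<dots> \<le> (P * (2 * K * \<mu>)) * (T - 0)"
      proof (rule integral_bound)
        show "0 \<le> T" using T_pos by simp
        show "continuous_on {0..T} (\<lambda>x. p x * (g0 x - g2 x) - p x * (s0 \<mu> x - s2 \<mu> x))" by (intro continuous_intros c1)
        fix x assume x: "x \<in> {0..T}"
        have "p x * (g0 x - g2 x) - p x * (s0 \<mu> x - s2 \<mu> x) = p x * ((s2 \<mu> x - g2 x) - (s0 \<mu> x - g0 x))" by (simp add: algebra_simps)
        moreover have "cmod ((s2 \<mu> x - g2 x) - (s0 \<mu> x - g0 x)) \<le> 2 * K * \<mu>"
          using norm_triangle_ineq4[of "s2 \<mu> x - g2 x" "s0 \<mu> x - g0 x"] close[of \<mu> x] elim x by simp
        ultimately show "cmod (p x * (g0 x - g2 x) - p x * (s0 \<mu> x - s2 \<mu> x)) \<le> P * (2 * K * \<mu>)"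
          using P x by (simp add: norm_mult mult_mono)
      qed
      finally show ?case by (simp add: mult_ac)
    qed
  qed
  show "((\<lambda>\<mu>. mass_defect (s0 \<mu>) (s2 \<mu>)) \<longlongrightarrow> mass_defect g0 g2) (at_right 0)"
    using int[of "\<lambda>x. 1" 1] unfolding mass_defect_def by simp
  show "((\<lambda>\<mu>. momentum_defect (s0 \<mu>) (s2 \<mu>)) \<longlongrightarrow> momentum_defect g0 g2) (at_right 0)"
    using int[of "\<lambda>x. of_real (u x)" U] U unfolding momentum_defect_def by (auto intro!: continuous_intros continuous_u)
  have "((\<lambda>\<mu>. s1 \<mu> T) \<longlongrightarrow> g1 T) (at_right 0)"
  proof (rule Lim_transform2[OF tendsto_const], rule Lim_null_comparison[OF _ lim[of K]])
    show "\<forall>\<^sub>F \<mu> in at_right 0. norm (g1 T - s1 \<mu> T) \<le> K * \<mu>"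
      using ev by eventually_elim (use close(2)[of _ T] T_pos in \<open>simp add: norm_minus_commute\<close>)
  qed
  moreover have "\<forall>\<^sub>F \<mu> in at_right 0. g1 0 = s1 \<mu> 0" using ev by eventually_elim (simp add: i)
  then have "((\<lambda>\<mu>. s1 \<mu> 0) \<longlongrightarrow> g1 0) (at_right 0)" by (rule Lim_transform_eventually[OF tendsto_const])
  ultimately show "((\<lambda>\<mu>. s1 \<mu> T - s1 \<mu> 0) \<longlongrightarrow> g1 T - g1 0) (at_right 0)" by (rule tendsto_diff)
qed

text \<open>Integration by parts, with boundary terms expressed by the jump of
  \<open>\<phi>1\<close>, that is by the period derivative. The defects are thus the derivatives of
  mass and momentum up to multiples of the period row, which a determinant does not see.\<close>

lemma tangent_functionals:
  assumes t: "tangent al et ga \<phi> \<phi>1"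
  defines "\<phi>2 \<equiv> second al ga \<phi>"
  shows "mass_defect (\<lambda>x. of_real (\<phi> x)) (\<lambda>x. of_real (\<phi>2 x)) = of_real (dM_of \<phi> \<phi>1 + (u2 0 - um) * dT_of \<phi>1)"
    "momentum_defect (\<lambda>x. of_real (\<phi> x)) (\<lambda>x. of_real (\<phi>2 x)) = of_real (dP_of \<phi> \<phi>1 + (um * u2 0 - um\<^sup>2 / 2) * dT_of \<phi>1)"
proof -
  note t' = tangentD[OF t]
  have T0: "0 \<le> T" using T_pos by simp
  have c\<phi>2: "continuous_on {0..T} \<phi>2"
    unfolding \<phi>2_def second_def[abs_def] using c by (intro continuous_intros t' continuous_q continuous_u continuous_u2) auto
  have intR: "integral {0..T} (\<lambda>x. complex_of_real (g x)) = of_real (integral {0..T} g)" if "continuous_on {0..T} g" for g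
  proof -
    have "(g has_integral integral {0..T} g) {0..T}" using that integrable_continuous_real by blast
    from has_integral_linear[OF this bounded_linear_of_real] show ?thesis by (auto simp: o_def integral_unique)
  qed
  have int: "\<phi> integrable_on {0..T}" "\<phi>2 integrable_on {0..T}" "(\<lambda>x. u x * \<phi> x) integrable_on {0..T}" "(\<lambda>x. u1 x * \<phi>1 x) integrable_on {0..T}" "(\<lambda>x. u x * \<phi>2 x) integrable_on {0..T}"
    by (intro integrable_continuous_real continuous_intros t' c\<phi>2 continuous_u continuous_u1)+
  have d2: "(\<phi>1 has_real_derivative \<phi>2 x) (at x)" for x using t'(2) by (simp add: \<phi>2_def second_def)
  have FTC: "(g has_integral (G T - G 0)) {0..T}" if "\<And>x. (G has_real_derivative g x) (at x)" for G g
    by (rule fundamental_theorem_of_calculus[OF T0])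
      (rule has_vector_derivative_at_within, use that in \<open>simp add: has_real_derivative_iff_has_vector_derivative\<close>)
  have I2: "integral {0..T} \<phi>2 = - u2 0 * dT_of \<phi>1"
    using integral_unique[OF FTC[OF d2]] t' by simp
  have "((\<lambda>x. u x * \<phi>1 x) has_real_derivative (u1 x * \<phi>1 x + u x * \<phi>2 x)) (at x)" for x
    using DERIV_mult[OF du[of x] d2[of x]] by (simp add: algebra_simps)
  from integral_unique[OF FTC[OF this]]
  have I3: "integral {0..T} (\<lambda>x. u x * \<phi>2 x) = - um * u2 0 * dT_of \<phi>1 - integral {0..T} (\<lambda>x. u1 x * \<phi>1 x)"
    using int t' by (simp add: integral_add u2_T0)
  have "mass_defect (\<lambda>x. of_real (\<phi> x)) (\<lambda>x. of_real (\<phi>2 x)) = integral {0..T} (\<lambda>x. of_real (\<phi> x - \<phi>2 x))" by (simp add: mass_defect_def)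
  also have "\<dots> = of_real (integral {0..T} (\<lambda>x. \<phi> x - \<phi>2 x))" by (intro intR continuous_intros t' c\<phi>2)
  also have "integral {0..T} (\<lambda>x. \<phi> x - \<phi>2 x) = integral {0..T} \<phi> - integral {0..T} \<phi>2" using int by (intro integral_diff)
  finally show "mass_defect (\<lambda>x. of_real (\<phi> x)) (\<lambda>x. of_real (\<phi>2 x)) = of_real (dM_of \<phi> \<phi>1 + (u2 0 - um) * dT_of \<phi>1)"
    by (simp add: I2 dM_of_def algebra_simps)
  have "momentum_defect (\<lambda>x. of_real (\<phi> x)) (\<lambda>x. of_real (\<phi>2 x)) = integral {0..T} (\<lambda>x. of_real (u x * \<phi> x - u x * \<phi>2 x))"
    by (simp add: momentum_defect_def algebra_simps)
  also have "\<dots> = of_real (integral {0..T} (\<lambda>x. u x * \<phi> x - u x * \<phi>2 x))" by (intro intR continuous_intros t' c\<phi>2 continuous_u)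
  also have "integral {0..T} (\<lambda>x. u x * \<phi> x - u x * \<phi>2 x) = integral {0..T} (\<lambda>x. u x * \<phi> x) - integral {0..T} (\<lambda>x. u x * \<phi>2 x)"
    using int by (intro integral_diff)
  finally have fin: "momentum_defect (\<lambda>x. of_real (\<phi> x)) (\<lambda>x. of_real (\<phi>2 x)) =
      of_real (integral {0..T} (\<lambda>x. u x * \<phi> x) - integral {0..T} (\<lambda>x. u x * \<phi>2 x))" .
  show "momentum_defect (\<lambda>x. of_real (\<phi> x)) (\<lambda>x. of_real (\<phi>2 x)) = of_real (dP_of \<phi> \<phi>1 + (um * u2 0 - um\<^sup>2 / 2) * dT_of \<phi>1)"
    unfolding fin I3 dP_of_def integral_add[OF int(3,4)] of_real_eq_iff by (simp add: left_diff_distrib)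
qed

text \<open>One more differentiation removes the constant \<open>al\<close>: the velocities in the
  directions a and E solve the Evans equation at \<open>\<mu> = 0\<close>, while the direction c
  leaves a forcing by the translation mode.\<close>

lemma tangent_third:
  assumes t: "tangent al et ga \<phi> \<phi>1"
  defines "\<phi>2 \<equiv> second al ga \<phi>"
  shows "((\<lambda>x. complex_of_real (\<phi> x)) has_vector_derivative of_real (\<phi>1 x)) (at x)"
    "((\<lambda>x. complex_of_real (\<phi>1 x)) has_vector_derivative of_real (\<phi>2 x)) (at x)"
    "((\<lambda>x. complex_of_real (\<phi>2 x)) has_vector_derivative
      (third_rhs 0 x (of_real (\<phi> x)) (of_real (\<phi>1 x)) (of_real (\<phi>2 x)) + of_real (ga * (u1 x - q x * u1 x / c) / c))) (at x)"
proof -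
  note t' = tangentD[OF t]
  have "(\<phi>2 has_real_derivative ((q' x * \<phi> x + \<phi>1 x * q x) + 0 + ga * (u1 x - q x * u1 x / c)) / c) (at x)"
    unfolding \<phi>2_def second_def[abs_def] by (intro DERIV_cdivide DERIV_add DERIV_mult DERIV_const DERIV_cmult DERIV_diff t' dq du du2)
  from has_vector_derivative_of_real[OF this, where ?'a = complex]
  show "((\<lambda>x. complex_of_real (\<phi>2 x)) has_vector_derivative
      (third_rhs 0 x (of_real (\<phi> x)) (of_real (\<phi>1 x)) (of_real (\<phi>2 x)) + of_real (ga * (u1 x - q x * u1 x / c) / c))) (at x)"
    by (simp add: third_rhs_def add_divide_distrib mult.commute)
  show "((\<lambda>x. complex_of_real (\<phi> x)) has_vector_derivative of_real (\<phi>1 x)) (at x)"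
    by (rule has_vector_derivative_of_real[OF t'(1)])
  show "((\<lambda>x. complex_of_real (\<phi>1 x)) has_vector_derivative of_real (\<phi>2 x)) (at x)"
    unfolding \<phi>2_def second_def by (rule has_vector_derivative_of_real[OF t'(2)])
qed

definition "U0 x = complex_of_real (u1 x)"
definition "U1 x = complex_of_real (u2 x)"
definition "U2 x = complex_of_real (q x * u1 x / c)"

lemma U_third: "third_sol 0 U0 U1 U2"
  unfolding third_sol_def
proof (intro allI conjI)
  fix x
  show "(U0 has_vector_derivative U1 x) (at x)" unfolding U0_def[abs_def] U1_def by (rule complex_derivs)
  show "(U1 has_vector_derivative U2 x) (at x)" unfolding U1_def[abs_def] U2_def by (rule complex_derivs)
  have "((\<lambda>x. q x * u1 x / c) has_real_derivative (q' x * u1 x + u2 x * q x) / c) (at x)"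
    by (intro DERIV_cdivide DERIV_mult dq du1)
  from has_vector_derivative_of_real[OF this, where ?'a = complex]
  show "(U2 has_vector_derivative third_rhs 0 x (U0 x) (U1 x) (U2 x)) (at x)"
    by (simp add: third_rhs_def U0_def U1_def U2_def[abs_def] mult.commute)
qed

text \<open>Each integrand is the derivative of an expression that takes equal values at 0 and
  \<open>T\<close>. So the column of the translation mode vanishes entirely at
  \<open>\<mu> = 0\<close>, and a corrector of first order is required.\<close>

lemma U_functionals: "mass_defect U0 U2 = 0" "momentum_defect U0 U2 = 0" "U1 T - U1 0 = 0"
proof -
  have T0: "0 \<le> T" using T_pos by simp
  have FTC: "integral {0..T} (\<lambda>x. complex_of_real (g x)) = of_real (G T - G 0)"
    if d: "\<And>x. (G has_real_derivative g x) (at x)" for G g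
    by (rule integral_unique, subst of_real_diff, rule fundamental_theorem_of_calculus[OF T0])
      (rule has_vector_derivative_at_within, rule has_vector_derivative_of_real[OF d])
  have "((\<lambda>x. u x - u2 x) has_real_derivative (u1 x - q x * u1 x / c)) (at x)" for x
    by (intro DERIV_diff du du2)
  from FTC[OF this] show "mass_defect U0 U2 = 0" by (simp add: mass_defect_def U0_def U2_def u2_T0 u_0)
  have "((\<lambda>x. u x * u x / 2 - u x * u2 x + u1 x * u1 x / 2) has_real_derivative
     (u1 x * u x + u1 x * u x) / 2 - (u1 x * u2 x + q x * u1 x / c * u x) + (u2 x * u1 x + u2 x * u1 x) / 2) (at x)" for x
    by (intro DERIV_diff DERIV_add DERIV_mult DERIV_cdivide du du1 du2)
  moreover have "(u1 x * u x + u1 x * u x) / 2 - (u1 x * u2 x + q x * u1 x / c * u x) + (u2 x * u1 x + u2 x * u1 x) / 2 = u x * (u1 x - q x * u1 x / c)" for x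
    using c by (simp add: field_simps)
  ultimately have d: "((\<lambda>x. u x * u x / 2 - u x * u2 x + u1 x * u1 x / 2) has_real_derivative u x * (u1 x - q x * u1 x / c)) (at x)" for x
    by (rule DERIV_cong)
  from FTC[OF d] show "momentum_defect U0 U2 = 0" by (simp add: momentum_defect_def U0_def U2_def u2_T0 u_0 u1_0)
  show "U1 T - U1 0 = 0" by (simp add: U1_def u2_T0)
qed

lemma functionals_shift:
  assumes s: "continuous_on {0..T} z0" "continuous_on {0..T} z2"
  shows "mass_defect (\<lambda>x. U0 x + k * z0 x) (\<lambda>x. U2 x + k * z2 x) = k * mass_defect z0 z2"
    "momentum_defect (\<lambda>x. U0 x + k * z0 x) (\<lambda>x. U2 x + k * z2 x) = k * momentum_defect z0 z2"
proof -
  note cU = third_sol_continuous[OF U_third, of "{0..T}"]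
  have cu: "continuous_on {0..T} (\<lambda>x. complex_of_real (u x))" by (intro continuous_intros continuous_u)
  have i: "(\<lambda>x. U0 x - U2 x) integrable_on {0..T}" "(\<lambda>x. k * (z0 x - z2 x)) integrable_on {0..T}"
    "(\<lambda>x. of_real (u x) * (U0 x - U2 x)) integrable_on {0..T}" "(\<lambda>x. k * (of_real (u x) * (z0 x - z2 x))) integrable_on {0..T}"
    by (intro integrable_continuous_real continuous_intros cU s cu)+
  have "mass_defect (\<lambda>x. U0 x + k * z0 x) (\<lambda>x. U2 x + k * z2 x) = integral {0..T} (\<lambda>x. (U0 x - U2 x) + k * (z0 x - z2 x))"
    unfolding mass_defect_def by (rule integral_cong) (simp add: algebra_simps)
  also have "\<dots> = mass_defect U0 U2 + k * mass_defect z0 z2" unfolding integral_add[OF i(1,2)] by (simp add: mass_defect_def)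
  finally show "mass_defect (\<lambda>x. U0 x + k * z0 x) (\<lambda>x. U2 x + k * z2 x) = k * mass_defect z0 z2" by (simp add: U_functionals)
  have "momentum_defect (\<lambda>x. U0 x + k * z0 x) (\<lambda>x. U2 x + k * z2 x) = integral {0..T} (\<lambda>x. of_real (u x) * (U0 x - U2 x) + k * (of_real (u x) * (z0 x - z2 x)))"
    unfolding momentum_defect_def by (rule integral_cong) (simp add: algebra_simps)
  also have "\<dots> = momentum_defect U0 U2 + k * momentum_defect z0 z2" unfolding integral_add[OF i(3,4)] by (simp add: momentum_defect_def)
  finally show "momentum_defect (\<lambda>x. U0 x + k * z0 x) (\<lambda>x. U2 x + k * z2 x) = k * momentum_defect z0 z2" by (simp add: U_functionals)
qed

text \<open>The determinant is computed in the basis of solutions with the initial data of \<open>u1\<close>, \<open>\<phi>a\<close>, \<open>\<phi>E\<close>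
  (solutions for \<open>\<mu> = 0\<close>), the first one being corrected to \<open>u1 - \<mu> \<phi>c\<close> since \<open>L \<phi>c = u2 - u\<close> and hence \<open>(L \<phi>c)\<^sub>x = - (u1 - u1\<^sub>x\<^sub>x)\<close>.\<close>

lemma evans_D_low_frequency:
  assumes ta: "tangent 1 0 0 \<phi>a \<phi>a1" and tE: "tangent 0 1 0 \<phi>E \<phi>E1" and tc: "tangent 0 0 1 \<phi>c \<phi>c1"
  shows "((\<lambda>\<mu>. evans_D \<Phi> T (of_real \<mu>) 1 / of_real (\<mu> ^ 3)) \<longlongrightarrow>
    of_real (- det (vector [vector [dT_of \<phi>a1, dT_of \<phi>E1, dT_of \<phi>c1],
       vector [dM_of \<phi>a \<phi>a1, dM_of \<phi>E \<phi>E1, dM_of \<phi>c \<phi>c1],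
       vector [dP_of \<phi>a \<phi>a1, dP_of \<phi>E \<phi>E1, dP_of \<phi>c \<phi>c1]] :: real^3^3))) (at_right 0)"
proof -
  define \<kappa> where "\<kappa> = u2 0"
  have \<kappa>: "\<kappa> > 0" using u2_0 by (simp add: \<kappa>_def)
  define a2 where "a2 = second 1 0 \<phi>a"
  define E2 where "E2 = second 0 0 \<phi>E"
  define c2 where "c2 = second 0 1 \<phi>c"
  note Ta = tangent_third[OF ta, folded a2_def] tangent_functionals[OF ta, folded a2_def] tangentD[OF ta]
  note TE = tangent_third[OF tE, folded E2_def] tangent_functionals[OF tE, folded E2_def] tangentD[OF tE]
  note Tc = tangent_third[OF tc, folded c2_def] tangent_functionals[OF tc, folded c2_def] tangentD[OF tc]
  define s where "s = (\<lambda>y i (\<mu>::real) x. (\<Phi> x (of_real \<mu>) *v y) $ i)"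
  have s: "third_sol (of_real \<mu>) (s y 1 \<mu>) (s y 2 \<mu>) (s y 3 \<mu>)" for y \<mu>
    unfolding s_def by (rule Phi_vector)
  have s0: "s y i \<mu> 0 = y $ i" for y i \<mu> by (simp add: s_def Phi_0)
  define ya :: "complex^3" where "ya = vector [of_real (\<phi>a 0), 0, of_real (a2 0)]"
  define yE :: "complex^3" where "yE = vector [of_real (\<phi>E 0), 0, of_real (E2 0)]"
  \<comment> \<open>The values at 0 of u1 - \<mu> \<phi>c and of its first two derivatives.\<close>
  define yc :: "real \<Rightarrow> complex^3" where "yc = (\<lambda>\<mu>. vector [of_real (- \<mu> * \<phi>c 0), of_real \<kappa>, of_real (- \<mu> * c2 0)])"
  \<comment> \<open>The corrector: the difference from \<open>u1\<close> divided by
    \<open>\<mu>\<close>. Its initial data are those of - \<phi>c whatever \<open>\<mu>\<close> is,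
    and it solves the equation with the fixed forcing \<open>?h\<close>, so it converges as
    \<open>\<mu>\<close> tends to 0.\<close>
  define z where "z = (\<lambda>i \<mu> x. (s (yc \<mu>) i \<mu> x - (if i = 1 then U0 x else if i = 2 then U1 x else U2 x)) / of_real \<mu>)"
  have z_simps: "z 1 \<mu> x = (s (yc \<mu>) 1 \<mu> x - U0 x) / of_real \<mu>" "z 2 \<mu> x = (s (yc \<mu>) 2 \<mu> x - U1 x) / of_real \<mu>"
    "z 3 \<mu> x = (s (yc \<mu>) 3 \<mu> x - U2 x) / of_real \<mu>" for \<mu> x by (simp_all add: z_def)
  have d: "(s y 1 \<mu> has_vector_derivative s y 2 \<mu> x) (at x)" "(s y 2 \<mu> has_vector_derivative s y 3 \<mu> x) (at x)"
    "(s y 3 \<mu> has_vector_derivative third_rhs (of_real \<mu>) x (s y 1 \<mu> x) (s y 2 \<mu> x) (s y 3 \<mu> x)) (at x)" for y \<mu> x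
    using s unfolding third_sol_def by blast+
  have dU: "(U0 has_vector_derivative U1 x) (at x)" "(U1 has_vector_derivative U2 x) (at x)"
    "(U2 has_vector_derivative third_rhs 0 x (U0 x) (U1 x) (U2 x)) (at x)" for x
    using U_third unfolding third_sol_def by blast+
  let ?h = "\<lambda>x. (U2 x - U0 x) / of_real c"
  have dz: "(z 1 \<mu> has_vector_derivative z 2 \<mu> x) (at x)" "(z 2 \<mu> has_vector_derivative z 3 \<mu> x) (at x)"
    "(z 3 \<mu> has_vector_derivative third_rhs (of_real \<mu>) x (z 1 \<mu> x) (z 2 \<mu> x) (z 3 \<mu> x) + ?h x) (at x)" if "\<mu> > 0" for \<mu> x
  proof -
    show "(z 1 \<mu> has_vector_derivative z 2 \<mu> x) (at x)" "(z 2 \<mu> has_vector_derivative z 3 \<mu> x) (at x)"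
      unfolding z_simps[abs_def] by (intro has_vector_derivative_divide has_vector_derivative_diff d dU)+
    have "(z 3 \<mu> has_vector_derivative (third_rhs (of_real \<mu>) x (s (yc \<mu>) 1 \<mu> x) (s (yc \<mu>) 2 \<mu> x) (s (yc \<mu>) 3 \<mu> x) -
        third_rhs 0 x (U0 x) (U1 x) (U2 x)) / of_real \<mu>) (at x)"
      unfolding z_simps[abs_def] by (intro has_vector_derivative_divide has_vector_derivative_diff d dU)
    moreover have "(third_rhs (of_real \<mu>) x v0 v1 v2 - third_rhs 0 x w0 w1 w2) / of_real \<mu> =
       third_rhs (of_real \<mu>) x ((v0 - w0) / of_real \<mu>) ((v1 - w1) / of_real \<mu>) ((v2 - w2) / of_real \<mu>) + (w2 - w0) / of_real c" for v0 v1 v2 w0 w1 w2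
      using c that by (simp add: third_rhs_def field_simps)
    ultimately show "(z 3 \<mu> has_vector_derivative third_rhs (of_real \<mu>) x (z 1 \<mu> x) (z 2 \<mu> x) (z 3 \<mu> x) + ?h x) (at x)"
      unfolding z_simps by simp
  qed
  have z0: "z 1 \<mu> 0 = - of_real (\<phi>c 0)" "z 2 \<mu> 0 = - of_real (\<phi>c1 0)" "z 3 \<mu> 0 = - of_real (c2 0)" if "\<mu> > 0" for \<mu>
    using that Tc(9) unfolding z_simps s0 by (simp_all add: yc_def vector_3 U0_def U1_def U2_def u1_0 \<kappa>_def)
  have gc: "((\<lambda>x. - complex_of_real (\<phi>c x)) has_vector_derivative - of_real (\<phi>c1 x)) (at x)"
    "((\<lambda>x. - complex_of_real (\<phi>c1 x)) has_vector_derivative - of_real (c2 x)) (at x)"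
    "((\<lambda>x. - complex_of_real (c2 x)) has_vector_derivative (third_rhs 0 x (- of_real (\<phi>c x)) (- of_real (\<phi>c1 x)) (- of_real (c2 x)) + ?h x)) (at x)" for x
  proof -
    show "((\<lambda>x. - complex_of_real (\<phi>c x)) has_vector_derivative - of_real (\<phi>c1 x)) (at x)"
      "((\<lambda>x. - complex_of_real (\<phi>c1 x)) has_vector_derivative - of_real (c2 x)) (at x)"
      by (intro has_vector_derivative_minus Tc)+
    have "((\<lambda>x. - complex_of_real (c2 x)) has_vector_derivative
       - (third_rhs 0 x (of_real (\<phi>c x)) (of_real (\<phi>c1 x)) (of_real (c2 x)) + of_real (1 * (u1 x - q x * u1 x / c) / c))) (at x)"
      by (intro has_vector_derivative_minus Tc)
    moreover have "- (third_rhs 0 x (of_real (\<phi>c x)) (of_real (\<phi>c1 x)) (of_real (c2 x)) + of_real (1 * (u1 x - q x * u1 x / c) / c)) =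
      third_rhs 0 x (- of_real (\<phi>c x)) (- of_real (\<phi>c1 x)) (- of_real (c2 x)) + ?h x"
      using c by (simp add: third_rhs_def U2_def U0_def field_simps)
    ultimately show "((\<lambda>x. - complex_of_real (c2 x)) has_vector_derivative (third_rhs 0 x (- of_real (\<phi>c x)) (- of_real (\<phi>c1 x)) (- of_real (c2 x)) + ?h x)) (at x)"
      by simp
  qed
  note lc = low_frequency_limits[of "\<lambda>x. - of_real (\<phi>c x)" "\<lambda>x. - of_real (\<phi>c1 x)" "\<lambda>x. - of_real (c2 x)" ?h "z 1" "z 2" "z 3", OF gc dz z0]
  have da: "((\<lambda>x. complex_of_real (a2 x)) has_vector_derivative (third_rhs 0 x (of_real (\<phi>a x)) (of_real (\<phi>a1 x)) (of_real (a2 x)) + 0)) (at x)"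
    "((\<lambda>x. complex_of_real (E2 x)) has_vector_derivative (third_rhs 0 x (of_real (\<phi>E x)) (of_real (\<phi>E1 x)) (of_real (E2 x)) + 0)) (at x)" for x
    using Ta(3)[of x] TE(3)[of x] by simp_all
  have d': "(s y 3 \<mu> has_vector_derivative (third_rhs (of_real \<mu>) x (s y 1 \<mu> x) (s y 2 \<mu> x) (s y 3 \<mu> x) + 0)) (at x)" for y \<mu> x
    using d(3) by simp
  have ia: "s ya 1 \<mu> 0 = of_real (\<phi>a 0)" "s ya 2 \<mu> 0 = of_real (\<phi>a1 0)" "s ya 3 \<mu> 0 = of_real (a2 0)"
    "s yE 1 \<mu> 0 = of_real (\<phi>E 0)" "s yE 2 \<mu> 0 = of_real (\<phi>E1 0)" "s yE 3 \<mu> 0 = of_real (E2 0)" for \<mu>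
    using Ta(9) TE(9) unfolding s0 by (simp_all add: ya_def yE_def vector_3)
  note la = low_frequency_limits[of "\<lambda>x. of_real (\<phi>a x)" "\<lambda>x. of_real (\<phi>a1 x)" "\<lambda>x. of_real (a2 x)" "\<lambda>x. 0" "s ya 1" "s ya 2" "s ya 3", OF Ta(1,2) da(1) d(1,2) d' ia(1,2,3)]
  note lE = low_frequency_limits[of "\<lambda>x. of_real (\<phi>E x)" "\<lambda>x. of_real (\<phi>E1 x)" "\<lambda>x. of_real (E2 x)" "\<lambda>x. 0" "s yE 1" "s yE 2" "s yE 3", OF TE(1,2) da(2) d(1,2) d' ia(4,5,6)]
  define N where "N = (\<lambda>\<mu>. vector [vector [momentum_defect (z 1 \<mu>) (z 3 \<mu>), momentum_defect (s ya 1 \<mu>) (s ya 3 \<mu>), momentum_defect (s yE 1 \<mu>) (s yE 3 \<mu>)],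
     vector [z 2 \<mu> T - z 2 \<mu> 0, s ya 2 \<mu> T - s ya 2 \<mu> 0, s yE 2 \<mu> T - s yE 2 \<mu> 0],
     vector [mass_defect (z 1 \<mu>) (z 3 \<mu>), mass_defect (s ya 1 \<mu>) (s ya 3 \<mu>), mass_defect (s yE 1 \<mu>) (s yE 3 \<mu>)]] :: complex^3^3)"
  have ident: "evans_D \<Phi> T (of_real \<mu>) 1 / of_real (\<mu> ^ 3) = - det (N \<mu>) / of_real \<kappa>" if \<mu>: "\<mu> > 0" for \<mu>
  proof -
    define y :: "3 \<Rightarrow> complex^3" where "y = (\<lambda>j. if j = 1 then yc \<mu> else if j = 2 then ya else yE)"
    have y: "y 1 = yc \<mu>" "y 2 = ya" "y 3 = yE" by (simp_all add: y_def)
    \<comment> \<open>The determinant of the initial data reduces to \<phi>a \<phi>E_xx - \<phi>E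
      \<phi>a_xx at 0; the equations for the second derivatives turn it into
      \<open>\<phi>E 0\<close>, whose value is prescribed in \<open>tangent\<close>.\<close>
    have dW: "det (vector [vector [s (y 1) 1 \<mu> 0, s (y 2) 1 \<mu> 0, s (y 3) 1 \<mu> 0], vector [s (y 1) 2 \<mu> 0, s (y 2) 2 \<mu> 0, s (y 3) 2 \<mu> 0],
       vector [s (y 1) 3 \<mu> 0, s (y 2) 3 \<mu> 0, s (y 3) 3 \<mu> 0]] :: complex^3^3) * of_real (c\<^sup>2 * u2 0) = - of_real \<kappa>"
    proof -
      have V: "f um - (c - 1) * um - a = - c * \<kappa>" using c u2_eq[of 0] by (simp add: \<kappa>_def u_0 field_simps)
      have E0: "\<phi>E 0 * (c * \<kappa>) = - 1" using TE(8) c \<kappa> unfolding V by (simp add: field_simps)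
      have a20: "a2 0 * c = q 0 * \<phi>a 0 + 1" "E2 0 * c = q 0 * \<phi>E 0" using c by (simp_all add: a2_def E2_def second_def)
      have "(- \<kappa> * (\<phi>a 0 * E2 0 - \<phi>E 0 * a2 0)) * (c\<^sup>2 * \<kappa>) = - \<kappa> * (\<phi>a 0 * (E2 0 * c) - \<phi>E 0 * (a2 0 * c)) * (c * \<kappa>)"
        by (simp add: power2_eq_square algebra_simps)
      also have "\<dots> = \<kappa> * (\<phi>E 0 * (c * \<kappa>))" unfolding a20 by (simp add: algebra_simps)
      finally have r: "(- \<kappa> * (\<phi>a 0 * E2 0 - \<phi>E 0 * a2 0)) * (c\<^sup>2 * \<kappa>) = - \<kappa>" unfolding E0 by simp
      have "det (vector [vector [s (y 1) 1 \<mu> 0, s (y 2) 1 \<mu> 0, s (y 3) 1 \<mu> 0], vector [s (y 1) 2 \<mu> 0, s (y 2) 2 \<mu> 0, s (y 3) 2 \<mu> 0],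
         vector [s (y 1) 3 \<mu> 0, s (y 2) 3 \<mu> 0, s (y 3) 3 \<mu> 0]] :: complex^3^3) = of_real (- \<kappa> * (\<phi>a 0 * E2 0 - \<phi>E 0 * a2 0))"
        unfolding det_vector3 y s0 ya_def yE_def yc_def by (simp add: vector_3 algebra_simps)
      then show ?thesis
        using r by (simp only: \<kappa>_def[symmetric] of_real_mult[symmetric] of_real_minus)
    qed
    have zc: "s (y 1) 1 \<mu> = (\<lambda>x. U0 x + of_real \<mu> * z 1 \<mu> x)" "s (y 1) 2 \<mu> = (\<lambda>x. U1 x + of_real \<mu> * z 2 \<mu> x)"
      "s (y 1) 3 \<mu> = (\<lambda>x. U2 x + of_real \<mu> * z 3 \<mu> x)"
      using \<mu> by (simp_all add: fun_eq_iff z_simps y)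
    have cz: "continuous_on {0..T} (z 1 \<mu>)" "continuous_on {0..T} (z 3 \<mu>)"
      by (intro continuous_at_imp_continuous_on ballI has_vector_derivative_continuous[OF dz(1)[OF \<mu>]]
          has_vector_derivative_continuous[OF dz(3)[OF \<mu>]])+
    have "evans_D \<Phi> T (of_real \<mu>) 1 * (- of_real \<kappa>) = (of_real \<mu>)\<^sup>2 * (of_real \<mu> * det (N \<mu>))"
    proof -
      have U1T: "U1 T = U1 0" using U_functionals(3) by simp
      have "of_real \<mu> * det (N \<mu>) = det (vector [vector [momentum_defect (s (y 1) 1 \<mu>) (s (y 1) 3 \<mu>), momentum_defect (s (y 2) 1 \<mu>) (s (y 2) 3 \<mu>), momentum_defect (s (y 3) 1 \<mu>) (s (y 3) 3 \<mu>)],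
         vector [s (y 1) 2 \<mu> T - s (y 1) 2 \<mu> 0, s (y 2) 2 \<mu> T - s (y 2) 2 \<mu> 0, s (y 3) 2 \<mu> T - s (y 3) 2 \<mu> 0],
         vector [mass_defect (s (y 1) 1 \<mu>) (s (y 1) 3 \<mu>), mass_defect (s (y 2) 1 \<mu>) (s (y 2) 3 \<mu>), mass_defect (s (y 3) 1 \<mu>) (s (y 3) 3 \<mu>)]] :: complex^3^3)"
      proof -
        have fc: "mass_defect (s (y 1) 1 \<mu>) (s (y 1) 3 \<mu>) = of_real \<mu> * mass_defect (z 1 \<mu>) (z 3 \<mu>)"
          "momentum_defect (s (y 1) 1 \<mu>) (s (y 1) 3 \<mu>) = of_real \<mu> * momentum_defect (z 1 \<mu>) (z 3 \<mu>)"
          unfolding zc(1,3) by (rule functionals_shift[OF cz])+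
        have cc: "s (y 1) 2 \<mu> T - s (y 1) 2 \<mu> 0 = of_real \<mu> * (z 2 \<mu> T - z 2 \<mu> 0)"
          unfolding zc(2) U1T by (simp add: right_diff_distrib)
        have lin3: "m * (x1 * y2 * z3 + x2 * y3 * z1 + x3 * y1 * z2 - x1 * y3 * z2 - x2 * y1 * z3 - x3 * y2 * z1) =
          (m * x1) * y2 * z3 + x2 * y3 * (m * z1) + x3 * (m * y1) * z2 - (m * x1) * y3 * z2 - x2 * (m * y1) * z3 - x3 * y2 * (m * z1)"
          for m x1 x2 x3 y1 y2 y3 z1 z2 z3 :: complex by (simp add: algebra_simps)
        show ?thesis unfolding fc cc unfolding y(2,3) N_def det_vector3 by (rule lin3)
      qed
      with evans_D_det[of "of_real \<mu>" "\<lambda>j. s (y j) 1 \<mu>" "\<lambda>j. s (y j) 2 \<mu>" "\<lambda>j. s (y j) 3 \<mu>", OF s] dW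
      show ?thesis by (simp add: mult.assoc)
    qed
    note h = this
    have "evans_D \<Phi> T (of_real \<mu>) 1 * of_real \<kappa> = - (evans_D \<Phi> T (of_real \<mu>) 1 * (- of_real \<kappa>))" by simp
    also have "\<dots> = - det (N \<mu>) * of_real (\<mu> ^ 3)"
      unfolding h by (simp add: power2_eq_square power3_eq_cube)
    finally show ?thesis using \<mu> \<kappa> by (subst frac_eq_eq) auto
  qed
  define A where "A = (\<lambda>\<phi> \<phi>1. dM_of \<phi> \<phi>1 + (\<kappa> - um) * dT_of \<phi>1)"
  define B where "B = (\<lambda>\<phi> \<phi>1. dP_of \<phi> \<phi>1 + (um * \<kappa> - um\<^sup>2 / 2) * dT_of \<phi>1)"
  define C where "C = (\<lambda>\<phi>1. - \<kappa> * dT_of \<phi>1)"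
  have lim: "((\<lambda>\<mu>. - det (N \<mu>) / of_real \<kappa>) \<longlongrightarrow> - det (vector [vector [- of_real (B \<phi>c \<phi>c1), of_real (B \<phi>a \<phi>a1), of_real (B \<phi>E \<phi>E1)],
     vector [- of_real (C \<phi>c1), of_real (C \<phi>a1), of_real (C \<phi>E1)],
     vector [- of_real (A \<phi>c \<phi>c1), of_real (A \<phi>a \<phi>a1), of_real (A \<phi>E \<phi>E1)]] :: complex^3^3) / of_real \<kappa>) (at_right 0)"
  proof -
    have m: "mass_defect (\<lambda>x. - v0 x) (\<lambda>x. - v2 x) = - mass_defect v0 v2" "momentum_defect (\<lambda>x. - v0 x) (\<lambda>x. - v2 x) = - momentum_defect v0 v2" for v0 v2
      unfolding mass_defect_def momentum_defect_def integral_neg[symmetric] by (simp_all add: algebra_simps)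
    show ?thesis
      unfolding N_def det_vector3
      by (intro tendsto_intros)
        (use lc la lE m Ta(4,5,9,11) TE(4,5,9,11) Tc(4,5,9,11) \<kappa> in \<open>simp_all add: A_def B_def C_def \<kappa>_def\<close>)
  qed
  have "- det (vector [vector [- of_real (B \<phi>c \<phi>c1), of_real (B \<phi>a \<phi>a1), of_real (B \<phi>E \<phi>E1)],
     vector [- of_real (C \<phi>c1), of_real (C \<phi>a1), of_real (C \<phi>E1)],
     vector [- of_real (A \<phi>c \<phi>c1), of_real (A \<phi>a \<phi>a1), of_real (A \<phi>E \<phi>E1)]] :: complex^3^3) / of_real \<kappa> =
    of_real (- det (vector [vector [dT_of \<phi>a1, dT_of \<phi>E1, dT_of \<phi>c1],
       vector [dM_of \<phi>a \<phi>a1, dM_of \<phi>E \<phi>E1, dM_of \<phi>c \<phi>c1],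
       vector [dP_of \<phi>a \<phi>a1, dP_of \<phi>E \<phi>E1, dP_of \<phi>c \<phi>c1]] :: real^3^3))"
  proof -
    \<comment> \<open>Rows and columns are permuted cyclically, at no cost of sign. Multiples of the
      period row drop out of \<open>A\<close> and \<open>B\<close>; the factor - \<kappa> of the
      period row and the sign of the first column combine to \<kappa>.\<close>
    have "(- B \<phi>c \<phi>c1) * C \<phi>a1 * A \<phi>E \<phi>E1 + B \<phi>a \<phi>a1 * C \<phi>E1 * (- A \<phi>c \<phi>c1) + B \<phi>E \<phi>E1 * (- C \<phi>c1) * A \<phi>a \<phi>a1
       - (- B \<phi>c \<phi>c1) * C \<phi>E1 * A \<phi>a \<phi>a1 - B \<phi>a \<phi>a1 * (- C \<phi>c1) * A \<phi>E \<phi>E1 - B \<phi>E \<phi>E1 * C \<phi>a1 * (- A \<phi>c \<phi>c1)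
       = \<kappa> * det (vector [vector [dT_of \<phi>a1, dT_of \<phi>E1, dT_of \<phi>c1],
       vector [dM_of \<phi>a \<phi>a1, dM_of \<phi>E \<phi>E1, dM_of \<phi>c \<phi>c1],
       vector [dP_of \<phi>a \<phi>a1, dP_of \<phi>E \<phi>E1, dP_of \<phi>c \<phi>c1]] :: real^3^3)" (is "?l = \<kappa> * ?r")
      unfolding det_vector3 A_def B_def C_def by (simp add: algebra_simps)
    then have "- ?l / \<kappa> = - ?r" using \<kappa> by simp
    then have "complex_of_real (- ?l / \<kappa>) = of_real (- ?r)" by (simp only:)
    then show ?thesis unfolding det_vector3 by simp
  qed
  with lim have "((\<lambda>\<mu>. - det (N \<mu>) / of_real \<kappa>) \<longlongrightarrow> of_real (- det (vector [vector [dT_of \<phi>a1, dT_of \<phi>E1, dT_of \<phi>c1],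
       vector [dM_of \<phi>a \<phi>a1, dM_of \<phi>E \<phi>E1, dM_of \<phi>c \<phi>c1],
       vector [dP_of \<phi>a \<phi>a1, dP_of \<phi>E \<phi>E1, dP_of \<phi>c \<phi>c1]] :: real^3^3))) (at_right 0)" by simp
  then show ?thesis
    by (rule Lim_transform_eventually)
       (rule eventually_mono[OF eventually_at_right_less], simp only: ident)
qed

end

section \<open>Stability for a nonnegative bracket\<close>

text \<open>The functions w + w_x and w - w_x are multiples of exp x and exp (- x), which take equal
  values at 0 and \<open>T\<close> only if they vanish.\<close>

lemma periodic_exp_zero:
  fixes w w1 :: "real \<Rightarrow> complex"
  assumes d: "\<And>x. (w has_vector_derivative w1 x) (at x)" "\<And>x. (w1 has_vector_derivative w x) (at x)"
    and per: "w T = w 0" "w1 T = w1 0" and T: "T > 0"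
  shows "w x = 0"
proof -
  have gen: "p x = 0" if dp: "\<And>x. (p has_vector_derivative of_real k * p x) (at x)" and pT: "p T = p 0" and k: "k \<noteq> 0"
    for p :: "real \<Rightarrow> complex" and k x
  proof -
    let ?g = "\<lambda>x. of_real (exp (- k * x)) * p x"
    have e: "((\<lambda>x. complex_of_real (exp (- k * x))) has_vector_derivative of_real (- k * exp (- k * x))) (at x)" for x
      by (rule has_vector_derivative_of_real) (auto intro!: derivative_eq_intros)
    have "(?g has_vector_derivative 0) (at x within UNIV)" for x
      using has_vector_derivative_mult[OF e dp, of x] by (simp add: algebra_simps)
    note d0 = this
    obtain k' where k': "\<And>x. x \<in> UNIV \<Longrightarrow> ?g x = k'"
      by (rule has_vector_derivative_zero_constant[OF convex_UNIV d0]) blast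
    have g: "?g x = p 0" for x using k'[of x] k'[of 0] by simp
    have "(of_real (exp (- k * T)) - 1) * p 0 = 0" using g[of T] pT by (simp add: algebra_simps)
    moreover have "complex_of_real (exp (- k * T)) - 1 \<noteq> 0"
    proof
      assume "complex_of_real (exp (- k * T)) - 1 = 0"
      then have "complex_of_real (exp (- k * T)) = of_real 1" by simp
      then have "exp (- k * T) = 1" by (simp only: of_real_eq_iff)
      then show False using k T by simp
    qed
    ultimately have "p 0 = 0" by simp
    then show "p x = 0" using g[of x] by simp
  qed
  have "((\<lambda>x. w x + w1 x) has_vector_derivative of_real 1 * (w x + w1 x)) (at x)" for x
    using has_vector_derivative_add[OF d(1)[of x] d(2)[of x]] by (simp add: add.commute)
  from gen[OF this] per have 1: "w x + w1 x = 0" by simp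
  have "((\<lambda>x. w x - w1 x) has_vector_derivative of_real (- 1) * (w x - w1 x)) (at x)" for x
    using has_vector_derivative_diff[OF d(1)[of x] d(2)[of x]] by simp
  from gen[OF this] per have 2: "w x - w1 x = 0" by simp
  from 1 2 show ?thesis by (simp add: add_eq_0_iff)
qed

lemma ReIm_deriv:
  assumes "(g has_vector_derivative d) (at x)"
  shows "((\<lambda>x. Re (g x)) has_real_derivative Re d) (at x)" "((\<lambda>x. Im (g x)) has_real_derivative Im d) (at x)"
  using bounded_linear.has_vector_derivative[OF bounded_linear_Re assms] bounded_linear.has_vector_derivative[OF bounded_linear_Im assms]
  by (simp_all add: has_real_derivative_iff_has_vector_derivative)

text \<open>A nonnegative diagonal entry allows a coordinate vector. Otherwise
  \<open>(s, - 2 * k11)\<close>, the maximiser of the form for its second coordinate, gives - k11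
  times s^2 - 4 k11 k22, which is nonnegative because s^2 >= 4 k12 k21. The matrix is not assumed to
  be symmetric.\<close>

lemma quadratic_nonneg_direction:
  fixes k11 k12 k21 k22 :: real
  assumes "k11 * k22 - k12 * k21 \<le> 0"
  obtains \<alpha> \<beta> where "(\<alpha>, \<beta>) \<noteq> (0, 0)" "\<alpha> * (k11 * \<alpha> + k12 * \<beta>) + \<beta> * (k21 * \<alpha> + k22 * \<beta>) \<ge> 0"
proof -
  consider "k11 \<ge> 0" | "k22 \<ge> 0" | "k11 < 0" "k22 < 0" by linarith
  then show ?thesis
  proof cases
    case 1 then show ?thesis using that[of 1 0] by simp
  next
    case 2 then show ?thesis using that[of 0 1] by simp
  next
    case 3
    define s where "s = k12 + k21"
    have "s\<^sup>2 - 4 * (k12 * k21) = (k12 - k21)\<^sup>2" by (simp add: s_def power2_eq_square algebra_simps)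
    moreover have "0 \<le> (k12 - k21)\<^sup>2" by simp
    ultimately have "s\<^sup>2 - 4 * (k11 * k22) \<ge> 0" using assms by linarith
    then have "- k11 * (s\<^sup>2 - 4 * (k11 * k22)) \<ge> 0" using 3 by (intro mult_nonneg_nonneg) auto
    moreover have "s * (k11 * s + k12 * (- 2 * k11)) + (- 2 * k11) * (k21 * s + k22 * (- 2 * k11)) = - k11 * (s\<^sup>2 - 4 * (k11 * k22))"
      by (simp add: s_def power2_eq_square algebra_simps)
    ultimately show ?thesis using that[of s "- 2 * k11"] 3 by simp
  qed
qed

section \<open>The quadratic form of the linearised operator and its constrained kernel\<close>

context wave begin

lemma integrable_cont: "continuous_on UNIV g \<Longrightarrow> g integrable_on {s..t}" for g :: "real \<Rightarrow> real"
  by (rule integrable_continuous_real, rule continuous_on_subset) auto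

lemma integral_periodic_deriv:
  assumes "\<And>x. (G has_real_derivative g x) (at x)" "G T = G 0"
  shows "integral {0..T} g = 0"
  using integral_FTC[of 0 T G g] assms T_pos by simp

definition "form \<phi> \<phi>1 = integral {0..T} (\<lambda>x. c * (\<phi>1 x)\<^sup>2 + q x * (\<phi> x)\<^sup>2)"

lemma mixed_form:
  assumes p: "\<And>x. (p has_real_derivative p1 x) (at x)" "\<And>x. (p1 has_real_derivative p2 x) (at x)" "continuous_on UNIV p2"
    and w: "\<And>x. (w has_real_derivative w1 x) (at x)" "continuous_on UNIV w1"
    and per: "p1 T = p1 0" "w T = w 0"
  shows "integral {0..T} (\<lambda>x. c * p1 x * w1 x + q x * p x * w x) = integral {0..T} (\<lambda>x. w x * (- c * p2 x + q x * p x))"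
proof -
  have cont: "continuous_on UNIV p" "continuous_on UNIV p1" "continuous_on UNIV w"
    by (rule DERIV_continuous_on[OF has_field_derivative_at_within[OF p(1)]]
        DERIV_continuous_on[OF has_field_derivative_at_within[OF p(2)]]
        DERIV_continuous_on[OF has_field_derivative_at_within[OF w(1)]])+
  have d: "((\<lambda>x. c * (p1 x * w x)) has_real_derivative c * (p2 x * w x + w1 x * p1 x)) (at x)" for x
    by (intro DERIV_cmult DERIV_mult p w)
  have "integral {0..T} (\<lambda>x. c * (p2 x * w x + w1 x * p1 x)) = 0"
    by (rule integral_periodic_deriv[OF d]) (simp add: per)
  moreover have "integral {0..T} (\<lambda>x. c * p1 x * w1 x + q x * p x * w x) =
     integral {0..T} (\<lambda>x. c * (p2 x * w x + w1 x * p1 x) + w x * (- c * p2 x + q x * p x))"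
    by (rule integral_cong) (simp add: algebra_simps)
  moreover have "\<dots> = integral {0..T} (\<lambda>x. c * (p2 x * w x + w1 x * p1 x)) + integral {0..T} (\<lambda>x. w x * (- c * p2 x + q x * p x))"
    by (intro integral_add integrable_cont continuous_intros cont p w continuous_q)
  ultimately show ?thesis by simp
qed

lemma form_eq:
  assumes p: "\<And>x. (p has_real_derivative p1 x) (at x)" "\<And>x. (p1 has_real_derivative p2 x) (at x)" "continuous_on UNIV p2"
    and per: "p1 T = p1 0" "p T = p 0"
  shows "form p p1 = integral {0..T} (\<lambda>x. p x * (- c * p2 x + q x * p x))"
proof -
  have "continuous_on UNIV p1" by (rule DERIV_continuous_on[OF has_field_derivative_at_within[OF p(2)]])
  from mixed_form[OF p p(1) this per] show ?thesis by (simp add: form_def power2_eq_square mult.assoc)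
qed

text \<open>Put y = \<alpha> + \<beta> (u - u_xx), so that L \<psi> = - y. Orthogonality of
  \<open>w\<close> to y makes the form diagonal on the span of \<open>\<psi>\<close> and
  \<open>w\<close>, with nonpositive diagonal. Some nontrivial combination has vanishing even part
  at the point \<open>x0\<close> of \<open>form_nonneg\<close>, hence is a multiple of
  \<open>u1\<close>; as \<open>\<psi>\<close> alone is not, \<open>w\<close> occurs in it.\<close>

lemma form_nonpos_kernel:
  fixes \<psi> \<psi>1 w w1 w2 :: "real \<Rightarrow> real"
  assumes e: "\<And>x. (e0 has_real_derivative e1 x) (at x)" "\<And>x. (e1 has_real_derivative (q x * e0 x / c)) (at x)"
      "e0 0 = 1" "e1 0 = 0" "e1 \<tau> < 0"
    and \<psi>: "\<And>x. (\<psi> has_real_derivative \<psi>1 x) (at x)"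
      "\<And>x. (\<psi>1 has_real_derivative ((q x * \<psi> x + (\<alpha> + \<beta> * (u x - u2 x))) / c)) (at x)"
      "\<And>x. \<psi> (x + T) = \<psi> x" "\<psi>1 T = \<psi>1 0"
    and nonneg: "integral {0..T} (\<lambda>x. \<psi> x * (\<alpha> + \<beta> * (u x - u2 x))) \<ge> 0" and ab: "(\<alpha>, \<beta>) \<noteq> (0, 0)"
    and w: "\<And>x. (w has_real_derivative w1 x) (at x)" "\<And>x. (w1 has_real_derivative w2 x) (at x)" "continuous_on UNIV w2"
      "\<And>x. w (x + T) = w x" "w1 T = w1 0"
    and orth: "integral {0..T} (\<lambda>x. w x * (\<alpha> + \<beta> * (u x - u2 x))) = 0"
    and le: "form w w1 \<le> 0"
  shows "form w w1 = 0 \<and> (\<exists>k \<gamma>. \<forall>x. w x = k * u1 x + \<gamma> * \<psi> x)"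
proof -
  obtain x0 where x0: "x0 \<in> {0<..<\<tau>}"
    "\<And>\<phi> \<phi>1. (\<And>x. (\<phi> has_real_derivative \<phi>1 x) (at x)) \<Longrightarrow> continuous_on UNIV \<phi>1 \<Longrightarrow>
       (\<And>x. \<phi> (x + T) = \<phi> x) \<Longrightarrow> \<phi> x0 + \<phi> (T - x0) = 0 \<Longrightarrow>
       integral {0..T} (\<lambda>x. c * (\<phi>1 x)\<^sup>2 + q x * (\<phi> x)\<^sup>2) \<le> 0 \<Longrightarrow>
       integral {0..T} (\<lambda>x. c * (\<phi>1 x)\<^sup>2 + q x * (\<phi> x)\<^sup>2) = 0 \<and> (\<exists>k. \<forall>x. \<phi> x = k * u1 x)"
    by (rule form_nonneg[OF e]) blast
  let ?y = "\<lambda>x. \<alpha> + \<beta> * (u x - u2 x)"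
  let ?\<psi>2 = "\<lambda>x. (q x * \<psi> x + ?y x) / c"
  have cont: "continuous_on UNIV \<psi>" "continuous_on UNIV \<psi>1" "continuous_on UNIV w" "continuous_on UNIV w1"
    by (rule DERIV_continuous_on[OF has_field_derivative_at_within[OF \<psi>(1)]]
        DERIV_continuous_on[OF has_field_derivative_at_within[OF \<psi>(2)]]
        DERIV_continuous_on[OF has_field_derivative_at_within[OF w(1)]]
        DERIV_continuous_on[OF has_field_derivative_at_within[OF w(2)]])+
  have cy: "continuous_on UNIV ?y" by (intro continuous_intros continuous_u continuous_u2)
  have c\<psi>2: "continuous_on UNIV ?\<psi>2" using c by (intro continuous_intros continuous_u continuous_u2 continuous_q cont) auto
  have perT: "\<psi> T = \<psi> 0" "w T = w 0" using \<psi>(3)[of 0] w(4)[of 0] by auto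
  have L: "- c * ?\<psi>2 x + q x * \<psi> x = - ?y x" for x using c by simp
  have neg: "integral {0..T} (\<lambda>x. - g x) = - integral {0..T} g" for g :: "real \<Rightarrow> real" by simp
  have F\<psi>: "form \<psi> \<psi>1 \<le> 0"
    using nonneg unfolding form_eq[OF \<psi>(1,2) c\<psi>2 \<psi>(4) perT(1)] L mult_minus_right neg
    by (simp only: neg_le_0_iff_le)
  have cross: "integral {0..T} (\<lambda>x. c * \<psi>1 x * w1 x + q x * \<psi> x * w x) = 0"
    unfolding mixed_form[OF \<psi>(1,2) c\<psi>2 w(1) cont(4) \<psi>(4) perT(2)] L mult_minus_right neg orth by simp
  have comb: "form (\<lambda>x. s * \<psi> x + t * w x) (\<lambda>x. s * \<psi>1 x + t * w1 x) = s\<^sup>2 * form \<psi> \<psi>1 + t\<^sup>2 * form w w1" for s t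
  proof -
    let ?a = "\<lambda>x. c * (\<psi>1 x)\<^sup>2 + q x * (\<psi> x)\<^sup>2" and ?b = "\<lambda>x. c * (w1 x)\<^sup>2 + q x * (w x)\<^sup>2"
      and ?m = "\<lambda>x. c * \<psi>1 x * w1 x + q x * \<psi> x * w x"
    have i: "?a integrable_on {0..T}" "?b integrable_on {0..T}" "?m integrable_on {0..T}"
      by (intro integrable_cont continuous_intros cont continuous_q)+
    have "form (\<lambda>x. s * \<psi> x + t * w x) (\<lambda>x. s * \<psi>1 x + t * w1 x) =
       integral {0..T} (\<lambda>x. (s\<^sup>2 * ?a x + t\<^sup>2 * ?b x) + (2 * s * t) * ?m x)"
      unfolding form_def by (rule integral_cong) (simp add: power2_eq_square algebra_simps)
    also have "\<dots> = (integral {0..T} (\<lambda>x. s\<^sup>2 * ?a x) + integral {0..T} (\<lambda>x. t\<^sup>2 * ?b x)) + integral {0..T} (\<lambda>x. (2 * s * t) * ?m x)"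
      using i by (simp only: integral_add integrable_add integrable_on_mult_right)
    also have "\<dots> = s\<^sup>2 * form \<psi> \<psi>1 + t\<^sup>2 * form w w1"
      unfolding integral_mult_right cross form_def by simp
    finally show ?thesis .
  qed
  have use: "form (\<lambda>x. s * \<psi> x + t * w x) (\<lambda>x. s * \<psi>1 x + t * w1 x) = 0 \<and> (\<exists>k. \<forall>x. s * \<psi> x + t * w x = k * u1 x)"
    if ev: "s * (\<psi> x0 + \<psi> (T - x0)) + t * (w x0 + w (T - x0)) = 0" for s t
    unfolding form_def
  proof (rule x0(2))
    show "((\<lambda>x. s * \<psi> x + t * w x) has_real_derivative s * \<psi>1 x + t * w1 x) (at x)" for x
      by (intro DERIV_add DERIV_cmult \<psi> w)
    show "continuous_on UNIV (\<lambda>x. s * \<psi>1 x + t * w1 x)" by (intro continuous_intros cont)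
    show "s * \<psi> (x + T) + t * w (x + T) = s * \<psi> x + t * w x" for x by (simp add: \<psi> w)
    show "s * \<psi> x0 + t * w x0 + (s * \<psi> (T - x0) + t * w (T - x0)) = 0" using ev by (simp add: algebra_simps)
    have "s\<^sup>2 * form \<psi> \<psi>1 + t\<^sup>2 * form w w1 \<le> 0"
      using F\<psi> le by (intro add_nonpos_nonpos mult_nonneg_nonpos) auto
    then show "integral {0..T} (\<lambda>x. c * (s * \<psi>1 x + t * w1 x)\<^sup>2 + q x * (s * \<psi> x + t * w x)\<^sup>2) \<le> 0"
      using comb[of s t] by (simp add: form_def)
  qed
  \<comment> \<open>If \<open>\<psi>\<close> were in the kernel, y would vanish; u - u_xx takes
    different values at 0 and \<open>\<tau>\<close>, which forces \<alpha> = \<beta> = 0.\<close>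
  have not_kernel: "\<not> (\<forall>x. \<psi> x = k * u1 x)" for k
  proof
    assume k: "\<forall>x. \<psi> x = k * u1 x"
    then have \<psi>k: "\<psi> = (\<lambda>x. k * u1 x)" by auto
    have "\<psi>1 x = k * u2 x" for x
      using DERIV_unique[OF \<psi>(1)[of x]] DERIV_cmult[OF du1, of k x] unfolding \<psi>k by blast
    then have \<psi>1k: "\<psi>1 = (\<lambda>x. k * u2 x)" by auto
    have "?\<psi>2 x = k * (q x * u1 x / c)" for x
      using DERIV_unique[OF \<psi>(2)[of x]] DERIV_cmult[OF du2, of k x] unfolding \<psi>1k by blast
    then have "?y x = 0" for x using c by (simp add: \<psi>k divide_simps)
    then have 1: "\<alpha> + \<beta> * (um - u2 0) = 0" "\<alpha> + \<beta> * (up - u2 \<tau>) = 0" using u_0 tau(2) by metis+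
    then have "\<beta> * ((up - um) + (u2 0 - u2 \<tau>)) = 0" by (simp add: algebra_simps)
    then have "\<beta> = 0" using um_less_up u2_0 u2_tau by auto
    with 1 ab show False by simp
  qed
  define eps where "eps = \<psi> x0 + \<psi> (T - x0)"
  define ew where "ew = w x0 + w (T - x0)"
  have concl: ?thesis if t: "t \<noteq> 0" and ev: "s * eps + t * ew = 0" for s t
  proof -
    from use[of s t] ev obtain k where k: "\<forall>x. s * \<psi> x + t * w x = k * u1 x"
      and z: "s\<^sup>2 * form \<psi> \<psi>1 + t\<^sup>2 * form w w1 = 0" unfolding comb eps_def ew_def by auto
    have "s\<^sup>2 * form \<psi> \<psi>1 \<le> 0" "t\<^sup>2 * form w w1 \<le> 0" using F\<psi> le by (auto intro: mult_nonneg_nonpos)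
    then have "t\<^sup>2 * form w w1 = 0" using z by linarith
    then have "form w w1 = 0" using t by simp
    moreover have "w x = (k / t) * u1 x + (- s / t) * \<psi> x" for x
      using k[rule_format, of x] t by (simp add: field_simps)
    ultimately show ?thesis by blast
  qed
  show ?thesis
  proof (cases "eps = 0")
    case False
    then show ?thesis using concl[of "- eps" ew] by simp
  next
    case True
    show ?thesis
    proof (cases "ew = 0")
      case True
      then show ?thesis using concl[of 1 0] by simp
    next
      case False
      have "1 * (\<psi> x0 + \<psi> (T - x0)) + 0 * (w x0 + w (T - x0)) = 0" using \<open>eps = 0\<close> by (simp add: eps_def)
      from use[OF this] not_kernel show ?thesis by auto
    qed
  qed
qed

lemma periodic_linear:
  assumes d: "\<And>x. (\<psi> has_real_derivative \<psi>1 x) (at x)" "\<And>x. (\<psi>1 has_real_derivative ((q x * \<psi> x + \<rho> x) / c)) (at x)"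
    and \<rho>: "\<And>x. \<rho> (x + T) = \<rho> x" and per: "\<psi> T = \<psi> 0" "\<psi>1 T = \<psi>1 0"
  shows "\<psi> (x + T) = \<psi> x"
proof -
  note hv = has_real_derivative_iff_has_vector_derivative
  let ?v = "\<lambda>x. \<psi> (x + T) - \<psi> x" and ?v1 = "\<lambda>x. \<psi>1 (x + T) - \<psi>1 x" and ?w = "\<lambda>x. q x / c * (\<psi> (x + T) - \<psi> x)"
  have d0: "(?v has_vector_derivative ?v1 x) (at x)" for x
    using has_vector_derivative_diff[OF has_vector_derivative_shift[OF d(1)[unfolded hv]] d(1)[unfolded hv]] .
  have "(?v1 has_vector_derivative ((q (x + T) * \<psi> (x + T) + \<rho> (x + T)) / c - (q x * \<psi> x + \<rho> x) / c)) (at x)" for x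
    using has_vector_derivative_diff[OF has_vector_derivative_shift[OF d(2)[unfolded hv]] d(2)[unfolded hv]] .
  moreover have "(q (x + T) * \<psi> (x + T) + \<rho> (x + T)) / c - (q x * \<psi> x + \<rho> x) / c = ?w x" for x
    using c by (simp add: q_T \<rho> field_simps)
  ultimately have d1: "(?v1 has_vector_derivative ?w x) (at x)" for x by simp
  have w: "\<exists>K. \<forall>x. \<bar>x\<bar> \<le> X \<longrightarrow> norm (?w x) \<le> K * (norm (?v x) + norm (?v1 x))" for X
  proof -
    obtain Q where Q: "Q \<ge> 0" "\<And>x. \<bar>x\<bar> \<le> X \<Longrightarrow> \<bar>q x\<bar> \<le> Q" by (rule q_bound[of X]) blast
    have "norm (?w x) \<le> (Q / c) * (norm (?v x) + norm (?v1 x))" if "\<bar>x\<bar> \<le> X" for x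
    proof -
      have "norm (?w x) = \<bar>q x\<bar> / c * norm (?v x)" using c by (simp add: abs_mult abs_divide)
      also have "\<dots> \<le> Q / c * (norm (?v x) + norm (?v1 x))"
        using Q(2)[OF that] Q(1) c by (intro mult_mono divide_right_mono) auto
      finally show ?thesis .
    qed
    then show ?thesis by blast
  qed
  from unique2(1)[OF d0 d1 w, of 0 x] per show ?thesis by simp
qed

text \<open>The momentum derivative pairs \<open>u1\<close> with \<open>\<phi>1\<close>; integration
  by parts moves the derivative onto the wave, without boundary terms because \<open>u1\<close>
  vanishes at both ends.\<close>

lemma tangent_integrals:
  assumes t: "tangent al et ga \<phi> \<phi>1"
  shows "integral {0..T} \<phi> = dM_of \<phi> \<phi>1 - um * dT_of \<phi>1"
    "integral {0..T} (\<lambda>x. \<phi> x * (u x - u2 x)) = dP_of \<phi> \<phi>1 - um\<^sup>2 / 2 * dT_of \<phi>1"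
proof -
  note t' = tangentD[OF t]
  show "integral {0..T} \<phi> = dM_of \<phi> \<phi>1 - um * dT_of \<phi>1" by (simp add: dM_of_def)
  have "integral {0..T} (\<lambda>x. u2 x * \<phi> x + \<phi>1 x * u1 x) = 0"
    by (rule integral_periodic_deriv[OF DERIV_mult[OF du1 t'(1)]]) (simp add: u2_T0 u1_0)
  then have "integral {0..T} (\<lambda>x. (u x * \<phi> x + u1 x * \<phi>1 x)) =
      integral {0..T} (\<lambda>x. (u x * \<phi> x + u1 x * \<phi>1 x)) - integral {0..T} (\<lambda>x. u2 x * \<phi> x + \<phi>1 x * u1 x)" by simp
  also have "\<dots> = integral {0..T} (\<lambda>x. (u x * \<phi> x + u1 x * \<phi>1 x) - (u2 x * \<phi> x + \<phi>1 x * u1 x))"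
    by (intro integral_diff[symmetric] integrable_cont continuous_intros continuous_u continuous_u1 continuous_u2 t')
  also have "\<dots> = integral {0..T} (\<lambda>x. \<phi> x * (u x - u2 x))" by (rule integral_cong) (simp add: algebra_simps)
  finally show "integral {0..T} (\<lambda>x. \<phi> x * (u x - u2 x)) = dP_of \<phi> \<phi>1 - um\<^sup>2 / 2 * dT_of \<phi>1" by (simp add: dP_of_def)
qed

text \<open>All increments of a periodic solution vanish, and \<open>\<mu> \<noteq> 0\<close> may be
  cancelled in \<open>third_sol_increments\<close>, so both defects are 0. The integrals of v_xx and
  of u v_xx - u_xx v vanish by periodicity.\<close>

lemma periodic_sol_orthogonal:
  assumes p: "periodic_sol \<mu> v0 v1 v2" and \<mu>: "\<mu> \<noteq> 0"
  shows "integral {0..T} v0 = 0" "integral {0..T} (\<lambda>x. of_real (u x - u2 x) * v0 x) = 0"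
proof -
  have s: "third_sol \<mu> v0 v1 v2" and per: "v0 T = v0 0" "v1 T = v1 0" "v2 T = v2 0"
    using p unfolding periodic_sol_def by (auto dest: spec[of _ 0])
  have d: "(v0 has_vector_derivative v1 x) (at x)" "(v1 has_vector_derivative v2 x) (at x)" for x
    using s unfolding third_sol_def by blast+
  note cont = third_sol_continuous[OF s, of "{0..T}"]
  have T0: "0 \<le> T" using T_pos by simp
  have A: "mass_defect v0 v2 = 0" using third_sol_increments(1)[OF s] per \<mu> by simp
  have B: "momentum_defect v0 v2 = 0" using third_sol_increments(2)[OF s] per \<mu> A by simp
  have cu: "continuous_on {0..T} (\<lambda>x. complex_of_real (u x))" "continuous_on {0..T} (\<lambda>x. complex_of_real (u2 x))"
    by (intro continuous_intros continuous_u continuous_u2)+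
  have "(v2 has_integral (v1 T - v1 0)) {0..T}"
    by (rule fundamental_theorem_of_calculus[OF T0 has_vector_derivative_at_within[OF d(2)]])
  then have "integral {0..T} v2 = 0" using per by (simp add: integral_unique)
  moreover have "mass_defect v0 v2 = integral {0..T} v0 - integral {0..T} v2"
    unfolding mass_defect_def by (intro integral_diff integrable_continuous_real cont)
  ultimately show "integral {0..T} v0 = 0" using A by simp
  have dW: "((\<lambda>x. of_real (u x) * v1 x - of_real (u1 x) * v0 x) has_vector_derivative
     (of_real (u x) * v2 x + of_real (u1 x) * v1 x) - (of_real (u1 x) * v1 x + of_real (u2 x) * v0 x)) (at x)" for x
    by (intro has_vector_derivative_diff has_vector_derivative_mult complex_derivs d)
  have "((\<lambda>x. (of_real (u x) * v2 x + of_real (u1 x) * v1 x) - (of_real (u1 x) * v1 x + of_real (u2 x) * v0 x)) has_integral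
     ((of_real (u T) * v1 T - of_real (u1 T) * v0 T) - (of_real (u 0) * v1 0 - of_real (u1 0) * v0 0))) {0..T}"
    by (rule fundamental_theorem_of_calculus[OF T0 has_vector_derivative_at_within[OF dW]])
  from integral_unique[OF this] have C: "integral {0..T} (\<lambda>x. of_real (u x) * v2 x - of_real (u2 x) * v0 x) = 0"
    using per by (simp add: u2_T0 u_0 u1_0)
  have "momentum_defect v0 v2 + integral {0..T} (\<lambda>x. of_real (u x) * v2 x - of_real (u2 x) * v0 x) =
     integral {0..T} (\<lambda>x. of_real (u x) * (v0 x - v2 x) + (of_real (u x) * v2 x - of_real (u2 x) * v0 x))"
    unfolding momentum_defect_def by (intro integral_add[symmetric] integrable_continuous_real continuous_intros cu cont)
  also have "\<dots> = integral {0..T} (\<lambda>x. of_real (u x - u2 x) * v0 x)" by (rule integral_cong) (simp add: algebra_simps)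
  finally show "integral {0..T} (\<lambda>x. of_real (u x - u2 x) * v0 x) = 0" using B C by simp
qed

text \<open>Since \<open>\<integral> v0 = 0\<close>, the equation integrates to \<open>L v = \<mu> (r - v1) + const\<close> with a periodic primitive \<open>r\<close> of \<open>v0\<close>;
  pairing with \<open>v0\<close> yields \<open>\<mu>\<close> times an imaginary number, while \<open>\<langle>L v, v\<rangle>\<close> is real.\<close>

lemma periodic_sol_null_form:
  assumes p: "periodic_sol \<mu> v0 v1 v2" and \<mu>: "Re \<mu> \<noteq> 0"
  shows "form (\<lambda>x. Re (v0 x)) (\<lambda>x. Re (v1 x)) + form (\<lambda>x. Im (v0 x)) (\<lambda>x. Im (v1 x)) = 0"
proof -
  have s: "third_sol \<mu> v0 v1 v2" and per: "v0 T = v0 0" "v1 T = v1 0" "v2 T = v2 0"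
    using p unfolding periodic_sol_def by (auto dest: spec[of _ 0])
  have d: "(v0 has_vector_derivative v1 x) (at x)" "(v1 has_vector_derivative v2 x) (at x)" for x
    using s unfolding third_sol_def by blast+
  have T0: "0 \<le> T" using T_pos by simp
  have R0: "((\<lambda>x. Re (v0 x)) has_real_derivative Re (v1 x)) (at x)" "((\<lambda>x. Im (v0 x)) has_real_derivative Im (v1 x)) (at x)"
    and R1: "((\<lambda>x. Re (v1 x)) has_real_derivative Re (v2 x)) (at x)" "((\<lambda>x. Im (v1 x)) has_real_derivative Im (v2 x)) (at x)" for x
    using ReIm_deriv[OF d(1)[of x]] ReIm_deriv[OF d(2)[of x]] by simp_all
  note cont = third_sol_continuous[OF s, of UNIV]
  obtain r where r: "r 0 = 0" "\<And>x. (r has_vector_derivative v0 x) (at x)"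
    by (rule continuous_antiderivative[OF cont(1), of 0]) blast
  have "(v0 has_integral (r T - r 0)) {0..T}"
    by (rule fundamental_theorem_of_calculus[OF T0 has_vector_derivative_at_within[OF r(2)]])
  moreover have "\<mu> \<noteq> 0" using \<mu> by auto
  ultimately have rT: "r T = 0" using periodic_sol_orthogonal(1)[OF p] r(1) by (simp add: integral_unique)
  have Rr: "((\<lambda>x. Re (r x)) has_real_derivative Re (v0 x)) (at x)" "((\<lambda>x. Im (r x)) has_real_derivative Im (v0 x)) (at x)" for x
    using ReIm_deriv[OF r(2)[of x]] by simp_all
  define Lv where "Lv = (\<lambda>x. - of_real c * v2 x + of_real (q x) * v0 x)"
  have dL: "(Lv has_vector_derivative \<mu> * (v0 x - v2 x)) (at x)" for x
    unfolding Lv_def by (rule third_sol_L_deriv[OF s])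
  have "((\<lambda>x. Lv x - \<mu> * (r x - v1 x)) has_vector_derivative \<mu> * (v0 x - v2 x) - \<mu> * (v0 x - v2 x)) (at x)" for x
    by (intro has_vector_derivative_diff has_vector_derivative_mult_right dL r d)
  then have d0: "((\<lambda>x. Lv x - \<mu> * (r x - v1 x)) has_vector_derivative 0) (at x within UNIV)" for x by simp
  obtain k where "\<And>x. x \<in> UNIV \<Longrightarrow> Lv x - \<mu> * (r x - v1 x) = k"
    by (rule has_vector_derivative_zero_constant[OF convex_UNIV d0]) blast
  then have Lk: "Lv x = \<mu> * (r x - v1 x) + k" for x by (metis UNIV_I diff_add_cancel add.commute)
  have cr: "continuous_on UNIV r"
    by (intro continuous_at_imp_continuous_on ballI has_vector_derivative_continuous[OF r(2)])
  let ?N = "\<lambda>x. cnj (v0 x) * (r x - v1 x)"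
  \<comment> \<open>The integrand is half the derivative of |r|^2 - |v|^2, and \<open>r\<close>
    returns to 0 because \<open>v0\<close> has mean zero.\<close>
  have ReN: "integral {0..T} (\<lambda>x. Re (?N x)) = 0"
  proof -
    let ?G = "\<lambda>x. (Re (r x) * Re (r x) + Im (r x) * Im (r x) - Re (v0 x) * Re (v0 x) - Im (v0 x) * Im (v0 x)) / 2"
    have "(?G has_real_derivative ((Re (v0 x) * Re (r x) + Re (v0 x) * Re (r x)) + (Im (v0 x) * Im (r x) + Im (v0 x) * Im (r x))
        - (Re (v1 x) * Re (v0 x) + Re (v1 x) * Re (v0 x)) - (Im (v1 x) * Im (v0 x) + Im (v1 x) * Im (v0 x))) / 2) (at x)" for x
      by (intro DERIV_cdivide DERIV_diff DERIV_add DERIV_mult R0 Rr)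
    moreover have "((Re (v0 x) * Re (r x) + Re (v0 x) * Re (r x)) + (Im (v0 x) * Im (r x) + Im (v0 x) * Im (r x))
        - (Re (v1 x) * Re (v0 x) + Re (v1 x) * Re (v0 x)) - (Im (v1 x) * Im (v0 x) + Im (v1 x) * Im (v0 x))) / 2 = Re (?N x)" for x
      by (simp add: field_simps)
    ultimately have G: "(?G has_real_derivative Re (?N x)) (at x)" for x by (rule DERIV_cong)
    show ?thesis by (rule integral_periodic_deriv[OF G]) (simp add: per r(1) rT)
  qed
  let ?S = "\<lambda>x. cnj (v0 x) * Lv x"
  \<comment> \<open>Symmetry of L: the imaginary part of cnj v times L v is an exact
    derivative.\<close>
  have ImS: "integral {0..T} (\<lambda>x. Im (?S x)) = 0"
  proof -
    let ?G = "\<lambda>x. - c * (Re (v0 x) * Im (v1 x) - Im (v0 x) * Re (v1 x))"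
    have "(?G has_real_derivative - c * ((Re (v1 x) * Im (v1 x) + Im (v2 x) * Re (v0 x)) - (Im (v1 x) * Re (v1 x) + Re (v2 x) * Im (v0 x)))) (at x)" for x
      by (intro DERIV_cmult DERIV_diff DERIV_mult R0 R1)
    moreover have "- c * ((Re (v1 x) * Im (v1 x) + Im (v2 x) * Re (v0 x)) - (Im (v1 x) * Re (v1 x) + Re (v2 x) * Im (v0 x))) = Im (?S x)" for x
      by (simp add: Lv_def algebra_simps)
    ultimately have G: "(?G has_real_derivative Im (?S x)) (at x)" for x by (rule DERIV_cong)
    show ?thesis by (rule integral_periodic_deriv[OF G]) (simp add: per)
  qed
  have cL: "continuous_on UNIV Lv"
    by (intro continuous_at_imp_continuous_on ballI has_vector_derivative_continuous[OF dL])
  have iC: "g integrable_on {0..T}" if "continuous_on UNIV g" for g :: "real \<Rightarrow> complex"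
    by (rule integrable_continuous_real, rule continuous_on_subset[OF that]) simp
  have iS: "?S integrable_on {0..T}" "?N integrable_on {0..T}" "v0 integrable_on {0..T}" "(\<lambda>x. cnj (v0 x)) integrable_on {0..T}"
    by (intro iC continuous_intros cont cL cr)+
  have comp: "Re (integral {0..T} g) = integral {0..T} (\<lambda>x. Re (g x))" "Im (integral {0..T} g) = integral {0..T} (\<lambda>x. Im (g x))"
    if "g integrable_on {0..T}" for g
    using integral_linear[OF that bounded_linear_Re] integral_linear[OF that bounded_linear_Im] by (simp_all add: o_def)
  have "integral {0..T} (\<lambda>x. cnj (v0 x)) = cnj (integral {0..T} v0)"
    using integral_linear[OF iS(3) bounded_linear_cnj] by (simp add: o_def)
  then have cnj0: "integral {0..T} (\<lambda>x. cnj (v0 x)) = 0" using periodic_sol_orthogonal(1)[OF p \<open>\<mu> \<noteq> 0\<close>] by simp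
  have "integral {0..T} ?S = integral {0..T} (\<lambda>x. \<mu> * ?N x + k * cnj (v0 x))"
    by (rule integral_cong) (simp add: Lk algebra_simps)
  also have "\<dots> = \<mu> * integral {0..T} ?N + k * integral {0..T} (\<lambda>x. cnj (v0 x))"
    using iS by (simp add: integral_add integrable_on_mult_right)
  finally have SN: "integral {0..T} ?S = \<mu> * integral {0..T} ?N" using cnj0 by simp
  have N: "Re (integral {0..T} ?N) = 0" "Im (integral {0..T} ?S) = 0"
    using ReN ImS comp(1)[OF iS(2)] comp(2)[OF iS(1)] by simp_all
  \<comment> \<open>With S = \<mu> N, where S is real and N imaginary, the imaginary part of the
    relation is Re \<mu> times Im N, so N vanishes and S with it.\<close>
  then have "Re \<mu> * Im (integral {0..T} ?N) = 0" using arg_cong[OF SN, of Im] by simp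
  then have "Re (integral {0..T} ?S) = 0" using \<mu> N arg_cong[OF SN, of Re] by simp
  then have ReS: "integral {0..T} (\<lambda>x. Re (?S x)) = 0" using comp(1)[OF iS(1)] by simp
  have cv: "continuous_on UNIV (\<lambda>x. Re (v2 x))" "continuous_on UNIV (\<lambda>x. Im (v2 x))" "continuous_on UNIV (\<lambda>x. Re (v0 x))" "continuous_on UNIV (\<lambda>x. Im (v0 x))"
    by (intro continuous_intros cont)+
  have "form (\<lambda>x. Re (v0 x)) (\<lambda>x. Re (v1 x)) + form (\<lambda>x. Im (v0 x)) (\<lambda>x. Im (v1 x)) =
     integral {0..T} (\<lambda>x. Re (v0 x) * (- c * Re (v2 x) + q x * Re (v0 x))) + integral {0..T} (\<lambda>x. Im (v0 x) * (- c * Im (v2 x) + q x * Im (v0 x)))"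
    using form_eq[OF R0(1) R1(1) cv(1)] form_eq[OF R0(2) R1(2) cv(2)] per by simp
  also have "\<dots> = integral {0..T} (\<lambda>x. Re (v0 x) * (- c * Re (v2 x) + q x * Re (v0 x)) + Im (v0 x) * (- c * Im (v2 x) + q x * Im (v0 x)))"
    by (intro integral_add[symmetric] integrable_cont continuous_intros cv continuous_q)
  also have "\<dots> = integral {0..T} (\<lambda>x. Re (?S x))" by (rule integral_cong) (simp add: Lv_def)
  finally show ?thesis using ReS by simp
qed

lemma integral_combination:
  fixes g1 g2 g3 :: "real \<Rightarrow> real"
  assumes "continuous_on UNIV g1" "continuous_on UNIV g2" "continuous_on UNIV g3"
  shows "integral {0..T} (\<lambda>x. r1 * g1 x + r2 * g2 x + r3 * g3 x) =
    r1 * integral {0..T} g1 + r2 * integral {0..T} g2 + r3 * integral {0..T} g3"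
proof -
  have i: "g1 integrable_on {0..T}" "g2 integrable_on {0..T}" "g3 integrable_on {0..T}"
    using assms by (blast intro: integrable_cont)+
  then show ?thesis by (simp add: integral_add integrable_on_mult_right integrable_add)
qed

text \<open>Eliminating the \<open>E\<close>-direction by the requirement that the period does not change leaves a \<open>2 \<times> 2\<close> matrix whose determinant
  is the negative of the bracket divided by \<open>T\<^sub>E\<close>.\<close>

lemma constrained_direction:
  assumes ta: "tangent 1 0 0 a0 a1" and tE: "tangent 0 1 0 b0 b1" and tc: "tangent 0 0 1 g0 g1"
    and TE: "dT_of b1 > 0"
    and det: "det (vector
      [vector [dT_of a1, dT_of b1, dT_of g1],
       vector [dM_of a0 a1, dM_of b0 b1, dM_of g0 g1],
       vector [dP_of a0 a1, dP_of b0 b1, dP_of g0 g1]] :: real^3^3) \<ge> 0"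
  obtains \<alpha> \<beta> \<psi> \<psi>1 where "(\<alpha>, \<beta>) \<noteq> (0, 0)" "\<And>x. (\<psi> has_real_derivative \<psi>1 x) (at x)"
    "\<And>x. (\<psi>1 has_real_derivative ((q x * \<psi> x + (\<alpha> + \<beta> * (u x - u2 x))) / c)) (at x)"
    "\<And>x. \<psi> (x + T) = \<psi> x" "\<psi>1 T = \<psi>1 0" "integral {0..T} (\<lambda>x. \<psi> x * (\<alpha> + \<beta> * (u x - u2 x))) \<ge> 0"
proof -
  note a = tangentD[OF ta] and b = tangentD[OF tE] and g = tangentD[OF tc]
  define Ta TE' Tc where T_defs: "Ta = dT_of a1" "TE' = dT_of b1" "Tc = dT_of g1"
  define Ma ME Mc where M_defs: "Ma = dM_of a0 a1" "ME = dM_of b0 b1" "Mc = dM_of g0 g1"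
  define Pa PE Pc where P_defs: "Pa = dP_of a0 a1" "PE = dP_of b0 b1" "Pc = dP_of g0 g1"
  note defs = T_defs M_defs P_defs
  have TE0: "TE' > 0" using TE by (simp add: T_defs)
  \<comment> \<open>Schur complement of the period entry \<open>TE'\<close> in the Jacobian.\<close>
  define k11 k12 k21 k22 where k_defs: "k11 = Ma - ME * Ta / TE'" "k12 = Mc - ME * Tc / TE'"
    "k21 = Pa - PE * Ta / TE'" "k22 = Pc - PE * Tc / TE'"
  define \<Delta> where "\<Delta> = Ta * ME * Pc + TE' * Mc * Pa + Tc * Ma * PE - Ta * Mc * PE - TE' * Ma * Pc - Tc * ME * Pa"
  have "\<Delta> \<ge> 0" using det unfolding det_vector3 \<Delta>_def defs .
  moreover have "k11 * k22 - k12 * k21 = - \<Delta> / TE'"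
    using TE0 unfolding k_defs \<Delta>_def by (simp add: field_simps)
  ultimately have "k11 * k22 - k12 * k21 \<le> 0" using TE0 by (simp add: divide_nonneg_pos)
  then obtain \<alpha> \<beta> where ab: "(\<alpha>, \<beta>) \<noteq> (0, 0)"
    and nn: "\<alpha> * (k11 * \<alpha> + k12 * \<beta>) + \<beta> * (k21 * \<alpha> + k22 * \<beta>) \<ge> 0" by (rule quadratic_nonneg_direction)
  \<comment> \<open>The share of the E-direction that cancels the change of period, so that the
    derivative of \<open>\<psi>\<close> closes up as well.\<close>
  define r where "r = - (\<alpha> * Ta + \<beta> * Tc) / TE'"
  have rT: "\<alpha> * Ta + \<beta> * Tc + r * TE' = 0" using TE0 by (simp add: r_def)
  define \<psi> where "\<psi> = (\<lambda>x. \<alpha> * a0 x + \<beta> * g0 x + r * b0 x)"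
  define \<psi>1 where "\<psi>1 = (\<lambda>x. \<alpha> * a1 x + \<beta> * g1 x + r * b1 x)"
  have d: "(\<psi> has_real_derivative \<psi>1 x) (at x)" for x
    unfolding \<psi>_def \<psi>1_def by (intro DERIV_add DERIV_cmult a b g)
  have d1: "(\<psi>1 has_real_derivative ((q x * \<psi> x + (\<alpha> + \<beta> * (u x - u2 x))) / c)) (at x)" for x
  proof (rule DERIV_cong)
    show "(\<psi>1 has_real_derivative (\<alpha> * ((q x * a0 x + 1 + 0 * (u x - u2 x)) / c) + \<beta> * ((q x * g0 x + 0 + 1 * (u x - u2 x)) / c)
       + r * ((q x * b0 x + 0 + 0 * (u x - u2 x)) / c))) (at x)"
      unfolding \<psi>1_def by (intro DERIV_add DERIV_cmult a b g)
  qed (use c in \<open>simp add: \<psi>_def field_simps\<close>)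
  have \<psi>0: "\<psi> T = \<psi> 0" by (simp add: \<psi>_def a b g)
  have "\<psi>1 T = - u2 0 * (\<alpha> * Ta + \<beta> * Tc + r * TE')"
    by (simp add: \<psi>1_def a(6) b(6) g(6) T_defs algebra_simps)
  then have \<psi>1T: "\<psi>1 T = \<psi>1 0" using rT by (simp add: \<psi>1_def a b g)
  have per: "\<psi> (x + T) = \<psi> x" for x
    by (rule periodic_linear[OF d d1 _ \<psi>0 \<psi>1T]) (simp add: u_T u2_T)
  have cont: "continuous_on UNIV (\<lambda>x. p x * (u x - u2 x))" if "continuous_on UNIV p" for p
    by (intro continuous_intros that continuous_u continuous_u2)
  have c\<psi>: "continuous_on UNIV \<psi>" unfolding \<psi>_def by (intro continuous_intros a b g)
  have eqs: "integral {0..T} a0 = Ma - um * Ta" "integral {0..T} b0 = ME - um * TE'" "integral {0..T} g0 = Mc - um * Tc"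
    "integral {0..T} (\<lambda>x. a0 x * (u x - u2 x)) = Pa - um\<^sup>2 / 2 * Ta"
    "integral {0..T} (\<lambda>x. b0 x * (u x - u2 x)) = PE - um\<^sup>2 / 2 * TE'"
    "integral {0..T} (\<lambda>x. g0 x * (u x - u2 x)) = Pc - um\<^sup>2 / 2 * Tc"
    using tangent_integrals[OF ta] tangent_integrals[OF tE] tangent_integrals[OF tc] by (simp_all only: defs)
  have "integral {0..T} \<psi> = \<alpha> * (Ma - um * Ta) + \<beta> * (Mc - um * Tc) + r * (ME - um * TE')"
    unfolding \<psi>_def integral_combination[OF a(7) g(7) b(7)] eqs ..
  also have "\<dots> = \<alpha> * Ma + \<beta> * Mc + r * ME - um * (\<alpha> * Ta + \<beta> * Tc + r * TE')" by (simp add: algebra_simps)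
  also have "\<dots> = k11 * \<alpha> + k12 * \<beta>" unfolding rT using TE0 by (simp add: r_def k_defs field_simps)
  finally have I1: "integral {0..T} \<psi> = k11 * \<alpha> + k12 * \<beta>" .
  have "integral {0..T} (\<lambda>x. \<psi> x * (u x - u2 x)) =
     integral {0..T} (\<lambda>x. \<alpha> * (a0 x * (u x - u2 x)) + \<beta> * (g0 x * (u x - u2 x)) + r * (b0 x * (u x - u2 x)))"
    by (rule integral_cong) (simp add: \<psi>_def algebra_simps)
  also have "\<dots> = \<alpha> * (Pa - um\<^sup>2 / 2 * Ta) + \<beta> * (Pc - um\<^sup>2 / 2 * Tc) + r * (PE - um\<^sup>2 / 2 * TE')"
    unfolding integral_combination[OF cont[OF a(7)] cont[OF g(7)] cont[OF b(7)]] eqs ..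
  also have "\<dots> = \<alpha> * Pa + \<beta> * Pc + r * PE - um\<^sup>2 / 2 * (\<alpha> * Ta + \<beta> * Tc + r * TE')" by (simp add: algebra_simps)
  also have "\<dots> = k21 * \<alpha> + k22 * \<beta>" unfolding rT using TE0 by (simp add: r_def k_defs field_simps)
  finally have I2: "integral {0..T} (\<lambda>x. \<psi> x * (u x - u2 x)) = k21 * \<alpha> + k22 * \<beta>" .
  have "integral {0..T} (\<lambda>x. \<psi> x * (\<alpha> + \<beta> * (u x - u2 x))) =
     integral {0..T} (\<lambda>x. \<alpha> * \<psi> x + \<beta> * (\<psi> x * (u x - u2 x)) + 0 * \<psi> x)"
    by (rule integral_cong) (simp add: algebra_simps)
  also have "\<dots> = \<alpha> * (k11 * \<alpha> + k12 * \<beta>) + \<beta> * (k21 * \<alpha> + k22 * \<beta>)"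
    unfolding integral_combination[OF c\<psi> cont[OF c\<psi>] c\<psi>] I1 I2 by simp
  finally have "integral {0..T} (\<lambda>x. \<psi> x * (\<alpha> + \<beta> * (u x - u2 x))) \<ge> 0" using nn by simp
  from that[OF ab d d1 per \<psi>1T this] show ?thesis .
qed

text \<open>Applying \<open>L\<close> gives \<open>\<mu> (v0 - v2) = \<gamma> \<beta> (u1\<^sub>x\<^sub>x - u1)\<close>, so that \<open>\<mu> v0 + \<gamma> \<beta> u1\<close> is a periodic solution of \<open>y\<^sub>x\<^sub>x = y\<close>, hence zero.\<close>

lemma no_unstable_sol_in_span:
  assumes p: "periodic_sol \<mu> v0 v1 v2" and \<mu>: "\<mu> \<noteq> 0"
    and \<psi>: "\<And>x. (\<psi> has_real_derivative \<psi>1 x) (at x)"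
      "\<And>x. (\<psi>1 has_real_derivative ((q x * \<psi> x + (\<alpha> + \<beta> * (u x - u2 x))) / c)) (at x)"
    and v0: "\<And>x. v0 x = k * of_real (u1 x) + \<gamma> * of_real (\<psi> x)"
  shows False
proof -
  have s: "third_sol \<mu> v0 v1 v2" and per: "v0 T = v0 0" "v1 T = v1 0"
    using p unfolding periodic_sol_def by (auto dest: spec[of _ 0])
  have d: "(v0 has_vector_derivative v1 x) (at x)" "(v1 has_vector_derivative v2 x) (at x)" for x
    using s unfolding third_sol_def by blast+
  note hv = has_real_derivative_iff_has_vector_derivative
  note cd = has_vector_derivative_of_real[OF \<psi>(1)] has_vector_derivative_of_real[OF \<psi>(2)]
  \<comment> \<open>Stated for arbitrary coefficients, because it is applied a second time with
    \<open>\<psi> = 0\<close>, once \<open>v0\<close> is known to be a multiple of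
    \<open>u1\<close>.\<close>
  have span_L: "- of_real c * v2 x + of_real (q x) * v0 x = - \<gamma> * of_real (\<alpha> + \<beta> * (u x - u2 x))"
    if \<psi>: "\<And>x. (\<psi> has_real_derivative \<psi>1 x) (at x)"
      "\<And>x. (\<psi>1 has_real_derivative ((q x * \<psi> x + (\<alpha> + \<beta> * (u x - u2 x))) / c)) (at x)"
    and v0: "\<And>x. v0 x = k * of_real (u1 x) + \<gamma> * of_real (\<psi> x)" for k \<gamma> \<psi> \<psi>1 \<alpha> \<beta> x
  proof -
    have v0': "v0 = (\<lambda>x. k * of_real (u1 x) + \<gamma> * of_real (\<psi> x))" using v0 by blast
    have "(v0 has_vector_derivative k * of_real (u2 x) + \<gamma> * of_real (\<psi>1 x)) (at x)" for x
      unfolding v0' by (intro has_vector_derivative_add has_vector_derivative_mult_right complex_derivs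
          has_vector_derivative_of_real[OF \<psi>(1)])
    then have "v1 x = k * of_real (u2 x) + \<gamma> * of_real (\<psi>1 x)" for x
      using vector_derivative_unique_at[OF d(1)[of x]] by blast
    then have v1': "v1 = (\<lambda>x. k * of_real (u2 x) + \<gamma> * of_real (\<psi>1 x))" by blast
    have "(v1 has_vector_derivative k * of_real (q x * u1 x / c) + \<gamma> * of_real ((q x * \<psi> x + (\<alpha> + \<beta> * (u x - u2 x))) / c)) (at x)" for x
      unfolding v1' by (intro has_vector_derivative_add has_vector_derivative_mult_right complex_derivs
          has_vector_derivative_of_real[OF \<psi>(2)])
    then have "v2 x = k * of_real (q x * u1 x / c) + \<gamma> * of_real ((q x * \<psi> x + (\<alpha> + \<beta> * (u x - u2 x))) / c)"
      using vector_derivative_unique_at[OF d(2)[of x]] by blast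
    then show ?thesis using c v0[of x] by (simp add: field_simps)
  qed
  have dL: "((\<lambda>x. - of_real c * v2 x + of_real (q x) * v0 x) has_vector_derivative \<mu> * (v0 x - v2 x)) (at x)" for x
    by (rule third_sol_L_deriv[OF s])
  have dr: "((\<lambda>x. \<alpha> + \<beta> * (u x - u2 x)) has_real_derivative 0 + \<beta> * (u1 x - q x * u1 x / c)) (at x)" for x
    by (intro DERIV_add DERIV_const DERIV_cmult DERIV_diff du du2)
  have "((\<lambda>x. - \<gamma> * complex_of_real (\<alpha> + \<beta> * (u x - u2 x))) has_vector_derivative
      - \<gamma> * of_real (0 + \<beta> * (u1 x - q x * u1 x / c))) (at x)" for x
    by (rule has_vector_derivative_mult_right[OF has_vector_derivative_of_real[OF dr]])
  then have "((\<lambda>x. - \<gamma> * complex_of_real (\<alpha> + \<beta> * (u x - u2 x))) has_vector_derivative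
      - \<gamma> * of_real (\<beta> * (u1 x - q x * u1 x / c))) (at x)" for x by simp
  then have "((\<lambda>x. - of_real c * v2 x + of_real (q x) * v0 x) has_vector_derivative
      - \<gamma> * of_real (\<beta> * (u1 x - q x * u1 x / c))) (at x)" for x
    unfolding span_L[OF \<psi> v0] .
  then have e: "\<mu> * (v0 x - v2 x) = - \<gamma> * of_real (\<beta> * (u1 x - q x * u1 x / c))" for x
    using vector_derivative_unique_at[OF dL[of x]] by blast
  let ?g = "\<gamma> * of_real \<beta>"
  have w1: "((\<lambda>x. \<mu> * v0 x + ?g * of_real (u1 x)) has_vector_derivative \<mu> * v1 x + ?g * of_real (u2 x)) (at x)" for x
    by (intro has_vector_derivative_add has_vector_derivative_mult_right complex_derivs d)
  have "((\<lambda>x. \<mu> * v1 x + ?g * of_real (u2 x)) has_vector_derivative \<mu> * v2 x + ?g * of_real (q x * u1 x / c)) (at x)" for x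
    by (intro has_vector_derivative_add has_vector_derivative_mult_right complex_derivs d)
  moreover have "\<mu> * v2 x + ?g * of_real (q x * u1 x / c) = \<mu> * v0 x + ?g * of_real (u1 x)" for x
    using e[of x] by (simp add: algebra_simps)
  ultimately have w2: "((\<lambda>x. \<mu> * v1 x + ?g * of_real (u2 x)) has_vector_derivative \<mu> * v0 x + ?g * of_real (u1 x)) (at x)" for x
    by simp
  have w: "\<mu> * v0 x + ?g * of_real (u1 x) = 0" for x
    by (rule periodic_exp_zero[OF w1 w2 _ _ T_pos]) (simp_all add: per u2_T0 u1_0)
  define \<kappa> where "\<kappa> = - ?g / \<mu>"
  have "\<mu> * v0 x = \<mu> * (\<kappa> * of_real (u1 x) + 0 * of_real 0)" for x using w[of x] \<mu> by (simp add: \<kappa>_def add_eq_0_iff2)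
  then have v0\<kappa>: "v0 x = \<kappa> * of_real (u1 x) + 0 * of_real 0" for x using \<mu> by (simp only: mult_cancel_left) simp
  have "- of_real c * v2 x + of_real (q x) * v0 x = - 0 * of_real (0 + 0 * (u x - u2 x))" for x
    by (rule span_L[of "\<lambda>_. 0" "\<lambda>_. 0" 0 0 \<kappa> 0 x, OF _ _ v0\<kappa>]) simp_all
  \<comment> \<open>Now L v = 0, so \<mu> (v - v_xx) = 0 and \<open>v0\<close> itself is a periodic
    solution of y_xx = y.\<close>
  then have "(\<lambda>x. - of_real c * v2 x + of_real (q x) * v0 x) = (\<lambda>x. 0)" by simp
  with dL have "((\<lambda>x. 0) has_vector_derivative \<mu> * (v0 x - v2 x)) (at x)" for x by simp
  from vector_derivative_unique_at[OF this has_vector_derivative_const] \<mu> have "v2 x = v0 x" for x by simp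
  then have d2: "(v1 has_vector_derivative v0 x) (at x)" for x using d(2)[of x] by simp
  have "v0 x = 0" for x by (rule periodic_exp_zero[OF d(1) d2 per T_pos])
  then show False using p unfolding periodic_sol_def by blast
qed

text \<open>The E-velocity \<open>b0\<close> is the even kernel solution up to its negative initial
  value. Hence \<open>b1 \<tau> > 0\<close>, the form in which the positive period derivative is
  used at the crest, is the sign condition on \<open>e1 \<tau>\<close> under which the form is
  controlled.\<close>

lemma stable_if_bracket_nonneg:
  assumes ta: "tangent 1 0 0 a0 a1" and tE: "tangent 0 1 0 b0 b1" and tc: "tangent 0 0 1 g0 g1"
    and TE: "dT_of b1 > 0" and b1: "b1 \<tau> > 0"
    and det: "det (vector
      [vector [dT_of a1, dT_of b1, dT_of g1],
       vector [dM_of a0 a1, dM_of b0 b1, dM_of g0 g1],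
       vector [dP_of a0 a1, dP_of b0 b1, dP_of g0 g1]] :: real^3^3) \<ge> 0"
  shows "\<not> spectrally_unstable f c u T"
proof
  assume "spectrally_unstable f c u T"
  then obtain \<mu> where \<mu>: "Re \<mu> > 0" "periodic_eigenvalue f c u T \<mu>" by (auto simp: spectrally_unstable_def)
  then have \<mu>0: "Re \<mu> \<noteq> 0" "\<mu> \<noteq> 0" by auto
  obtain v0 v1 v2 where p: "periodic_sol \<mu> v0 v1 v2" by (rule periodic_sol_if_eigenvalue[OF \<mu>(2)])
  have s: "third_sol \<mu> v0 v1 v2" and per: "v0 (x + T) = v0 x" "v1 T = v1 0" for x
    using p unfolding periodic_sol_def by (auto dest: spec[of _ 0])
  have d: "(v0 has_vector_derivative v1 x) (at x)" "(v1 has_vector_derivative v2 x) (at x)" for x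
    using s unfolding third_sol_def by blast+
  note cont = third_sol_continuous[OF s, of UNIV]
  obtain \<alpha> \<beta> \<psi> \<psi>1 where ab: "(\<alpha>, \<beta>) \<noteq> (0, 0)" and \<psi>: "\<And>x. (\<psi> has_real_derivative \<psi>1 x) (at x)"
    "\<And>x. (\<psi>1 has_real_derivative ((q x * \<psi> x + (\<alpha> + \<beta> * (u x - u2 x))) / c)) (at x)"
    "\<And>x. \<psi> (x + T) = \<psi> x" "\<psi>1 T = \<psi>1 0" and nn: "integral {0..T} (\<lambda>x. \<psi> x * (\<alpha> + \<beta> * (u x - u2 x))) \<ge> 0"
    by (rule constrained_direction[OF ta tE tc TE det]) blast
  note b = tangentD[OF tE]
  have b0: "b0 0 < 0" using b(3) V'_um by simp
  define e0 where "e0 = (\<lambda>x. b0 x / b0 0)"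
  define e1 where "e1 = (\<lambda>x. b1 x / b0 0)"
  have e: "(e0 has_real_derivative e1 x) (at x)" "(e1 has_real_derivative (q x * e0 x / c)) (at x)" for x
  proof -
    show "(e0 has_real_derivative e1 x) (at x)" unfolding e0_def e1_def by (intro DERIV_cdivide b)
    show "(e1 has_real_derivative (q x * e0 x / c)) (at x)" unfolding e1_def e0_def
      by (rule DERIV_cong[OF DERIV_cdivide[OF b(2)]]) simp
  qed
  have e': "e0 0 = 1" "e1 0 = 0" "e1 \<tau> < 0"
    using b0 b(4) divide_pos_neg[OF b1 b0] unfolding e0_def e1_def by simp_all
  \<comment> \<open>Formulated for a real linear functional, to cover real and imaginary parts at
    once.\<close>
  have orth: "integral {0..T} (\<lambda>x. P (v0 x) * (\<alpha> + \<beta> * (u x - u2 x))) = 0"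
    if P: "bounded_linear P" and Ps: "\<And>r z. P (of_real r * z) = r * P z" for P :: "complex \<Rightarrow> real"
  proof -
    have cP: "continuous_on UNIV (\<lambda>x. P (v0 x))" by (intro bounded_linear.continuous_on[OF P] cont)
    have ci: "g integrable_on {0..T}" if "continuous_on UNIV g" for g :: "real \<Rightarrow> complex"
      by (rule integrable_continuous_real, rule continuous_on_subset[OF that]) simp
    have 1: "integral {0..T} (\<lambda>x. P (v0 x)) = 0"
      using integral_linear[OF ci[OF cont(1)] P] periodic_sol_orthogonal(1)[OF p \<mu>0(2)] linear_0[OF bounded_linear.linear[OF P]]
      by (simp add: o_def)
    have "continuous_on UNIV (\<lambda>x. of_real (u x - u2 x) * v0 x)"
      by (intro continuous_intros continuous_u continuous_u2 cont)
    from integral_linear[OF ci[OF this] P] have 2: "integral {0..T} (\<lambda>x. (u x - u2 x) * P (v0 x)) = 0"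
      unfolding periodic_sol_orthogonal(2)[OF p \<mu>0(2)] o_def Ps using linear_0[OF bounded_linear.linear[OF P]] by simp
    have "integral {0..T} (\<lambda>x. P (v0 x) * (\<alpha> + \<beta> * (u x - u2 x))) =
       integral {0..T} (\<lambda>x. \<alpha> * P (v0 x) + \<beta> * ((u x - u2 x) * P (v0 x)) + 0 * P (v0 x))"
      by (rule integral_cong) (simp add: algebra_simps)
    also have "\<dots> = 0"
      unfolding integral_combination[OF cP continuous_on_mult[OF continuous_on_diff[OF continuous_u continuous_u2] cP] cP] 1 2 by simp
    finally show ?thesis .
  qed
  have cl: "form w w1 = 0 \<and> (\<exists>k \<gamma>. \<forall>x. w x = k * u1 x + \<gamma> * \<psi> x)"
    if "\<And>x. (w has_real_derivative w1 x) (at x)" "\<And>x. (w1 has_real_derivative w2 x) (at x)" "continuous_on UNIV w2"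
      "\<And>x. w (x + T) = w x" "w1 T = w1 0" "integral {0..T} (\<lambda>x. w x * (\<alpha> + \<beta> * (u x - u2 x))) = 0" "form w w1 \<le> 0" for w w1 w2
    by (rule form_nonpos_kernel[OF e e' \<psi> nn ab that])
  have Re: "form (\<lambda>x. Re (v0 x)) (\<lambda>x. Re (v1 x)) = 0 \<and> (\<exists>k \<gamma>. \<forall>x. Re (v0 x) = k * u1 x + \<gamma> * \<psi> x)"
    if "form (\<lambda>x. Re (v0 x)) (\<lambda>x. Re (v1 x)) \<le> 0"
    by (rule cl[OF ReIm_deriv(1)[OF d(1)] ReIm_deriv(1)[OF d(2)] continuous_on_Re[OF cont(3)] _ _ orth[OF bounded_linear_Re] that])
       (simp_all add: per)
  have Im: "form (\<lambda>x. Im (v0 x)) (\<lambda>x. Im (v1 x)) = 0 \<and> (\<exists>k \<gamma>. \<forall>x. Im (v0 x) = k * u1 x + \<gamma> * \<psi> x)"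
    if "form (\<lambda>x. Im (v0 x)) (\<lambda>x. Im (v1 x)) \<le> 0"
    by (rule cl[OF ReIm_deriv(2)[OF d(1)] ReIm_deriv(2)[OF d(2)] continuous_on_Im[OF cont(3)] _ _ orth[OF bounded_linear_Im] that])
       (simp_all add: per)
  have "form (\<lambda>x. Re (v0 x)) (\<lambda>x. Re (v1 x)) + form (\<lambda>x. Im (v0 x)) (\<lambda>x. Im (v1 x)) = 0"
    by (rule periodic_sol_null_form[OF p \<mu>0(1)])
  \<comment> \<open>The two values add up to 0 and each vanishes as soon as it is nonpositive, so
    neither can be positive.\<close>
  then have "form (\<lambda>x. Re (v0 x)) (\<lambda>x. Re (v1 x)) \<le> 0 \<and> form (\<lambda>x. Im (v0 x)) (\<lambda>x. Im (v1 x)) \<le> 0"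
    using Re Im by linarith
  then obtain k \<gamma> k' \<gamma>' where k: "\<And>x. Re (v0 x) = k * u1 x + \<gamma> * \<psi> x" "\<And>x. Im (v0 x) = k' * u1 x + \<gamma>' * \<psi> x"
    using Re Im by blast
  have "v0 x = Complex k k' * of_real (u1 x) + Complex \<gamma> \<gamma>' * of_real (\<psi> x)" for x
    by (rule complex_eqI) (simp_all add: k)
  from no_unstable_sol_in_span[OF p \<mu>0(2) \<psi>(1,2) this] show False .
qed

end

section \<open>The Jacobian and the instability criterion\<close>

context wave_family begin

lemma tangent_family: "tangent al et ga \<phi> \<phi>1"
  unfolding tangent_def using d\<phi> d\<phi>1 \<phi>_0 \<phi>1_0 \<phi>_T by blast

lemma Td_eq: "Td = dT_of \<phi>1"
  using \<phi>1_T u2_0 by (simp add: dT_of_def)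

text \<open>Transfers the sign of the period derivative to the velocity at the crest, where
  \<open>u2\<close> is negative.\<close>

lemma \<phi>1_tau: "\<phi>1 \<tau> = - dT_of \<phi>1 * u2 \<tau> / 2"
  using u2_tau unfolding Td_eq[symmetric] Td_def by simp

end

locale wave_manifold = wave_evans f F "w a E c" a E c "wm a E c" "wp a E c" \<Phi>
  for f F :: "real \<Rightarrow> real" and w :: "real \<Rightarrow> real \<Rightarrow> real \<Rightarrow> real \<Rightarrow> real" and wm wp :: "real \<Rightarrow> real \<Rightarrow> real \<Rightarrow> real"
    and a E c :: real and \<Phi> +
  fixes U :: "(real \<times> real \<times> real) set"
  assumes open_U: "open U" and base: "(a, E, c) \<in> U"
    and speed: "(a', E', c') \<in> U \<Longrightarrow> 1 < c'"
    and wm_cont: "continuous_on U (\<lambda>(a, E, c). wm a E c)"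
    and wp_cont: "continuous_on U (\<lambda>(a, E, c). wp a E c)"
    and wells: "(a', E', c') \<in> U \<Longrightarrow> potential_well F a' E' c' (wm a' E' c') (wp a' E' c')"
    and waves: "(a', E', c') \<in> U \<Longrightarrow> periodic_wave f F a' E' c' (wm a' E' c') (wp a' E' c') (w a' E' c')"
begin

text \<open>The family is restricted to a line through the base point; openness of \<open>U\<close>
  keeps a short segment inside. The velocity is constructed first, by solving the linearised
  equation with the right data, and then recognised as a derivative through
  \<open>wave_family\<close>.\<close>

lemma direction:
  obtains \<phi> \<phi>1 where "tangent al et ga \<phi> \<phi>1"
    "((\<lambda>s. wave_period (w (a + s * al) (E + s * et) (c + s * ga))) has_real_derivative dT_of \<phi>1) (at 0)"
    "((\<lambda>s. wave_mass (w (a + s * al) (E + s * et) (c + s * ga))) has_real_derivative dM_of \<phi> \<phi>1) (at 0)"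
    "((\<lambda>s. wave_momentum (w (a + s * al) (E + s * et) (c + s * ga))) has_real_derivative dP_of \<phi> \<phi>1) (at 0)"
    "\<phi>1 \<tau> = - dT_of \<phi>1 * deriv (deriv (w a E c)) \<tau> / 2"
proof -
  let ?\<gamma> = "\<lambda>s. (a + s * al, E + s * et, c + s * ga)"
  have c\<gamma>: "continuous_on UNIV ?\<gamma>" by (intro continuous_intros)
  have op: "open (?\<gamma> -` U)" by (rule open_vimage[OF open_U c\<gamma>])
  have z: "0 \<in> ?\<gamma> -` U" using base by simp
  obtain \<delta> where \<delta>: "\<delta> > 0" "ball 0 \<delta> \<subseteq> ?\<gamma> -` U" using op z unfolding open_contains_ball by blast
  have inU: "?\<gamma> s \<in> U" if "\<bar>s\<bar> < \<delta>" for s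
  proof -
    have "s \<in> ball 0 \<delta>" using that by (simp add: dist_real_def)
    then show ?thesis using \<delta>(2) by blast
  qed
  have isCont: "isCont (\<lambda>s. g (a + s * al) (E + s * et) (c + s * ga)) 0"
    if "continuous_on U (\<lambda>(a, E, c). g a E c)" for g :: "real \<Rightarrow> real \<Rightarrow> real \<Rightarrow> real"
  proof -
    have "continuous_on (?\<gamma> -` U) (\<lambda>s. (\<lambda>(a, E, c). g a E c) (?\<gamma> s))"
      by (rule continuous_on_compose2[OF that continuous_on_subset[OF c\<gamma>]]) auto
    then show ?thesis using z by (simp add: continuous_on_eq_continuous_at[OF op])
  qed
  have "continuous_on UNIV (\<lambda>x. al + ga * (w a E c x - deriv (deriv (w a E c)) x))"
    by (intro continuous_intros continuous_u continuous_u2)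
  then obtain \<phi> \<phi>1 where \<phi>: "\<And>x. (\<phi> has_real_derivative \<phi>1 x) (at x)"
    "\<And>x. (\<phi>1 has_real_derivative ((q x * \<phi> x + (al + ga * (w a E c x - deriv (deriv (w a E c)) x))) / c)) (at x)"
    "\<phi> 0 = (et + al * wm a E c + ga * (wm a E c)\<^sup>2 / 2) / (f (wm a E c) - (c - 1) * wm a E c - a)" "\<phi>1 0 = 0"
    by (rule linear_solution) blast
  interpret fam: wave_family f F "w a E c" a E c "wm a E c" "wp a E c" al et ga \<delta>
    "\<lambda>s. w (a + s * al) (E + s * et) (c + s * ga)" "\<lambda>s. wm (a + s * al) (E + s * et) (c + s * ga)"
    "\<lambda>s. wp (a + s * al) (E + s * et) (c + s * ga)" \<phi> \<phi>1
  proof (intro wave_family.intro wave_family_axioms.intro, rule wave_axioms)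
    show "wave f F (w (a + s * al) (E + s * et) (c + s * ga)) (a + s * al) (E + s * et) (c + s * ga)
        (wm (a + s * al) (E + s * et) (c + s * ga)) (wp (a + s * al) (E + s * et) (c + s * ga))" if "\<bar>s\<bar> < \<delta>" for s
      using C2 F speed[OF inU[OF that]] wells[OF inU[OF that]] waves[OF inU[OF that]] by (rule wave.intro)
    show "isCont (\<lambda>s. wm (a + s * al) (E + s * et) (c + s * ga)) 0" by (rule isCont[OF wm_cont])
    show "isCont (\<lambda>s. wp (a + s * al) (E + s * et) (c + s * ga)) 0" by (rule isCont[OF wp_cont])
    show "(\<phi>1 has_real_derivative ((q x * \<phi> x + al + ga * (w a E c x - deriv (deriv (w a E c)) x)) / c)) (at x)" for x
      using \<phi>(2)[of x] by (simp add: add.assoc)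
  qed (simp_all add: \<phi> \<delta>)
  show ?thesis
    by (rule that[OF fam.tangent_family fam.dT[unfolded fam.Td_eq] fam.dM[unfolded fam.Td_eq, folded dM_of_def]
        fam.dP[unfolded fam.Td_eq, folded dP_of_def] fam.\<phi>1_tau])
qed

lemma TMP_bracket_eq:
  obtains a0 a1 b0 b1 g0 g1 where
    "tangent 1 0 0 a0 a1" "tangent 0 1 0 b0 b1" "tangent 0 0 1 g0 g1"
    "TMP_bracket w a E c = det (vector
      [vector [dT_of a1, dT_of b1, dT_of g1],
       vector [dM_of a0 a1, dM_of b0 b1, dM_of g0 g1],
       vector [dP_of a0 a1, dP_of b0 b1, dP_of g0 g1]] :: real^3^3)"
    "deriv (\<lambda>E. wave_period (w a E c)) E = dT_of b1" "b1 \<tau> = - dT_of b1 * deriv (deriv (w a E c)) \<tau> / 2"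
proof -
  have D: "deriv h x = d" if "((\<lambda>s. h (x + s * 1)) has_real_derivative d) (at 0)" for h :: "real \<Rightarrow> real" and x d
    using that DERIV_shift[of h d 0 x] by (intro DERIV_imp_deriv) (simp add: add.commute)
  obtain a0 a1 where a: "tangent 1 0 0 a0 a1"
    "((\<lambda>s. wave_period (w (a + s * 1) (E + s * 0) (c + s * 0))) has_real_derivative dT_of a1) (at 0)"
    "((\<lambda>s. wave_mass (w (a + s * 1) (E + s * 0) (c + s * 0))) has_real_derivative dM_of a0 a1) (at 0)"
    "((\<lambda>s. wave_momentum (w (a + s * 1) (E + s * 0) (c + s * 0))) has_real_derivative dP_of a0 a1) (at 0)"
    by (rule direction)
  obtain b0 b1 where b: "tangent 0 1 0 b0 b1"
    "((\<lambda>s. wave_period (w (a + s * 0) (E + s * 1) (c + s * 0))) has_real_derivative dT_of b1) (at 0)"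
    "((\<lambda>s. wave_mass (w (a + s * 0) (E + s * 1) (c + s * 0))) has_real_derivative dM_of b0 b1) (at 0)"
    "((\<lambda>s. wave_momentum (w (a + s * 0) (E + s * 1) (c + s * 0))) has_real_derivative dP_of b0 b1) (at 0)"
    "b1 \<tau> = - dT_of b1 * deriv (deriv (w a E c)) \<tau> / 2"
    by (rule direction)
  obtain g0 g1 where g: "tangent 0 0 1 g0 g1"
    "((\<lambda>s. wave_period (w (a + s * 0) (E + s * 0) (c + s * 1))) has_real_derivative dT_of g1) (at 0)"
    "((\<lambda>s. wave_mass (w (a + s * 0) (E + s * 0) (c + s * 1))) has_real_derivative dM_of g0 g1) (at 0)"
    "((\<lambda>s. wave_momentum (w (a + s * 0) (E + s * 0) (c + s * 1))) has_real_derivative dP_of g0 g1) (at 0)"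
    by (rule direction)
  note ds = a(2-4) b(2-4) g(2-4)
  note Ds = ds[unfolded mult_zero_right add_0_right, THEN D]
  have "TMP_bracket w a E c = det (vector
      [vector [dT_of a1, dT_of b1, dT_of g1],
       vector [dM_of a0 a1, dM_of b0 b1, dM_of g0 g1],
       vector [dP_of a0 a1, dP_of b0 b1, dP_of g0 g1]] :: real^3^3)"
    unfolding TMP_bracket_def gradient3_def Ds ..
  from that[OF a(1) b(1) g(1) this Ds(4) b(5)] show ?thesis .
qed

lemma odd_roots:
  assumes "TMP_bracket w a E c < 0"
  defines "Z \<equiv> positive_real_roots (\<lambda>\<mu>. evans_D \<Phi> T \<mu> 1)"
  shows "finite Z" "odd (\<Sum>\<mu>\<in>Z. zorder (\<lambda>\<mu>. evans_D \<Phi> T \<mu> 1) \<mu>)"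
proof -
  obtain a0 a1 b0 b1 g0 g1 where t: "tangent 1 0 0 a0 a1" "tangent 0 1 0 b0 b1" "tangent 0 0 1 g0 g1"
    and br: "TMP_bracket w a E c = det (vector
      [vector [dT_of a1, dT_of b1, dT_of g1],
       vector [dM_of a0 a1, dM_of b0 b1, dM_of g0 g1],
       vector [dP_of a0 a1, dP_of b0 b1, dP_of g0 g1]] :: real^3^3)"
    by (rule TMP_bracket_eq)
  have "((\<lambda>\<mu>. Re (evans_D \<Phi> T (of_real \<mu>) 1 / of_real (\<mu> ^ 3))) \<longlongrightarrow> - TMP_bracket w a E c) (at_right 0)"
    using tendsto_Re[OF evans_D_low_frequency[OF t]] unfolding br[symmetric] by simp
  then have "\<forall>\<^sub>F \<mu> in at_right 0. 0 < Re (evans_D \<Phi> T (of_real \<mu>) 1 / of_real (\<mu> ^ 3))"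
    by (rule order_tendstoD) (use assms in simp)
  then have near: "\<forall>\<^sub>F \<mu> in at_right 0. 0 < Re (evans_D \<Phi> T (of_real \<mu>) 1)"
    using eventually_at_right_less[of 0]
  proof eventually_elim
    case (elim \<mu>)
    then show ?case unfolding Re_divide_of_real by (simp add: zero_less_divide_iff)
  qed
  have hol: "(\<lambda>\<mu>. evans_D \<Phi> T \<mu> 1) holomorphic_on UNIV" by (rule evans_D_holomorphic) (use T_pos in simp)
  show "finite Z" "odd (\<Sum>\<mu>\<in>Z. zorder (\<lambda>\<mu>. evans_D \<Phi> T \<mu> 1) \<mu>)"
    unfolding Z_def using odd_positive_zeros[OF hol evans_D_real near evans_D_neg_at_top] by blast+
qed

lemma roots_eigenvalues:
  "positive_real_roots (\<lambda>\<mu>. evans_D \<Phi> T \<mu> 1) = {\<mu>. \<mu> \<in> \<real> \<and> 0 < Re \<mu> \<and> periodic_eigenvalue f c (w a E c) T \<mu>}"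
  unfolding positive_real_roots_def evans_zero_iff ..

lemma unstable_iff:
  assumes "deriv (\<lambda>E. wave_period (w a E c)) E > 0"
  shows "spectrally_unstable f c (w a E c) T \<longleftrightarrow> TMP_bracket w a E c < 0"
proof
  assume neg: "TMP_bracket w a E c < 0"
  have "positive_real_roots (\<lambda>\<mu>. evans_D \<Phi> T \<mu> 1) \<noteq> {}" using odd_roots(2)[OF neg] by auto
  then show "spectrally_unstable f c (w a E c) T" unfolding roots_eigenvalues spectrally_unstable_def by blast
next
  assume un: "spectrally_unstable f c (w a E c) T"
  obtain a0 a1 b0 b1 g0 g1 where t: "tangent 1 0 0 a0 a1" "tangent 0 1 0 b0 b1" "tangent 0 0 1 g0 g1"
    and br: "TMP_bracket w a E c = det (vector
      [vector [dT_of a1, dT_of b1, dT_of g1],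
       vector [dM_of a0 a1, dM_of b0 b1, dM_of g0 g1],
       vector [dP_of a0 a1, dP_of b0 b1, dP_of g0 g1]] :: real^3^3)"
    and TE: "deriv (\<lambda>E. wave_period (w a E c)) E = dT_of b1" and b1: "b1 \<tau> = - dT_of b1 * deriv (deriv (w a E c)) \<tau> / 2"
    by (rule TMP_bracket_eq)
  have pos: "dT_of b1 > 0" using assms TE by simp
  then have "b1 \<tau> > 0" using u2_tau mult_pos_neg[OF pos u2_tau] unfolding b1 by simp
  then show "TMP_bracket w a E c < 0" using stable_if_bracket_nonneg[OF t pos] un unfolding br by force
qed

end

theorem theorem1:
  fixes f F :: "real \<Rightarrow> real"
    and u :: "real \<Rightarrow> real \<Rightarrow> real \<Rightarrow> real \<Rightarrow> real"
    and um up :: "real \<Rightarrow> real \<Rightarrow> real \<Rightarrow> real"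
    and U :: "(real \<times> real \<times> real) set"
    and a0 E0 c0 :: real
    and \<Phi> :: "real \<Rightarrow> complex \<Rightarrow> complex^3^3"
  assumes "C2_real f"
    and "\<And>x. (F has_real_derivative f x) (at x)" and "F 0 = 0"
    and "open U" and "U \<subseteq> interior (wave_parameters F)" and "(a0, E0, c0) \<in> U"
    and "continuous_on U (\<lambda>(a, E, c). um a E c)"
    and "continuous_on U (\<lambda>(a, E, c). up a E c)"
    and "\<And>a E c. (a, E, c) \<in> U \<Longrightarrow> potential_well F a E c (um a E c) (up a E c)"
    and "\<And>a E c. (a, E, c) \<in> U \<Longrightarrow> periodic_wave f F a E c (um a E c) (up a E c) (u a E c)"
    and "fundamental_matrix f c0 (u a0 E0 c0) \<Phi>"
  shows "let T = (\<lambda>a E c. wave_period (u a E c));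
             T0 = T a0 E0 c0;
             u0 = u a0 E0 c0;
             D = evans_D \<Phi> T0;
             Z = positive_real_roots (\<lambda>\<mu>. D \<mu> 1)
         in (TMP_bracket u a0 E0 c0 < 0 \<longrightarrow>
               finite Z \<and> odd (\<Sum>\<mu>\<in>Z. zorder (\<lambda>\<mu>. D \<mu> 1) \<mu>) \<and>
               Z = {\<mu>. \<mu> \<in> \<real> \<and> 0 < Re \<mu> \<and> periodic_eigenvalue f c0 u0 T0 \<mu>}) \<and>
            (deriv (\<lambda>E. T a0 E c0) E0 > 0 \<longrightarrow>
               (spectrally_unstable f c0 u0 T0 \<longleftrightarrow> TMP_bracket u a0 E0 c0 < 0))"
proof -
  have speed: "1 < c'" if "(a', E', c') \<in> U" for a' E' c'
    using that assms(5) interior_subset unfolding wave_parameters_def by blast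
  interpret wave_manifold f F u um up a0 E0 c0 \<Phi> U
    by unfold_locales (fact assms speed speed[OF assms(6)] assms(9,10)[OF assms(6)])+
  show ?thesis
    unfolding Let_def wave_period_eq using odd_roots roots_eigenvalues unstable_iff by blast
qed

end
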